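(* Let $H$ be a Hopf algebra and $\chi:H\otimes H\to k$ a unital 2-cocycle. Then there is an isomorphism of braided categories $\mathcal{G}^\chi:{}^H_H\mathcal{M}^H_H\to{}^{H^\chi}_{H^\chi}\mathcal{M}^{H^\chi}_{H^\chi}$ between the braided categories of bicovariant bimodules over $H$ and over $H^\chi$. The functor $\mathcal{G}^\chi$ leaves the underlying vector spaces and the left and right coactions unchanged, and transforms the actions to $$h\bullet v=\chi(h_{(1)}\otimes v_{(1)})\,h_{(2)}v_{(\underline 2)}\,\chi^{-1}(h_{(3)}\otimes v_{(3)}),\qquad v\bullet h=\chi(v_{(1)}\otimes h_{(1)})\,v_{(\underline 2)}h_{(2)}\,\chi^{-1}(v_{(3)}\otimes h_{(3)}).$$ The monoidal structure is provided by the natural transformation $$c^\chi:\mathcal{G}^\chi(V)\otimes_{H^\chi}\mathcal{G}^\chi(W)\to\mathcal{G}^\chi(V\otimes_H W),\qquad v\otimes_{H^\chi} w\mapsto\chi(v_{(1)}\otimes w_{(1)})\,v_{(\underline 2)}\otimes_H w_{(\underline 2)}\,\chi^{-1}(v_{(3)}\otimes w_{(3)})$$ for all $V,W\in{}^H_H\mathcal{M}^H_H$.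
   Context: $k$ is a field; Hopf algebras have invertible antipode; Sweedler notation $\Delta h=h_{(1)}\otimes h_{(2)}$. A unital 2-cocycle on $H$ is a convolution-invertible linear map $\chi:H\otimes H\to k$ with $\chi(g_{(1)}\otimes f_{(1)})\chi(h\otimes g_{(2)}f_{(2)})=\chi(h_{(1)}\otimes g_{(1)})\chi(h_{(2)}g_{(2)}\otimes f)$ and $\chi(1\otimes h)=\epsilon(h)$; $\chi^{-1}$ is its convolution inverse. $H^\chi$ is the Hopf algebra with the same coalgebra and unit as $H$ and with product $h\bullet g=\chi(h_{(1)}\otimes g_{(1)})h_{(2)}g_{(2)}\chi^{-1}(h_{(3)}\otimes g_{(3)})$ and antipode $S^\chi h=U(h_{(1)})\,Sh_{(2)}\,U^{-1}(h_{(3)})$, $U(h)=\chi(h_{(1)}\otimes Sh_{(2)})$. A bicovariant bimodule over $H$ is an $H$-bimodule $V$ with commuting left and right coactions $\beta_L:V\to H\otimes V$, $\beta_R:V\to V\otimes H$, each a bimodule map (with $H$ acting on the targets via $\Delta$). Applying both coactions is written $v\mapsto v_{(1)}\otimes v_{(\underline 2)}\otimes v_{(3)}\in H\otimes V\otimes H$. Morphisms are the linear maps commuting with both actions and both coactions. The category ${}^H_H\mathcal{M}^H_H$ of these is monoidal with tensor product $\otimes_H$ (left action on the first factor, right action on the last, codiagonal coactions $\beta_L(v\otimes_H w)=v_{(1)}w_{(1)}\otimes v_{(\underline 2)}\otimes_H w_{(\underline 2)}$ and similarly $\beta_R$), and braided by $\Psi(hv\otimes_H wg)=hw\otimes_H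 vg$ for $h,g\in H$, $v$ left-invariant ($\beta_L(v)=1\otimes v$) and $w$ right-invariant ($\beta_R(w)=w\otimes1$). An isomorphism of braided categories here is an invertible functor, trivial on morphisms as linear maps, that is monoidal via the indicated natural isomorphism and respects the braidings. *)

theory Defs
  imports "HOL-Algebra.Module"
begin

text \<open>
  Vector spaces over a field \<open>K\<close> are modules \<open>module K V\<close> in the sense of HOL-Algebra. The fields
  \<open>mult\<close> and \<open>one\<close>, which every module record inherits from the ring record, are used for Hopf
  algebras and carry no meaning for plain vector spaces and bimodules.

  Objects are not confined to one type: tensor products of bimodules live on a new carrier type, so
  each object variable below has a type variable of its own.
\<close>

section \<open>Tensor products\<close>

text \<open>
  A formal sum \<open>\<Sum>\<^sub>i v\<^sub>i \<otimes> w\<^sub>i\<close> is represented by the list of the pairs \<open>(v\<^sub>i, w\<^sub>i)\<close>, and a tensor by a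
  class of formal sums under the congruence generated by biadditivity and by a set \<open>B\<close> of balancing
  relations \<open>((v, w), (v', w'))\<close>, read as \<open>v \<otimes> w = v' \<otimes> w'\<close>. No rule for negatives is needed, since
  \<open>(\<ominus> v) \<otimes> w\<close> is the inverse of \<open>v \<otimes> w\<close>. The balancing relations of \<open>\<otimes>\<^sub>K\<close> and of \<open>\<otimes>\<^sub>H\<close> are
  \<open>scalar_balance\<close> and \<open>action_balance\<close> below.
\<close>

inductive tensor_eq ::
  "('v, 'm) ring_scheme \<Rightarrow> ('w, 'n) ring_scheme \<Rightarrow> (('v \<times> 'w) \<times> ('v \<times> 'w)) set
    \<Rightarrow> ('v \<times> 'w) list \<Rightarrow> ('v \<times> 'w) list \<Rightarrow> bool"
  for V and W and B
  where
    refl: "xs \<in> lists (carrier V \<times> carrier W) \<Longrightarrow> tensor_eq V W B xs xs"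
  | sym: "tensor_eq V W B xs ys \<Longrightarrow> tensor_eq V W B ys xs"
  | trans: "tensor_eq V W B xs ys \<Longrightarrow> tensor_eq V W B ys zs \<Longrightarrow> tensor_eq V W B xs zs"
  | append: "tensor_eq V W B xs ys \<Longrightarrow> tensor_eq V W B xs' ys' \<Longrightarrow> tensor_eq V W B (xs @ xs') (ys @ ys')"
  | commute: "xs \<in> lists (carrier V \<times> carrier W) \<Longrightarrow> ys \<in> lists (carrier V \<times> carrier W)
      \<Longrightarrow> tensor_eq V W B (xs @ ys) (ys @ xs)"
  | add_left: "v \<in> carrier V \<Longrightarrow> v' \<in> carrier V \<Longrightarrow> w \<in> carrier W
      \<Longrightarrow> tensor_eq V W B [(v \<oplus>\<^bsub>V\<^esub> v', w)] [(v, w), (v', w)]"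
  | add_right: "v \<in> carrier V \<Longrightarrow> w \<in> carrier W \<Longrightarrow> w' \<in> carrier W
      \<Longrightarrow> tensor_eq V W B [(v, w \<oplus>\<^bsub>W\<^esub> w')] [(v, w), (v, w')]"
  | zero_left: "w \<in> carrier W \<Longrightarrow> tensor_eq V W B [(\<zero>\<^bsub>V\<^esub>, w)] []"
  | zero_right: "v \<in> carrier V \<Longrightarrow> tensor_eq V W B [(v, \<zero>\<^bsub>W\<^esub>)] []"
  | balanced: "(p, q) \<in> B \<Longrightarrow> p \<in> carrier V \<times> carrier W \<Longrightarrow> q \<in> carrier V \<times> carrier W
      \<Longrightarrow> tensor_eq V W B [p] [q]"

definition tensor_class ::
  "('v, 'm) ring_scheme \<Rightarrow> ('w, 'n) ring_scheme \<Rightarrow> (('v \<times> 'w) \<times> ('v \<times> 'w)) set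
    \<Rightarrow> ('v \<times> 'w) list \<Rightarrow> ('v \<times> 'w) list set"
  where "tensor_class V W B xs = {ys. tensor_eq V W B xs ys}"

definition tensor_rep :: "('v \<times> 'w) list set \<Rightarrow> ('v \<times> 'w) list"
  where "tensor_rep t = (SOME xs. xs \<in> t)"

definition tensor_module ::
  "('k, 'v, 'm) module_scheme \<Rightarrow> ('k, 'w, 'n) module_scheme \<Rightarrow> (('v \<times> 'w) \<times> ('v \<times> 'w)) set
    \<Rightarrow> ('k, ('v \<times> 'w) list set) module"
  where "tensor_module V W B =
    \<lparr> carrier = tensor_class V W B ` lists (carrier V \<times> carrier W),
      mult = undefined, one = undefined,
      zero = tensor_class V W B [],
      add = (\<lambda>s t. tensor_class V W B (tensor_rep s @ tensor_rep t)),
      smult = (\<lambda>a t. tensor_class V W B (map (\<lambda>(v, w). (a \<odot>\<^bsub>V\<^esub> v, w)) (tensor_rep t))) \<rparr>"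

text \<open>
  \<open>tensor_lift M f t\<close> is \<open>\<Sum>\<^sub>i f v\<^sub>i w\<^sub>i\<close> in \<open>M\<close> for \<open>t = \<Sum>\<^sub>i v\<^sub>i \<otimes> w\<^sub>i\<close>. It does not depend on the chosen
  formal sum when \<open>f\<close> is biadditive and respects the balancing relations of \<open>t\<close>; it is only used for
  such \<open>f\<close>.
\<close>

definition tensor_lift :: "('x, 'm) ring_scheme \<Rightarrow> ('v \<Rightarrow> 'w \<Rightarrow> 'x) \<Rightarrow> ('v \<times> 'w) list set \<Rightarrow> 'x"
  where "tensor_lift M f t = foldr (\<lambda>(v, w) s. f v w \<oplus>\<^bsub>M\<^esub> s) (tensor_rep t) \<zero>\<^bsub>M\<^esub>"

definition scalar_balance ::
  "('k, 'l) ring_scheme \<Rightarrow> ('k, 'v, 'm) module_scheme \<Rightarrow> ('k, 'w, 'n) module_scheme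
    \<Rightarrow> (('v \<times> 'w) \<times> ('v \<times> 'w)) set"
  where "scalar_balance K V W =
    {((a \<odot>\<^bsub>V\<^esub> v, w), (v, a \<odot>\<^bsub>W\<^esub> w)) | a v w. a \<in> carrier K \<and> v \<in> carrier V \<and> w \<in> carrier W}"

definition tensor_space ::
  "('k, 'l) ring_scheme \<Rightarrow> ('k, 'v, 'm) module_scheme \<Rightarrow> ('k, 'w, 'n) module_scheme
    \<Rightarrow> ('k, ('v \<times> 'w) list set) module"
  where "tensor_space K V W = tensor_module V W (scalar_balance K V W)"

definition tensor ::
  "('k, 'l) ring_scheme \<Rightarrow> ('k, 'v, 'm) module_scheme \<Rightarrow> ('k, 'w, 'n) module_scheme
    \<Rightarrow> 'v \<Rightarrow> 'w \<Rightarrow> ('v \<times> 'w) list set"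
  where "tensor K V W v w = tensor_class V W (scalar_balance K V W) [(v, w)]"

definition linear_map ::
  "('k, 'l) ring_scheme \<Rightarrow> ('k, 'v, 'm) module_scheme \<Rightarrow> ('k, 'w, 'n) module_scheme
    \<Rightarrow> ('v \<Rightarrow> 'w) \<Rightarrow> bool"
  where "linear_map K V W f \<longleftrightarrow>
    f \<in> carrier V \<rightarrow> carrier W \<and>
    (\<forall>x\<in>carrier V. \<forall>y\<in>carrier V. f (x \<oplus>\<^bsub>V\<^esub> y) = f x \<oplus>\<^bsub>W\<^esub> f y) \<and>
    (\<forall>a\<in>carrier K. \<forall>x\<in>carrier V. f (a \<odot>\<^bsub>V\<^esub> x) = a \<odot>\<^bsub>W\<^esub> f x)"

definition bilinear_map ::
  "('k, 'l) ring_scheme \<Rightarrow> ('k, 'v, 'm) module_scheme \<Rightarrow> ('k, 'w, 'n) module_scheme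
    \<Rightarrow> ('k, 'x, 'o) module_scheme \<Rightarrow> ('v \<Rightarrow> 'w \<Rightarrow> 'x) \<Rightarrow> bool"
  where "bilinear_map K V W X f \<longleftrightarrow>
    (\<forall>v\<in>carrier V. linear_map K W X (\<lambda>w. f v w)) \<and>
    (\<forall>w\<in>carrier W. linear_map K V X (\<lambda>v. f v w))"

definition ground_module :: "('k, 'l) ring_scheme \<Rightarrow> ('k, 'k) module"
  where "ground_module K =
    \<lparr> carrier = carrier K, mult = mult K, one = one K, zero = zero K, add = add K, smult = mult K \<rparr>"

section \<open>Hopf algebras\<close>

record ('k, 'h) hopf = "('k, 'h) module" +
  comult :: "'h \<Rightarrow> ('h \<times> 'h) list set"
  counit :: "'h \<Rightarrow> 'k"
  antipode :: "'h \<Rightarrow> 'h"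

text \<open>
  Sweedler sums with values in \<open>M\<close>: \<open>sweedler2 M H h (\<lambda>h1 h2. f h1 h2)\<close> stands for
  \<open>f(h_(1), h_(2))\<close> with the summation understood, and likewise \<open>sweedler3\<close>.
\<close>

definition sweedler2 ::
  "('x, 'm) ring_scheme \<Rightarrow> ('k, 'h, 'n) hopf_scheme \<Rightarrow> 'h \<Rightarrow> ('h \<Rightarrow> 'h \<Rightarrow> 'x) \<Rightarrow> 'x"
  where "sweedler2 M H h f = tensor_lift M f (comult H h)"

definition sweedler3 ::
  "('x, 'm) ring_scheme \<Rightarrow> ('k, 'h, 'n) hopf_scheme \<Rightarrow> 'h \<Rightarrow> ('h \<Rightarrow> 'h \<Rightarrow> 'h \<Rightarrow> 'x) \<Rightarrow> 'x"
  where "sweedler3 M H h f = sweedler2 M H h (\<lambda>h1 h'. sweedler2 M H h' (\<lambda>h2 h3. f h1 h2 h3))"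

definition associative_algebra :: "('k, 'l) ring_scheme \<Rightarrow> ('k, 'h, 'm) module_scheme \<Rightarrow> bool"
  where "associative_algebra K A \<longleftrightarrow> ring A \<and> module K A \<and> bilinear_map K A A A (mult A)"

definition coassociative_coalgebra :: "('k, 'l) ring_scheme \<Rightarrow> ('k, 'h, 'm) hopf_scheme \<Rightarrow> bool"
  where "coassociative_coalgebra K H \<longleftrightarrow>
    linear_map K H (tensor_space K H H) (comult H) \<and>
    linear_map K H (ground_module K) (counit H) \<and>
    (\<forall>h\<in>carrier H.
      (let HHH = tensor_space K H (tensor_space K H H);
           ten = (\<lambda>x y z. tensor K H (tensor_space K H H) x (tensor K H H y z))
       in sweedler2 HHH H h (\<lambda>h1 h2. sweedler2 HHH H h1 (\<lambda>h11 h12. ten h11 h12 h2))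
        = sweedler2 HHH H h (\<lambda>h1 h2. sweedler2 HHH H h2 (\<lambda>h21 h22. ten h1 h21 h22)))) \<and>
    (\<forall>h\<in>carrier H. sweedler2 H H h (\<lambda>h1 h2. counit H h1 \<odot>\<^bsub>H\<^esub> h2) = h) \<and>
    (\<forall>h\<in>carrier H. sweedler2 H H h (\<lambda>h1 h2. counit H h2 \<odot>\<^bsub>H\<^esub> h1) = h)"

definition hopf_algebra :: "('k, 'l) ring_scheme \<Rightarrow> ('k, 'h, 'm) hopf_scheme \<Rightarrow> bool"
  where "hopf_algebra K H \<longleftrightarrow>
    associative_algebra K H \<and> coassociative_coalgebra K H \<and>
    (\<forall>h\<in>carrier H. \<forall>g\<in>carrier H.
      comult H (h \<otimes>\<^bsub>H\<^esub> g) = sweedler2 (tensor_space K H H) H h (\<lambda>h1 h2.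
        sweedler2 (tensor_space K H H) H g (\<lambda>g1 g2. tensor K H H (h1 \<otimes>\<^bsub>H\<^esub> g1) (h2 \<otimes>\<^bsub>H\<^esub> g2)))) \<and>
    comult H \<one>\<^bsub>H\<^esub> = tensor K H H \<one>\<^bsub>H\<^esub> \<one>\<^bsub>H\<^esub> \<and>
    (\<forall>h\<in>carrier H. \<forall>g\<in>carrier H. counit H (h \<otimes>\<^bsub>H\<^esub> g) = counit H h \<otimes>\<^bsub>K\<^esub> counit H g) \<and>
    counit H \<one>\<^bsub>H\<^esub> = \<one>\<^bsub>K\<^esub> \<and>
    linear_map K H H (antipode H) \<and>
    (\<forall>h\<in>carrier H. sweedler2 H H h (\<lambda>h1 h2. antipode H h1 \<otimes>\<^bsub>H\<^esub> h2) = counit H h \<odot>\<^bsub>H\<^esub> \<one>\<^bsub>H\<^esub>) \<and>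
    (\<forall>h\<in>carrier H. sweedler2 H H h (\<lambda>h1 h2. h1 \<otimes>\<^bsub>H\<^esub> antipode H h2) = counit H h \<odot>\<^bsub>H\<^esub> \<one>\<^bsub>H\<^esub>) \<and>
    bij_betw (antipode H) (carrier H) (carrier H)"

section \<open>Convolution and cocycle twists\<close>

text \<open>Linear functionals on a coalgebra with space \<open>C\<close>, coproduct \<open>\<Delta>\<close> and counit \<open>e\<close>.\<close>

definition convolution ::
  "('k, 'l) ring_scheme \<Rightarrow> ('c \<Rightarrow> ('c \<times> 'c) list set) \<Rightarrow> ('c \<Rightarrow> 'k) \<Rightarrow> ('c \<Rightarrow> 'k) \<Rightarrow> 'c \<Rightarrow> 'k"
  where "convolution K \<Delta> \<phi> \<psi> x = tensor_lift K (\<lambda>x1 x2. \<phi> x1 \<otimes>\<^bsub>K\<^esub> \<psi> x2) (\<Delta> x)"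

definition is_convolution_inverse ::
  "('k, 'l) ring_scheme \<Rightarrow> ('k, 'c, 'm) module_scheme \<Rightarrow> ('c \<Rightarrow> ('c \<times> 'c) list set) \<Rightarrow> ('c \<Rightarrow> 'k)
    \<Rightarrow> ('c \<Rightarrow> 'k) \<Rightarrow> ('c \<Rightarrow> 'k) \<Rightarrow> bool"
  where "is_convolution_inverse K C \<Delta> e \<phi> \<psi> \<longleftrightarrow>
    linear_map K C (ground_module K) \<psi> \<and>
    (\<forall>x\<in>carrier C. convolution K \<Delta> \<phi> \<psi> x = e x \<and> convolution K \<Delta> \<psi> \<phi> x = e x)"

definition convolution_inverse ::
  "('k, 'l) ring_scheme \<Rightarrow> ('k, 'c, 'm) module_scheme \<Rightarrow> ('c \<Rightarrow> ('c \<times> 'c) list set) \<Rightarrow> ('c \<Rightarrow> 'k)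
    \<Rightarrow> ('c \<Rightarrow> 'k) \<Rightarrow> 'c \<Rightarrow> 'k"
  where "convolution_inverse K C \<Delta> e \<phi> = (SOME \<psi>. is_convolution_inverse K C \<Delta> e \<phi> \<psi>)"

definition comult2 ::
  "('k, 'l) ring_scheme \<Rightarrow> ('k, 'h, 'm) hopf_scheme
    \<Rightarrow> ('h \<times> 'h) list set \<Rightarrow> (('h \<times> 'h) list set \<times> ('h \<times> 'h) list set) list set"
  where "comult2 K H =
    (let HH = tensor_space K H H; HHHH = tensor_space K HH HH
     in tensor_lift HHHH (\<lambda>h g. sweedler2 HHHH H h (\<lambda>h1 h2. sweedler2 HHHH H g (\<lambda>g1 g2.
          tensor K HH HH (tensor K H H h1 g1) (tensor K H H h2 g2)))))"

definition counit2 ::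
  "('k, 'l) ring_scheme \<Rightarrow> ('k, 'h, 'm) hopf_scheme \<Rightarrow> ('h \<times> 'h) list set \<Rightarrow> 'k"
  where "counit2 K H = tensor_lift K (\<lambda>h g. counit H h \<otimes>\<^bsub>K\<^esub> counit H g)"

definition unital_2_cocycle ::
  "('k, 'l) ring_scheme \<Rightarrow> ('k, 'h, 'm) hopf_scheme \<Rightarrow> (('h \<times> 'h) list set \<Rightarrow> 'k) \<Rightarrow> bool"
  where "unital_2_cocycle K H \<chi> \<longleftrightarrow>
    linear_map K (tensor_space K H H) (ground_module K) \<chi> \<and>
    (\<exists>\<psi>. is_convolution_inverse K (tensor_space K H H) (comult2 K H) (counit2 K H) \<chi> \<psi>) \<and>
    (\<forall>h\<in>carrier H. \<forall>g\<in>carrier H. \<forall>f\<in>carrier H.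
      sweedler2 K H g (\<lambda>g1 g2. sweedler2 K H f (\<lambda>f1 f2.
        \<chi> (tensor K H H g1 f1) \<otimes>\<^bsub>K\<^esub> \<chi> (tensor K H H h (g2 \<otimes>\<^bsub>H\<^esub> f2)))) =
      sweedler2 K H h (\<lambda>h1 h2. sweedler2 K H g (\<lambda>g1 g2.
        \<chi> (tensor K H H h1 g1) \<otimes>\<^bsub>K\<^esub> \<chi> (tensor K H H (h2 \<otimes>\<^bsub>H\<^esub> g2) f)))) \<and>
    (\<forall>h\<in>carrier H. \<chi> (tensor K H H \<one>\<^bsub>H\<^esub> h) = counit H h)"

definition cocycle_inverse ::
  "('k, 'l) ring_scheme \<Rightarrow> ('k, 'h, 'm) hopf_scheme \<Rightarrow> (('h \<times> 'h) list set \<Rightarrow> 'k)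
    \<Rightarrow> ('h \<times> 'h) list set \<Rightarrow> 'k"
  where "cocycle_inverse K H \<chi> =
    convolution_inverse K (tensor_space K H H) (comult2 K H) (counit2 K H) \<chi>"

definition twist_functional ::
  "('k, 'l) ring_scheme \<Rightarrow> ('k, 'h, 'm) hopf_scheme \<Rightarrow> (('h \<times> 'h) list set \<Rightarrow> 'k) \<Rightarrow> 'h \<Rightarrow> 'k"
  where "twist_functional K H \<chi> h = sweedler2 K H h (\<lambda>h1 h2. \<chi> (tensor K H H h1 (antipode H h2)))"

text \<open>The Hopf algebra \<open>H\<^sup>\<chi>\<close>; \<open>U\<^sup>-\<^sup>1\<close> is the convolution inverse of \<open>U = twist_functional K H \<chi>\<close>.\<close>

definition twisted_hopf ::
  "('k, 'l) ring_scheme \<Rightarrow> ('k, 'h) hopf \<Rightarrow> (('h \<times> 'h) list set \<Rightarrow> 'k) \<Rightarrow> ('k, 'h) hopf"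
  where "twisted_hopf K H \<chi> = H
    \<lparr> mult := (\<lambda>h g. sweedler3 H H h (\<lambda>h1 h2 h3. sweedler3 H H g (\<lambda>g1 g2 g3.
        (\<chi> (tensor K H H h1 g1) \<otimes>\<^bsub>K\<^esub> cocycle_inverse K H \<chi> (tensor K H H h3 g3)) \<odot>\<^bsub>H\<^esub> (h2 \<otimes>\<^bsub>H\<^esub> g2)))),
      antipode := (\<lambda>h. sweedler3 H H h (\<lambda>h1 h2 h3.
        (twist_functional K H \<chi> h1 \<otimes>\<^bsub>K\<^esub>
          convolution_inverse K H (comult H) (counit H) (twist_functional K H \<chi>) h3)
        \<odot>\<^bsub>H\<^esub> antipode H h2)) \<rparr>"

section \<open>Bicovariant bimodules\<close>

record ('k, 'h, 'v) bimodule = "('k, 'v) module" +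
  lact :: "'h \<Rightarrow> 'v \<Rightarrow> 'v"
  ract :: "'v \<Rightarrow> 'h \<Rightarrow> 'v"
  lcoact :: "'v \<Rightarrow> ('h \<times> 'v) list set"
  rcoact :: "'v \<Rightarrow> ('v \<times> 'h) list set"

text \<open>
  Actions and coactions are required to be \<open>extensional\<close>, i.e. equal to \<open>undefined\<close> off their
  domain, so that a bimodule determines them as HOL functions; this is what makes it meaningful
  below for a functor to be a bijection on objects.
\<close>

definition hopf_bimodule ::
  "('k, 'l) ring_scheme \<Rightarrow> ('k, 'h) hopf \<Rightarrow> ('k, 'h, 'v) bimodule \<Rightarrow> bool"
  where "hopf_bimodule K H V \<longleftrightarrow>
    module K V \<and>
    lact V \<in> carrier H \<rightarrow>\<^sub>E (carrier V \<rightarrow>\<^sub>E carrier V) \<and>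
    ract V \<in> carrier V \<rightarrow>\<^sub>E (carrier H \<rightarrow>\<^sub>E carrier V) \<and>
    bilinear_map K H V V (lact V) \<and>
    bilinear_map K V H V (ract V) \<and>
    (\<forall>v\<in>carrier V. lact V \<one>\<^bsub>H\<^esub> v = v \<and> ract V v \<one>\<^bsub>H\<^esub> = v) \<and>
    (\<forall>h\<in>carrier H. \<forall>g\<in>carrier H. \<forall>v\<in>carrier V.
      lact V (h \<otimes>\<^bsub>H\<^esub> g) v = lact V h (lact V g v) \<and>
      ract V v (h \<otimes>\<^bsub>H\<^esub> g) = ract V (ract V v h) g \<and>
      ract V (lact V h v) g = lact V h (ract V v g))"

definition hopf_bicomodule ::
  "('k, 'l) ring_scheme \<Rightarrow> ('k, 'h) hopf \<Rightarrow> ('k, 'h, 'v) bimodule \<Rightarrow> bool"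
  where "hopf_bicomodule K H V \<longleftrightarrow>
    module K V \<and>
    lcoact V \<in> carrier V \<rightarrow>\<^sub>E carrier (tensor_space K H V) \<and>
    rcoact V \<in> carrier V \<rightarrow>\<^sub>E carrier (tensor_space K V H) \<and>
    linear_map K V (tensor_space K H V) (lcoact V) \<and>
    linear_map K V (tensor_space K V H) (rcoact V) \<and>
    (\<forall>v\<in>carrier V.
      tensor_lift V (\<lambda>h v'. counit H h \<odot>\<^bsub>V\<^esub> v') (lcoact V v) = v \<and>
      tensor_lift V (\<lambda>v' h. counit H h \<odot>\<^bsub>V\<^esub> v') (rcoact V v) = v \<and>
      (let HHV = tensor_space K H (tensor_space K H V);
           ten = (\<lambda>x y z. tensor K H (tensor_space K H V) x (tensor K H V y z))
       in tensor_lift HHV (\<lambda>h v'. sweedler2 HHV H h (\<lambda>h1 h2. ten h1 h2 v')) (lcoact V v)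
        = tensor_lift HHV (\<lambda>h v'. tensor_lift HHV (\<lambda>g v''. ten h g v'') (lcoact V v')) (lcoact V v)) \<and>
      (let VHH = tensor_space K V (tensor_space K H H);
           ten = (\<lambda>x y z. tensor K V (tensor_space K H H) x (tensor K H H y z))
       in tensor_lift VHH (\<lambda>v' h. sweedler2 VHH H h (\<lambda>h1 h2. ten v' h1 h2)) (rcoact V v)
        = tensor_lift VHH (\<lambda>v' h. tensor_lift VHH (\<lambda>v'' g. ten v'' g h) (rcoact V v')) (rcoact V v)) \<and>
      (let HVH = tensor_space K H (tensor_space K V H);
           ten = (\<lambda>x y z. tensor K H (tensor_space K V H) x (tensor K V H y z))
       in tensor_lift HVH (\<lambda>h v'. tensor_lift HVH (\<lambda>v'' g. ten h v'' g) (rcoact V v')) (lcoact V v)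
        = tensor_lift HVH (\<lambda>v' g. tensor_lift HVH (\<lambda>h v''. ten h v'' g) (lcoact V v')) (rcoact V v)))"

definition bicovariant_bimodules ::
  "('k, 'l) ring_scheme \<Rightarrow> ('k, 'h) hopf \<Rightarrow> ('k, 'h, 'v) bimodule set"
  where "bicovariant_bimodules K H = {V.
    hopf_bimodule K H V \<and> hopf_bicomodule K H V \<and>
    (\<forall>h\<in>carrier H. \<forall>v\<in>carrier V.
      (let HV = tensor_space K H V; VH = tensor_space K V H
       in lcoact V (lact V h v) = sweedler2 HV H h (\<lambda>h1 h2.
            tensor_lift HV (\<lambda>g v'. tensor K H V (h1 \<otimes>\<^bsub>H\<^esub> g) (lact V h2 v')) (lcoact V v)) \<and>
          lcoact V (ract V v h) = sweedler2 HV H h (\<lambda>h1 h2.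
            tensor_lift HV (\<lambda>g v'. tensor K H V (g \<otimes>\<^bsub>H\<^esub> h1) (ract V v' h2)) (lcoact V v)) \<and>
          rcoact V (lact V h v) = sweedler2 VH H h (\<lambda>h1 h2.
            tensor_lift VH (\<lambda>v' g. tensor K V H (lact V h1 v') (h2 \<otimes>\<^bsub>H\<^esub> g)) (rcoact V v)) \<and>
          rcoact V (ract V v h) = sweedler2 VH H h (\<lambda>h1 h2.
            tensor_lift VH (\<lambda>v' g. tensor K V H (ract V v' h1) (g \<otimes>\<^bsub>H\<^esub> h2)) (rcoact V v))))}"

text \<open>\<open>bisweedler M V v (\<lambda>v1 v2 v3. f v1 v2 v3)\<close> stands for
  \<open>f(v_(1), v_(2), v_(3))\<close> where \<open>v_(1)\<close>, \<open>v_(3)\<close> lie in \<open>H\<close> and \<open>v_(2)\<close> in \<open>V\<close>.\<close>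

definition bisweedler ::
  "('x, 'm) ring_scheme \<Rightarrow> ('k, 'h, 'v) bimodule \<Rightarrow> 'v \<Rightarrow> ('h \<Rightarrow> 'v \<Rightarrow> 'h \<Rightarrow> 'x) \<Rightarrow> 'x"
  where "bisweedler M V v f =
    tensor_lift M (\<lambda>v1 v'. tensor_lift M (\<lambda>v2 v3. f v1 v2 v3) (rcoact V v')) (lcoact V v)"

definition bicovariant_hom ::
  "('k, 'l) ring_scheme \<Rightarrow> ('k, 'h) hopf \<Rightarrow> ('k, 'h, 'v) bimodule \<Rightarrow> ('k, 'h, 'w) bimodule
    \<Rightarrow> ('v \<Rightarrow> 'w) set"
  where "bicovariant_hom K H V W = {f \<in> carrier V \<rightarrow>\<^sub>E carrier W.
    linear_map K V W f \<and>
    (\<forall>h\<in>carrier H. \<forall>v\<in>carrier V.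
      f (lact V h v) = lact W h (f v) \<and> f (ract V v h) = ract W (f v) h) \<and>
    (\<forall>v\<in>carrier V.
      lcoact W (f v) = tensor_lift (tensor_space K H W) (\<lambda>h v'. tensor K H W h (f v')) (lcoact V v) \<and>
      rcoact W (f v) = tensor_lift (tensor_space K W H) (\<lambda>v' h. tensor K W H (f v') h) (rcoact V v))}"

definition bicovariant_iso ::
  "('k, 'l) ring_scheme \<Rightarrow> ('k, 'h) hopf \<Rightarrow> ('k, 'h, 'v) bimodule \<Rightarrow> ('k, 'h, 'w) bimodule
    \<Rightarrow> ('v \<Rightarrow> 'w) set"
  where "bicovariant_iso K H V W = {f \<in> bicovariant_hom K H V W.
    \<exists>g\<in>bicovariant_hom K H W V. (\<forall>v\<in>carrier V. g (f v) = v) \<and> (\<forall>w\<in>carrier W. f (g w) = w)}"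

section \<open>The monoidal structure\<close>

definition action_balance ::
  "('k, 'h) hopf \<Rightarrow> ('k, 'h, 'v) bimodule \<Rightarrow> ('k, 'h, 'w) bimodule \<Rightarrow> (('v \<times> 'w) \<times> ('v \<times> 'w)) set"
  where "action_balance H V W =
    {((ract V v h, w), (v, lact W h w)) | h v w. h \<in> carrier H \<and> v \<in> carrier V \<and> w \<in> carrier W}"

definition htensor ::
  "('k, 'h) hopf \<Rightarrow> ('k, 'h, 'v) bimodule \<Rightarrow> ('k, 'h, 'w) bimodule \<Rightarrow> 'v \<Rightarrow> 'w \<Rightarrow> ('v \<times> 'w) list set"
  where "htensor H V W v w = tensor_class V W (action_balance H V W) [(v, w)]"

text \<open>The object \<open>V \<otimes>\<^sub>H W\<close>. Balancing over \<open>H\<close> includes balancing over \<open>K\<close>, because \<open>K\<close> acts through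
  the unit of \<open>H\<close>.\<close>

definition htensor_bimodule ::
  "('k, 'l) ring_scheme \<Rightarrow> ('k, 'h) hopf \<Rightarrow> ('k, 'h, 'v) bimodule \<Rightarrow> ('k, 'h, 'w) bimodule
    \<Rightarrow> ('k, 'h, ('v \<times> 'w) list set) bimodule"
  where "htensor_bimodule K H V W =
    (let T = tensor_module V W (action_balance H V W); HT = tensor_space K H T; TH = tensor_space K T H
     in \<lparr> carrier = carrier T, mult = mult T, one = one T, zero = zero T, add = add T, smult = smult T,
          lact = (\<lambda>h\<in>carrier H. \<lambda>t\<in>carrier T. tensor_lift T (\<lambda>v w. htensor H V W (lact V h v) w) t),
          ract = (\<lambda>t\<in>carrier T. \<lambda>h\<in>carrier H. tensor_lift T (\<lambda>v w. htensor H V W v (ract W w h)) t),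
          lcoact = (\<lambda>t\<in>carrier T. tensor_lift HT (\<lambda>v w.
            tensor_lift HT (\<lambda>v1 v2. tensor_lift HT (\<lambda>w1 w2.
              tensor K H T (v1 \<otimes>\<^bsub>H\<^esub> w1) (htensor H V W v2 w2)) (lcoact W w)) (lcoact V v)) t),
          rcoact = (\<lambda>t\<in>carrier T. tensor_lift TH (\<lambda>v w.
            tensor_lift TH (\<lambda>v1 v2. tensor_lift TH (\<lambda>w1 w2.
              tensor K T H (htensor H V W v1 w1) (v2 \<otimes>\<^bsub>H\<^esub> w2)) (rcoact W w)) (rcoact V v)) t) \<rparr>)"

definition htensor_map ::
  "('k, 'l) ring_scheme \<Rightarrow> ('k, 'h) hopf \<Rightarrow> ('k, 'h, 'v) bimodule \<Rightarrow> ('k, 'h, 'w) bimodule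
    \<Rightarrow> ('k, 'h, 'v1) bimodule \<Rightarrow> ('k, 'h, 'w1) bimodule \<Rightarrow> ('v \<Rightarrow> 'v1) \<Rightarrow> ('w \<Rightarrow> 'w1)
    \<Rightarrow> ('v \<times> 'w) list set \<Rightarrow> ('v1 \<times> 'w1) list set"
  where "htensor_map K H V W V' W' f g =
    (\<lambda>t\<in>carrier (htensor_bimodule K H V W).
      tensor_lift (htensor_bimodule K H V' W') (\<lambda>v w. htensor H V' W' (f v) (g w)) t)"

definition identity_map :: "('v, 'm) partial_object_scheme \<Rightarrow> 'v \<Rightarrow> 'v"
  where "identity_map V = (\<lambda>v\<in>carrier V. v)"

definition unit_bimodule :: "('k, 'h) hopf \<Rightarrow> ('k, 'h, 'h) bimodule"
  where "unit_bimodule H =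
    \<lparr> carrier = carrier H, mult = undefined, one = undefined, zero = zero H, add = add H, smult = smult H,
      lact = (\<lambda>h\<in>carrier H. \<lambda>x\<in>carrier H. h \<otimes>\<^bsub>H\<^esub> x),
      ract = (\<lambda>x\<in>carrier H. \<lambda>h\<in>carrier H. x \<otimes>\<^bsub>H\<^esub> h),
      lcoact = (\<lambda>x\<in>carrier H. comult H x),
      rcoact = (\<lambda>x\<in>carrier H. comult H x) \<rparr>"

definition associator ::
  "('k, 'l) ring_scheme \<Rightarrow> ('k, 'h) hopf \<Rightarrow> ('k, 'h, 'v) bimodule \<Rightarrow> ('k, 'h, 'w) bimodule
    \<Rightarrow> ('k, 'h, 'u) bimodule
    \<Rightarrow> (('v \<times> 'w) list set \<times> 'u) list set \<Rightarrow> ('v \<times> ('w \<times> 'u) list set) list set"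
  where "associator K H V W U =
    (let WU = htensor_bimodule K H W U; T = htensor_bimodule K H V WU
     in (\<lambda>t\<in>carrier (htensor_bimodule K H (htensor_bimodule K H V W) U).
          tensor_lift T (\<lambda>s u. tensor_lift T (\<lambda>v w. htensor H V WU v (htensor H W U w u)) s) t))"

definition left_unitor ::
  "('k, 'l) ring_scheme \<Rightarrow> ('k, 'h) hopf \<Rightarrow> ('k, 'h, 'v) bimodule \<Rightarrow> ('h \<times> 'v) list set \<Rightarrow> 'v"
  where "left_unitor K H V =
    (\<lambda>t\<in>carrier (htensor_bimodule K H (unit_bimodule H) V). tensor_lift V (\<lambda>h v. lact V h v) t)"

definition right_unitor ::
  "('k, 'l) ring_scheme \<Rightarrow> ('k, 'h) hopf \<Rightarrow> ('k, 'h, 'v) bimodule \<Rightarrow> ('v \<times> 'h) list set \<Rightarrow> 'v"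
  where "right_unitor K H V =
    (\<lambda>t\<in>carrier (htensor_bimodule K H V (unit_bimodule H)). tensor_lift V (\<lambda>v h. ract V v h) t)"

section \<open>The braiding\<close>

definition left_invariant ::
  "('k, 'l) ring_scheme \<Rightarrow> ('k, 'h) hopf \<Rightarrow> ('k, 'h, 'v) bimodule \<Rightarrow> 'v set"
  where "left_invariant K H V = {v \<in> carrier V. lcoact V v = tensor K H V \<one>\<^bsub>H\<^esub> v}"

definition right_invariant ::
  "('k, 'l) ring_scheme \<Rightarrow> ('k, 'h) hopf \<Rightarrow> ('k, 'h, 'v) bimodule \<Rightarrow> 'v set"
  where "right_invariant K H V = {v \<in> carrier V. rcoact V v = tensor K V H v \<one>\<^bsub>H\<^esub>}"

definition is_braiding ::
  "('k, 'l) ring_scheme \<Rightarrow> ('k, 'h) hopf \<Rightarrow> ('k, 'h, 'v) bimodule \<Rightarrow> ('k, 'h, 'w) bimodule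
    \<Rightarrow> (('v \<times> 'w) list set \<Rightarrow> ('w \<times> 'v) list set) \<Rightarrow> bool"
  where "is_braiding K H V W \<Psi> \<longleftrightarrow>
    \<Psi> \<in> extensional (carrier (htensor_bimodule K H V W)) \<and>
    linear_map K (htensor_bimodule K H V W) (htensor_bimodule K H W V) \<Psi> \<and>
    (\<forall>h\<in>carrier H. \<forall>g\<in>carrier H. \<forall>v\<in>left_invariant K H V. \<forall>w\<in>right_invariant K H W.
      \<Psi> (htensor H V W (lact V h v) (ract W w g)) = htensor H W V (lact W h w) (ract V v g))"

definition braiding ::
  "('k, 'l) ring_scheme \<Rightarrow> ('k, 'h) hopf \<Rightarrow> ('k, 'h, 'v) bimodule \<Rightarrow> ('k, 'h, 'w) bimodule
    \<Rightarrow> ('v \<times> 'w) list set \<Rightarrow> ('w \<times> 'v) list set"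
  where "braiding K H V W = (THE \<Psi>. is_braiding K H V W \<Psi>)"

section \<open>Braided monoidal category axioms\<close>

text \<open>
  The axioms are stated for given objects, each of a type of its own; they hold for the category when
  they hold for all objects.
\<close>

definition category_axioms ::
  "('k, 'l) ring_scheme \<Rightarrow> ('k, 'h) hopf \<Rightarrow> ('k, 'h, 'v) bimodule \<Rightarrow> ('k, 'h, 'w) bimodule
    \<Rightarrow> ('k, 'h, 'u) bimodule \<Rightarrow> bool"
  where "category_axioms K H V W U \<longleftrightarrow>
    identity_map V \<in> bicovariant_hom K H V V \<and>
    (\<forall>f\<in>bicovariant_hom K H V W. \<forall>g\<in>bicovariant_hom K H W U.
      compose (carrier V) g f \<in> bicovariant_hom K H V U)"

definition tensor_functor_axioms ::
  "('k, 'l) ring_scheme \<Rightarrow> ('k, 'h) hopf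
    \<Rightarrow> ('k, 'h, 'v) bimodule \<Rightarrow> ('k, 'h, 'v1) bimodule \<Rightarrow> ('k, 'h, 'v2) bimodule
    \<Rightarrow> ('k, 'h, 'w) bimodule \<Rightarrow> ('k, 'h, 'w1) bimodule \<Rightarrow> ('k, 'h, 'w2) bimodule \<Rightarrow> bool"
  where "tensor_functor_axioms K H V V' V'' W W' W'' \<longleftrightarrow>
    htensor_bimodule K H V W \<in> bicovariant_bimodules K H \<and>
    htensor_map K H V W V W (identity_map V) (identity_map W) = identity_map (htensor_bimodule K H V W) \<and>
    (\<forall>f\<in>bicovariant_hom K H V V'. \<forall>g\<in>bicovariant_hom K H W W'.
      htensor_map K H V W V' W' f g
        \<in> bicovariant_hom K H (htensor_bimodule K H V W) (htensor_bimodule K H V' W')) \<and>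
    (\<forall>f\<in>bicovariant_hom K H V V'. \<forall>g\<in>bicovariant_hom K H W W'.
     \<forall>f'\<in>bicovariant_hom K H V' V''. \<forall>g'\<in>bicovariant_hom K H W' W''.
      htensor_map K H V W V'' W'' (compose (carrier V) f' f) (compose (carrier W) g' g) =
      compose (carrier (htensor_bimodule K H V W))
        (htensor_map K H V' W' V'' W'' f' g') (htensor_map K H V W V' W' f g))"

definition associator_axioms ::
  "('k, 'l) ring_scheme \<Rightarrow> ('k, 'h) hopf
    \<Rightarrow> ('k, 'h, 'v) bimodule \<Rightarrow> ('k, 'h, 'v1) bimodule \<Rightarrow> ('k, 'h, 'w) bimodule
    \<Rightarrow> ('k, 'h, 'w1) bimodule \<Rightarrow> ('k, 'h, 'u) bimodule \<Rightarrow> ('k, 'h, 'u1) bimodule \<Rightarrow> bool"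
  where "associator_axioms K H V V' W W' U U' \<longleftrightarrow>
    (let VW = htensor_bimodule K H V W; WU = htensor_bimodule K H W U;
         VW' = htensor_bimodule K H V' W'; WU' = htensor_bimodule K H W' U'
     in associator K H V W U
          \<in> bicovariant_iso K H (htensor_bimodule K H VW U) (htensor_bimodule K H V WU) \<and>
        (\<forall>f\<in>bicovariant_hom K H V V'. \<forall>g\<in>bicovariant_hom K H W W'. \<forall>e\<in>bicovariant_hom K H U U'.
         \<forall>t\<in>carrier (htensor_bimodule K H VW U).
          associator K H V' W' U' (htensor_map K H VW U VW' U' (htensor_map K H V W V' W' f g) e t) =
          htensor_map K H V WU V' WU' f (htensor_map K H W U W' U' g e) (associator K H V W U t)))"

definition unit_axioms ::
  "('k, 'l) ring_scheme \<Rightarrow> ('k, 'h) hopf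
    \<Rightarrow> ('k, 'h, 'v) bimodule \<Rightarrow> ('k, 'h, 'v1) bimodule \<Rightarrow> bool"
  where "unit_axioms K H V V' \<longleftrightarrow>
    (let I = unit_bimodule H
     in I \<in> bicovariant_bimodules K H \<and>
        left_unitor K H V \<in> bicovariant_iso K H (htensor_bimodule K H I V) V \<and>
        right_unitor K H V \<in> bicovariant_iso K H (htensor_bimodule K H V I) V \<and>
        (\<forall>f\<in>bicovariant_hom K H V V'.
          (\<forall>t\<in>carrier (htensor_bimodule K H I V).
            left_unitor K H V' (htensor_map K H I V I V' (identity_map I) f t) = f (left_unitor K H V t)) \<and>
          (\<forall>t\<in>carrier (htensor_bimodule K H V I).
            right_unitor K H V' (htensor_map K H V I V' I f (identity_map I) t) = f (right_unitor K H V t))))"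

definition pentagon_axiom ::
  "('k, 'l) ring_scheme \<Rightarrow> ('k, 'h) hopf \<Rightarrow> ('k, 'h, 'v) bimodule \<Rightarrow> ('k, 'h, 'w) bimodule
    \<Rightarrow> ('k, 'h, 'u) bimodule \<Rightarrow> ('k, 'h, 'x) bimodule \<Rightarrow> bool"
  where "pentagon_axiom K H V W U X \<longleftrightarrow>
    (let VW = htensor_bimodule K H V W; WU = htensor_bimodule K H W U; UX = htensor_bimodule K H U X;
         VW_U = htensor_bimodule K H VW U; V_WU = htensor_bimodule K H V WU;
         WU_X = htensor_bimodule K H WU X; W_UX = htensor_bimodule K H W UX
     in \<forall>t\<in>carrier (htensor_bimodule K H VW_U X).
          associator K H V W UX (associator K H VW U X t) =
          htensor_map K H V WU_X V W_UX (identity_map V) (associator K H W U X)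
            (associator K H V WU X
              (htensor_map K H VW_U X V_WU X (associator K H V W U) (identity_map X) t)))"

definition triangle_axiom ::
  "('k, 'l) ring_scheme \<Rightarrow> ('k, 'h) hopf \<Rightarrow> ('k, 'h, 'v) bimodule \<Rightarrow> ('k, 'h, 'w) bimodule \<Rightarrow> bool"
  where "triangle_axiom K H V W \<longleftrightarrow>
    (let I = unit_bimodule H; VI = htensor_bimodule K H V I; IW = htensor_bimodule K H I W
     in \<forall>t\<in>carrier (htensor_bimodule K H VI W).
          htensor_map K H V IW V W (identity_map V) (left_unitor K H W) (associator K H V I W t) =
          htensor_map K H VI W V W (right_unitor K H V) (identity_map W) t)"

text \<open>By the first conjunct the condition in \<open>is_braiding\<close> determines \<open>\<Psi>\<close>.\<close>

definition braiding_axioms ::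
  "('k, 'l) ring_scheme \<Rightarrow> ('k, 'h) hopf
    \<Rightarrow> ('k, 'h, 'v) bimodule \<Rightarrow> ('k, 'h, 'v1) bimodule \<Rightarrow> ('k, 'h, 'w) bimodule
    \<Rightarrow> ('k, 'h, 'w1) bimodule \<Rightarrow> bool"
  where "braiding_axioms K H V V' W W' \<longleftrightarrow>
    (\<exists>!\<Psi>. is_braiding K H V W \<Psi>) \<and>
    braiding K H V W \<in> bicovariant_iso K H (htensor_bimodule K H V W) (htensor_bimodule K H W V) \<and>
    (\<forall>f\<in>bicovariant_hom K H V V'. \<forall>g\<in>bicovariant_hom K H W W'. \<forall>t\<in>carrier (htensor_bimodule K H V W).
      braiding K H V' W' (htensor_map K H V W V' W' f g t) =
      htensor_map K H W V W' V' g f (braiding K H V W t))"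

definition hexagon_axioms ::
  "('k, 'l) ring_scheme \<Rightarrow> ('k, 'h) hopf \<Rightarrow> ('k, 'h, 'v) bimodule \<Rightarrow> ('k, 'h, 'w) bimodule
    \<Rightarrow> ('k, 'h, 'u) bimodule \<Rightarrow> bool"
  where "hexagon_axioms K H V W U \<longleftrightarrow>
    (let VW = htensor_bimodule K H V W; WV = htensor_bimodule K H W V;
         VU = htensor_bimodule K H V U; UV = htensor_bimodule K H U V;
         WU = htensor_bimodule K H W U; UW = htensor_bimodule K H U W
     in (\<forall>t\<in>carrier (htensor_bimodule K H VW U).
          associator K H W U V (braiding K H V WU (associator K H V W U t)) =
          htensor_map K H W VU W UV (identity_map W) (braiding K H V U)
            (associator K H W V U
              (htensor_map K H VW U WV U (braiding K H V W) (identity_map U) t))) \<and>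
        (\<forall>t\<in>carrier (htensor_bimodule K H VW U).
          braiding K H VW U t =
          associator K H U V W
            (htensor_map K H VU W UV W (braiding K H V U) (identity_map W)
              (inv_into (carrier (htensor_bimodule K H VU W)) (associator K H V U W)
                (htensor_map K H V WU V UW (identity_map V) (braiding K H W U)
                  (associator K H V W U t))))))"

definition braided_monoidal_axioms ::
  "('k, 'l) ring_scheme \<Rightarrow> ('k, 'h) hopf
    \<Rightarrow> ('k, 'h, 'v) bimodule \<Rightarrow> ('k, 'h, 'v1) bimodule \<Rightarrow> ('k, 'h, 'v2) bimodule
    \<Rightarrow> ('k, 'h, 'w) bimodule \<Rightarrow> ('k, 'h, 'w1) bimodule \<Rightarrow> ('k, 'h, 'w2) bimodule
    \<Rightarrow> ('k, 'h, 'u) bimodule \<Rightarrow> ('k, 'h, 'u1) bimodule \<Rightarrow> ('k, 'h, 'x) bimodule \<Rightarrow> bool"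
  where "braided_monoidal_axioms K H V V' V'' W W' W'' U U' X \<longleftrightarrow>
    category_axioms K H V W U \<and>
    tensor_functor_axioms K H V V' V'' W W' W'' \<and>
    associator_axioms K H V V' W W' U U' \<and>
    unit_axioms K H V V' \<and>
    pentagon_axiom K H V W U X \<and>
    triangle_axiom K H V W \<and>
    braiding_axioms K H V V' W W' \<and>
    hexagon_axioms K H V W U"

section \<open>The twisting functor\<close>

text \<open>
  The functor on objects; on morphisms it is the identity. The new \<open>lact\<close> and \<open>ract\<close> are
  \<open>h \<bullet> v\<close> and \<open>v \<bullet> h\<close>; the vector space and the coactions are those of \<open>V\<close>.
\<close>

definition twisted_bimodule ::
  "('k, 'l) ring_scheme \<Rightarrow> ('k, 'h) hopf \<Rightarrow> (('h \<times> 'h) list set \<Rightarrow> 'k)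
    \<Rightarrow> ('k, 'h, 'v) bimodule \<Rightarrow> ('k, 'h, 'v) bimodule"
  where "twisted_bimodule K H \<chi> V = V
    \<lparr> lact := (\<lambda>h\<in>carrier H. \<lambda>v\<in>carrier V.
        sweedler3 V H h (\<lambda>h1 h2 h3. bisweedler V V v (\<lambda>v1 v2 v3.
          (\<chi> (tensor K H H h1 v1) \<otimes>\<^bsub>K\<^esub> cocycle_inverse K H \<chi> (tensor K H H h3 v3)) \<odot>\<^bsub>V\<^esub> lact V h2 v2))),
      ract := (\<lambda>v\<in>carrier V. \<lambda>h\<in>carrier H.
        bisweedler V V v (\<lambda>v1 v2 v3. sweedler3 V H h (\<lambda>h1 h2 h3.
          (\<chi> (tensor K H H v1 h1) \<otimes>\<^bsub>K\<^esub> cocycle_inverse K H \<chi> (tensor K H H v3 h3)) \<odot>\<^bsub>V\<^esub> ract V v2 h2))) \<rparr>"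

text \<open>
  \<open>twist_formula K H \<chi> V W v w\<close> is \<open>\<chi>(v_(1) \<otimes> w_(1)) v_(2) \<otimes>\<^sub>H w_(2) \<chi>\<^sup>-\<^sup>1(v_(3) \<otimes> w_(3))\<close>, and
  \<open>monoidal_twist\<close> is the map it induces on the tensor product over the twisted Hopf algebra.
\<close>

definition twist_formula ::
  "('k, 'l) ring_scheme \<Rightarrow> ('k, 'h) hopf \<Rightarrow> (('h \<times> 'h) list set \<Rightarrow> 'k)
    \<Rightarrow> ('k, 'h, 'v) bimodule \<Rightarrow> ('k, 'h, 'w) bimodule \<Rightarrow> 'v \<Rightarrow> 'w \<Rightarrow> ('v \<times> 'w) list set"
  where "twist_formula K H \<chi> V W v w =
    (let T = htensor_bimodule K H V W
     in bisweedler T V v (\<lambda>v1 v2 v3. bisweedler T W w (\<lambda>w1 w2 w3.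
          (\<chi> (tensor K H H v1 w1) \<otimes>\<^bsub>K\<^esub> cocycle_inverse K H \<chi> (tensor K H H v3 w3))
          \<odot>\<^bsub>T\<^esub> htensor H V W v2 w2)))"

definition monoidal_twist ::
  "('k, 'l) ring_scheme \<Rightarrow> ('k, 'h) hopf \<Rightarrow> (('h \<times> 'h) list set \<Rightarrow> 'k)
    \<Rightarrow> ('k, 'h, 'v) bimodule \<Rightarrow> ('k, 'h, 'w) bimodule \<Rightarrow> ('v \<times> 'w) list set \<Rightarrow> ('v \<times> 'w) list set"
  where "monoidal_twist K H \<chi> V W =
    (\<lambda>t\<in>carrier (htensor_bimodule K (twisted_hopf K H \<chi>) (twisted_bimodule K H \<chi> V) (twisted_bimodule K H \<chi> W)).
      tensor_lift (htensor_bimodule K H V W) (twist_formula K H \<chi> V W) t)"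

text \<open>
  The coherence conditions making the twisting functor \<open>G\<close>, with \<open>c = monoidal_twist\<close> and the identity
  as unit comparison \<open>H\<^sup>\<chi> = G(H)\<close>, a strong monoidal functor. Since \<open>G\<close> is the identity on morphisms,
  \<open>G(f)\<close> is written \<open>f\<close>.
\<close>

definition monoidal_functor_axioms ::
  "('k, 'l) ring_scheme \<Rightarrow> ('k, 'h) hopf \<Rightarrow> (('h \<times> 'h) list set \<Rightarrow> 'k)
    \<Rightarrow> ('k, 'h, 'v) bimodule \<Rightarrow> ('k, 'h, 'v1) bimodule \<Rightarrow> ('k, 'h, 'w) bimodule
    \<Rightarrow> ('k, 'h, 'w1) bimodule \<Rightarrow> ('k, 'h, 'u) bimodule \<Rightarrow> bool"
  where "monoidal_functor_axioms K H \<chi> V V' W W' U \<longleftrightarrow>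
    (let H\<chi> = twisted_hopf K H \<chi>; I = unit_bimodule H; I\<chi> = unit_bimodule H\<chi>;
         GV = twisted_bimodule K H \<chi> V; GV' = twisted_bimodule K H \<chi> V';
         GW = twisted_bimodule K H \<chi> W; GW' = twisted_bimodule K H \<chi> W';
         GU = twisted_bimodule K H \<chi> U;
         VW = htensor_bimodule K H V W; WU = htensor_bimodule K H W U;
         GV_GW = htensor_bimodule K H\<chi> GV GW; GW_GU = htensor_bimodule K H\<chi> GW GU;
         G_VW = twisted_bimodule K H \<chi> VW; G_WU = twisted_bimodule K H \<chi> WU
     in monoidal_twist K H \<chi> V W \<in> bicovariant_iso K H\<chi> GV_GW G_VW \<and>
        (\<forall>v\<in>carrier V. \<forall>w\<in>carrier W.
          monoidal_twist K H \<chi> V W (htensor H\<chi> GV GW v w) = twist_formula K H \<chi> V W v w) \<and>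
        (\<forall>f\<in>bicovariant_hom K H V V'. \<forall>g\<in>bicovariant_hom K H W W'. \<forall>t\<in>carrier GV_GW.
          monoidal_twist K H \<chi> V' W' (htensor_map K H\<chi> GV GW GV' GW' f g t) =
          htensor_map K H V W V' W' f g (monoidal_twist K H \<chi> V W t)) \<and>
        (\<forall>t\<in>carrier (htensor_bimodule K H\<chi> GV_GW GU).
          associator K H V W U
            (monoidal_twist K H \<chi> VW U
              (htensor_map K H\<chi> GV_GW GU G_VW GU (monoidal_twist K H \<chi> V W) (identity_map GU) t)) =
          monoidal_twist K H \<chi> V WU
            (htensor_map K H\<chi> GV GW_GU GV G_WU (identity_map GV) (monoidal_twist K H \<chi> W U)
              (associator K H\<chi> GV GW GU t))) \<and>
        twisted_bimodule K H \<chi> I = I\<chi> \<and>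
        (\<forall>t\<in>carrier (htensor_bimodule K H\<chi> I\<chi> GV).
          left_unitor K H V (monoidal_twist K H \<chi> I V t) = left_unitor K H\<chi> GV t) \<and>
        (\<forall>t\<in>carrier (htensor_bimodule K H\<chi> GV I\<chi>).
          right_unitor K H V (monoidal_twist K H \<chi> V I t) = right_unitor K H\<chi> GV t))"

definition braided_functor_axiom ::
  "('k, 'l) ring_scheme \<Rightarrow> ('k, 'h) hopf \<Rightarrow> (('h \<times> 'h) list set \<Rightarrow> 'k)
    \<Rightarrow> ('k, 'h, 'v) bimodule \<Rightarrow> ('k, 'h, 'w) bimodule \<Rightarrow> bool"
  where "braided_functor_axiom K H \<chi> V W \<longleftrightarrow>
    (let H\<chi> = twisted_hopf K H \<chi>; GV = twisted_bimodule K H \<chi> V; GW = twisted_bimodule K H \<chi> W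
     in \<forall>t\<in>carrier (htensor_bimodule K H\<chi> GV GW).
          braiding K H V W (monoidal_twist K H \<chi> V W t) =
          monoidal_twist K H \<chi> W V (braiding K H\<chi> GV GW t))"

end

theory Submission imports Defs begin

text \<open>
  Every structure map in sight (the product of \<open>H\<close>, the actions, the universal maps \<open>V \<times> W \<rightarrow> V \<otimes>\<^sub>H W\<close>)
  is a bicolinear bilinear map \<open>m\<close>, and \<open>\<chi>\<close> deforms all of them by the same rule
  \<open>m(x, y) \<mapsto> \<chi>(x\<^sub>1, y\<^sub>1) m(x\<^sub>2, y\<^sub>2) \<chi>\<^sup>-\<^sup>1(x\<^sub>3, y\<^sub>3)\<close>. The cocycle identity makes the rule preserve associativity
  constraints \<open>n(m(x, y), z) = n'(x, m'(y, z))\<close>; it commutes with bicolinear maps, turns \<open>H\<close>-colinear maps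
  into \<open>H\<^sup>\<chi>\<close>-colinear ones, fixes \<open>m(x, y)\<close> when \<open>x\<close> and \<open>y\<close> are invariant on opposite sides, and is inverted
  by \<open>\<chi>\<^sup>-\<^sup>1\<close>, which is a cocycle on \<open>H\<^sup>\<chi>\<close>. Hence the twisting functor, its inverse and its monoidal structure
  all come from this one construction, and compatibility with the braidings need only be checked on
  products of a left-invariant and a right-invariant element, where the twist does nothing.

  A right-handed statement is the left-handed one for the co-opposite Hopf algebra. The braiding is
  \<open>\<Psi>(v \<otimes> w) = v\<^sub>-\<^sub>1 w\<^sub>0 \<otimes> S(w\<^sub>1) P(v\<^sub>0) w\<^sub>2\<close> with \<open>P(v) = S(v\<^sub>-\<^sub>1) v\<^sub>0\<close> the projection on left-invariant elements,
  and its inverse is the braiding for the co-opposite.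
\<close>

text \<open>The two-sided twist factors into twisting by \<chi> through the left coactions and by
  \<chi>^-1 through the right coactions; the two commute because the coactions do. Right coactions
  over \<open>H\<close> are left coactions over the co-opposite, where \<chi>^-1 is a cocycle, so
  each identity is computed only for the left twist by a cocycle. Invertibility of the antipode is
  what makes the co-opposite a Hopf algebra. The antipode of the twist falls outside the scheme of
  bilinear maps: its axioms need \<open>U\<close> to be convolution invertible, which rests on a
  mixed identity between \<chi> and \<chi>^-1. Sweedler notation hides a choice of representatives:
  regrouping a sum is legitimate only for multilinear summands, so each coassociativity or antipode
  step carries a linearity proof that follows the syntax of the summand. The symmetry between
  \<open>H\<close> with \<chi> and its twist with \<chi>^-1, and the passage to co-opposites, are
  built into the locales by describing the twist \<open>H'\<close> through its properties instead of
  as one particular record.\<close>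

abbreviation mem_carrier (infix ":<" 50) where "x :< V \<equiv> x \<in> carrier V"
abbreviation "tlift \<equiv> tensor_lift"
abbreviation scaled ("_ *[_] _" [70, 0, 71] 70) where "a *[M] b \<equiv> a \<odot>\<^bsub>M\<^esub> b"

section \<open>Formal sums and tensor products\<close>

text \<open>A fold over a list, because a formal sum may repeat a pair and
  \<open>tensor_lift\<close> folds in exactly this way.\<close>

definition lsum :: "('x, 'm) ring_scheme \<Rightarrow> 'p list \<Rightarrow> ('p \<Rightarrow> 'x) \<Rightarrow> 'x" where
 "lsum M xs f = foldr (%p s. f p \<oplus>\<^bsub>M\<^esub> s) xs \<zero>\<^bsub>M\<^esub>"

lemma lsum_Nil [simp]: "lsum M [] f = \<zero>\<^bsub>M\<^esub>"
 and lsum_Cons [simp]: "lsum M (x # xs) f = f x \<oplus>\<^bsub>M\<^esub> lsum M xs f"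
 by (simp_all add: lsum_def)

lemma tensor_lift_eq_lsum: "tlift M f t = lsum M (tensor_rep t) (case_prod f)"
 by (simp add: lsum_def tensor_lift_def split_def)

lemma lsum_map: "lsum M (map g xs) f = lsum M xs (%x. f (g x))"
 by (induction xs) simp_all

lemma lsum_cong: "(!!p. p : set xs ==> f p = g p) ==> lsum M xs f = lsum M xs g"
 by (induction xs) simp_all

context abelian_group
begin

lemma lsum_closed: "(!!p. p : set xs ==> f p :< G) ==> lsum G xs f :< G"
 by (induction xs) simp_all

lemma lsum_append:
 "(!!p. p : set xs \<union> set ys ==> f p :< G) ==> lsum G (xs @ ys) f = lsum G xs f \<oplus> lsum G ys f"
 by (induction xs) (simp_all add: lsum_closed a_assoc)

lemma lsum_zero: "lsum G xs (%_. \<zero>) = \<zero>"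
 by (induction xs) simp_all

lemma lsum_add:
 assumes "!!p. p : set xs ==> f p :< G" "!!p. p : set xs ==> g p :< G"
 shows "lsum G xs (%p. f p \<oplus> g p) = lsum G xs f \<oplus> lsum G xs g"
 using assms
proof (induction xs)
 case (Cons x xs)
 then have "lsum G xs f :< G" "lsum G xs g :< G" "f x :< G" "g x :< G"
  by (simp_all add: lsum_closed)
 with Cons show ?case by (simp add: a_ac)
qed simp

lemma lsum_swap:
 assumes "!!p q. p : set xs ==> q : set ys ==> f p q :< G"
 shows "lsum G xs (%p. lsum G ys (f p)) = lsum G ys (%q. lsum G xs (%p. f p q))"
 using assms
proof (induction xs)
 case (Cons x xs)
 then show ?case by (simp add: lsum_add lsum_closed)
qed (simp add: lsum_zero)

end

lemma additive_zero:
 assumes "abelian_group V" "abelian_group W" "f : carrier V \<rightarrow> carrier W"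
  "!!x y. x :< V ==> y :< V ==> f (x \<oplus>\<^bsub>V\<^esub> y) = f x \<oplus>\<^bsub>W\<^esub> f y"
 shows "f \<zero>\<^bsub>V\<^esub> = \<zero>\<^bsub>W\<^esub>"
proof -
 interpret V: abelian_group V by fact
 interpret W: abelian_group W by fact
 have "f \<zero>\<^bsub>V\<^esub> :< W" using assms(3) by auto
 then show ?thesis using assms(4)[of "\<zero>\<^bsub>V\<^esub>" "\<zero>\<^bsub>V\<^esub>"] by (metis V.l_zero V.zero_closed W.add.l_cancel_one')
qed

text \<open>Equivalent formal sums have entries in the carriers, so inductions over the congruence
  may assume it. Closure of the two structures under sums and zero is what the additive rules
  require.\<close>

lemma tensor_eq_lists:
 assumes "tensor_eq V W B xs ys"
  and "!!a b. a :< V ==> b :< V ==> a \<oplus>\<^bsub>V\<^esub> b :< V"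
  and "!!a b. a :< W ==> b :< W ==> a \<oplus>\<^bsub>W\<^esub> b :< W"
  and "\<zero>\<^bsub>V\<^esub> :< V" "\<zero>\<^bsub>W\<^esub> :< W"
 shows "xs : lists (carrier V \<times> carrier W) \<and> ys : lists (carrier V \<times> carrier W)"
 using assms(1) by induction (use assms(2-) in auto)

lemma tensor_class_eq: "tensor_eq V W B xs ys ==> tensor_class V W B xs = tensor_class V W B ys"
 unfolding tensor_class_def by (auto intro: tensor_eq.sym tensor_eq.trans)

text \<open>The class contains \<open>xs\<close> by reflexivity, so the choice succeeds and returns
  an equivalent formal sum. All facts about chosen representatives go back to this one.\<close>

lemma tensor_rep_eq:
 "xs : lists (carrier V \<times> carrier W) ==> tensor_eq V W B xs (tensor_rep (tensor_class V W B xs))"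
proof -
 assume "xs : lists (carrier V \<times> carrier W)"
 then have "xs : tensor_class V W B xs" by (simp add: tensor_class_def tensor_eq.refl)
 then have "tensor_rep (tensor_class V W B xs) : tensor_class V W B xs"
  unfolding tensor_rep_def by (rule someI)
 then show ?thesis by (simp add: tensor_class_def)
qed

lemma ground_module_simps [simp]:
 "carrier (ground_module K) = carrier K" "add (ground_module K) = add K"
 "zero (ground_module K) = zero K" "smult (ground_module K) = mult K"
 "mult (ground_module K) = mult K" "one (ground_module K) = one K"
 by (simp_all add: ground_module_def)

lemma tensor_lift_ground: "tlift (ground_module K) = tlift K"
 by (simp add: fun_eq_iff tensor_lift_def)

lemma tensor_module_simps:
 "carrier (tensor_module V W B) = tensor_class V W B ` lists (carrier V \<times> carrier W)"
 "zero (tensor_module V W B) = tensor_class V W B []"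
 by (simp_all add: tensor_module_def)

text \<open>Rules that prove a map linear, bilinear or trilinear by following its syntax. Together
  with the membership rules \<open>cl\<close> they settle the side conditions when Sweedler sums are
  regrouped.\<close>

named_theorems lin

declare tensor_module_simps [simp]

named_theorems cl

locale ground =
 fixes K :: "('k, 'l) ring_scheme"
 assumes K_cring: "cring K"
begin

abbreviation kmult (infixl "\<star>" 70) where "a \<star> b \<equiv> a \<otimes>\<^bsub>K\<^esub> b"
abbreviation "lmap \<equiv> linear_map K"
abbreviation "bmap \<equiv> bilinear_map K"
abbreviation "kmod \<equiv> module K"
abbreviation "ts \<equiv> tensor_space K"
abbreviation "tn \<equiv> tensor K"

sublocale K: cring K by (rule K_cring)

abbreviation "G \<equiv> ground_module K"

lemma modG [cl]: "kmod G"
proof -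
 have "abelian_group G"
  by (rule abelian_groupI) (auto simp: K.a_ac intro: K.l_neg)
 then show ?thesis by (intro moduleI K_cring) (auto simp: K.l_distr K.r_distr K.m_assoc)
qed

lemma module_grp: "kmod M ==> abelian_group M"
 by (simp add: module_def)

section \<open>Linear and bilinear maps\<close>

lemma linear_mapI [intro?]:
 assumes "!!x. x :< V ==> f x :< W"
  "!!x y. x :< V ==> y :< V ==> f (x \<oplus>\<^bsub>V\<^esub> y) = f x \<oplus>\<^bsub>W\<^esub> f y"
  "!!a x. a :< K ==> x :< V ==> f (a *[V] x) = a *[W] f x"
 shows "lmap V W f"
 using assms by (auto simp: linear_map_def)

lemma linear_closed: "lmap V W f ==> x :< V ==> f x :< W"
 and linear_add: "lmap V W f ==> x :< V ==> y :< V ==> f (x \<oplus>\<^bsub>V\<^esub> y) = f x \<oplus>\<^bsub>W\<^esub> f y"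
 and linear_smult: "lmap V W f ==> x :< V ==> a :< K ==> f (a *[V] x) = a *[W] f x"
 by (auto simp: linear_map_def)

lemma linear_cong:
 assumes "!!x. x :< V ==> f x = g x" "kmod V"
 shows "lmap V W f \<longleftrightarrow> lmap V W g"
proof -
 interpret V: module K V by fact
 show ?thesis using assms(1) unfolding linear_map_def Pi_def by simp
qed

lemma linear_zero:
 "lmap V W f ==> kmod V ==> kmod W ==> f \<zero>\<^bsub>V\<^esub> = \<zero>\<^bsub>W\<^esub>"
 by (rule additive_zero) (auto simp: linear_map_def module_def)

lemma linear_compose: "lmap V W f ==> lmap W X g ==> lmap V X (%x. g (f x))"
 by (auto simp: linear_map_def Pi_iff)

lemma linear_lsum:
 assumes "lmap V W f" "kmod V" "kmod W" "!!p. p : set xs ==> g p :< V"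
 shows "f (lsum V xs g) = lsum W xs (%p. f (g p))"
 using assms(4)
proof (induction xs)
 case (Cons x xs)
 have "lsum V xs g :< V" using Cons by (simp add: abelian_group.lsum_closed[OF module_grp[OF assms(2)]])
 with Cons show ?case by (simp add: linear_add[OF assms(1)])
qed (simp add: linear_zero assms)

lemma bilinear_mapI [lin]:
 "(!!v. v :< V ==> lmap W X (%w. f v w)) ==>
  (!!w. w :< W ==> lmap V X (%v. f v w)) ==> bmap V W X f"
 by (simp add: bilinear_map_def)

lemma bilinear_l: "bmap V W X f ==> w :< W ==> lmap V X (%v. f v w)"
 and bilinear_r: "bmap V W X f ==> v :< V ==> lmap W X (%w. f v w)"
 by (simp_all add: bilinear_map_def)

lemma bilinear_closed: "bmap V W X f ==> v :< V ==> w :< W ==> f v w :< X"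
 by (metis bilinear_l linear_closed)

lemma linear_bil_l: "bmap V W X m ==> lmap Y V f ==> w :< W ==> lmap Y X (%y. m (f y) w)"
 and linear_bil_r: "bmap V W X m ==> lmap Y W g ==> v :< V ==> lmap Y X (%y. m v (g y))"
 by (auto intro: linear_compose bilinear_l bilinear_r)

lemmas bmap_rules = linear_bil_l linear_bil_r bilinear_closed

lemma linear_id [lin]: "lmap V V (%v. v)"
 by (simp add: linear_map_def)

text \<open>Scalars are treated as a bilinear map out of the ground module, so that the general
  rules for bilinear maps cover them. Homogeneity in the vector uses the commutativity of
  \<open>K\<close>.\<close>

lemma bilinear_smult: "kmod M ==> bmap G M M (smult M)"
proof (intro bilinear_mapI linear_mapI)
 assume "kmod M"
 then interpret M: module K M .
 { fix v x y assume "v :< G" "x :< M" "y :< M"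
  then show "v *[M] x :< M" "v *[M] (x \<oplus>\<^bsub>M\<^esub> y) = v *[M] x \<oplus>\<^bsub>M\<^esub> v *[M] y"
   by (simp_all add: M.smult_r_distr) }
 { fix a v x assume "v :< G" "a :< K" "x :< M"
  then show "v *[M] (a *[M] x) = a *[M] (v *[M] x)"
   using M.smult_assoc1 by (simp add: M.smult_assoc1[symmetric] K.m_comm) }
 { fix w x y assume "w :< M" "x :< G" "y :< G"
  then show "x *[M] w :< M" "(x \<oplus>\<^bsub>G\<^esub> y) *[M] w = x *[M] w \<oplus>\<^bsub>M\<^esub> y *[M] w"
   by (simp_all add: M.smult_l_distr) }
 { fix a v x assume "v :< M" "a :< K" "x :< G"
  then show "(a *[G] x) *[M] v = a *[M] (x *[M] v)"
   using M.smult_assoc1 by simp }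
qed

lemma linear_smult_l [lin]:
  "lmap X G f ==> m :< M ==> kmod M ==> lmap X M (%x. f x *[M] m)"
 and linear_smult_r [lin]:
  "lmap X M g ==> a :< K ==> kmod M ==> lmap X M (%x. a *[M] g x)"
 using linear_bil_l[OF bilinear_smult] linear_bil_r[OF bilinear_smult] by auto

lemma linear_multK_l [lin]: "lmap X G f ==> b :< K ==> lmap X G (%x. f x \<star> b)"
 and linear_multK_r [lin]: "lmap X G f ==> b :< K ==> lmap X G (%x. b \<star> f x)"
 using linear_smult_l[of X f b G] linear_smult_r[of X G f b] modG by auto

lemma linear_plus:
 assumes "lmap X M f" "lmap X M g" "kmod M"
 shows "lmap X M (%x. f x \<oplus>\<^bsub>M\<^esub> g x)"
proof -
 interpret M: module K M by fact
 have "f x :< M" "g x :< M" if "x :< X" for x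
  using linear_closed[OF assms(1) that] linear_closed[OF assms(2) that] by blast+
 then show ?thesis
  using assms by (intro linear_mapI) (simp_all add: linear_add linear_smult M.a_ac M.smult_r_distr)
qed

lemma linear_const_zero:
 assumes "kmod M" shows "lmap X M (%x. \<zero>\<^bsub>M\<^esub>)"
proof -
 interpret M: module K M by fact
 show ?thesis by (intro linear_mapI) simp_all
qed

lemma linear_lsum_fun:
 assumes "kmod M" "!!p. p : set ps ==> lmap X M (%x. F x p)"
 shows "lmap X M (%x. lsum M ps (F x))"
 using assms(2) by (induction ps) (simp_all add: linear_const_zero linear_plus assms(1))

definition balanced_map where
 "balanced_map V W B f \<longleftrightarrow> (\<forall>(p, q) \<in> B. p : carrier V \<times> carrier W \<longrightarrow> q : carrier V \<times> carrier W \<longrightarrow>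
   case_prod f p = case_prod f q)"

text \<open>Scaling in the first factor must respect the balancing relations for the tensor product to be a module.\<close>

definition good_balance where
 "good_balance V W B \<longleftrightarrow> (\<forall>v w v' w' a. ((v, w), (v', w')) : B \<longrightarrow> v :< V \<longrightarrow> w :< W \<longrightarrow>
   v' :< V \<longrightarrow> w' :< W \<longrightarrow> a :< K \<longrightarrow>
   ((a *[V] v, w), (a *[V] v', w')) : B)"

text \<open>Independence of the representative, by induction over the congruence: each generating
  rule matches a property of \<open>f\<close>, namely additivity in one argument, vanishing at zero,
  or balance.\<close>

lemma tensor_eq_lsum:
 assumes V: "kmod V" and W: "kmod W" and M: "kmod M" and f: "bmap V W M f"
  and bal: "balanced_map V W B f" and eq: "tensor_eq V W B xs ys"
 shows "lsum M xs (case_prod f) = lsum M ys (case_prod f)"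
proof -
 interpret V: module K V by fact
 interpret W: module K W by fact
 interpret M: module K M by fact
 have cl: "case_prod f p :< M" if "p : carrier V \<times> carrier W" for p
  using that bilinear_closed[OF f] by auto
 have L: "xs : lists (carrier V \<times> carrier W) \<and> ys : lists (carrier V \<times> carrier W)"
  if "tensor_eq V W B xs ys" for xs ys by (rule tensor_eq_lists[OF that]) auto
 have ap: "lsum M (xs @ ys) (case_prod f) = lsum M xs (case_prod f) \<oplus>\<^bsub>M\<^esub> lsum M ys (case_prod f)"
  if "xs : lists (carrier V \<times> carrier W)" "ys : lists (carrier V \<times> carrier W)" for xs ys
  by (rule M.lsum_append) (use that cl in auto)
 have lc: "lsum M xs (case_prod f) :< M" if "xs : lists (carrier V \<times> carrier W)" for xs
  by (rule M.lsum_closed) (use that cl in auto)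
 show ?thesis using eq
 proof induction
  case (append xs ys xs' ys')
  then show ?case using L[OF append(1)] L[OF append(2)] by (simp add: ap)
 next
  case (commute xs ys)
  then show ?case by (simp add: ap M.a_comm lc)
 next
  case (add_left v v' w)
  then show ?case using bilinear_closed[OF f] by (simp add: linear_add[OF bilinear_l[OF f]])
 next
  case (add_right v w w')
  then show ?case using bilinear_closed[OF f] by (simp add: linear_add[OF bilinear_r[OF f]])
 next
  case (zero_left w)
  then show ?case using linear_zero[OF bilinear_l[OF f] V M] by simp
 next
  case (zero_right v)
  then show ?case using linear_zero[OF bilinear_r[OF f] W M] by simp
 next
  case (balanced p q)
  then show ?case using bal cl unfolding balanced_map_def by fastforce
 qed auto
qed

lemma tensor_lift_class:
 assumes "kmod V" "kmod W" "kmod M" "bmap V W M f" "balanced_map V W B f"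
  "xs : lists (carrier V \<times> carrier W)"
 shows "tlift M f (tensor_class V W B xs) = lsum M xs (case_prod f)"
 unfolding tensor_lift_eq_lsum
 using tensor_eq_lsum[OF assms(1-5) tensor_rep_eq[OF assms(6), of B]] by simp

lemma tensor_rep_lists:
 assumes "kmod V" "kmod W" "t :< (tensor_module V W B)"
 shows "tensor_rep t : lists (carrier V \<times> carrier W)" "tensor_class V W B (tensor_rep t) = t"
proof -
 interpret V: module K V by fact
 interpret W: module K W by fact
 obtain xs where xs: "t = tensor_class V W B xs" "xs : lists (carrier V \<times> carrier W)"
  using assms(3) by auto
 from tensor_rep_eq[OF xs(2), of B] have *: "tensor_eq V W B xs (tensor_rep t)" by (simp add: xs)
 show "tensor_rep t : lists (carrier V \<times> carrier W)"
  using tensor_eq_lists[OF *] by auto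
 show "tensor_class V W B (tensor_rep t) = t"
  using tensor_class_eq[OF *] xs by simp
qed

section \<open>The module of formal sums modulo the congruence\<close>

lemma tensor_module_add:
 assumes "xs : lists (carrier V \<times> carrier W)" "ys : lists (carrier V \<times> carrier W)"
 shows "tensor_class V W B xs \<oplus>\<^bsub>tensor_module V W B\<^esub> tensor_class V W B ys = tensor_class V W B (xs @ ys)"
proof -
 have "tensor_eq V W B (xs @ ys) (tensor_rep (tensor_class V W B xs) @ tensor_rep (tensor_class V W B ys))"
  by (intro tensor_eq.append tensor_rep_eq assms)
 then show ?thesis by (simp add: tensor_module_def tensor_class_eq[symmetric])
qed

lemma map_fst_lists:
 "(!!v. v : A ==> f v : A) ==> xs : lists (A \<times> B) ==> map (\<lambda>(v, w). (f v, w)) xs : lists (A \<times> B)"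
 by (induction xs) auto

text \<open>Scaling all first factors maps each generating rule to an instance of the same rule; for
  the balancing rule this is the content of \<open>good_balance\<close>.\<close>

lemma tensor_eq_scale:
 assumes V: "kmod V" and W: "kmod W" and B: "good_balance V W B" and a: "a :< K"
  and eq: "tensor_eq V W B xs ys"
 shows "tensor_eq V W B (map (\<lambda>(v, w). (a *[V] v, w)) xs) (map (\<lambda>(v, w). (a *[V] v, w)) ys)"
proof -
 interpret V: module K V by fact
 interpret W: module K W by fact
 have L: "map (\<lambda>(v, w). (a *[V] v, w)) xs : lists (carrier V \<times> carrier W)"
  if "xs : lists (carrier V \<times> carrier W)" for xs
  by (rule map_fst_lists[OF _ that]) (simp add: a)
 show ?thesis using eq
 proof induction
  case (refl xs)
  show ?case by (rule tensor_eq.refl[OF L[OF refl]])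
 next
  case (sym xs ys)
  then show ?case by (blast intro: tensor_eq.sym)
 next
  case (trans xs ys zs)
  then show ?case by (blast intro: tensor_eq.trans)
 next
  case (append xs ys xs' ys')
  then show ?case by (simp add: tensor_eq.append)
 next
  case (commute xs ys)
  then show ?case using tensor_eq.commute[OF L[OF commute(1)] L[OF commute(2)]] by simp
 next
  case (add_left v v' w)
  then show ?case using a by (simp add: V.smult_r_distr tensor_eq.add_left)
 next
  case (balanced p q)
  then show ?case using B a
   by (cases p; cases q) (auto simp: good_balance_def intro!: tensor_eq.balanced)
 qed (use a in \<open>auto intro: tensor_eq.intros\<close>)
qed

lemma tensor_module_smult:
 assumes "kmod V" "kmod W" "good_balance V W B" "a :< K" "xs : lists (carrier V \<times> carrier W)"
 shows "a *[tensor_module V W B] tensor_class V W B xs = tensor_class V W B (map (\<lambda>(v, w). (a *[V] v, w)) xs)"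
 using tensor_class_eq[OF tensor_eq_scale[OF assms(1-4) tensor_rep_eq[OF assms(5)]]]
 by (simp add: tensor_module_def)

lemma tensor_eq_concat:
 "(!!x. x : set xs ==> tensor_eq V W B (f x) (g x)) ==>
  tensor_eq V W B (concat (map f xs)) (concat (map g xs))"
 by (induction xs) (auto intro: tensor_eq.append tensor_eq.refl)

text \<open>Sorts an interleaved formal sum into two blocks by moving each \<open>g x\<close> behind
  the remaining terms \<open>f y\<close>. Both the negatives and the distributive law for scalars
  need it.\<close>

lemma tensor_eq_unzip:
 assumes V: "kmod V" and W: "kmod W"
  and "!!x. x : set xs ==> f x : carrier V \<times> carrier W \<and> g x : carrier V \<times> carrier W"
 shows "tensor_eq V W B (concat (map (%x. [f x, g x]) xs)) (map f xs @ map g xs)"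
 using assms(3)
proof (induction xs)
 case (Cons x xs)
 have l: "map f xs : lists (carrier V \<times> carrier W)" "map g xs : lists (carrier V \<times> carrier W)"
  "[f x] : lists (carrier V \<times> carrier W)" "[g x] : lists (carrier V \<times> carrier W)"
  using Cons by fastforce+
 have "tensor_eq V W B (([f x] @ [g x]) @ concat (map (%x. [f x, g x]) xs)) (([f x] @ [g x]) @ (map f xs @ map g xs))"
  by (intro tensor_eq.append Cons.IH tensor_eq.refl) (use l Cons in auto)
 moreover have "tensor_eq V W B ([f x] @ ([g x] @ map f xs) @ map g xs) ([f x] @ (map f xs @ [g x]) @ map g xs)"
  by (intro tensor_eq.append tensor_eq.commute tensor_eq.refl) (use l in auto)
 ultimately show ?case by (auto intro: tensor_eq.trans)
qed (simp add: tensor_eq.refl)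

text \<open>Pair by pair, \<open>(-v + v) \<otimes> w\<close> is \<open>0 \<otimes> w\<close>, hence
  the empty sum. This supplies the negatives of the module.\<close>

lemma tensor_eq_cancel:
 assumes V: "kmod V" and W: "kmod W" and xs: "xs : lists (carrier V \<times> carrier W)"
 shows "tensor_eq V W B (map (\<lambda>(v, w). (\<ominus>\<^bsub>V\<^esub> v, w)) xs @ xs) []"
proof -
 interpret V: module K V by fact
 interpret W: module K W by fact
 let ?n = "\<lambda>(v, w). (\<ominus>\<^bsub>V\<^esub> v, w)"
 have 1: "tensor_eq V W B (concat (map (%x. [?n x, x]) xs)) (map ?n xs @ map (%x. x) xs)"
  by (rule tensor_eq_unzip[OF V W]) (use xs in auto)
 have "tensor_eq V W B [?n x, x] []" if x0: "x : carrier V \<times> carrier W" for x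
 proof -
  obtain v w where x: "x = (v, w)" "v :< V" "w :< W" using x0 by auto
  have "tensor_eq V W B [(\<ominus>\<^bsub>V\<^esub> v \<oplus>\<^bsub>V\<^esub> v, w)] [(\<ominus>\<^bsub>V\<^esub> v, w), (v, w)]"
   by (rule tensor_eq.add_left) (use x in auto)
  moreover have "tensor_eq V W B [(\<ominus>\<^bsub>V\<^esub> v \<oplus>\<^bsub>V\<^esub> v, w)] []"
   using x by (simp add: V.l_neg tensor_eq.zero_left)
  ultimately show ?thesis using x by (auto intro: tensor_eq.sym tensor_eq.trans)
 qed
 then have "tensor_eq V W B (concat (map (%x. [?n x, x]) xs)) (concat (map (%x. []) xs))"
  by (intro tensor_eq_concat) (use xs in auto)
 moreover have "concat (map (%x. []) xs) = []" by (induction xs) auto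
 ultimately have "tensor_eq V W B (concat (map (%x. [?n x, x]) xs)) []" by metis
 with 1 show ?thesis by (auto intro: tensor_eq.sym tensor_eq.trans)
qed

lemma module_tensor_module:
 assumes V: "kmod V" and W: "kmod W" and B: "good_balance V W B"
 shows "kmod (tensor_module V W B)"
proof -
 interpret V: module K V by fact
 interpret W: module K W by fact
 let ?T = "tensor_module V W B"
 let ?L = "lists (carrier V \<times> carrier W)"
 have grp: "abelian_group ?T"
 proof (rule abelian_groupI)
  fix x y z assume x: "x :< ?T" and y: "y :< ?T" and z: "z :< ?T"
  then obtain xs ys zs where e: "x = tensor_class V W B xs" "y = tensor_class V W B ys" "z = tensor_class V W B zs"
   "xs : ?L" "ys : ?L" "zs : ?L" by auto
  then have "xs @ ys : ?L" "ys @ zs : ?L" by auto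
  then show "x \<oplus>\<^bsub>?T\<^esub> y :< ?T" "x \<oplus>\<^bsub>?T\<^esub> y \<oplus>\<^bsub>?T\<^esub> z = x \<oplus>\<^bsub>?T\<^esub> (y \<oplus>\<^bsub>?T\<^esub> z)" "x \<oplus>\<^bsub>?T\<^esub> y = y \<oplus>\<^bsub>?T\<^esub> x"
   using e by (auto simp: tensor_module_add tensor_class_eq tensor_eq.commute simp del: append_in_lists_conv)
  show "\<zero>\<^bsub>?T\<^esub> \<oplus>\<^bsub>?T\<^esub> x = x" using e tensor_module_add[of "[]" V W xs B] by simp
  have "map (\<lambda>(v, w). (\<ominus>\<^bsub>V\<^esub> v, w)) xs : ?L" by (rule map_fst_lists[OF _ e(4)]) simp
  then have "tensor_class V W B (map (\<lambda>(v, w). (\<ominus>\<^bsub>V\<^esub> v, w)) xs) \<oplus>\<^bsub>?T\<^esub> x = \<zero>\<^bsub>?T\<^esub>"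
   using e tensor_class_eq[OF tensor_eq_cancel[OF V W e(4), of B]] by (simp add: tensor_module_add)
  then show "\<exists>y\<in>carrier ?T. y \<oplus>\<^bsub>?T\<^esub> x = \<zero>\<^bsub>?T\<^esub>"
   using \<open>map _ xs : ?L\<close> by (intro bexI) auto
 qed auto
 note sm = tensor_module_smult[OF V W B]
 show ?thesis
 proof (rule moduleI[OF K_cring grp])
  fix a b x y assume a: "a :< K" and b: "b :< K" and x: "x :< ?T" and y: "y :< ?T"
  then obtain xs ys where e: "x = tensor_class V W B xs" "y = tensor_class V W B ys" "xs : ?L" "ys : ?L" by auto
  have l: "map (\<lambda>(v, w). (a *[V] v, w)) zs : ?L" if "a :< K" "zs : ?L" for zs a
   by (rule map_fst_lists[OF _ that(2)]) (simp add: that)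
  have l2: "xs @ ys : ?L" using e by auto
  show "a *[?T] x :< ?T" using e l[OF a e(3)] a by (auto simp: sm)
  show "a *[?T] (x \<oplus>\<^bsub>?T\<^esub> y) = a *[?T] x \<oplus>\<^bsub>?T\<^esub> a *[?T] y"
   using e a l2 l[OF a e(3)] l[OF a e(4)] by (simp add: tensor_module_add sm del: append_in_lists_conv)
  show "(a \<star> b) *[?T] x = a *[?T] (b *[?T] x)"
  proof -
   have "map (\<lambda>(v, w). ((a \<star> b) *[V] v, w)) xs
     = map (\<lambda>(v, w). (a *[V] v, w)) (map (\<lambda>(v, w). (b *[V] v, w)) xs)"
    using e a b by (auto simp: V.smult_assoc1)
   then show ?thesis unfolding e(1) using a b
    by (simp only: sm[OF a l[OF b e(3)]] sm[OF b e(3)] sm[OF K.m_closed[OF a b] e(3)])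
  qed
  \<comment> \<open>Additivity in the first factor splits each pair in two; sorting the copies into
    blocks then gives the two scaled sums.\<close>
  have "tensor_eq V W B (concat (map (\<lambda>(v, w). [((a \<oplus>\<^bsub>K\<^esub> b) *[V] v, w)]) xs))
     (concat (map (\<lambda>(v, w). [(a *[V] v, w), (b *[V] v, w)]) xs))"
  proof (intro tensor_eq_concat)
   fix p assume "p : set xs"
   then obtain v w where "p = (v, w)" "v :< V" "w :< W" using e(3) by auto
   then show "tensor_eq V W B (case p of (v, w) \<Rightarrow> [((a \<oplus>\<^bsub>K\<^esub> b) *[V] v, w)])
     (case p of (v, w) \<Rightarrow> [(a *[V] v, w), (b *[V] v, w)])"
    using a b by (simp add: V.smult_l_distr tensor_eq.add_left)
  qed
  moreover have "tensor_eq V W B (concat (map (%x. [(\<lambda>(v, w). (a *[V] v, w)) x, (\<lambda>(v, w). (b *[V] v, w)) x]) xs))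
    (map (\<lambda>(v, w). (a *[V] v, w)) xs @ map (\<lambda>(v, w). (b *[V] v, w)) xs)"
   by (rule tensor_eq_unzip[OF V W]) (use e a b in auto)
  ultimately have "tensor_eq V W B (map (\<lambda>(v, w). ((a \<oplus>\<^bsub>K\<^esub> b) *[V] v, w)) xs)
    (map (\<lambda>(v, w). (a *[V] v, w)) xs @ map (\<lambda>(v, w). (b *[V] v, w)) xs)"
   by (auto simp: split_def intro: tensor_eq.trans)
  then show "(a \<oplus>\<^bsub>K\<^esub> b) *[?T] x = a *[?T] x \<oplus>\<^bsub>?T\<^esub> b *[?T] x"
   using e a b l[OF a e(3)] l[OF b e(3)] by (simp add: sm tensor_module_add tensor_class_eq del: in_lists_conv_set)
 next
  fix x assume "x :< ?T"
  then obtain xs where e: "x = tensor_class V W B xs" "xs : ?L" by auto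
  show "\<one>\<^bsub>K\<^esub> *[?T] x = x"
  proof -
   have "map (\<lambda>(v, w). (\<one>\<^bsub>K\<^esub> *[V] v, w)) xs = xs" using e by (intro map_idI) auto
   then show ?thesis using e by (simp add: sm)
  qed
 qed
qed

section \<open>The universal property\<close>

lemma linear_tensor_lift:
 assumes V: "kmod V" and W: "kmod W" and B: "good_balance V W B" and M: "kmod M"
  and f: "bmap V W M f" and bal: "balanced_map V W B f"
 shows "lmap (tensor_module V W B) M (tlift M f)"
proof -
 interpret V: module K V by fact
 interpret W: module K W by fact
 interpret M: module K M by fact
 let ?T = "tensor_module V W B"
 let ?L = "lists (carrier V \<times> carrier W)"
 have cl: "case_prod f p :< M" if "p : carrier V \<times> carrier W" for p
  using that bilinear_closed[OF f] by auto
 note tc = tensor_lift_class[OF V W M f bal]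
 show ?thesis
 proof (rule linear_mapI)
  fix x y a assume x: "x :< ?T" and y: "y :< ?T"
  then obtain xs ys where e: "x = tensor_class V W B xs" "y = tensor_class V W B ys" "xs : ?L" "ys : ?L" by auto
  show "tlift M f x :< M" using e cl by (auto simp: tc intro!: M.lsum_closed)
  have "xs @ ys : ?L" using e by auto
  then have "tlift M f (x \<oplus>\<^bsub>?T\<^esub> y) = lsum M (xs @ ys) (case_prod f)"
   using e by (simp add: tensor_module_add tc del: append_in_lists_conv)
  also have "... = tlift M f x \<oplus>\<^bsub>M\<^esub> tlift M f y"
   using e cl by (simp add: tc) (rule M.lsum_append, auto)
  finally show "tlift M f (x \<oplus>\<^bsub>?T\<^esub> y) = tlift M f x \<oplus>\<^bsub>M\<^esub> tlift M f y" .
 next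
  fix x a assume x: "x :< ?T" and a: "a :< K"
  then obtain xs where e: "x = tensor_class V W B xs" "xs : ?L" by auto
  have l: "map (\<lambda>(v, w). (a *[V] v, w)) xs : ?L"
   by (rule map_fst_lists[OF _ e(2)]) (simp add: a)
  have "tlift M f (a *[?T] x) = lsum M (map (\<lambda>(v, w). (a *[V] v, w)) xs) (case_prod f)"
   using e a l by (simp add: tensor_module_smult[OF V W B] tc del: in_lists_conv_set)
  also have "... = lsum M xs (%p. a *[M] case_prod f p)"
   unfolding lsum_map using e a by (intro lsum_cong) (auto simp: linear_smult[OF bilinear_l[OF f]])
  also have "... = a *[M] lsum M xs (case_prod f)"
   using e a cl by (intro linear_lsum[OF bilinear_r[OF bilinear_smult[OF M]] M M, of a xs "case_prod f", symmetric]) auto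
  finally show "tlift M f (a *[?T] x) = a *[M] tlift M f x" using e by (simp add: tc)
 qed
qed

lemma tensor_lift_gen:
 assumes "kmod V" "kmod W" "kmod M" "bmap V W M f" "balanced_map V W B f"
  "v :< V" "w :< W"
 shows "tlift M f (tensor_class V W B [(v, w)]) = f v w"
proof -
 interpret M: module K M by fact
 show ?thesis using assms bilinear_closed[OF assms(4)] by (subst tensor_lift_class[OF assms(1-5)]) auto
qed

lemma bilinear_tensor_class:
 assumes V: "kmod V" and W: "kmod W" and B: "good_balance V W B"
  and sc: "!!a v w. a :< K ==> v :< V ==> w :< W ==>
    tensor_class V W B [(v, a *[W] w)] = tensor_class V W B [(a *[V] v, w)]"
 shows "bmap V W (tensor_module V W B) (%v w. tensor_class V W B [(v, w)])"
proof -
 interpret V: module K V by fact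
 interpret W: module K W by fact
 show ?thesis
  by (intro bilinear_mapI linear_mapI)
   (simp_all add: tensor_module_add tensor_module_smult V W B sc tensor_class_eq
     tensor_eq.add_left tensor_eq.add_right)
qed

text \<open>Uniqueness in the universal property: a tensor is a finite sum of pure tensors, by
  induction on a list that represents it.\<close>

lemma tensor_module_ext:
 assumes V: "kmod V" and W: "kmod W" and B: "good_balance V W B" and M: "kmod M"
  and f: "lmap (tensor_module V W B) M f" and g: "lmap (tensor_module V W B) M g"
  and eq: "!!v w. v :< V ==> w :< W ==> f (tensor_class V W B [(v, w)]) = g (tensor_class V W B [(v, w)])"
  and t: "t :< (tensor_module V W B)"
 shows "f t = g t"
proof -
 obtain xs where xs: "t = tensor_class V W B xs" "xs : lists (carrier V \<times> carrier W)" using t by auto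
 note T = module_tensor_module[OF V W B]
 show ?thesis unfolding xs(1) using xs(2)
 proof (induction xs)
  case Nil
  show ?case using linear_zero[OF f T M] linear_zero[OF g T M] by simp
 next
  case (Cons p xs)
  obtain v w where p: "p = (v, w)" "v :< V" "w :< W" using Cons by auto
  have "tensor_class V W B (p # xs) = tensor_class V W B [p] \<oplus>\<^bsub>tensor_module V W B\<^esub> tensor_class V W B xs"
   using tensor_module_add[of "[p]" V W xs B] Cons p by auto
  moreover have "tensor_class V W B [p] :< (tensor_module V W B)" "tensor_class V W B xs :< (tensor_module V W B)"
   using Cons p by (auto simp del: in_lists_conv_set)
  ultimately show ?case using p eq[of v w] Cons.IH by (simp add: linear_add[OF f] linear_add[OF g])
 qed
qed

end

declare tensor_module_simps [simp del]

section \<open>Tensor products over the ground field\<close>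

text \<open>The data on which tensor products and linear maps depend. \<open>H\<close>, its unit
  bimodule, its co-opposite and its twist are different records that agree in these data, so their
  tensor products are equal and not merely isomorphic.\<close>

definition same_module where
 "same_module V V' \<longleftrightarrow> carrier V = carrier V' \<and> add V = add V' \<and> zero V = zero V' \<and> smult V = smult V'"

lemma tensor_eq_same:
 assumes "tensor_eq V W B xs ys" "carrier V = carrier V'" "add V = add V'" "zero V = zero V'"
  "carrier W = carrier W'" "add W = add W'" "zero W = zero W'"
 shows "tensor_eq V' W' B xs ys"
 using assms(1)
proof induction
 case (sym xs ys) show ?case by (rule tensor_eq.sym[OF sym.IH])
next
 case (trans xs ys zs) show ?case by (rule tensor_eq.trans[OF trans.IH])
next
 case (append xs ys xs' ys') show ?case by (rule tensor_eq.append[OF append.IH])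
next
 case (refl xs) then show ?case by (intro tensor_eq.refl) (simp add: assms(2-))
next
 case (commute xs ys) then show ?case by (intro tensor_eq.commute) (simp_all add: assms(2-))
next
 case (add_left v v' w) then show ?case unfolding assms(2-) by (rule tensor_eq.add_left)
next
 case (add_right v w w') then show ?case unfolding assms(2-) by (rule tensor_eq.add_right)
next
 case (zero_left w) then show ?case unfolding assms(2-) by (rule tensor_eq.zero_left)
next
 case (zero_right w) then show ?case unfolding assms(2-) by (rule tensor_eq.zero_right)
next
 case (balanced p q) then show ?case unfolding assms(2-) by (rule tensor_eq.balanced)
qed

lemma tensor_class_same:
 assumes "same_module V V'" "same_module W W'"
 shows "tensor_class V W B = tensor_class V' W' B"
 unfolding tensor_class_def fun_eq_iff 
 using assms tensor_eq_same[of V W B _ _ V' W'] tensor_eq_same[of V' W' B _ _ V W]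
 unfolding same_module_def by (intro allI Collect_cong iffI) auto

lemma tensor_module_same:
 assumes "same_module V V'" "same_module W W'"
 shows "tensor_module V W B = tensor_module V' W' B"
 using tensor_class_same[OF assms] assms
 by (simp add: tensor_module_def same_module_def fun_eq_iff)

lemma scalar_balance_same:
 assumes "same_module V V'" "same_module W W'"
 shows "scalar_balance K V W = scalar_balance K V' W'"
 using assms by (simp add: scalar_balance_def same_module_def)

lemma tensor_space_same: "same_module V V' ==> same_module W W' ==> tensor_space K V W = tensor_space K V' W'"
 using scalar_balance_same[of V V' W W' K] tensor_module_same[of V V' W W']
 by (simp add: tensor_space_def)

lemma tensor_same: "same_module V V' ==> same_module W W' ==> tensor K V W = tensor K V' W'"
 using scalar_balance_same[of V V' W W' K] tensor_class_same[of V V' W W']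
 by (simp add: tensor_def fun_eq_iff)

lemma same_module_refl [simp]: "same_module V V" by (simp add: same_module_def)

lemma abelian_group_same:
 assumes "carrier V = carrier V'" "add V = add V'" "zero V = zero V'" "abelian_group V"
 shows "abelian_group V'"
proof -
 interpret abelian_group V by fact
 show ?thesis
  by (rule abelian_groupI; unfold assms(1-3)[symmetric]) (auto simp: a_ac intro: l_neg)
qed

lemma module_same: assumes "same_module V V'" "module K V" shows "module K V'"
proof -
 interpret module K V by fact
 have s: "carrier V = carrier V'" "add V = add V'" "zero V = zero V'" "smult V = smult V'"
  using assms by (auto simp: same_module_def)
 show ?thesis
  by (intro moduleI abelian_group_same[OF s(1-3)] R.cring_axioms abelian_group_axioms)
   (simp_all add: s[symmetric] smult_l_distr smult_r_distr smult_assoc1 is_cring)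
qed

lemma linear_map_same: "same_module V V' ==> same_module W W' ==> linear_map K V W f = linear_map K V' W' f"
 by (simp add: linear_map_def same_module_def)

lemma bilinear_map_same:
 "same_module V V' ==> same_module W W' ==> same_module X X' ==> bilinear_map K V W X f = bilinear_map K V' W' X' f"
 unfolding bilinear_map_def using linear_map_same[of W W' X X' K] linear_map_same[of V V' X X' K]
 by (simp add: same_module_def)

lemma tensor_lift_same: "add M = add M' ==> zero M = zero M' ==> tlift M = tlift M'"
 by (simp add: tensor_lift_def fun_eq_iff)

text \<open>Acts on a class as a set of lists, so that it is an involution on arbitrary sets and
  cancels without membership conditions.\<close>

definition flip :: "('a \<times> 'b) list set \<Rightarrow> ('b \<times> 'a) list set" where
 "flip t = map prod.swap ` t"

lemma flip_flip [simp]: "flip (flip t) = t"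
 by (simp add: flip_def image_image comp_def)

text \<open>Swapping turns a scalar balancing pair into the reverse of such a pair, so this case
  goes through the symmetry of the congruence.\<close>

lemma tensor_eq_flip:
 assumes "tensor_eq V W (scalar_balance K V W) xs ys"
 shows "tensor_eq W V (scalar_balance K W V) (map prod.swap xs) (map prod.swap ys)"
 using assms
proof induction
 case (balanced p q)
 then have "(prod.swap q, prod.swap p) : scalar_balance K W V" by (fastforce simp: scalar_balance_def)
 with balanced show ?case by (cases p; cases q) (auto intro!: tensor_eq.sym[OF tensor_eq.balanced])
next
 case (refl xs) then show ?case by (intro tensor_eq.refl) auto
next
 case (commute xs ys)
 then have "map prod.swap xs : lists (carrier W \<times> carrier V)" "map prod.swap ys : lists (carrier W \<times> carrier V)"
  by auto
 then show ?case by (simp add: tensor_eq.commute del: in_lists_conv_set)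
next
 case (sym xs ys) show ?case by (rule tensor_eq.sym[OF sym.IH])
next
 case (trans xs ys zs) show ?case by (rule tensor_eq.trans[OF trans.IH])
next
 case (append xs ys xs' ys') show ?case using tensor_eq.append[OF append.IH] by simp
qed (simp_all add: tensor_eq.add_left tensor_eq.add_right tensor_eq.zero_left tensor_eq.zero_right)

lemma flip_class:
 "flip (tensor_class V W (scalar_balance K V W) xs) = tensor_class W V (scalar_balance K W V) (map prod.swap xs)"
proof -
 have 1: "map prod.swap (map prod.swap ys) = ys" for ys :: "('x \<times> 'y) list"
  by (simp add: comp_def)
 have "ys : flip (tensor_class V W (scalar_balance K V W) xs) \<longleftrightarrow>
    ys : tensor_class W V (scalar_balance K W V) (map prod.swap xs)" for ys
 proof
  assume "ys : flip (tensor_class V W (scalar_balance K V W) xs)"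
  then show "ys : tensor_class W V (scalar_balance K W V) (map prod.swap xs)"
   by (auto simp: flip_def tensor_class_def intro: tensor_eq_flip)
 next
  assume "ys : tensor_class W V (scalar_balance K W V) (map prod.swap xs)"
  from tensor_eq_flip[OF this[unfolded tensor_class_def mem_Collect_eq]]
  have "map prod.swap ys : tensor_class V W (scalar_balance K V W) xs"
   by (simp add: 1 tensor_class_def del: map_map)
  then show "ys : flip (tensor_class V W (scalar_balance K V W) xs)"
   unfolding flip_def by (intro image_eqI[of _ _ "map prod.swap ys"]) (simp_all add: 1 del: map_map)
 qed
 then show ?thesis by blast
qed

lemma flip_tensor [simp]: "flip (tensor K V W v w) = tensor K W V w v"
 by (simp add: tensor_def flip_class)

section \<open>Tensor products over \<open>K\<close>: lifts, and sums over representatives\<close>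

context ground
begin

text \<open>Rests on \<open>b (a v) = a (b v)\<close>, that is, on the commutativity of
  \<open>K\<close>.\<close>

lemma good_scalar: "kmod V ==> kmod W ==> good_balance V W (scalar_balance K V W)"
proof -
 assume "kmod V" "kmod W"
 then interpret V: module K V by simp
 show ?thesis unfolding good_balance_def scalar_balance_def
  by (clarsimp simp: V.smult_assoc1[symmetric]) (metis K.m_comm V.smult_assoc1 V.smult_closed)
qed

lemma module_tensor_space [cl]: "kmod V ==> kmod W ==> kmod (ts V W)"
 unfolding tensor_space_def by (intro module_tensor_module good_scalar)

lemma bilinear_tensor: "kmod V ==> kmod W ==> bmap V W (ts V W) (tn V W)"
 unfolding tensor_space_def tensor_def
proof (rule bilinear_tensor_class)
 assume V: "kmod V" and W: "kmod W"
 then show "good_balance V W (scalar_balance K V W)" by (rule good_scalar)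
 interpret V: module K V by fact
 interpret W: module K W by fact
 fix a v w assume "a :< K" "v :< V" "w :< W"
 then show "tensor_class V W (scalar_balance K V W) [(v, a *[W] w)]
   = tensor_class V W (scalar_balance K V W) [(a *[V] v, w)]"
  by (intro tensor_class_eq[symmetric] tensor_eq.balanced) (auto simp: scalar_balance_def)
qed auto

lemma linear_tensor_l [lin]:
 "lmap X V f ==> w :< W ==> kmod V ==> kmod W ==>
  lmap X (ts V W) (%x. tn V W (f x) w)"
 by (rule linear_bil_l[OF bilinear_tensor])

lemma linear_tensor_r [lin]:
 "lmap X W g ==> v :< V ==> kmod V ==> kmod W ==>
  lmap X (ts V W) (%x. tn V W v (g x))"
 by (rule linear_bil_r[OF bilinear_tensor])

lemma tensor_closed [cl]: "v :< V ==> w :< W ==> kmod V ==> kmod W ==>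
  tn V W v w :< (ts V W)"
 by (blast intro: bilinear_closed bilinear_tensor)

lemma balanced_scalar: "bmap V W M f ==> balanced_map V W (scalar_balance K V W) f"
 unfolding balanced_map_def scalar_balance_def
 by (clarsimp simp: linear_smult[OF bilinear_l] linear_smult[OF bilinear_r])

lemma linear_tl:
 "kmod V ==> kmod W ==> kmod M ==> bmap V W M f ==>
  lmap (ts V W) M (tlift M f)"
 unfolding tensor_space_def by (intro linear_tensor_lift good_scalar balanced_scalar)

lemma tl_tensor:
 "kmod V ==> kmod W ==> kmod M ==> bmap V W M f ==> v :< V ==> w :< W ==>
  tlift M f (tn V W v w) = f v w"
 unfolding tensor_def by (intro tensor_lift_gen balanced_scalar)

lemma tensor_space_ext:
 assumes "kmod V" "kmod W" "kmod M"
  "lmap (ts V W) M f" "lmap (ts V W) M g"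
  "!!v w. v :< V ==> w :< W ==> f (tn V W v w) = g (tn V W v w)"
  "t :< (ts V W)"
 shows "f t = g t"
 by (rule tensor_module_ext[OF assms(1,2) good_scalar[OF assms(1,2)] assms(3)
   assms(4,5)[unfolded tensor_space_def] _ assms(7)[unfolded tensor_space_def]])
  (rule assms(6)[unfolded tensor_def])

text \<open>For a fixed tensor, \<open>tlift\<close> is a finite sum over one chosen list. Hence
  this rule and the next four hold for arbitrary summands, be they balanced or not; bilinearity
  enters when the representative changes.\<close>

lemma tm_closed:
 assumes "kmod V" "kmod W" "t :< (tensor_module V W B)" "kmod M"
  "!!v w. v :< V ==> w :< W ==> f v w :< M"
 shows "tlift M f t :< M"
 unfolding tensor_lift_eq_lsum
 using tensor_rep_lists(1)[OF assms(1-3)] assms(5)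
 by (intro abelian_group.lsum_closed[OF module_grp[OF assms(4)]]) fastforce

lemma tm_cong:
 assumes "kmod V" "kmod W" "t :< (tensor_module V W B)"
  "!!v w. v :< V ==> w :< W ==> f v w = g v w"
 shows "tlift M f t = tlift M g t"
 unfolding tensor_lift_eq_lsum
 using tensor_rep_lists(1)[OF assms(1-3)] assms(4)
 by (intro lsum_cong) fastforce

lemma tm_push:
 assumes "kmod V" "kmod W" "t :< (tensor_module V W B)" "kmod M" "kmod N"
  "!!v w. v :< V ==> w :< W ==> f v w :< M" "lmap M N phi"
 shows "phi (tlift M f t) = tlift N (%v w. phi (f v w)) t"
 unfolding tensor_lift_eq_lsum
 by (subst linear_lsum[OF assms(7,4,5)])
  (use tensor_rep_lists(1)[OF assms(1-3)] assms(6) in \<open>fastforce intro!: lsum_cong simp: split_def\<close>)+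

lemma tm_swap:
 assumes "kmod V" "kmod W" "t :< (tensor_module V W B)"
  "kmod V'" "kmod W'" "t' :< (tensor_module V' W' B')" "kmod M"
  "!!v w v' w'. v :< V ==> w :< W ==> v' :< V' ==> w' :< W' ==> f v w v' w' :< M"
 shows "tlift M (%v w. tlift M (f v w) t') t = tlift M (%v' w'. tlift M (%v w. f v w v' w') t) t'"
proof -
 have "lsum M (tensor_rep t) (%p. lsum M (tensor_rep t') (%q. f (fst p) (snd p) (fst q) (snd q))) =
    lsum M (tensor_rep t') (%q. lsum M (tensor_rep t) (%p. f (fst p) (snd p) (fst q) (snd q)))"
  using tensor_rep_lists(1)[OF assms(1-3)] tensor_rep_lists(1)[OF assms(4-6)] assms(8)
  by (intro abelian_group.lsum_swap[OF module_grp[OF assms(7)]]) fastforce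
 then show ?thesis by (simp add: tensor_lift_eq_lsum split_def)
qed

lemma tm_linear_fun:
 assumes "kmod V" "kmod W" "t :< (tensor_module V W B)" "kmod M"
  "!!v w. v :< V ==> w :< W ==> lmap X M (%x. F x v w)"
 shows "lmap X M (%x. tlift M (F x) t)"
 unfolding tensor_lift_eq_lsum
 using tensor_rep_lists(1)[OF assms(1-3)] assms(5)
 by (intro linear_lsum_fun[OF assms(4)]) fastforce

lemmas ts_closed = tm_closed[of V W _ "scalar_balance K V W" for V W, folded tensor_space_def]
 and ts_cong = tm_cong[of V W _ "scalar_balance K V W" for V W, folded tensor_space_def]
 and ts_push = tm_push[of V W _ "scalar_balance K V W" for V W, folded tensor_space_def]
 and ts_swap = tm_swap[of V W _ "scalar_balance K V W" V' W' _ "scalar_balance K V' W'" for V W V' W', folded tensor_space_def]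
 and ts_linear_fun = tm_linear_fun[of V W _ "scalar_balance K V W" for V W, folded tensor_space_def]

lemma flip_linear:
 assumes "kmod V" "kmod W"
 shows "lmap (ts V W) (ts W V) flip"
  and "!!t. t :< (ts V W) ==> flip t = tlift (ts W V) (%v w. tn W V w v) t"
proof -
 note m = assms module_tensor_space[OF assms(2,1)]
 have b: "bmap V W (ts W V) (%v w. tn W V w v)"
  using assms by (intro lin)
 show *: "flip t = tlift (ts W V) (%v w. tn W V w v) t"
  if t: "t :< (ts V W)" for t
 proof -
  have tm: "t :< (tensor_module V W (scalar_balance K V W))" using t by (simp add: tensor_space_def)
  obtain xs where xs: "xs : lists (carrier V \<times> carrier W)" "t = tensor_class V W (scalar_balance K V W) xs"
   using tm by (auto simp: tensor_module_simps)
  have "tlift (ts W V) (%v w. tn W V w v) t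
   = lsum (ts W V) xs (\<lambda>(v, w). tn W V w v)"
   unfolding xs(2) by (rule tensor_lift_class[OF m b balanced_scalar[OF b] xs(1)])
  also have "... = tensor_class W V (scalar_balance K W V) (map prod.swap xs)"
   using xs(1)
  proof (induction xs)
   case (Cons p xs)
   then have l: "[prod.swap p] : lists (carrier W \<times> carrier V)" "map prod.swap xs : lists (carrier W \<times> carrier V)" by auto
   show ?case using Cons tensor_module_add[OF l, of "scalar_balance K W V"]
    by (cases p) (simp add: tensor_space_def tensor_def)
  qed (simp add: tensor_space_def tensor_module_simps)
  also have "... = flip t" by (simp add: xs flip_class)
  finally show ?thesis by simp
 qed
 show "lmap (ts V W) (ts W V) flip"
  using linear_cong[of "ts V W" flip "tlift (ts W V) (%v w. tn W V w v)"
    "ts W V", OF * module_tensor_space[OF assms]] linear_tl[OF m b] by blast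
qed

text \<open>The representatives chosen for \<open>t\<close> and for \<open>flip t\<close> are
  unrelated, so a termwise comparison is impossible. Bilinearity of \<open>F\<close> makes both
  sides linear in \<open>t\<close>, and pure tensors decide.\<close>

lemma tl_flip:
 assumes "kmod V" "kmod W" "kmod M" "bmap W V M F" "t :< (ts V W)"
 shows "tlift M F (flip t) = tlift M (%v w. F w v) t"
proof (rule tensor_space_ext[OF assms(1-3) _ _ _ assms(5)])
 have b: "bmap V W M (%v w. F w v)" using assms(4) by (simp add: bilinear_map_def)
 show "lmap (ts V W) M (tlift M (%v w. F w v))"
  by (rule linear_tl[OF assms(1-3) b])
 show "lmap (ts V W) M (%t. tlift M F (flip t))"
  by (rule linear_compose[OF flip_linear(1)[OF assms(1,2)] linear_tl[OF assms(2,1,3,4)]])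
 fix v w assume "v :< V" "w :< W"
 then show "tlift M F (flip (tn V W v w)) = tlift M (%v w. F w v) (tn V W v w)"
  by (simp add: tl_tensor[OF assms(2,1,3,4)] tl_tensor[OF assms(1-3) b])
qed

section \<open>Trilinear maps\<close>

definition trilinear_map where
 "trilinear_map A B C M F \<longleftrightarrow>
  (\<forall>b\<in>carrier B. \<forall>c\<in>carrier C. lmap A M (%a. F a b c)) \<and>
  (\<forall>a\<in>carrier A. \<forall>c\<in>carrier C. lmap B M (%b. F a b c)) \<and>
  (\<forall>a\<in>carrier A. \<forall>b\<in>carrier B. lmap C M (%c. F a b c))"

lemma trilinear_mapI [lin]:
 "(!!b c. b :< B ==> c :< C ==> lmap A M (%a. F a b c)) ==>
  (!!a c. a :< A ==> c :< C ==> lmap B M (%b. F a b c)) ==>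
  (!!a b. a :< A ==> b :< B ==> lmap C M (%c. F a b c)) ==> trilinear_map A B C M F"
 by (simp add: trilinear_map_def)

lemma trilinear_1: "trilinear_map A B C M F ==> b :< B ==> c :< C ==> lmap A M (%a. F a b c)"
 and trilinear_2: "trilinear_map A B C M F ==> a :< A ==> c :< C ==> lmap B M (%b. F a b c)"
 and trilinear_3: "trilinear_map A B C M F ==> a :< A ==> b :< B ==> lmap C M (%c. F a b c)"
 by (simp_all add: trilinear_map_def)

lemma trilinear_closed:
 "trilinear_map A B C M F ==> a :< A ==> b :< B ==> c :< C ==> F a b c :< M"
 by (rule linear_closed[OF trilinear_1])

text \<open>The comodule axioms are equations in a triple tensor product. Applying this lift turns
  them into statements about an arbitrary trilinear \<open>F\<close>, which is how Sweedler notation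
  uses them.\<close>

lemma trilinear_lift:
 assumes m: "kmod A" "kmod B" "kmod C" "kmod M" and F: "trilinear_map A B C M F"
 shows "lmap (ts A (ts B C)) M (tlift M (%a t. tlift M (F a) t))"
  and "!!a b c. a :< A ==> b :< B ==> c :< C ==>
   tlift M (%a t. tlift M (F a) t) (tn A (ts B C) a (tn B C b c)) = F a b c"
proof -
 have b: "bmap B C M (F a)" if "a :< A" for a
  using F that by (auto simp: trilinear_map_def bilinear_map_def)
 have b2: "bmap A (ts B C) M (%a t. tlift M (F a) t)"
 proof (rule bilinear_mapI)
  fix a assume "a :< A" then show "lmap (ts B C) M (tlift M (F a))"
   by (intro linear_tl m b)
 next
  fix t assume "t :< (ts B C)"
  then show "lmap A M (%a. tlift M (F a) t)"
   by (intro ts_linear_fun[OF m(2,3)] m trilinear_1[OF F])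
 qed
 show "lmap (ts A (ts B C)) M (tlift M (%a t. tlift M (F a) t))"
  by (intro linear_tl m module_tensor_space b2)
 show "tlift M (%a t. tlift M (F a) t) (tn A (ts B C) a (tn B C b c)) = F a b c"
  if "a :< A" "b :< B" "c :< C" for a b c
  using that by (simp add: tl_tensor[OF m(1) module_tensor_space[OF m(2,3)] m(4) b2] tensor_closed m tl_tensor[OF m(2,3,4) b])
qed

end

section \<open>Comodules and Sweedler sums\<close>

text \<open>Right coactions use the same sum: \<open>lsw M (bcop V)\<close> runs over the right
  coaction of \<open>V\<close>, with the element of \<open>H\<close> as the first argument of the
  summand.\<close>

definition lsw where "lsw M V v F = tlift M F (lcoact V v)"

definition left_comodule ::
 "('k, 'l) ring_scheme \<Rightarrow> ('k, 'h) hopf \<Rightarrow> ('k, 'h, 'v) bimodule \<Rightarrow> bool" where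
 "left_comodule K H V \<longleftrightarrow> module K V \<and> linear_map K V (tensor_space K H V) (lcoact V) \<and>
  (\<forall>v\<in>carrier V. lsw V V v (%h v'. counit H h *[V] v') = v \<and>
   (let HHV = tensor_space K H (tensor_space K H V);
      ten = (%x y z. tensor K H (tensor_space K H V) x (tensor K H V y z))
    in lsw HHV V v (%h v'. sweedler2 HHV H h (%h1 h2. ten h1 h2 v'))
    = lsw HHV V v (%h v'. lsw HHV V v' (%g v''. ten h g v''))))"

text \<open>The antipode of the co-opposite is the inverse of that of \<open>H\<close>. Off the
  carrier the old value is kept, so that the co-opposite of the co-opposite is \<open>H\<close>
  itself as a record.\<close>

definition hcop :: "('k, 'h) hopf \<Rightarrow> ('k, 'h) hopf" where
 "hcop H = H\<lparr>comult := %h. flip (comult H h),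
   antipode := %h. if h :< H then inv_into (carrier H) (antipode H) h else antipode H h\<rparr>"

text \<open>The two coactions exchange roles and the actions stay. Restricting to the carrier makes
  the construction an involution on bimodules with extensional coactions.\<close>

definition bcop :: "('k, 'h, 'v) bimodule \<Rightarrow> ('k, 'h, 'v) bimodule" where
 "bcop V = V\<lparr>lcoact := \<lambda>v\<in>carrier V. flip (rcoact V v), rcoact := \<lambda>v\<in>carrier V. flip (lcoact V v)\<rparr>"

lemma hcop_simps [simp]:
 "carrier (hcop H) = carrier H" "add (hcop H) = add H" "zero (hcop H) = zero H"
 "smult (hcop H) = smult H" "mult (hcop H) = mult H" "one (hcop H) = one H"
 "counit (hcop H) = counit H" "comult (hcop H) h = flip (comult H h)"
 by (simp_all add: hcop_def)

lemma bcop_simps [simp]: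
 "carrier (bcop V) = carrier V" "add (bcop V) = add V" "zero (bcop V) = zero V"
 "smult (bcop V) = smult V" "mult (bcop V) = mult V" "one (bcop V) = one V"
 "lact (bcop V) = lact V" "ract (bcop V) = ract V"
 by (simp_all add: bcop_def)

lemma bcop_ext [simp]:
 "lcoact (bcop V) : extensional (carrier V)" "rcoact (bcop V) : extensional (carrier V)"
 by (simp_all add: bcop_def)

lemma same_cop [simp]: "same_module (hcop H) H" "same_module (bcop V) V"
 by (simp_all add: same_module_def)

lemma bcop_cop:
 "lcoact V : extensional (carrier V) ==> rcoact V : extensional (carrier V) ==> bcop (bcop V) = V"
 by (auto simp: bcop_def fun_eq_iff extensional_def intro!: bimodule.equality)

lemma tensor_space_cop [simp]:
 "tensor_space K (hcop H) V = tensor_space K H V" "tensor_space K V (hcop H) = tensor_space K V H"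
 "tensor_space K (bcop W) V = tensor_space K W V" "tensor_space K V (bcop W) = tensor_space K V W"
 "tensor K (hcop H) V = tensor K H V" "tensor K V (hcop H) = tensor K V H"
 "tensor K (bcop W) V = tensor K W V" "tensor K V (bcop W) = tensor K V W"
 by (auto intro: tensor_space_same tensor_same)

lemma linear_map_cop [simp]:
 "linear_map K (hcop H) V = linear_map K H V" "linear_map K V (hcop H) = linear_map K V H"
 "linear_map K (bcop W) V = linear_map K W V" "linear_map K V (bcop W) = linear_map K V W"
 by (simp_all add: fun_eq_iff linear_map_def)

lemma module_cop [simp]: "module K (hcop H) = module K H" "module K (bcop V) = module K V"
 by (auto elim: module_same[rotated] simp: same_module_def)

lemma tensor_lift_cop [simp]: "tlift (hcop H) = tlift H" "tlift (bcop V) = tlift V"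
 by (auto intro: tensor_lift_same)

lemma bilinear_map_cop [simp]:
 "bilinear_map K (hcop H) V W = bilinear_map K H V W" "bilinear_map K V (hcop H) W = bilinear_map K V H W"
 "bilinear_map K V W (hcop H) = bilinear_map K V W H"
 "bilinear_map K (bcop X) V W = bilinear_map K X V W" "bilinear_map K V (bcop X) W = bilinear_map K V X W"
 "bilinear_map K V W (bcop X) = bilinear_map K V W X"
 by (simp_all add: bilinear_map_def fun_eq_iff)

lemma sweedler2_cop_module [simp]:
 "sweedler2 (hcop H') H = sweedler2 H' H" "sweedler2 (bcop V) H = sweedler2 V H"
 by (simp_all add: sweedler2_def fun_eq_iff)

lemma lsw_cop_module [simp]: "lsw (hcop H') V = lsw H' V" "lsw (bcop W) V = lsw W V"
 by (simp_all add: lsw_def fun_eq_iff)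

lemma unit_bimodule_simps [simp]:
 "carrier (unit_bimodule H) = carrier H" "add (unit_bimodule H) = add H" "zero (unit_bimodule H) = zero H"
 "smult (unit_bimodule H) = smult H"
 "lact (unit_bimodule H) = (\<lambda>h\<in>carrier H. \<lambda>x\<in>carrier H. h \<otimes>\<^bsub>H\<^esub> x)"
 "ract (unit_bimodule H) = (\<lambda>x\<in>carrier H. \<lambda>h\<in>carrier H. x \<otimes>\<^bsub>H\<^esub> h)"
 "lcoact (unit_bimodule H) = (\<lambda>x\<in>carrier H. comult H x)" "rcoact (unit_bimodule H) = (\<lambda>x\<in>carrier H. comult H x)"
 by (simp_all add: unit_bimodule_def)

lemma same_unit [simp]: "same_module (unit_bimodule H) H"
 by (simp add: same_module_def)

lemma tensor_space_unit [simp]: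
 "tensor_space K (unit_bimodule H) V = tensor_space K H V" "tensor_space K V (unit_bimodule H) = tensor_space K V H"
 "tensor K (unit_bimodule H) V = tensor K H V" "tensor K V (unit_bimodule H) = tensor K V H"
 by (auto intro: tensor_space_same tensor_same)

lemma linear_map_unit [simp]:
 "linear_map K (unit_bimodule H) V = linear_map K H V" "linear_map K V (unit_bimodule H) = linear_map K V H"
 by (simp_all add: fun_eq_iff linear_map_def)

lemma bilinear_map_unit [simp]:
 "bilinear_map K (unit_bimodule H) V W = bilinear_map K H V W" "bilinear_map K V (unit_bimodule H) W = bilinear_map K V H W"
 "bilinear_map K V W (unit_bimodule H) = bilinear_map K V W H"
 by (simp_all add: bilinear_map_def fun_eq_iff)

lemma module_unit [simp]: "module K (unit_bimodule H) = module K H"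
 by (auto elim: module_same[rotated] simp: same_module_def)

lemma tensor_lift_unit [simp]: "tlift (unit_bimodule H) = tlift H"
 by (auto intro: tensor_lift_same)

lemma lsw_unit [simp]: "h :< H ==> lsw M (unit_bimodule H) h F = sweedler2 M H h F"
 by (simp add: lsw_def sweedler2_def)

lemma lsw_module_unit [simp]: "lsw (unit_bimodule H) V = lsw H V" "sweedler2 (unit_bimodule H) C = sweedler2 H C"
 by (simp_all add: lsw_def sweedler2_def fun_eq_iff)

lemma cop_unit: "bcop (unit_bimodule H) = unit_bimodule (hcop H)"
 by (auto simp: bcop_def fun_eq_iff intro!: bimodule.equality) (simp_all add: unit_bimodule_def)

text \<open>The part of a Hopf algebra that comodules see. It carries comodule facts over to the
  double co-opposite and to the twist, where the product and the antipode may differ.\<close>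

definition same_coalg where
 "same_coalg H H' \<longleftrightarrow> same_module H H' \<and> comult H = comult H' \<and> counit H = counit H'"

lemma same_coalg_cop_cop [simp]: "same_coalg (hcop (hcop H)) H"
 by (simp add: same_coalg_def same_module_def fun_eq_iff)

lemma left_comodule_same: "same_coalg H H' ==> left_comodule K H V = left_comodule K H' V"
 unfolding left_comodule_def same_coalg_def
 using tensor_space_same[of H H' V V K] tensor_space_same[of H H' "tensor_space K H V" "tensor_space K H V" K]
  tensor_same[of H H' V V K] tensor_same[of H H' "tensor_space K H V" "tensor_space K H V" K]
 by (simp add: sweedler2_def)

section \<open>Sweedler calculus over a coalgebra\<close>

locale coalg = ground K for K :: "('k, 'l) ring_scheme" +
 fixes H :: "('k, 'h) hopf"
 assumes modH [cl]: "module K H" and H_coalg: "coassociative_coalgebra K H"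
begin

abbreviation "sw M \<equiv> sweedler2 M H"
abbreviation "csw M \<equiv> sweedler2 M (hcop H)"
abbreviation "cH \<equiv> carrier H"
abbreviation "eps \<equiv> counit H"
abbreviation "lc \<equiv> left_comodule K H"

sublocale Hm: module K H by (rule modH)

text \<open>A linear coaction without coassociativity or counit. This is enough for every rule that
  does not regroup iterated coactions, and since the coproduct does not occur, the same predicate
  serves \<open>H\<close> and its co-opposite.\<close>

definition coact where "coact V \<longleftrightarrow> kmod V \<and> lmap V (ts H V) (lcoact V)"

lemma coact_lc: "lc V ==> coact V"
 by (simp add: coact_def left_comodule_def)

lemma coact_lc_cop: "left_comodule K (hcop H) V ==> coact V"
 by (simp add: coact_def left_comodule_def)

lemma lc_module: "lc V ==> kmod V"
 by (simp add: left_comodule_def)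

lemma coact_module: "coact V ==> kmod V"
 by (simp add: coact_def)

lemma coact_mem: "coact V ==> v :< V ==> lcoact V v :< (ts H V)"
 using linear_closed by (auto simp: coact_def)

lemma lsw_closed [cl]:
 "coact V ==> v :< V ==> kmod M ==>
  (!!h x. h : cH ==> x :< V ==> F h x :< M) ==> lsw M V v F :< M"
 unfolding lsw_def by (rule ts_closed[OF modH coact_module coact_mem])

lemma lsw_cong:
 "coact V ==> v :< V ==>
  (!!h x. h : cH ==> x :< V ==> F h x = F' h x) ==> lsw M V v F = lsw M V v F'"
 unfolding lsw_def by (rule ts_cong[OF modH coact_module coact_mem])

lemma lsw_push:
 "coact V ==> v :< V ==> kmod M ==> kmod N ==>
  (!!h x. h : cH ==> x :< V ==> F h x :< M) ==> lmap M N phi ==>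
  phi (lsw M V v F) = lsw N V v (%h x. phi (F h x))"
 unfolding lsw_def by (rule ts_push[OF modH coact_module coact_mem])

lemma lsw_swap:
 "coact V ==> v :< V ==> coact W ==> w :< W ==> kmod M ==>
  (!!h x g y. h : cH ==> x :< V ==> g : cH ==> y :< W ==> F h x g y :< M) ==>
  lsw M V v (%h x. lsw M W w (%g y. F h x g y)) = lsw M W w (%g y. lsw M V v (%h x. F h x g y))"
 unfolding lsw_def by (rule ts_swap[OF modH coact_module coact_mem modH coact_module coact_mem])

lemma lsw_linear_fun [lin]:
 "coact V ==> v :< V ==> kmod M ==>
  (!!h x. h : cH ==> x :< V ==> lmap X M (%y. F y h x)) ==>
  lmap X M (%y. lsw M V v (F y))"
 unfolding lsw_def by (rule ts_linear_fun[OF modH coact_module coact_mem])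

lemma lsw_linear:
 "coact V ==> bmap H V M F ==> kmod M ==> lmap V M (%v. lsw M V v F)"
 unfolding lsw_def coact_def by (elim conjE, rule linear_compose, assumption, rule linear_tl[OF modH])

lemma lsw_linear_arg [lin]:
 "coact V ==> lmap X V f ==> bmap H V M F ==> kmod M ==>
  lmap X M (%y. lsw M V (f y) F)"
 by (rule linear_compose[OF _ lsw_linear])

text \<open>\<open>H\<close> is a comodule over itself, so most rules for the coproduct sums
  \<open>sw\<close> are specialisations of those for \<open>lsw\<close>.\<close>

lemma lc_unit [cl]: "lc (unit_bimodule H)"
proof -
 have 1: "lmap H (ts H H) (comult H)"
  using H_coalg by (simp add: coassociative_coalgebra_def)
 then have 2: "lmap H (ts H H) (\<lambda>x\<in>cH. comult H x)"
  by (subst linear_cong[OF _ modH, of _ "comult H"]) auto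
 have c: "coact (unit_bimodule H)" using 2 by (simp add: coact_def modH)
 have [simp]: "sweedler2 M H h (%h v'. lsw M (unit_bimodule H) v' (%g v''. F h g v''))
   = sweedler2 M H h (%h v'. sweedler2 M H v' (%g v''. F h g v''))"
  if "h : cH" for M h and F :: "'h \<Rightarrow> 'h \<Rightarrow> 'h \<Rightarrow> 'x"
  using lsw_cong[OF c, of h "%h v'. lsw M (unit_bimodule H) v' (%g v''. F h g v'')"
    "%h v'. sweedler2 M H v' (%g v''. F h g v'')"] that by simp
 show ?thesis
  using H_coalg unfolding left_comodule_def coassociative_coalgebra_def
  by (auto simp: modH 2 Let_def)
qed

lemma counit_linear: "lmap H G eps"
 using H_coalg by (simp add: coassociative_coalgebra_def)

lemma counit_closed [simp, cl]: "h : cH ==> eps h :< K"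
 using linear_closed[OF counit_linear] by simp

lemma linear_counit [lin]: "lmap X H f ==> lmap X G (%x. eps (f x))"
 by (rule linear_compose[OF _ counit_linear])

lemma coact_unit [cl]: "coact (unit_bimodule H)" by (rule coact_lc[OF lc_unit])

lemma sw_closed [cl]:
 "h : cH ==> kmod M ==> (!!a b. a : cH ==> b : cH ==> F a b :< M) ==> sw M h F :< M"
 using lsw_closed[OF coact_unit, of h M F] by simp

lemma sw_cong:
 "h : cH ==> (!!a b. a : cH ==> b : cH ==> F a b = F' a b) ==> sw M h F = sw M h F'"
 using lsw_cong[OF coact_unit, of h F F' M] by simp

lemma sw_push:
 "h : cH ==> kmod M ==> kmod N ==>
  (!!a b. a : cH ==> b : cH ==> F a b :< M) ==> lmap M N phi ==>
  phi (sw M h F) = sw N h (%a b. phi (F a b))"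
 using lsw_push[OF coact_unit, of h M N F phi] by simp

lemma lsw_sw_swap:
 "coact V ==> v :< V ==> g : cH ==> kmod M ==>
  (!!h x a b. h : cH ==> x :< V ==> a : cH ==> b : cH ==> F h x a b :< M) ==>
  lsw M V v (%h x. sw M g (%a b. F h x a b)) = sw M g (%a b. lsw M V v (%h x. F h x a b))"
 using lsw_swap[OF _ _ coact_unit, of V v g M F] by simp

lemma sw_swap:
 "h : cH ==> g : cH ==> kmod M ==>
  (!!a b c d. a : cH ==> b : cH ==> c : cH ==> d : cH ==> F a b c d :< M) ==>
  sw M h (%a b. sw M g (%c d. F a b c d)) = sw M g (%c d. sw M h (%a b. F a b c d))"
 using lsw_sw_swap[OF coact_unit, of h g M F] by simp

lemma sw_linear_fun [lin]:
 "h : cH ==> kmod M ==>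
  (!!a b. a : cH ==> b : cH ==> lmap X M (%y. F y a b)) ==>
  lmap X M (%y. sw M h (F y))"
 using lsw_linear_fun[OF coact_unit, of h M X F] by simp

lemma sw_linear_arg [lin]:
 assumes "lmap X H f" "bmap H H M F" "kmod M"
 shows "lmap X M (%y. sw M (f y) F)"
proof (rule linear_compose[OF assms(1)])
 have "lmap H M (%h. lsw M (unit_bimodule H) h F)"
  using lsw_linear[OF coact_unit, of M F] assms by simp
 then show "lmap H M (%h. sw M h F)"
  by (subst linear_cong[OF _ modH, of _ "%h. lsw M (unit_bimodule H) h F"]) simp_all
qed

lemma lsw_counit:
 assumes V: "lc V" and v: "v :< V" and M: "kmod M" and f: "lmap V M f"
 shows "lsw M V v (%h x. eps h *[M] f x) = f v"
proof -
 interpret V: module K V using lc_module[OF V] .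
 have "f v = f (lsw V V v (%h v'. eps h *[V] v'))"
  using V v by (simp add: left_comodule_def)
 also have "... = lsw M V v (%h x. f (eps h *[V] x))"
  by (rule lsw_push[OF coact_lc[OF V] v]) (simp_all add: M f V.module_axioms)
 also have "... = lsw M V v (%h x. eps h *[M] f x)"
  by (rule lsw_cong[OF coact_lc[OF V] v]) (simp add: linear_smult[OF f])
 finally show ?thesis by simp
qed

lemma lsw_coassoc:
 assumes V: "lc V" and v: "v :< V" and M: "kmod M" and F: "trilinear_map H H V M F"
 shows "lsw M V v (%h x. sw M h (%a b. F a b x)) = lsw M V v (%h x. lsw M V x (%g y. F h g y))"
proof -
 note mV = lc_module[OF V] and cV = coact_lc[OF V]
 let ?HHV = "ts H (ts H V)"
 let ?ten = "%x y z. tn H (ts H V) x (tn H V y z)"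
 let ?P = "tlift M (%a t. tlift M (F a) t)"
 note lift = trilinear_lift[OF modH modH mV M F]
 note mT = module_tensor_space[OF modH module_tensor_space[OF modH mV]]
 have ten: "?ten a b c :< ?HHV" if "a : cH" "b : cH" "c :< V" for a b c
  by (intro cl that mV)
 have "lsw ?HHV V v (%h x. sw ?HHV h (%a b. ?ten a b x)) = lsw ?HHV V v (%h x. lsw ?HHV V x (%g y. ?ten h g y))"
  using V v by (auto simp: left_comodule_def Let_def)
 then have "?P (lsw ?HHV V v (%h x. sw ?HHV h (%a b. ?ten a b x))) = ?P (lsw ?HHV V v (%h x. lsw ?HHV V x (%g y. ?ten h g y)))"
  by simp
 also have "?P (lsw ?HHV V v (%h x. sw ?HHV h (%a b. ?ten a b x))) = lsw M V v (%h x. ?P (sw ?HHV h (%a b. ?ten a b x)))"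
  by (intro lsw_push[OF cV v mT M _ lift(1)] sw_closed mT ten)
 also have "... = lsw M V v (%h x. sw M h (%a b. F a b x))"
  by (intro lsw_cong[OF cV v]) (subst sw_push[OF _ mT M ten lift(1)], simp_all add: lift(2) cong: sw_cong)
 also have "?P (lsw ?HHV V v (%h x. lsw ?HHV V x (%g y. ?ten h g y))) = lsw M V v (%h x. ?P (lsw ?HHV V x (%g y. ?ten h g y)))"
  by (intro lsw_push[OF cV v mT M _ lift(1)] lsw_closed[OF cV] mT ten)
 also have "... = lsw M V v (%h x. lsw M V x (%g y. F h g y))"
  by (intro lsw_cong[OF cV v]) (subst lsw_push[OF cV _ mT M ten lift(1)], simp_all add: lift(2) cV cong: lsw_cong)
 finally show ?thesis .
qed

lemma sw_counit_l:
 "h : cH ==> kmod M ==> lmap H M f ==> sw M h (%a b. eps a *[M] f b) = f h"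
 using lsw_counit[OF lc_unit, of h M f] by simp

lemma sw_counit_r:
 assumes h: "h : cH" and M: "kmod M" and f: "lmap H M f"
 shows "sw M h (%a b. eps b *[M] f a) = f h"
proof -
 have "f h = f (sw H h (%a b. eps b *[H] a))"
  using H_coalg h by (simp add: coassociative_coalgebra_def)
 also have "... = sw M h (%a b. f (eps b *[H] a))"
  by (rule sw_push[OF h]) (simp_all add: M f modH)
 also have "... = sw M h (%a b. eps b *[M] f a)"
  by (rule sw_cong[OF h]) (simp add: linear_smult[OF f])
 finally show ?thesis by simp
qed

lemma sw_coassoc:
 assumes h: "h : cH" and M: "kmod M" and F: "trilinear_map H H H M F"
 shows "sw M h (%x y. sw M x (%a b. F a b y)) = sw M h (%x y. sw M y (%a b. F x a b))"
proof -
 have "trilinear_map H H (unit_bimodule H) M F" using F by (simp add: trilinear_map_def)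
 from lsw_coassoc[OF lc_unit _ M this, of h] h
 have "sw M h (%x y. sw M x (%a b. F a b y)) = sw M h (%x y. lsw M (unit_bimodule H) y (%a b. F x a b))"
  by simp
 also have "... = sw M h (%x y. sw M y (%a b. F x a b))" by (rule sw_cong[OF h]) simp
 finally show ?thesis .
qed

lemma comult_mem: "h : cH ==> comult H h :< (ts H H)"
 using coact_mem[OF coact_unit, of h] by simp

lemma comult_linear: "lmap H (ts H H) (comult H)"
 using H_coalg by (simp add: coassociative_coalgebra_def)

lemma sw_cop_raw:
 "h : cH ==> kmod M ==> bmap H H M F ==>
  csw M h F = sw M h (%a b. F b a)"
 using tl_flip[OF modH modH _ _ comult_mem] by (simp add: sweedler2_def)

text \<open>Once the flips are expanded, each side of coassociativity becomes the other side of
  coassociativity for \<open>H\<close>, and the two counit laws change places.\<close>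

lemma coalg_cop: "coalg K (hcop H)"
proof (rule coalg.intro[OF ground_axioms coalg_axioms.intro])
 note mT = module_tensor_space[OF modH module_tensor_space[OF modH modH]]
 show "kmod (hcop H)" by (simp add: modH)
 have 1: "lmap H (ts H H) (comult (hcop H))"
  using linear_compose[OF comult_linear flip_linear(1)[OF modH modH]]
  by (simp add: hcop_def)
 have b2: "bmap H H H (%h1 h2. eps h1 *[H] h2)" "bmap H H H (%h1 h2. eps h2 *[H] h1)"
  by (intro lin cl; assumption)+
 have 2: "csw H h (%h1 h2. eps h1 *[H] h2) = h" if "h : cH" for h
  using sw_counit_r[OF that modH linear_id] by (simp add: sw_cop_raw[OF that modH b2(1)])
 have 3: "csw H h (%h1 h2. eps h2 *[H] h1) = h" if "h : cH" for h
  using sw_counit_l[OF that modH linear_id] by (simp add: sw_cop_raw[OF that modH b2(2)])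
 let ?HHH = "ts H (ts H H)"
 let ?ten = "%x y z. tn H (ts H H) x (tn H H y z)"
 let ?sc = "%M. csw M"
 have cong: "?sc M h F = ?sc M h F'"
  if "h : cH" "!!a b. a : cH ==> b : cH ==> F a b = F' a b" for M :: "('x, 'y) ring_scheme" and h F F'
  unfolding sweedler2_def hcop_simps
  by (rule ts_cong[OF modH modH linear_closed[OF flip_linear(1)[OF modH modH] comult_mem[OF that(1)]] that(2)])
 have 4: "?sc ?HHH h (%h1 h2. ?sc ?HHH h1 (%h11 h12. ?ten h11 h12 h2))
   = ?sc ?HHH h (%h1 h2. ?sc ?HHH h2 (%h21 h22. ?ten h1 h21 h22))" if h: "h : cH" for h
 proof -
  have "?sc ?HHH h (%h1 h2. ?sc ?HHH h1 (%a b. ?ten a b h2)) = ?sc ?HHH h (%h1 h2. sw ?HHH h1 (%a b. ?ten b a h2))"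
   by (rule cong[OF h], rule sw_cop_raw, assumption, rule mT) (intro lin cl; assumption)
  also have "... = sw ?HHH h (%h2 h1. sw ?HHH h1 (%a b. ?ten b a h2))"
   by (intro sw_cop_raw h mT lin cl; assumption)
  also have "... = sw ?HHH h (%h2 h1. sw ?HHH h2 (%a b. ?ten h1 b a))"
   by (rule sw_coassoc[OF h mT, symmetric]) (intro lin cl; assumption)
  also have "... = ?sc ?HHH h (%h1 h2. sw ?HHH h2 (%a b. ?ten h1 b a))"
   by (rule sw_cop_raw[OF h mT, symmetric]) (intro lin cl; assumption)
  also have "... = ?sc ?HHH h (%h1 h2. ?sc ?HHH h2 (%a b. ?ten h1 a b))"
   by (rule cong[OF h], rule sw_cop_raw[symmetric], assumption, rule mT) (intro lin cl; assumption)
  finally show ?thesis .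
 qed
 show "coassociative_coalgebra K (hcop H)"
  unfolding coassociative_coalgebra_def using 1 2 3 4 counit_linear by (simp add: Let_def)
qed

lemma lsw_cop_raw:
 assumes "kmod V" "lmap V (ts V H) (rcoact V)" "v :< V" "kmod M"
  "bmap H V M F"
 shows "lsw M (bcop V) v F = tlift M (%x h. F h x) (rcoact V v)"
 using tl_flip[OF assms(1) modH assms(4,5) linear_closed[OF assms(2,3)]] assms(3)
 by (simp add: lsw_def bcop_def)

end

text \<open>The right comodule axioms appear as left ones over the co-opposite, and the
  compatibility of the coactions uses the same sums. In this form the notion is visibly symmetric
  under \<open>bcop\<close>.\<close>

definition bicomodule where
 "bicomodule K H V \<longleftrightarrow> left_comodule K H V \<and> left_comodule K (hcop H) (bcop V) \<and>
  lcoact V : extensional (carrier V) \<and> rcoact V : extensional (carrier V) \<and>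
  (\<forall>v\<in>carrier V. let HVH = tensor_space K H (tensor_space K V H);
      ten = (%x y z. tensor K H (tensor_space K V H) x (tensor K V H y z))
   in lsw HVH V v (%h x. lsw HVH (bcop V) x (%g y. ten h y g)) =
     lsw HVH (bcop V) v (%g x. lsw HVH V x (%h y. ten h y g)))"

section \<open>Bicomodules\<close>

context coalg
begin

abbreviation "bic \<equiv> bicomodule K H"

lemma bic_lc: "bic V ==> lc V"
 and bic_cop_lc: "bic V ==> left_comodule K (hcop H) (bcop V)"
 by (simp_all add: bicomodule_def)

lemma bic_module: "bic V ==> kmod V"
 by (simp add: lc_module[OF bic_lc])

lemma bic_coact: "bic V ==> coact V"
 by (simp add: coact_lc[OF bic_lc])

lemma bic_cop_coact: "bic V ==> coact (bcop V)"
 by (rule coact_lc_cop[OF bic_cop_lc])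

text \<open>\<open>flip\<close> is linear in both directions, so linearity of a right coaction can
  be read off from the flipped one.\<close>

lemma rcoact_linear:
 assumes "kmod V"
 shows "lmap V (ts V H) (rcoact V) \<longleftrightarrow> lmap V (ts H V) (lcoact (bcop V))"
proof -
 interpret V: module K V by fact
 have 1: "lmap V (ts H V) (lcoact (bcop V)) = lmap V (ts H V) (%v. flip (rcoact V v))"
  by (rule linear_cong[OF _ assms]) (simp add: bcop_def)
 show ?thesis
 proof
  assume "lmap V (ts V H) (rcoact V)"
  from linear_compose[OF this flip_linear(1)[OF assms modH]] 1
  show "lmap V (ts H V) (lcoact (bcop V))" by simp
 next
  assume "lmap V (ts H V) (lcoact (bcop V))"
  with 1 have "lmap V (ts H V) (%v. flip (rcoact V v))" by simp
  from linear_compose[OF this flip_linear(1)[OF modH assms]]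
  show "lmap V (ts V H) (rcoact V)" by simp
 qed
qed

lemma cop_lsw:
 assumes c: "coact (bcop V)"
 shows "kmod M ==> lmap X V f ==> bmap H V M F ==> lmap X M (%x. lsw M (bcop V) (f x) F)"
  "kmod M ==> v :< V ==> (!!h x. h : cH ==> x :< V ==> lmap X M (%y. F' y h x)) ==> lmap X M (%y. lsw M (bcop V) v (F' y))"
  "kmod M ==> v :< V ==> (!!h x. h : cH ==> x :< V ==> F h x :< M) ==> lsw M (bcop V) v F :< M"
 using lsw_linear_arg[OF c, of X f M F] lsw_linear_fun[OF c, of v M X F'] lsw_closed[OF c, of v M F] by simp_all

lemma lsw_cop:
 assumes "coact (bcop V)" "v :< V" "kmod M" "bmap H V M F"
 shows "lsw M (bcop V) v F = tlift M (%x h. F h x) (rcoact V v)"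
 using assms rcoact_linear[of V] by (intro lsw_cop_raw) (simp_all add: coact_def)

lemma bic_comm:
 assumes V: "bic V" and v: "v :< V" and M: "kmod M" and F: "trilinear_map H V H M F"
 shows "lsw M V v (%h x. lsw M (bcop V) x (%g y. F h y g)) =
     lsw M (bcop V) v (%g x. lsw M V x (%h y. F h y g))"
proof -
 note mV = bic_module[OF V] and cV = bic_coact[OF V] and cW = bic_cop_coact[OF V]
 let ?HVH = "ts H (ts V H)"
 let ?ten = "%x y z. tn H (ts V H) x (tn V H y z)"
 let ?P = "tlift M (%a t. tlift M (F a) t)"
 note lift = trilinear_lift[OF modH mV modH M F]
 note mT = module_tensor_space[OF modH module_tensor_space[OF mV modH]]
 have ten: "?ten a b c :< ?HVH" if "a : cH" "b :< V" "c : cH" for a b c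
  by (intro cl that mV)
 have vW: "x :< (bcop V)" if "x :< V" for x using that by simp
 have "lsw ?HVH V v (%h x. lsw ?HVH (bcop V) x (%g y. ?ten h y g)) =
     lsw ?HVH (bcop V) v (%g x. lsw ?HVH V x (%h y. ?ten h y g))"
  using V v by (auto simp: bicomodule_def Let_def)
 then have "?P (lsw ?HVH V v (%h x. lsw ?HVH (bcop V) x (%g y. ?ten h y g))) =
     ?P (lsw ?HVH (bcop V) v (%g x. lsw ?HVH V x (%h y. ?ten h y g)))"
  by simp
 also have "?P (lsw ?HVH V v (%h x. lsw ?HVH (bcop V) x (%g y. ?ten h y g)))
   = lsw M V v (%h x. ?P (lsw ?HVH (bcop V) x (%g y. ?ten h y g)))"
  by (intro lsw_push[OF cV v mT M _ lift(1)] lsw_closed[OF cW] mT ten) simp_all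
 also have "... = lsw M V v (%h x. lsw M (bcop V) x (%g y. F h y g))"
  by (intro lsw_cong[OF cV v]) (subst lsw_push[OF cW _ mT M ten lift(1)]; auto simp: lift(2) intro!: lsw_cong[OF cW])
 also have "?P (lsw ?HVH (bcop V) v (%g x. lsw ?HVH V x (%h y. ?ten h y g)))
   = lsw M (bcop V) v (%g x. ?P (lsw ?HVH V x (%h y. ?ten h y g)))"
  by (intro lsw_push[OF cW vW[OF v] mT M _ lift(1)] lsw_closed[OF cV] mT ten) simp_all
 also have "... = lsw M (bcop V) v (%g x. lsw M V x (%h y. F h y g))"
  by (intro lsw_cong[OF cW vW[OF v]]) (subst lsw_push[OF cV _ mT M ten lift(1)], simp_all add: lift(2) cV cong: lsw_cong)
 finally show ?thesis .
qed

lemma hopf_bicomodule_bic: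
 assumes V: "hopf_bicomodule K H V"
 shows "bic V"
proof -
 have mV: "kmod V" and ext: "lcoact V : extensional (carrier V)" "rcoact V : extensional (carrier V)"
  and lin_l: "lmap V (ts H V) (lcoact V)"
  and lin_r: "lmap V (ts V H) (rcoact V)"
  using V by (auto simp: hopf_bicomodule_def PiE_def)
 have cV: "coact V" using mV lin_l by (simp add: coact_def)
 have cW: "coact (bcop V)" using mV lin_r rcoact_linear[OF mV] by (simp add: coact_def)
 note raw = lsw_cop[OF cW]
 note rmem = linear_closed[OF lin_r]
 interpret V: module K V by (rule mV)
 have lV: "lc V" using V by (simp add: left_comodule_def hopf_bicomodule_def lsw_def)
 have lW: "left_comodule K (hcop H) (bcop V)"
  unfolding left_comodule_def
 proof (intro conjI ballI)
  show "kmod (bcop V)" by (simp add: mV)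
  show "lmap (bcop V) (ts (hcop H) (bcop V)) (lcoact (bcop V))"
   using lin_r rcoact_linear[OF mV] by simp
  fix v assume "v :< (bcop V)" then have v: "v :< V" by simp
  have "lsw V (bcop V) v (%h v'. eps h *[V] v') = tlift V (%v' h. eps h *[V] v') (rcoact V v)"
   by (rule raw[OF v mV]) (intro lin cl mV; assumption)
  then show "lsw (bcop V) (bcop V) v (%h v'. counit (hcop H) h *[bcop V] v') = v"
   using V v by (simp add: hopf_bicomodule_def)
  let ?HHV = "ts H (ts H V)"
  let ?ten = "%x y z. tn H (ts H V) x (tn H V y z)"
  let ?VHH = "ts V (ts H H)"
  let ?ten' = "%x y z. tn V (ts H H) x (tn H H y z)"
  \<comment> \<open>The map reversing three tensor factors. It carries the right coassociativity
    axiom, an equation in \<open>V \<otimes> (H \<otimes> H)\<close>, to the left one over the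
    co-opposite, an equation in \<open>H \<otimes> (H \<otimes> V)\<close>.\<close>
  let ?P = "tlift ?HHV (%a t. tlift ?HHV (%b c. ?ten c b a) t)"
  have mT: "kmod ?HHV" and mT': "kmod ?VHH" by (intro cl mV)+
  have tri: "trilinear_map V H H ?HHV (%a b c. ?ten c b a)" by (intro lin cl mV; assumption)
  note lift = trilinear_lift[OF mV modH modH mT tri]
  have ten': "?ten' a b c :< ?VHH" if "a :< V" "b : cH" "c : cH" for a b c
   by (intro cl that mV)
  have "tlift ?VHH (%x h. sw ?VHH h (%a b. ?ten' x a b)) (rcoact V v)
    = tlift ?VHH (%x h. tlift ?VHH (%y g. ?ten' y g h) (rcoact V x)) (rcoact V v)"
   using V v by (simp add: hopf_bicomodule_def Let_def)
  then have "?P (tlift ?VHH (%x h. sw ?VHH h (%a b. ?ten' x a b)) (rcoact V v))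
    = ?P (tlift ?VHH (%x h. tlift ?VHH (%y g. ?ten' y g h) (rcoact V x)) (rcoact V v))" by simp
  also have "?P (tlift ?VHH (%x h. sw ?VHH h (%a b. ?ten' x a b)) (rcoact V v))
   = tlift ?HHV (%x h. ?P (sw ?VHH h (%a b. ?ten' x a b))) (rcoact V v)"
   by (intro ts_push[OF mV modH rmem[OF v] mT' mT _ lift(1)] sw_closed mT' ten')
  also have "... = tlift ?HHV (%x h. sw ?HHV h (%a b. ?ten b a x)) (rcoact V v)"
   by (intro ts_cong[OF mV modH rmem[OF v]]) (subst sw_push[OF _ mT' mT ten' lift(1)], simp_all add: lift(2) cong: sw_cong)
  also have "... = lsw ?HHV (bcop V) v (%h x. sw ?HHV h (%a b. ?ten b a x))"
   by (rule raw[OF v mT, symmetric]) (intro lin cl mV; assumption)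
  also have "... = lsw ?HHV (bcop V) v (%h x. csw ?HHV h (%a b. ?ten a b x))"
   using v by (intro lsw_cong[OF cW] sw_cop_raw[symmetric] mT; simp?; intro lin cl mV; simp)
  also have "?P (tlift ?VHH (%x h. tlift ?VHH (%y g. ?ten' y g h) (rcoact V x)) (rcoact V v))
   = tlift ?HHV (%x h. ?P (tlift ?VHH (%y g. ?ten' y g h) (rcoact V x))) (rcoact V v)"
   by (intro ts_push[OF mV modH rmem[OF v] mT' mT _ lift(1)] ts_closed[OF mV modH rmem] mT' ten')
  also have "... = tlift ?HHV (%x h. tlift ?HHV (%y g. ?ten h g y) (rcoact V x)) (rcoact V v)"
   by (intro ts_cong[OF mV modH rmem[OF v]])
    (subst ts_push[OF mV modH rmem mT' mT ten' lift(1)]; auto simp: lift(2) intro!: ts_cong[OF mV modH rmem])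
  also have "... = tlift ?HHV (%x h. lsw ?HHV (bcop V) x (%g y. ?ten h g y)) (rcoact V v)"
   by (rule ts_cong[OF mV modH rmem[OF v]], rule raw[symmetric], assumption, rule mT) (intro lin cl mV; assumption)
  also have "... = lsw ?HHV (bcop V) v (%h x. lsw ?HHV (bcop V) x (%g y. ?ten h g y))"
   using v by (intro raw[OF v mT, symmetric] lin cl mV cW) (simp_all add: linear_id)
  finally show "let HHV = ts (hcop H) (ts (hcop H) (bcop V));
      ten = (%x y z. tn (hcop H) (ts (hcop H) (bcop V)) x (tn (hcop H) (bcop V) y z))
    in lsw HHV (bcop V) v (%h v'. csw HHV h (%h1 h2. ten h1 h2 v'))
    = lsw HHV (bcop V) v (%h v'. lsw HHV (bcop V) v' (%g v''. ten h g v''))"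
   by (simp add: Let_def)
 qed
 have "lsw HVH V v (%h x. lsw HVH (bcop V) x (%g y. ten h y g)) =
     lsw HVH (bcop V) v (%g x. lsw HVH V x (%h y. ten h y g))"
  if v: "v :< V" and HVH: "HVH = ts H (ts V H)"
   and ten: "ten = (%x y z. tn H (ts V H) x (tn V H y z))" for v HVH ten
 proof -
  have mT: "kmod HVH" unfolding HVH by (intro cl mV)
  have b1: "bmap H V HVH (%g y. ten h y g)" if "h : cH" for h
   unfolding ten HVH by (intro lin cl mV that; assumption)
  have b2: "bmap H V HVH (%g x. lsw HVH V x (%h y. ten h y g))"
   unfolding ten HVH by (intro lin cl mV cV; assumption)
  have "lsw HVH V v (%h x. lsw HVH (bcop V) x (%g y. ten h y g)) =
    lsw HVH V v (%h x. tlift HVH (%y g. ten h y g) (rcoact V x))"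
   by (intro lsw_cong[OF cV v] raw mT b1)
  also have "... = tlift HVH (%v' g. tlift HVH (%h v''. ten h v'' g) (lcoact V v')) (rcoact V v)"
   using V v by (simp add: hopf_bicomodule_def Let_def HVH ten lsw_def)
  also have "... = lsw HVH (bcop V) v (%g x. lsw HVH V x (%h y. ten h y g))"
   by (subst raw[OF v mT b2]) (simp add: lsw_def)
  finally show ?thesis .
 qed
 then show ?thesis
  using lV lW ext by (simp add: bicomodule_def Let_def)
qed

lemma bic_hopf_bicomodule:
 assumes V: "bic V"
 shows "hopf_bicomodule K H V"
proof -
 note mV = bic_module[OF V] and cV = bic_coact[OF V] and cW = bic_cop_coact[OF V]
 note lV = bic_lc[OF V] and lW = bic_cop_lc[OF V]
 interpret V: module K V by (rule mV)
 have lin_l: "lmap V (ts H V) (lcoact V)" using cV by (simp add: coact_def)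
 have lin_r: "lmap V (ts V H) (rcoact V)" using cW by (simp add: coact_def rcoact_linear[OF mV])
 have ext: "lcoact V : extensional (carrier V)" "rcoact V : extensional (carrier V)"
  using V by (simp_all add: bicomodule_def)
 note raw = lsw_cop[OF cW, symmetric]
 let ?VHH = "ts V (ts H H)"
 let ?ten' = "%x y z. tn V (ts H H) x (tn H H y z)"
 let ?HVH = "ts H (ts V H)"
 let ?ten = "%x y z. tn H (ts V H) x (tn V H y z)"
 have mT': "kmod ?VHH" and mT: "kmod ?HVH" by (intro cl mV)+
 have e1: "tlift V (%v' h. eps h *[V] v') (rcoact V v) = v" if v: "v :< V" for v
 proof -
  have "tlift V (%v' h. eps h *[V] v') (rcoact V v) = lsw V (bcop V) v (%h v'. eps h *[V] v')"
   by (rule raw[OF v mV]) (intro lin cl mV; assumption)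
  then show ?thesis using lW v by (simp add: left_comodule_def)
 qed
 have e2: "tlift ?VHH (%x h. sw ?VHH h (%a b. ?ten' x a b)) (rcoact V v)
    = tlift ?VHH (%x h. tlift ?VHH (%y g. ?ten' y g h) (rcoact V x)) (rcoact V v)"
  if v: "v :< V" for v
 proof -
  have tri: "trilinear_map (hcop H) (hcop H) (bcop V) ?VHH (%a b x. ?ten' x b a)"
   by (intro lin cl mV; simp; intro lin cl mV; assumption)
  have "tlift ?VHH (%x h. sw ?VHH h (%a b. ?ten' x a b)) (rcoact V v)
    = lsw ?VHH (bcop V) v (%h x. sw ?VHH h (%a b. ?ten' x a b))"
   by (rule raw[OF v mT']) (intro lin cl mV; assumption)
  also have "... = lsw ?VHH (bcop V) v (%h x. csw ?VHH h (%a b. ?ten' x b a))"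
   using v by (intro lsw_cong[OF cW] sw_cop_raw[symmetric] mT'; simp?; intro lin cl mV; simp)
  also have "... = lsw ?VHH (bcop V) v (%h x. lsw ?VHH (bcop V) x (%g y. ?ten' y g h))"
   using coalg.lsw_coassoc[OF coalg_cop lW _ mT' tri] v by simp
  also have "... = tlift ?VHH (%x h. lsw ?VHH (bcop V) x (%g y. ?ten' y g h)) (rcoact V v)"
   by (intro raw[OF v mT', symmetric] lin cl mV cW) (simp_all add: linear_id)
  also have "... = tlift ?VHH (%x h. tlift ?VHH (%y g. ?ten' y g h) (rcoact V x)) (rcoact V v)"
   by (rule ts_cong[OF mV modH linear_closed[OF lin_r v]], rule raw[symmetric], assumption, rule mT')
    (intro lin cl mV; assumption)
  finally show ?thesis .
 qed
 have e3: "tlift ?HVH (%h x. tlift ?HVH (%y g. ?ten h y g) (rcoact V x)) (lcoact V v)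
   = tlift ?HVH (%x g. tlift ?HVH (%h y. ?ten h y g) (lcoact V x)) (rcoact V v)"
  if v: "v :< V" for v
 proof -
  have "tlift ?HVH (%h x. tlift ?HVH (%y g. ?ten h y g) (rcoact V x)) (lcoact V v)
    = tlift ?HVH (%h x. lsw ?HVH (bcop V) x (%g y. ?ten h y g)) (lcoact V v)"
   by (rule ts_cong[OF modH mV linear_closed[OF lin_l v]], rule raw, assumption, rule mT)
    (intro lin cl mV; assumption)
  also have "... = lsw ?HVH V v (%h x. lsw ?HVH (bcop V) x (%g y. ?ten h y g))"
   by (simp only: lsw_def)
  also have "... = lsw ?HVH (bcop V) v (%g x. lsw ?HVH V x (%h y. ?ten h y g))"
   using V v by (simp add: bicomodule_def Let_def)
  also have "... = tlift ?HVH (%x g. lsw ?HVH V x (%h y. ?ten h y g)) (rcoact V v)"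
   by (intro raw[OF v mT, symmetric] lin cl mV cV; assumption)
  finally show ?thesis by (simp add: lsw_def)
 qed
 show ?thesis
  unfolding hopf_bicomodule_def
  using mV ext lin_l lin_r e1 e2 e3 lV linear_closed[OF lin_l] linear_closed[OF lin_r]
  by (auto simp: Let_def PiE_def left_comodule_def lsw_def)
qed

lemma bic_cop:
 assumes V: "bic V" shows "bicomodule K (hcop H) (bcop V)"
proof -
 have ext: "lcoact V : extensional (carrier V)" "rcoact V : extensional (carrier V)"
  using V by (simp_all add: bicomodule_def)
 note mV = bic_module[OF V]
 have tri: "trilinear_map H V H (ts H (ts V H)) 
   (%x y z. tn H (ts V H) z (tn V H y x))"
  by (intro lin cl mV; assumption)
 have mT: "kmod (ts H (ts V H))" by (intro cl mV)
 have "left_comodule K (hcop (hcop H)) (bcop (bcop V))"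
  using bic_lc[OF V] by (simp add: left_comodule_same[OF same_coalg_cop_cop] bcop_cop[OF ext])
 then show ?thesis
  using bic_cop_lc[OF V] bic_comm[OF V _ mT tri] bcop_cop[OF ext]
  unfolding bicomodule_def by (auto simp: Let_def bcop_ext)
qed

end

section \<open>Hopf algebras\<close>

text \<open>Left colinearity of a bilinear map for the codiagonal coaction on
  \<open>X \<otimes> Y\<close>, phrased without forming that comodule. The product, both actions and
  the universal map of the tensor product over \<open>H\<close> are all instances.\<close>

definition colin ::
 "('k, 'l) ring_scheme \<Rightarrow> ('k, 'h) hopf \<Rightarrow> ('k, 'h, 'x) bimodule \<Rightarrow> ('k, 'h, 'y) bimodule \<Rightarrow> ('k, 'h, 'p) bimodule
  \<Rightarrow> ('x \<Rightarrow> 'y \<Rightarrow> 'p) \<Rightarrow> bool" where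
 "colin K H X Y P m \<longleftrightarrow> (\<forall>x\<in>carrier X. \<forall>y\<in>carrier Y.
   lcoact P (m x y) = lsw (tensor_space K H P) X x (%a x'. lsw (tensor_space K H P) Y y (%b y'.
    tensor K H P (a \<otimes>\<^bsub>H\<^esub> b) (m x' y'))))"

lemma ring_same:
 assumes "carrier R = carrier R'" "add R = add R'" "zero R = zero R'" "mult R = mult R'" "one R = one R'" "ring R"
 shows "ring R'"
proof -
 interpret ring R by fact
 show ?thesis
  by (rule ringI, rule abelian_group_same[OF assms(1-3) abelian_group_axioms], rule monoidI; unfold assms(1-5)[symmetric])
   (auto simp: m_assoc l_distr r_distr)
qed

locale hopf_loc = ground K for K :: "('k, 'l) ring_scheme" +
 fixes H :: "('k, 'h) hopf"
 assumes H_hopf: "hopf_algebra K H"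
begin

sublocale coalg K H
 by (rule coalg.intro[OF ground_axioms coalg_axioms.intro]) (use H_hopf in \<open>simp_all add: hopf_algebra_def associative_algebra_def\<close>)

sublocale Hr: ring H
 using H_hopf by (simp add: hopf_algebra_def associative_algebra_def)

abbreviation "S \<equiv> antipode H"
abbreviation hm (infixl "**" 70) where "a ** b \<equiv> a \<otimes>\<^bsub>H\<^esub> b"
abbreviation "u \<equiv> \<one>\<^bsub>H\<^esub>"
abbreviation "ht \<equiv> htensor H"
abbreviation "HU \<equiv> unit_bimodule H"

lemma mult_bilinear: "bmap H H H (mult H)"
 using H_hopf by (simp add: hopf_algebra_def associative_algebra_def)

lemma linear_mult_l [lin]: "lmap X H f ==> b : cH ==> lmap X H (%x. f x ** b)"
 by (rule linear_bil_l[OF mult_bilinear])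

lemma linear_mult_r [lin]: "lmap X H f ==> b : cH ==> lmap X H (%x. b ** f x)"
 by (rule linear_bil_r[OF mult_bilinear])

lemma antipode_linear: "lmap H H S"
 using H_hopf by (simp add: hopf_algebra_def)

lemma linear_antipode [lin]: "lmap X H f ==> lmap X H (%x. S (f x))"
 by (rule linear_compose[OF _ antipode_linear])

lemma S_closed [simp, cl]: "h : cH ==> S h : cH"
 by (rule linear_closed[OF antipode_linear])

lemmas [cl] = Hr.m_closed Hr.one_closed K.m_closed K.one_closed Hm.smult_closed

lemma smult_r: "a :< K ==> x : cH ==> y : cH ==> x ** (a *[H] y) = a *[H] (x ** y)"
 by (rule linear_smult[OF bilinear_r[OF mult_bilinear]])

lemma counit_mult [simp]: "h : cH ==> g : cH ==> eps (h ** g) = eps h \<star> eps g"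
 and counit_one [simp]: "eps u = \<one>\<^bsub>K\<^esub>"
 using H_hopf by (simp_all add: hopf_algebra_def)

text \<open>The defining equation lives in \<open>H \<otimes> P\<close>; applying the lift of
  \<open>F\<close> to it gives the form used in calculations.\<close>

lemma colinD:
 assumes m: "colin K H X Y P m" "coact X" "coact Y" "coact P" "bmap X Y P m"
  and M: "kmod M" and F: "bmap H P M F" and x: "x :< X" and y: "y :< Y"
 shows "lsw M P (m x y) F = lsw M X x (%a x'. lsw M Y y (%b y'. F (a ** b) (m x' y')))"
proof -
 let ?HP = "ts H P"
 note mP = coact_module[OF m(4)]
 have mT: "kmod ?HP" by (intro cl mP)
 have T: "tn H P (a ** b) (m x' y') :< ?HP" if "a : cH" "b : cH" "x' :< X" "y' :< Y" for a b x' y'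
  by (intro cl mP bilinear_closed[OF m(5)] that)
 note l = linear_tl[OF modH mP M F] and g = tl_tensor[OF modH mP M F]
 have "lsw M P (m x y) F = tlift M F (lsw ?HP X x (%a x'. lsw ?HP Y y (%b y'. tn H P (a ** b) (m x' y'))))"
  using m(1) x y by (simp add: lsw_def colin_def)
 also have "... = lsw M X x (%a x'. tlift M F (lsw ?HP Y y (%b y'. tn H P (a ** b) (m x' y'))))"
  by (intro lsw_push[OF m(2) x mT M _ l] lsw_closed[OF m(3) y] mT T)
 also have "... = lsw M X x (%a x'. lsw M Y y (%b y'. F (a ** b) (m x' y')))"
 proof (intro lsw_cong[OF m(2) x])
  fix a x' assume *: "a : cH" "x' :< X"
  have "tlift M F (lsw ?HP Y y (%b y'. tn H P (a ** b) (m x' y')))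
   = lsw M Y y (%b y'. tlift M F (tn H P (a ** b) (m x' y')))"
   by (intro lsw_push[OF m(3) y mT M _ l] T *)
  also have "... = lsw M Y y (%b y'. F (a ** b) (m x' y'))"
   using * by (intro lsw_cong[OF m(3) y] g cl bilinear_closed[OF m(5)])
  finally show "tlift M F (lsw ?HP Y y (%b y'. tn H P (a ** b) (m x' y'))) = lsw M Y y (%b y'. F (a ** b) (m x' y'))" .
 qed
 finally show ?thesis .
qed

lemma colin_mult: "colin K H HU HU HU (mult H)"
proof -
 have "comult H (h ** g) = sw (ts H H) h (%h1 h2.
    sw (ts H H) g (%g1 g2. tn H H (h1 ** g1) (h2 ** g2)))"
  if "h : cH" "g : cH" for h g
  using H_hopf that by (simp add: hopf_algebra_def)
 then show ?thesis by (simp add: colin_def)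
qed

lemma sw_mult:
 "h : cH ==> g : cH ==> kmod M ==> bmap H H M F ==>
  sw M (h ** g) F = sw M h (%h1 h2. sw M g (%g1 g2. F (h1 ** g1) (h2 ** g2)))"
 using colinD[OF colin_mult coact_unit coact_unit coact_unit, of M F h g] by (simp add: mult_bilinear)

lemma sw_one: "kmod M ==> bmap H H M F ==> sw M u F = F u u"
 using H_hopf tl_tensor[OF modH modH, of M F u u] by (simp add: sweedler2_def hopf_algebra_def)

section \<open>The antipode\<close>

lemma antipode_l:
 assumes h: "h : cH" and M: "kmod M" and f: "lmap H M f"
 shows "sw M h (%a b. f (S a ** b)) = eps h *[M] f u"
proof -
 have "sw M h (%a b. f (S a ** b)) = f (sw H h (%a b. S a ** b))"
  by (rule sw_push[symmetric, OF h modH M _ f]) simp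
 also have "sw H h (%a b. S a ** b) = eps h *[H] u" using H_hopf h by (simp add: hopf_algebra_def)
 finally show ?thesis using h by (simp add: linear_smult[OF f])
qed

lemma antipode_r:
 assumes h: "h : cH" and M: "kmod M" and f: "lmap H M f"
 shows "sw M h (%a b. f (a ** S b)) = eps h *[M] f u"
proof -
 have "sw M h (%a b. f (a ** S b)) = f (sw H h (%a b. a ** S b))"
  by (rule sw_push[symmetric, OF h modH M _ f]) simp
 also have "sw H h (%a b. a ** S b) = eps h *[H] u" using H_hopf h by (simp add: hopf_algebra_def)
 finally show ?thesis using h by (simp add: linear_smult[OF f])
qed

lemma S_one: "S u = u"
proof -
 have "S u ** u = sw H u (%a b. S a ** b)"
  by (rule sw_one[OF modH, symmetric]) (intro lin cl; assumption)
 also have "... = u" using antipode_l[OF Hr.one_closed modH linear_id] by simp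
 finally show ?thesis by simp
qed

lemma counit_S [simp]: assumes h: "h : cH" shows "eps (S h) = eps h"
proof -
 have "eps (S h) = sw G h (%a b. eps b *[G] eps (S a))"
  by (rule sw_counit_r[symmetric, OF h modG]) (intro lin)
 also have "... = sw G h (%a b. eps (S a ** b))"
 proof (intro sw_cong[OF h])
  fix a b assume a: "a : cH" and b: "b : cH"
  show "eps b *[G] eps (S a) = eps (S a ** b)"
   unfolding counit_mult[OF S_closed[OF a] b] ground_module_simps
   by (rule K.m_comm) (simp_all add: a b)
 qed
 also have "... = eps h" using antipode_l[OF h modG counit_linear] h by simp
 finally show ?thesis .
qed

text \<open>Insert \<open>eps (h_2 g_2) u = (h_2 g_2) S (h_3 g_3)\<close> behind
  \<open>S g_1 S h_1\<close>. Then \<open>S h_1 h_2\<close> cancels, next \<open>S g_1 g_2\<close>,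
  and \<open>S (h g)\<close> remains.\<close>

lemma S_mult:
 assumes h: "h : cH" and g: "g : cH"
 shows "S (h ** g) = S g ** S h"
proof -
 note m = modH
 have "S g ** S h = sw H h (%h1 h'. eps h' *[H] (S g ** S h1))"
  by (rule sw_counit_r[OF h m, symmetric]) (intro lin cl g)
 also have "... = sw H h (%h1 h'. eps h' *[H] sw H g (%g1 g'. eps g' *[H] (S g1 ** S h1)))"
  by (rule sw_cong[OF h], rule arg_cong, rule sw_counit_r[OF g m, symmetric]) (intro lin cl; assumption)
 also have "... = sw H h (%h1 h'. sw H g (%g1 g'. (S g1 ** S h1) ** (eps (h' ** g') *[H] u)))"
  by (intro sw_cong[OF h], subst sw_push[OF g m m, of _ "smult H _"])
   (simp_all add: linear_smult_r linear_id m smult_r Hm.smult_assoc1 cong: sw_cong add: g)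
 also have "... = sw H h (%h1 h'. sw H g (%g1 g'. sw H (h' ** g') (%a b. (S g1 ** S h1) ** (a ** S b))))"
  apply (intro sw_cong[OF h] sw_cong[OF g])
  apply (subst antipode_r[OF _ m, of _ "%z. (S _ ** S _) ** z"])
   apply (simp_all add: smult_r)
  apply (intro lin cl; assumption)
  done
 also have "... = sw H h (%h1 h'. sw H g (%g1 g'. sw H h' (%h2 h3. sw H g' (%g2 g3. (S g1 ** S h1) ** ((h2 ** g2) ** S (h3 ** g3))))))"
  by (intro sw_cong[OF h] sw_cong[OF g] sw_mult m lin cl; assumption)
 also have "... = sw H h (%h1 h'. sw H h' (%h2 h3. sw H g (%g1 g'. sw H g' (%g2 g3. S g1 ** ((S h1 ** h2) ** g2) ** S (h3 ** g3)))))"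
  apply (intro sw_cong[OF h])
  apply (subst sw_swap[OF g _ m])
   apply assumption
   apply (intro cl; assumption)
  apply (intro sw_cong[OF _] sw_cong[OF g])
  by (simp_all add: Hr.m_assoc g)
 also have "... = sw H h (%x h3. sw H x (%h1 h2. sw H g (%g1 g'. sw H g' (%g2 g3. S g1 ** ((S h1 ** h2) ** g2) ** S (h3 ** g3)))))"
  by (rule sw_coassoc[OF h m, symmetric]) (intro lin cl g; assumption)
 also have "... = sw H h (%x h3. eps x *[H] sw H g (%g1 g'. sw H g' (%g2 g3. S g1 ** (u ** g2) ** S (h3 ** g3))))"
  by (intro sw_cong[OF h] antipode_l[OF _ m] lin cl g; assumption)
 also have "... = sw H g (%g1 g'. sw H g' (%g2 g3. S g1 ** (u ** g2) ** S (h ** g3)))"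
  by (intro sw_counit_l[OF h m] lin cl g; assumption)
 also have "... = sw H g (%y g3. sw H y (%g1 g2. S g1 ** (u ** g2) ** S (h ** g3)))"
  by (rule sw_coassoc[OF g m, symmetric]) (intro lin cl h; assumption)
 also have "... = sw H g (%y g3. sw H y (%g1 g2. (S g1 ** g2) ** S (h ** g3)))"
  by (intro sw_cong[OF g]) (rule sw_cong, simp_all)
 also have "... = sw H g (%y g3. eps y *[H] (u ** S (h ** g3)))"
  by (intro sw_cong[OF g] antipode_l[OF _ m] lin cl h; assumption)
 also have "... = u ** S (h ** g)"
  by (intro sw_counit_l[OF g m] lin cl h; assumption)
 finally show ?thesis using h g by simp
qed

lemma S_comult:
 assumes h: "h : cH" and M: "kmod M" and F: "bmap H H M F"
 shows "sw M (S h) F = sw M h (%a b. F (S b) (S a))"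
proof -
 note Fr = bmap_rules[OF F]
 \<comment> \<open>An expression to be evaluated in two ways. Cancelling \<open>c S d\<close> and
   then \<open>b S e\<close> leaves \<open>F\<close> on the coproduct of \<open>S a\<close>, times
   \<open>eps r\<close>. Merging instead the coproducts of \<open>S a\<close> and \<open>y\<close>
   gives the coproduct of \<open>S a ** y\<close>, which the antipode axiom collapses once
   \<open>a\<close> and \<open>y\<close> come from the same element.\<close>
 define J where "J a r = sw M (S a) (%s t. sw M r (%b r2. sw M r2 (%c d'. sw M d' (%d e. F (s ** (b ** S e)) (t ** (c ** S d))))))" for a r
 have 1: "J a r = eps r *[M] sw M (S a) F" if a: "a : cH" and r: "r : cH" for a r
 proof -
  have in1: "sw M r (%b r2. sw M r2 (%c d'. sw M d' (%d e. F (s ** (b ** S e)) (t ** (c ** S d))))) = eps r *[M] F s t"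
   if s: "s : cH" and t: "t : cH" for s t
  proof -
   have "sw M r (%b r2. sw M r2 (%c d'. sw M d' (%d e. F (s ** (b ** S e)) (t ** (c ** S d)))))
     = sw M r (%b r2. sw M r2 (%x e. sw M x (%c d. F (s ** (b ** S e)) (t ** (c ** S d)))))"
    by (intro sw_cong[OF r] sw_coassoc[symmetric] M lin Fr cl s t; assumption)
   also have "... = sw M r (%b r2. sw M r2 (%x e. eps x *[M] F (s ** (b ** S e)) (t ** u)))"
    by (intro sw_cong[OF r] sw_cong antipode_r M lin Fr cl s t; assumption)
   also have "... = sw M r (%b r2. F (s ** (b ** S r2)) (t ** u))"
    by (intro sw_cong[OF r] sw_counit_l M lin Fr cl s t; assumption)
   also have "... = eps r *[M] F (s ** u) (t ** u)"
    by (intro antipode_r[OF r M] M lin Fr cl s t; assumption)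
   finally show ?thesis using s t by simp
  qed
  have "J a r = sw M (S a) (%s t. eps r *[M] F s t)"
   unfolding J_def using a by (intro sw_cong in1) simp_all
  also have "... = eps r *[M] sw M (S a) F"
   using a r by (intro sw_push[symmetric, OF _ M M] Fr lin M) simp_all
  finally show ?thesis .
 qed
 have 2: "J a r = sw M r (%y d'. sw M (S a ** y) (%p q. sw M d' (%d e. F (p ** S e) (q ** S d))))"
  if a: "a : cH" and r: "r : cH" for a r
 proof -
  have "J a r = sw M (S a) (%s t. sw M r (%y d'. sw M y (%b c. sw M d' (%d e. F (s ** (b ** S e)) (t ** (c ** S d))))))"
   unfolding J_def
   by (rule sw_cong[OF S_closed[OF a]], rule sw_coassoc[OF r M, symmetric]) (intro M lin Fr cl; assumption)
  also have "... = sw M r (%y d'. sw M (S a) (%s t. sw M y (%b c. sw M d' (%d e. F (s ** (b ** S e)) (t ** (c ** S d))))))"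
   by (intro sw_swap[OF S_closed[OF a] r M] cl Fr M; assumption)
  also have "... = sw M r (%y d'. sw M (S a) (%s t. sw M y (%b c. sw M d' (%d e. F ((s ** b) ** S e) ((t ** c) ** S d)))))"
   by (intro sw_cong[OF r] sw_cong[OF S_closed[OF a]] sw_cong) (simp_all add: Hr.m_assoc)
  also have "... = sw M r (%y d'. sw M (S a ** y) (%p q. sw M d' (%d e. F (p ** S e) (q ** S d))))"
   by (intro sw_cong[OF r] sw_mult[symmetric] S_closed a M lin Fr cl; assumption)
  finally show ?thesis .
 qed
 have "sw M (S h) F = sw M h (%a r. eps r *[M] sw M (S a) F)"
  by (rule sw_counit_r[OF h M, symmetric]) (intro lin F M)
 also have "... = sw M h (%a r. sw M r (%y d'. sw M (S a ** y) (%p q. sw M d' (%d e. F (p ** S e) (q ** S d)))))"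
  by (intro sw_cong[OF h]) (simp add: 1[symmetric] 2)
 also have "... = sw M h (%z d'. sw M z (%a y. sw M (S a ** y) (%p q. sw M d' (%d e. F (p ** S e) (q ** S d)))))"
  by (rule sw_coassoc[OF h M, symmetric]) (intro lin Fr cl M; assumption)
 also have "... = sw M h (%z d'. eps z *[M] sw M u (%p q. sw M d' (%d e. F (p ** S e) (q ** S d))))"
  by (intro sw_cong[OF h] antipode_l[where f = "%z. sw M z _"] lin Fr cl M; assumption)
 also have "... = sw M u (%p q. sw M h (%d e. F (p ** S e) (q ** S d)))"
  by (intro sw_counit_l[OF h M] lin Fr cl M; assumption)
 also have "... = sw M h (%d e. F (u ** S e) (u ** S d))"
  by (intro sw_one[OF M] lin Fr cl M h; assumption)
 also have "... = sw M h (%d e. F (S e) (S d))"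
  by (intro sw_cong[OF h]) simp
 finally show ?thesis .
qed

lemma S_bij: "bij_betw S (cH) (cH)"
 using H_hopf by (simp add: hopf_algebra_def)

lemma S_inv:
 assumes h: "h : cH"
 shows "antipode (hcop H) h : cH" "S (antipode (hcop H) h) = h"
 using h S_bij unfolding hcop_def
 by (auto simp: bij_betw_inv_into_right bij_betw_def inv_into_into)

lemma S_inj: "S x = S y ==> x : cH ==> y : cH ==> x = y"
 using S_bij by (auto simp: bij_betw_def inj_on_def)

text \<open>Each property of the inverse antipode is checked after applying \<open>S\<close>, which
  is injective, linear and reverses products; this turns the two antipode axioms of the co-opposite
  into those of \<open>H\<close>.\<close>

lemma hopf_cop: "hopf_algebra K (hcop H)"
proof -
 let ?S = "antipode (hcop H)"
 let ?HH = "ts H H"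
 have mHH: "kmod ?HH" by (intro cl)
 have ring: "ring (hcop H)" by (rule ring_same[OF _ _ _ _ _ Hr.ring_axioms]) simp_all
 have alg: "associative_algebra K (hcop H)"
  using modH mult_bilinear by (simp add: associative_algebra_def ring)
 have coalg: "coassociative_coalgebra K (hcop H)"
  using coalg_cop by (simp add: coalg_def coalg_axioms_def)
 have Slin: "lmap H H ?S"
 proof (rule linear_mapI)
  fix x y assume "x : cH" "y : cH"
  then show "?S (x \<oplus>\<^bsub>H\<^esub> y) = ?S x \<oplus>\<^bsub>H\<^esub> ?S y"
   by - (rule S_inj, simp_all add: S_inv linear_add[OF antipode_linear])
 next
  fix a x assume "a :< K" "x : cH"
  then show "?S (a *[H] x) = a *[H] ?S x"
   by - (rule S_inj, simp_all add: S_inv linear_smult[OF antipode_linear])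
 qed (simp add: S_inv)
 note Sl = linear_compose[OF _ Slin]
 have eps1: "csw H h (%a b. ?S a ** b) = eps h *[H] u" if h: "h : cH" for h
 proof (rule S_inj)
  have "csw H h (%a b. ?S a ** b) = sw H h (%a b. ?S b ** a)"
   by (rule sw_cop_raw[OF h modH]) (intro lin Sl cl S_inv; assumption)
  moreover have "S (sw H h (%a b. ?S b ** a)) = sw H h (%a b. S (?S b ** a))"
   by (rule sw_push[OF h modH modH _ antipode_linear]) (simp add: S_inv)
  moreover have "... = sw H h (%a b. S a ** b)"
   by (intro sw_cong[OF h]) (simp add: S_mult S_inv)
  ultimately show "S (csw H h (%a b. ?S a ** b)) = S (eps h *[H] u)"
   using antipode_l[OF h modH linear_id] h by (simp add: linear_smult[OF antipode_linear] S_one)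
  show "csw H h (%a b. ?S a ** b) : cH"
   using \<open>sweedler2 H (hcop H) h _ = _\<close> h by (simp add: sw_closed modH S_inv)
 qed (simp add: h)
 have eps2: "csw H h (%a b. a ** ?S b) = eps h *[H] u" if h: "h : cH" for h
 proof (rule S_inj)
  have "csw H h (%a b. a ** ?S b) = sw H h (%a b. b ** ?S a)"
   by (rule sw_cop_raw[OF h modH]) (intro lin Sl cl S_inv; assumption)
  moreover have "S (sw H h (%a b. b ** ?S a)) = sw H h (%a b. S (b ** ?S a))"
   by (rule sw_push[OF h modH modH _ antipode_linear]) (simp add: S_inv)
  moreover have "... = sw H h (%a b. a ** S b)"
   by (intro sw_cong[OF h]) (simp add: S_mult S_inv)
  ultimately show "S (csw H h (%a b. a ** ?S b)) = S (eps h *[H] u)"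
   using antipode_r[OF h modH linear_id] h by (simp add: linear_smult[OF antipode_linear] S_one)
  show "csw H h (%a b. a ** ?S b) : cH"
   using \<open>sweedler2 H (hcop H) h _ = _\<close> h by (simp add: sw_closed modH S_inv)
 qed (simp add: h)
 have mult: "flip (comult H (h ** g)) = csw ?HH h (%h1 h2.
    csw ?HH g (%g1 g2. tn H H (h1 ** g1) (h2 ** g2)))"
  if h: "h : cH" and g: "g : cH" for h g
 proof -
  have b: "bmap H H ?HH (%h1 h2. sw ?HH g (%g2 g1. tn H H (h1 ** g1) (h2 ** g2)))"
   by (intro lin cl g; assumption)
  have c: "csw ?HH g (%g1 g2. tn H H (h1 ** g1) (h2 ** g2)) =
    sw ?HH g (%g2 g1. tn H H (h1 ** g1) (h2 ** g2))" if "h1 : cH" "h2 : cH" for h1 h2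
   by (rule sw_cop_raw[OF g mHH]) (intro lin cl that; assumption)
  have "flip (comult H (h ** g)) = sw ?HH (h ** g) (%a b. tn H H b a)"
   using flip_linear(2)[OF modH modH comult_mem] h g by (simp add: sweedler2_def)
  also have "... = sw ?HH h (%h1 h2. sw ?HH g (%g1 g2. tn H H (h2 ** g2) (h1 ** g1)))"
   by (intro sw_mult h g mHH lin cl; assumption)
  also have "... = csw ?HH h (%h1 h2. sw ?HH g (%g2 g1. tn H H (h1 ** g1) (h2 ** g2)))"
   by (rule sw_cop_raw[OF h mHH b, symmetric])
  also have "... = csw ?HH h (%h1 h2.
    csw ?HH g (%g1 g2. tn H H (h1 ** g1) (h2 ** g2)))"
   using h c by (intro coalg.sw_cong[OF coalg_cop]) simp_all
  finally show ?thesis .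
 qed
 have bij: "bij_betw ?S (cH) (cH)"
  using bij_betw_inv_into[OF S_bij] by (subst bij_betw_cong[of _ _ "inv_into (cH) S"]) (simp_all add: hcop_def)
 have one: "comult H u = tn H H u u"
  using H_hopf by (simp add: hopf_algebra_def)
 show ?thesis
  unfolding hopf_algebra_def
  using alg coalg mult Slin eps1 eps2 bij by (simp add: one)
qed

lemma hopf_loc_cop: "hopf_loc K (hcop H)"
 using hopf_cop by (simp add: hopf_loc_def hopf_loc_axioms_def ground_axioms)

text \<open>An equality of records, so that facts instantiated at the co-opposite can be
  instantiated there once more and return to \<open>H\<close>.\<close>

lemma cop_cop_hopf: "hcop (hcop H) = H"
proof -
 have "inv_into (cH) (antipode (hcop H)) h = S h" if "h : cH" for h
 proof (rule inv_into_f_eq)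
  show "inj_on (antipode (hcop H)) (cH)"
   by (rule inj_onI) (metis S_inv(2))
  have "S (antipode (hcop H) (S h)) = S h" using that by (simp add: S_inv)
  then show "antipode (hcop H) (S h) = h" using that by - (rule S_inj, simp_all add: S_inv)
 qed (use that in simp)
 then show ?thesis
  unfolding hcop_def[of "hcop H"]
  by (intro hopf.equality) (auto simp: fun_eq_iff hcop_def)
qed

section \<open>Bicovariant bimodules elementwise\<close>

text \<open>Bicovariance as four colinearity statements, each action over \<open>H\<close> and over
  the co-opposite. Thus the notion is stable under co-opposites, and results on colinear bilinear
  maps apply to the actions directly.\<close>

definition bbi where
 "bbi V \<longleftrightarrow> hopf_bimodule K H V \<and> bic V \<and> colin K H HU V V (lact V) \<and> colin K H V HU V (ract V) \<and>
  colin K (hcop H) (unit_bimodule (hcop H)) (bcop V) (bcop V) (lact V) \<and>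
  colin K (hcop H) (bcop V) (unit_bimodule (hcop H)) (bcop V) (ract V)"

text \<open>The two conditions on the left coaction agree with \<open>colin\<close>, up to
  exchanging two sums for the right action. Those on the right coaction become conditions on the
  left coaction of \<open>bcop V\<close> by flipping both sides, and \<open>flip\<close> is
  injective.\<close>

lemma bbi_iff: "V : bicovariant_bimodules K H \<longleftrightarrow> bbi V"
proof (cases "hopf_bimodule K H V \<and> bic V")
 case False
 then show ?thesis using hopf_bicomodule_bic by (auto simp: bicovariant_bimodules_def bbi_def)
next
 case True
 then have b: "hopf_bimodule K H V" "bic V" by auto
 note hb = bic_hopf_bicomodule[OF b(2)]
 note mV = bic_module[OF b(2)] and cV = bic_coact[OF b(2)] and cW = bic_cop_coact[OF b(2)]
 have cW': "coalg.coact K (hcop H) (bcop V)"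
  using cW by (simp add: coact_def coalg.coact_def[OF coalg_cop])
 let ?HV = "ts H V" and ?VH = "ts V H"
 have la: "bmap H V V (lact V)" and ra: "bmap V H V (ract V)"
  using b by (simp_all add: hopf_bimodule_def)
 note Vr = linear_bil_l[OF la] linear_bil_r[OF la] linear_bil_l[OF ra] linear_bil_r[OF ra]
  bilinear_closed[OF la] bilinear_closed[OF ra]
 have mHV: "kmod ?HV" and mVH: "kmod ?VH" by (intro cl mV)+
 have rlin: "lmap V ?VH (rcoact V)"
  using rcoact_linear[OF mV] cW by (simp add: coact_def)
 note rmem = linear_closed[OF rlin]
 have a1: "(lcoact V (lact V h v) = sw ?HV h (%h1 h2. tlift ?HV (%g v'. tn H V (h1 ** g) (lact V h2 v')) (lcoact V v)))
   \<longleftrightarrow> (lcoact V (lact V h v) = lsw ?HV HU h (%a x'. lsw ?HV V v (%b y'. tn H V (a ** b) (lact V x' y'))))"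
  if "h : cH" for h v using that by (simp add: lsw_def sweedler2_def)
 have a2: "sw ?HV h (%h1 h2. tlift ?HV (%g v'. tn H V (g ** h1) (ract V v' h2)) (lcoact V v))
   = lsw ?HV V v (%a x'. lsw ?HV HU h (%b y'. tn H V (a ** b) (ract V x' y')))"
  if h: "h : cH" and v: "v :< V" for h v
 proof -
  have "lsw ?HV V v (%a x'. lsw ?HV HU h (%b y'. tn H V (a ** b) (ract V x' y')))
    = lsw ?HV V v (%a x'. sw ?HV h (%b y'. tn H V (a ** b) (ract V x' y')))" using h by simp
  also have "... = sw ?HV h (%b y'. lsw ?HV V v (%a x'. tn H V (a ** b) (ract V x' y')))"
   by (intro lsw_sw_swap cV v h mHV cl Vr mV; assumption)
  finally show ?thesis by (simp add: lsw_def)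
 qed
 have flip_r: "flip (tlift ?VH F (rcoact V v)) = lsw ?HV (bcop V) v (%h x. flip (F x h))"
  if v: "v :< V" and F: "bmap V H ?VH F" for v F
 proof -
  have "flip (tlift ?VH F (rcoact V v)) = tlift ?HV (%x h. flip (F x h)) (rcoact V v)"
   by (rule ts_push[OF mV modH rmem[OF v] mVH mHV bilinear_closed[OF F] flip_linear(1)[OF mV modH]])
  also have "... = lsw ?HV (bcop V) v (%h x. flip (F x h))"
   by (rule lsw_cop[OF cW v mHV, symmetric])
    (intro lin linear_compose[OF bilinear_l[OF F] flip_linear(1)] linear_compose[OF bilinear_r[OF F] flip_linear(1)] mV modH; assumption)
  finally show ?thesis .
 qed
 have flip_s: "flip (sw ?VH h F) = csw ?HV h (%b a. flip (F a b))"
  if h: "h : cH" and F: "bmap H H ?VH F" for h F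
 proof -
  have "flip (sw ?VH h F) = sw ?HV h (%a b. flip (F a b))"
   by (rule sw_push[OF h mVH mHV bilinear_closed[OF F] flip_linear(1)[OF mV modH]])
  also have "... = csw ?HV h (%b a. flip (F a b))"
   by (rule sw_cop_raw[OF h mHV, symmetric])
    (intro lin linear_compose[OF bilinear_l[OF F] flip_linear(1)] linear_compose[OF bilinear_r[OF F] flip_linear(1)] mV modH; assumption)
  finally show ?thesis .
 qed
 have lcoact_cop: "lcoact (bcop V) x = flip (rcoact V x)" if "x :< V" for x
  using that by (simp add: bcop_def)
 have flip_inj: "flip s = flip t \<longleftrightarrow> s = t" for s t :: "('x \<times> 'y) list set"
  by (metis flip_flip)
 have ltl: "lmap X ?VH (%y. tlift ?VH (F y) (rcoact V v))"
  if "v :< V" "!!x h. x :< V ==> h : cH ==> lmap X ?VH (%y. F y x h)" for X F v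
  by (rule ts_linear_fun[OF mV modH rmem[OF that(1)] mVH that(2)])
 have a3: "(rcoact V (lact V h v) = sw ?VH h (%h1 h2. tlift ?VH (%v' g. tn V H (lact V h1 v') (h2 ** g)) (rcoact V v)))
   \<longleftrightarrow> (lcoact (bcop V) (lact V h v) = lsw ?HV (unit_bimodule (hcop H)) h (%a x'. lsw ?HV (bcop V) v (%b y'. tn H V (a ** b) (lact V x' y'))))"
  if h: "h : cH" and v: "v :< V" for h v
 proof -
  have "flip (sw ?VH h (%h1 h2. tlift ?VH (%v' g. tn V H (lact V h1 v') (h2 ** g)) (rcoact V v)))
    = csw ?HV h (%h2 h1. flip (tlift ?VH (%v' g. tn V H (lact V h1 v') (h2 ** g)) (rcoact V v)))"
   by (rule flip_s[OF h]) (intro bilinear_mapI ltl lin Vr cl v mV; assumption)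
  also have "... = csw ?HV h (%h2 h1. lsw ?HV (bcop V) v (%g v'. tn H V (h2 ** g) (lact V h1 v')))"
  proof (rule coalg.sw_cong[OF coalg_cop])
   fix h2 h1 assume *: "h2 :< (hcop H)" "h1 :< (hcop H)"
   have "bmap V H ?VH (%v' g. tn V H (lact V h1 v') (h2 ** g))"
    using * unfolding hcop_simps by - (intro lin Vr cl mV; assumption)
   from flip_r[OF v this] show "flip (tlift ?VH (%v' g. tn V H (lact V h1 v') (h2 ** g)) (rcoact V v)) =
     lsw ?HV (bcop V) v (%g v'. tn H V (h2 ** g) (lact V h1 v'))" by simp
  qed (simp add: h)
  also note e = calculation
  show ?thesis
   unfolding lcoact_cop[OF bilinear_closed[OF la h v]] using h
   by (simp add: e[symmetric] flip_inj)
 qed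
 have a4: "(rcoact V (ract V v h) = sw ?VH h (%h1 h2. tlift ?VH (%v' g. tn V H (ract V v' h1) (g ** h2)) (rcoact V v)))
   \<longleftrightarrow> (lcoact (bcop V) (ract V v h) = lsw ?HV (bcop V) v (%a x'. lsw ?HV (unit_bimodule (hcop H)) h (%b y'. tn H V (a ** b) (ract V x' y'))))"
  if h: "h : cH" and v: "v :< V" for h v
 proof -
  have "flip (sw ?VH h (%h1 h2. tlift ?VH (%v' g. tn V H (ract V v' h1) (g ** h2)) (rcoact V v)))
    = csw ?HV h (%h2 h1. flip (tlift ?VH (%v' g. tn V H (ract V v' h1) (g ** h2)) (rcoact V v)))"
   by (rule flip_s[OF h]) (intro bilinear_mapI ltl lin Vr cl v mV; assumption)
  also have "... = csw ?HV h (%h2 h1. lsw ?HV (bcop V) v (%g v'. tn H V (g ** h2) (ract V v' h1)))"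
  proof (rule coalg.sw_cong[OF coalg_cop])
   fix h2 h1 assume *: "h2 :< (hcop H)" "h1 :< (hcop H)"
   have "bmap V H ?VH (%v' g. tn V H (ract V v' h1) (g ** h2))"
    using * unfolding hcop_simps by - (intro lin Vr cl mV; assumption)
   from flip_r[OF v this] show "flip (tlift ?VH (%v' g. tn V H (ract V v' h1) (g ** h2)) (rcoact V v)) =
     lsw ?HV (bcop V) v (%g v'. tn H V (g ** h2) (ract V v' h1))" by simp
  qed (simp add: h)
  also have "... = lsw ?HV (bcop V) v (%g v'. csw ?HV h (%h2 h1. tn H V (g ** h2) (ract V v' h1)))"
   using coalg.lsw_sw_swap[OF coalg_cop cW', of v h ?HV "%g v' h2 h1. tn H V (g ** h2) (ract V v' h1)"] h v
   by (simp add: mHV tensor_closed modH mV Vr)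
  also note e = calculation
  show ?thesis
   unfolding lcoact_cop[OF bilinear_closed[OF ra v h]] using h
   by (simp add: e[symmetric] flip_inj)
 qed
 show ?thesis
  using b hb a1 a2 a3 a4
  by (simp add: bicovariant_bimodules_def bbi_def colin_def Let_def) blast
qed

end

section \<open>Calculation rules for bicovariant bimodules\<close>

context hopf_loc
begin

lemma bb_bimodule: "bbi V ==> hopf_bimodule K H V"
 and bb_bic: "bbi V ==> bic V"
 by (simp_all add: bbi_def)

lemma bb_module: "bbi V ==> kmod V" by (rule bic_module[OF bb_bic])
lemma bb_coact: "bbi V ==> coact V" by (rule bic_coact[OF bb_bic])
lemma bb_cop_coact: "bbi V ==> coact (bcop V)" by (rule bic_cop_coact[OF bb_bic])
lemma bb_lact: "bbi V ==> bmap H V V (lact V)"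
 and bb_ract: "bbi V ==> bmap V H V (ract V)"
 by (auto dest: bb_bimodule simp: hopf_bimodule_def)

lemma lact_lin_l: "bbi V ==> lmap X H f ==> v :< V ==> lmap X V (%x. lact V (f x) v)"
 by (rule linear_bil_l[OF bb_lact])
lemma lact_lin_r: "bbi V ==> lmap X V f ==> h : cH ==> lmap X V (%x. lact V h (f x))"
 by (rule linear_bil_r[OF bb_lact])
lemma ract_lin_l: "bbi V ==> lmap X V f ==> h : cH ==> lmap X V (%x. ract V (f x) h)"
 by (rule linear_bil_l[OF bb_ract])
lemma ract_lin_r: "bbi V ==> lmap X H f ==> v :< V ==> lmap X V (%x. ract V v (f x))"
 by (rule linear_bil_r[OF bb_ract])
lemma lact_closed: "bbi V ==> h : cH ==> v :< V ==> lact V h v :< V"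
 by (rule bilinear_closed[OF bb_lact])
lemma ract_closed: "bbi V ==> h : cH ==> v :< V ==> ract V v h :< V"
 by (rule bilinear_closed[OF bb_ract])

lemmas bb_rules = bb_module bb_coact bb_cop_coact lact_lin_l lact_lin_r ract_lin_l ract_lin_r lact_closed ract_closed

lemma lact_one: "bbi V ==> v :< V ==> lact V u v = v"
 and ract_one: "bbi V ==> v :< V ==> ract V v u = v"
 and lact_mult: "bbi V ==> h : cH ==> g : cH ==> v :< V ==> lact V (h ** g) v = lact V h (lact V g v)"
 and ract_mult: "bbi V ==> h : cH ==> g : cH ==> v :< V ==> ract V v (h ** g) = ract V (ract V v h) g"
 and lact_ract: "bbi V ==> h : cH ==> g : cH ==> v :< V ==> ract V (lact V h v) g = lact V h (ract V v g)"
 by (auto dest!: bb_bimodule simp: hopf_bimodule_def)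

lemma lsw_lact:
 assumes V: "bbi V" and h: "h : cH" and v: "v :< V" and M: "kmod M" and F: "bmap H V M F"
 shows "lsw M V (lact V h v) F = sw M h (%a h'. lsw M V v (%b v'. F (a ** b) (lact V h' v')))"
 using colinD[OF _ coact_unit bb_coact[OF V] bb_coact[OF V] _ M F, of "lact V" h v] V h v bb_lact[OF V] by (simp add: bbi_def)

lemma lsw_ract:
 assumes V: "bbi V" and h: "h : cH" and v: "v :< V" and M: "kmod M" and F: "bmap H V M F"
 shows "lsw M V (ract V v h) F = lsw M V v (%a v'. sw M h (%b h'. F (a ** b) (ract V v' h')))"
proof -
 have "lsw M V (ract V v h) F = lsw M V v (%a v'. lsw M HU h (%b h'. F (a ** b) (ract V v' h')))"
  using colinD[OF _ bb_coact[OF V] coact_unit bb_coact[OF V] _ M F, of "ract V" v h] V h v bb_ract[OF V] by (simp add: bbi_def)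
 then show ?thesis using h by simp
qed

lemma bbi_cop:
 assumes V: "bbi V" shows "hopf_loc.bbi K (hcop H) (bcop V)"
proof -
 have ext: "lcoact V : extensional (carrier V)" "rcoact V : extensional (carrier V)"
  using bb_bic[OF V] by (simp_all add: bicomodule_def)
 show ?thesis
  using V bic_cop[OF bb_bic[OF V]]
  by (simp add: bbi_def hopf_loc.bbi_def[OF hopf_loc_cop] cop_cop_hopf bcop_cop[OF ext] hopf_bimodule_def)
qed

lemma cop_cop_bimod: "bbi V ==> bcop (bcop V) = V"
 by (drule bb_bic) (simp add: bicomodule_def bcop_cop)

lemma colin_cong:
 assumes "!!x y. x :< X ==> y :< Y ==> m x y = m' x y" "coact X" "coact Y"
 shows "colin K H X Y P m = colin K H X Y P m'"
proof -
 have "lsw M X x (%a x'. lsw M Y y (%b y'. tn H P (a ** b) (m x' y')))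
   = lsw M X x (%a x'. lsw M Y y (%b y'. tn H P (a ** b) (m' x' y')))"
  if "x :< X" "y :< Y" for M x y
  by (intro lsw_cong[OF assms(2) that(1)] lsw_cong[OF assms(3) that(2)]) (simp add: assms(1))
 note e = this
 show ?thesis unfolding colin_def
 proof (rule ball_cong[OF HOL.refl], rule ball_cong[OF HOL.refl])
  fix x y assume xy: "x :< X" "y :< Y"
  show "(lcoact P (m x y) = lsw (ts H P) X x (%a x'. lsw (ts H P) Y y (%b y'. tn H P (a ** b) (m x' y')))) =
    (lcoact P (m' x y) = lsw (ts H P) X x (%a x'. lsw (ts H P) Y y (%b y'. tn H P (a ** b) (m' x' y'))))"
   unfolding assms(1)[OF xy] e[OF xy] ..
 qed
qed

text \<open>Both coactions of \<open>H\<close> are the coproduct, so their compatibility is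
  coassociativity.\<close>

lemma bic_unit: "bic HU"
proof -
 have 1: "left_comodule K (hcop H) (bcop HU)"
  unfolding cop_unit by (rule coalg.lc_unit[OF coalg_cop])
 let ?T = "ts H (ts H H)"
 let ?ten = "%x y z. tn H (ts H H) x (tn H H y z)"
 have mT: "kmod ?T" by (intro cl)
 have "lsw ?T HU v (%h x. lsw ?T (bcop HU) x (%g y. ?ten h y g)) =
     lsw ?T (bcop HU) v (%g x. lsw ?T HU x (%h y. ?ten h y g))" if v: "v : cH" for v
 proof -
  have c: "lsw ?T (bcop HU) x F = sw ?T x (%a b. F b a)" if "x : cH" "bmap H H ?T F" for x F
   unfolding cop_unit using that by (simp add: sw_cop_raw mT)
   have "lsw ?T HU v (%h x. lsw ?T (bcop HU) x (%g y. ?ten h y g)) = sw ?T v (%h x. lsw ?T (bcop HU) x (%g y. ?ten h y g))"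
   using v by simp
  also have "... = sw ?T v (%h x. sw ?T x (%y g. ?ten h y g))"
   by (rule sw_cong[OF v], rule c, assumption) (intro lin cl; assumption)
  also have "... = sw ?T v (%x g. sw ?T x (%h y. ?ten h y g))"
   by (rule sw_coassoc[OF v mT, symmetric]) (intro lin cl; assumption)
  also have "... = lsw ?T (bcop HU) v (%g x. sw ?T x (%h y. ?ten h y g))"
   by (rule c[OF v, symmetric]) (intro lin cl; assumption)
  also have "... = lsw ?T (bcop HU) v (%g x. lsw ?T HU x (%h y. ?ten h y g))"
   using v by (intro lsw_cong[OF coact_lc_cop[OF 1]]) simp_all
  finally show ?thesis .
 qed
 then show ?thesis
  using lc_unit 1 by (simp add: bicomodule_def Let_def)
qed

lemma bilinear_cong:
 assumes "!!x y. x :< X ==> y :< Y ==> m x y = m' x y" "kmod X" "kmod Y"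
 shows "bmap X Y M m = bmap X Y M m'"
proof -
 have "lmap Y M (m x) = lmap Y M (m' x)" if "x :< X" for x
  by (rule linear_cong[OF _ assms(3)]) (rule assms(1)[OF that])
 moreover have "lmap X M (%x. m x y) = lmap X M (%x. m' x y)" if "y :< Y" for y
  by (rule linear_cong[OF _ assms(2)]) (rule assms(1)[OF _ that])
 ultimately show ?thesis unfolding bilinear_map_def by blast
qed

lemma bbi_unit: "bbi HU"
proof -
 have "bmap H H H (\<lambda>h\<in>cH. \<lambda>x\<in>cH. h ** x)" "bmap H H H (\<lambda>x\<in>cH. \<lambda>h\<in>cH. x ** h)"
  using bilinear_cong[of H H "\<lambda>h\<in>cH. \<lambda>x\<in>cH. h ** x" "mult H" H] mult_bilinear modH by simp_all
 then have "hopf_bimodule K H HU"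
  using modH by (auto simp: hopf_bimodule_def Hr.m_assoc)
 moreover have "colin K H HU HU HU (lact HU)" "colin K H HU HU HU (ract HU)"
  by (rule colin_cong[THEN iffD1, OF _ coact_unit coact_unit colin_mult], simp)+
 moreover have "colin K (hcop H) (unit_bimodule (hcop H)) (bcop HU) (bcop HU) (lact HU)"
  "colin K (hcop H) (bcop HU) (unit_bimodule (hcop H)) (bcop HU) (ract HU)"
  unfolding cop_unit
  by (rule hopf_loc.colin_cong[THEN iffD1, OF hopf_loc_cop _ coalg.coact_unit[OF coalg_cop]
    coalg.coact_unit[OF coalg_cop] hopf_loc.colin_mult[OF hopf_loc_cop]], simp)+
 ultimately show ?thesis using bic_unit by (simp add: bbi_def)
qed

section \<open>The tensor product over H\<close>

abbreviation htb (infixr "><" 75) where "V >< W \<equiv> htensor_bimodule K H V W"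

lemma ht_simps:
 "carrier (V >< W) = carrier (tensor_module V W (action_balance H V W))"
 "same_module (V >< W) (tensor_module V W (action_balance H V W))"
 by (simp_all add: htensor_bimodule_def Let_def same_module_def)

lemma ht_good: "bbi V ==> bbi W ==> good_balance V W (action_balance H V W)"
 unfolding good_balance_def action_balance_def
 by clarsimp (metis linear_smult[OF bilinear_l[OF bb_ract]] module.smult_closed[OF bb_module])

lemma ht_module: "bbi V ==> bbi W ==> kmod (V >< W)"
 by (rule module_same[OF _ module_tensor_module[OF bb_module bb_module ht_good]])
  (simp_all add: htensor_bimodule_def Let_def same_module_def)

lemma ht_balance:
 assumes "bbi V" "bbi W" "v :< V" "h : cH" "w :< W"
 shows "ht V W (ract V v h) w = ht V W v (lact W h w)"
 unfolding htensor_def using assms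
 by (intro tensor_class_eq tensor_eq.balanced) (auto simp: action_balance_def ract_closed lact_closed)

lemma ht_bilinear: "bbi V ==> bbi W ==> bmap V W (V >< W) (ht V W)"
proof -
 assume V: "bbi V" and W: "bbi W"
 interpret V: module K V by (rule bb_module[OF V])
 interpret W: module K W by (rule bb_module[OF W])
 have "tensor_class V W (action_balance H V W) [(v, a *[W] w)] = tensor_class V W (action_balance H V W) [(a *[V] v, w)]"
  if "a :< K" "v :< V" "w :< W" for a v w
 proof -
  have "lact W (a *[H] u) w = a *[W] w" "ract V v (a *[H] u) = a *[V] v"
   using that V W by (simp_all add: linear_smult[OF bilinear_l[OF bb_lact]] linear_smult[OF bilinear_r[OF bb_ract]] lact_one ract_one)
  then show ?thesis using ht_balance[OF V W that(2) _ that(3), of "a *[H] u"] that by (simp add: htensor_def)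
 qed
 from bilinear_tensor_class[OF bb_module[OF V] bb_module[OF W] ht_good[OF V W] this]
 show ?thesis
  by (subst bilinear_map_same[OF same_module_refl same_module_refl ht_simps(2)]) (simp add: htensor_def[abs_def])
qed

lemma ht_closed: "bbi V ==> bbi W ==> v :< V ==> w :< W ==> ht V W v w :< (V >< W)"
 by (rule bilinear_closed[OF ht_bilinear])

lemma ht_lin_l: "bbi V ==> bbi W ==> lmap X V f ==> w :< W ==> lmap X (V >< W) (%x. ht V W (f x) w)"
 by (rule linear_bil_l[OF ht_bilinear])
lemma ht_lin_r: "bbi V ==> bbi W ==> lmap X W f ==> v :< V ==> lmap X (V >< W) (%x. ht V W v (f x))"
 by (rule linear_bil_r[OF ht_bilinear])

lemmas ht_rules = ht_module ht_closed ht_lin_l ht_lin_r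

definition hbal where
 "hbal V W M F \<longleftrightarrow> bmap V W M F \<and>
  (\<forall>v\<in>carrier V. \<forall>h\<in>cH. \<forall>w\<in>carrier W. F (ract V v h) w = F v (lact W h w))"

lemma hbalI:
 "bmap V W M F ==>
  (!!v h w. v :< V ==> h : cH ==> w :< W ==> F (ract V v h) w = F v (lact W h w)) ==> hbal V W M F"
 by (simp add: hbal_def)

lemma hbal_balanced: "hbal V W M F ==> balanced_map V W (action_balance H V W) F"
 by (auto simp: hbal_def balanced_map_def action_balance_def)

lemma ht_lift:
 assumes V: "bbi V" and W: "bbi W" and M: "kmod M" and F: "hbal V W M F"
 shows "lmap (V >< W) M (tlift M F)"
  and "v :< V ==> w :< W ==> tlift M F (ht V W v w) = F v w"
proof -
 note a = bb_module[OF V] bb_module[OF W]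
 have b: "bmap V W M F" using F by (simp add: hbal_def)
 show "lmap (V >< W) M (tlift M F)"
  using linear_tensor_lift[OF a ht_good[OF V W] M b hbal_balanced[OF F]]
  by (simp add: linear_map_same[OF ht_simps(2) same_module_refl])
 show "v :< V ==> w :< W ==> tlift M F (ht V W v w) = F v w"
  unfolding htensor_def by (rule tensor_lift_gen[OF a M b hbal_balanced[OF F]])
qed

lemma ht_ext:
 assumes V: "bbi V" and W: "bbi W" and M: "kmod M"
  and f: "lmap (V >< W) M f" and g: "lmap (V >< W) M g"
  and eq: "!!v w. v :< V ==> w :< W ==> f (ht V W v w) = g (ht V W v w)"
  and t: "t :< (V >< W)"
 shows "f t = g t"
 using tensor_module_ext[OF bb_module[OF V] bb_module[OF W] ht_good[OF V W] M, of f g t]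
  f g eq t by (simp add: linear_map_same[OF ht_simps(2) same_module_refl] ht_simps(1) htensor_def)

lemma ht_lift_fun:
 assumes "bbi V" "bbi W" "t :< (V >< W)" "kmod M"
  "!!v w. v :< V ==> w :< W ==> lmap X M (%x. F x v w)"
 shows "lmap X M (%x. tlift M (F x) t)"
 using assms by (intro tm_linear_fun[OF bb_module bb_module]) (simp_all add: ht_simps)

lemma restrict_linear: "lmap V W f ==> kmod V ==> lmap V W (\<lambda>x\<in>carrier V. f x)"
 by (subst linear_cong[of V _ f]) simp_all

context
 fixes V :: "('k, 'h, 'v) bimodule" and W :: "('k, 'h, 'w) bimodule"
 assumes V: "bbi V" and W: "bbi W"
begin

private abbreviation "T \<equiv> V >< W"
private abbreviation "B \<equiv> ht V W"

private lemmas Vr = bb_rules[OF V] and Wr = bb_rules[OF W] and Tr = ht_rules[OF V W]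

private lemma T_same: "tlift (tensor_module V W (action_balance H V W)) = tlift T"
 "ts H (tensor_module V W (action_balance H V W)) = ts H T"
 "ts (tensor_module V W (action_balance H V W)) H = ts T H"
 "tn H (tensor_module V W (action_balance H V W)) = tn H T"
 "tn (tensor_module V W (action_balance H V W)) H = tn T H"
 using ht_simps(2)[of V W]
 by (auto intro!: tensor_lift_same tensor_space_same tensor_same simp: same_module_def)

lemma ht_lact_def: "lact T = (\<lambda>h\<in>cH. \<lambda>t\<in>carrier T. tlift T (%v w. B (lact V h v) w) t)"
 and ht_ract_def: "ract T = (\<lambda>t\<in>carrier T. \<lambda>h\<in>cH. tlift T (%v w. B v (ract W w h)) t)"
 and ht_lcoact_def: "lcoact T = (\<lambda>t\<in>carrier T. tlift (ts H T) (%v w.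
   lsw (ts H T) V v (%a v'. lsw (ts H T) W w (%b w'. tn H T (a ** b) (B v' w')))) t)"
 and ht_rcoact_def: "rcoact T = (\<lambda>t\<in>carrier T. tlift (ts T H) (%v w.
   tlift (ts T H) (%v1 v2. tlift (ts T H) (%w1 w2.
    tn T H (B v1 w1) (v2 ** w2)) (rcoact W w)) (rcoact V v)) t)"
 unfolding T_same[symmetric] ht_simps(1) lsw_def
 by (simp_all add: htensor_bimodule_def Let_def)

private lemma lact_bal: "h : cH ==> hbal V W T (%v w. B (lact V h v) w)"
 by (intro hbalI lin Vr Wr Tr) (simp_all add: lact_ract[OF V, symmetric] ht_balance[OF V W] Vr)

private lemma ract_bal: "h : cH ==> hbal V W T (%v w. B v (ract W w h))"
 by (intro hbalI lin Vr Wr Tr) (simp_all add: lact_ract[OF W] ht_balance[OF V W] Wr)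

lemma ht_lact: "h : cH ==> v :< V ==> w :< W ==> lact T h (B v w) = B (lact V h v) w"
 using ht_lift(2)[OF V W Tr(1) lact_bal] by (simp add: ht_lact_def Tr)

lemma ht_ract: "h : cH ==> v :< V ==> w :< W ==> ract T (B v w) h = B v (ract W w h)"
 using ht_lift(2)[OF V W Tr(1) ract_bal] by (simp add: ht_ract_def Tr)

lemma ht_lact_bilinear: "bmap H T T (lact T)"
proof (rule bilinear_mapI)
 fix h assume "h : cH"
 then show "lmap T T (lact T h)"
  using ht_lift(1)[OF V W Tr(1) lact_bal] by (simp add: ht_lact_def restrict_linear Tr)
next
 fix t assume t: "t :< T"
 have "lmap H T (%h. tlift T (%v w. B (lact V h v) w) t)"
  by (intro ht_lift_fun[OF V W t Tr(1)] lin Vr Tr; assumption)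
 then show "lmap H T (%h. lact T h t)"
  by (subst linear_cong[OF _ modH, of _ "%h. tlift T (%v w. B (lact V h v) w) t"])
   (simp_all add: ht_lact_def t)
qed

lemma ht_ract_bilinear: "bmap T H T (ract T)"
proof (rule bilinear_mapI)
 fix h assume h: "h : cH"
 then show "lmap T T (%t. ract T t h)"
  using ht_lift(1)[OF V W Tr(1) ract_bal[OF h]]
  by (subst linear_cong[OF _ Tr(1), of _ "tlift T (%v w. B v (ract W w h))"]) (simp_all add: ht_ract_def)
next
 fix t assume t: "t :< T"
 have "lmap H T (%h. tlift T (%v w. B v (ract W w h)) t)"
  by (intro ht_lift_fun[OF V W t Tr(1)] lin Wr Tr; assumption)
 then show "lmap H T (ract T t)"
  by (subst linear_cong[OF _ modH, of _ "%h. tlift T (%v w. B v (ract W w h)) t"])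
   (simp_all add: ht_ract_def t)
qed

private lemmas Tr2 = Tr linear_bil_l[OF ht_lact_bilinear] linear_bil_r[OF ht_lact_bilinear]
 linear_bil_l[OF ht_ract_bilinear] linear_bil_r[OF ht_ract_bilinear]
 bilinear_closed[OF ht_lact_bilinear] bilinear_closed[OF ht_ract_bilinear]

lemma ht_hopf_bimodule: "hopf_bimodule K H T"
proof -
 have c: "lact T h t :< T" "ract T t h :< T" if "h : cH" "t :< T" for h t
  using that by (simp_all add: Tr2)
 have 1: "lact T u t = t" if "t :< T" for t
  by (rule ht_ext[OF V W Tr(1) _ linear_id _ that]) (intro lin Tr2 cl, simp add: ht_lact lact_one V)
 have 2: "ract T t u = t" if "t :< T" for t
  by (rule ht_ext[OF V W Tr(1) _ linear_id _ that]) (intro lin Tr2 cl, simp add: ht_ract ract_one W)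
 have 3: "lact T (h ** g) t = lact T h (lact T g t)" if "h : cH" "g : cH" "t :< T" for h g t
  using that by (intro ht_ext[OF V W Tr(1) _ _ _ that(3), of "%t. lact T (h ** g) t" "%t. lact T h (lact T g t)"] lin Tr2 cl)
   (simp_all add: ht_lact lact_mult V Vr linear_id)
 have 4: "ract T t (h ** g) = ract T (ract T t h) g" if "h : cH" "g : cH" "t :< T" for h g t
  using that by (intro ht_ext[OF V W Tr(1) _ _ _ that(3), of "%t. ract T t (h ** g)" "%t. ract T (ract T t h) g"] lin Tr2 cl)
   (simp_all add: ht_ract ract_mult W Wr linear_id)
 have 5: "ract T (lact T h t) g = lact T h (ract T t g)" if "h : cH" "g : cH" "t :< T" for h g t
  using that by (intro ht_ext[OF V W Tr(1) _ _ _ that(3), of "%t. ract T (lact T h t) g" "%t. lact T h (ract T t g)"] lin Tr2 cl)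
   (simp_all add: ht_ract ht_lact Vr Wr linear_id)
 have e: "lact T : extensional (cH)" "!!h. h : cH ==> lact T h : extensional (carrier T)"
  "ract T : extensional (carrier T)" "!!t. t :< T ==> ract T t : extensional (cH)"
  by (simp_all add: ht_lact_def ht_ract_def)
 show ?thesis
  unfolding hopf_bimodule_def
  using 1 2 3 4 5 c e Tr(1) ht_lact_bilinear ht_ract_bilinear by (auto simp: PiE_def)
qed

private abbreviation "HT \<equiv> ts H T"

private lemma mHT: "kmod HT" by (intro cl Tr)

text \<open>The codiagonal coaction is well defined: for \<open>vh\<close> and for \<open>hw\<close>
  alike, \<open>h_1\<close> lands between the two factors from \<open>H\<close>, while
  \<open>h_2\<close> crosses the tensor sign by balance.\<close>

private lemma lcoact_bal: "hbal V W HT (%v w. lsw HT V v (%a v'. lsw HT W w (%b w'. tn H T (a ** b) (B v' w'))))"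
proof (rule hbalI)
 show "bmap V W HT (%v w. lsw HT V v (%a v'. lsw HT W w (%b w'. tn H T (a ** b) (B v' w'))))"
  by (intro lin cl Vr Wr Tr; assumption)
 fix v h w assume v: "v :< V" and h: "h : cH" and w: "w :< W"
 have "lsw HT V (ract V v h) (%a v'. lsw HT W w (%b w'. tn H T (a ** b) (B v' w')))
  = lsw HT V v (%a v'. sw HT h (%c h'. lsw HT W w (%b w'. tn H T ((a ** c) ** b) (B (ract V v' h') w'))))"
  by (rule lsw_ract[OF V h v mHT]) (intro lin cl Vr Wr Tr w; assumption)
 also have "... = lsw HT V v (%a v'. sw HT h (%c h'. lsw HT W w (%b w'. tn H T (a ** (c ** b)) (B v' (lact W h' w')))))"
  by (intro lsw_cong[OF Vr(2) v] sw_cong[OF h] lsw_cong[OF Wr(2) w]) (simp add: Hr.m_assoc ht_balance[OF V W])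
 also have "... = lsw HT V v (%a v'. lsw HT W (lact W h w) (%b w'. tn H T (a ** b) (B v' w')))"
  by (rule lsw_cong[OF Vr(2) v], rule lsw_lact[OF W h w mHT, symmetric]) (intro lin cl Wr Tr; assumption)
 finally show "lsw HT V (ract V v h) (%a v'. lsw HT W w (%b w'. tn H T (a ** b) (B v' w')))
  = lsw HT V v (%a v'. lsw HT W (lact W h w) (%b w'. tn H T (a ** b) (B v' w')))" .
qed

lemma ht_coact: "coact T"
 using ht_lift(1)[OF V W mHT lcoact_bal] by (simp add: coact_def Tr ht_lcoact_def restrict_linear)

lemma ht_colin: "colin K H V W T B"
 using ht_lift(2)[OF V W mHT lcoact_bal] by (simp add: colin_def ht_lcoact_def Tr)

lemma lsw_ht:
 "v :< V ==> w :< W ==> kmod M ==> bmap H T M F ==>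
  lsw M T (B v w) F = lsw M V v (%a v'. lsw M W w (%b w'. F (a ** b) (B v' w')))"
 by (rule colinD[OF ht_colin Vr(2) Wr(2) ht_coact ht_bilinear[OF V W]])

text \<open>Both axioms are linear in \<open>t\<close>, so pure tensors suffice. Multiplicativity of
  the coproduct and of the counit separates the contributions of \<open>v\<close> and
  \<open>w\<close>, and the axioms of \<open>V\<close> and \<open>W\<close> apply one after the
  other.\<close>

lemma ht_lc: "lc T"
 unfolding left_comodule_def
proof (intro conjI ballI)
 show "kmod T" by (rule Tr)
 show "lmap T HT (lcoact T)" using ht_coact by (simp add: coact_def)
 fix t assume t: "t :< T"
 interpret T: module K T by (rule Tr)
 show "lsw T T t (%h v'. eps h *[T] v') = t"
 proof (rule ht_ext[OF V W Tr(1) _ linear_id _ t])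
  show "lmap T T (%t. lsw T T t (%h v'. eps h *[T] v'))" by (intro lin cl Tr ht_coact; assumption)
  fix v w assume v: "v :< V" and w: "w :< W"
  have "lsw T T (B v w) (%h v'. eps h *[T] v') = lsw T V v (%a v'. lsw T W w (%b w'. eps (a ** b) *[T] B v' w'))"
   by (rule lsw_ht[OF v w Tr(1)]) (intro lin cl Tr; assumption)
  also have "... = lsw T V v (%a v'. lsw T W w (%b w'. eps b *[T] (eps a *[T] B v' w')))"
   by (intro lsw_cong[OF Vr(2) v] lsw_cong[OF Wr(2) w]) (simp add: T.smult_assoc1[symmetric] Tr K.m_comm)
  also have "... = lsw T V v (%a v'. eps a *[T] B v' w)"
   by (rule lsw_cong[OF Vr(2) v], rule lsw_counit[OF bic_lc[OF bb_bic[OF W]] w Tr(1)]) (intro lin cl Tr; assumption)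
  also have "... = B v w"
   by (rule lsw_counit[OF bic_lc[OF bb_bic[OF V]] v Tr(1)]) (intro lin cl Tr w; assumption)
  finally show "lsw T T (B v w) (%h v'. eps h *[T] v') = B v w" .
 qed
 let ?M = "ts H HT"
 let ?ten = "%x y z. tn H HT x (tn H T y z)"
 have mM: "kmod ?M" by (intro cl Tr)
 have "lsw ?M T t (%h v'. sw ?M h (%h1 h2. ?ten h1 h2 v')) = lsw ?M T t (%h v'. lsw ?M T v' (%g v''. ?ten h g v''))"
 proof (rule ht_ext[OF V W mM _ _ _ t, of "%t. lsw ?M T t (%h v'. sw ?M h (%h1 h2. ?ten h1 h2 v'))" "%t. lsw ?M T t (%h v'. lsw ?M T v' (%g v''. ?ten h g v''))"])
  show "lmap T ?M (%t. lsw ?M T t (%h v'. sw ?M h (%h1 h2. ?ten h1 h2 v')))" by (intro lin cl Tr ht_coact; assumption)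
  show "lmap T ?M (%t. lsw ?M T t (%h v'. lsw ?M T v' (%g v''. ?ten h g v'')))" by (intro lin cl Tr ht_coact; assumption)
  fix v w assume v: "v :< V" and w: "w :< W"
  have "lsw ?M T (B v w) (%h v'. sw ?M h (%h1 h2. ?ten h1 h2 v'))
    = lsw ?M V v (%a v'. lsw ?M W w (%b w'. sw ?M (a ** b) (%h1 h2. ?ten h1 h2 (B v' w'))))"
   by (rule lsw_ht[OF v w mM]) (intro lin cl Tr; assumption)
  also have "... = lsw ?M V v (%a v'. lsw ?M W w (%b w'. sw ?M a (%a1 a2. sw ?M b (%b1 b2. ?ten (a1 ** b1) (a2 ** b2) (B v' w')))))"
   by (rule lsw_cong[OF Vr(2) v], rule lsw_cong[OF Wr(2) w], rule sw_mult, assumption, assumption, rule mM)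
    (intro lin cl Tr; assumption)
  also have "... = lsw ?M V v (%a v'. sw ?M a (%a1 a2. lsw ?M W w (%b w'. sw ?M b (%b1 b2. ?ten (a1 ** b1) (a2 ** b2) (B v' w')))))"
   by (rule lsw_cong[OF Vr(2) v], rule lsw_sw_swap[OF Wr(2) w _ mM], assumption) (intro cl Tr; assumption)
  also have "... = lsw ?M V v (%a v'. lsw ?M V v' (%a2 v''. lsw ?M W w (%b w'. sw ?M b (%b1 b2. ?ten (a ** b1) (a2 ** b2) (B v'' w')))))"
   by (rule lsw_coassoc[OF bic_lc[OF bb_bic[OF V]] v mM]) (intro lin cl Tr Wr w; assumption)
  also have "... = lsw ?M V v (%a v'. lsw ?M V v' (%a2 v''. lsw ?M W w (%b w'. lsw ?M W w' (%b2 w''. ?ten (a ** b) (a2 ** b2) (B v'' w'')))))"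
   by (rule lsw_cong[OF Vr(2) v], rule lsw_cong[OF Vr(2)], assumption, rule lsw_coassoc[OF bic_lc[OF bb_bic[OF W]] w mM]) (intro lin cl Tr Wr w; assumption)
  also have "... = lsw ?M V v (%a v'. lsw ?M W w (%b w'. lsw ?M V v' (%a2 v''. lsw ?M W w' (%b2 w''. ?ten (a ** b) (a2 ** b2) (B v'' w'')))))"
   by (rule lsw_cong[OF Vr(2) v], rule lsw_swap[OF Vr(2) _ Wr(2) w mM], assumption) (intro cl Tr Wr; assumption)
  also have "... = lsw ?M V v (%a v'. lsw ?M W w (%b w'. lsw ?M T (B v' w') (%g t''. ?ten (a ** b) g t'')))"
   by (rule lsw_cong[OF Vr(2) v], rule lsw_cong[OF Wr(2) w], rule lsw_ht[symmetric], assumption, assumption, rule mM)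
    (intro lin cl Tr; assumption)
  also have "... = lsw ?M T (B v w) (%h v'. lsw ?M T v' (%g v''. ?ten h g v''))"
   by (rule lsw_ht[OF v w mM, symmetric]) (intro lin cl Tr ht_coact; assumption)
  finally show "lsw ?M T (B v w) (%h v'. sw ?M h (%h1 h2. ?ten h1 h2 v')) = lsw ?M T (B v w) (%h v'. lsw ?M T v' (%g v''. ?ten h g v''))" .
 qed
 then show "let HHV = ts H (ts H T);
      ten = (%x y z. tn H (ts H T) x (tn H T y z))
    in lsw HHV T t (%h v'. sw HHV h (%h1 h2. ten h1 h2 v'))
    = lsw HHV T t (%h v'. lsw HHV T v' (%g v''. ten h g v''))" by (simp add: Let_def)
qed

section \<open>Bicovariance of the tensor product over \<open>H\<close>\<close>

lemma ht_colin_lact: "colin K H HU T T (lact T)"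
 unfolding colin_def
proof (intro ballI)
 fix h t assume h': "h :< HU" and t: "t :< T"
 then have h: "h : cH" by simp
 have "lcoact T (lact T h t) = sw HT h (%a h'. lsw HT T t (%b t'. tn H T (a ** b) (lact T h' t')))"
 proof (rule ht_ext[OF V W mHT _ _ _ t, of "%t. lcoact T (lact T h t)" "%t. sw HT h (%a h'. lsw HT T t (%b t'. tn H T (a ** b) (lact T h' t')))"])
  show "lmap T HT (%t. lcoact T (lact T h t))"
   by (rule linear_compose[OF bilinear_r[OF ht_lact_bilinear h] ht_coact[unfolded coact_def, THEN conjunct2]])
  show "lmap T HT (%t. sw HT h (%a h'. lsw HT T t (%b t'. tn H T (a ** b) (lact T h' t'))))"
   by (intro lin cl Tr2 ht_coact h; assumption)
  fix v w assume v: "v :< V" and w: "w :< W"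
  have "lcoact T (lact T h (B v w)) = lsw HT V (lact V h v) (%a v'. lsw HT W w (%b w'. tn H T (a ** b) (B v' w')))"
   using ht_colin h v w by (simp add: ht_lact colin_def Vr)
  also have "... = sw HT h (%c h'. lsw HT V v (%a v'. lsw HT W w (%b w'. tn H T ((c ** a) ** b) (B (lact V h' v') w'))))"
   by (rule lsw_lact[OF V h v mHT]) (intro lin cl Wr Tr w; assumption)
  also have "... = sw HT h (%c h'. lsw HT V v (%a v'. lsw HT W w (%b w'. tn H T (c ** (a ** b)) (lact T h' (B v' w')))))"
   by (intro sw_cong[OF h] lsw_cong[OF Vr(2) v] lsw_cong[OF Wr(2) w]) (simp add: Hr.m_assoc ht_lact)
  also have "... = sw HT h (%a h'. lsw HT T (B v w) (%b t'. tn H T (a ** b) (lact T h' t')))"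
   by (rule sw_cong[OF h], rule lsw_ht[OF v w mHT, symmetric]) (intro lin cl Tr2; assumption)
  finally show "lcoact T (lact T h (B v w)) = sw HT h (%a h'. lsw HT T (B v w) (%b t'. tn H T (a ** b) (lact T h' t')))" .
 qed
 then show "lcoact T (lact T h t) = lsw HT HU h (%a h'. lsw HT T t (%b t'. tn H T (a ** b) (lact T h' t')))"
  using h by simp
qed

lemma ht_colin_ract: "colin K H T HU T (ract T)"
 unfolding colin_def
proof (intro ballI)
 fix h t assume h': "h :< HU" and t: "t :< T"
 then have h: "h : cH" by simp
 have "lcoact T (ract T t h) = lsw HT T t (%a t'. sw HT h (%b h'. tn H T (a ** b) (ract T t' h')))"
 proof (rule ht_ext[OF V W mHT _ _ _ t, of "%t. lcoact T (ract T t h)" "%t. lsw HT T t (%a t'. sw HT h (%b h'. tn H T (a ** b) (ract T t' h')))"])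
  show "lmap T HT (%t. lcoact T (ract T t h))"
   by (rule linear_compose[OF bilinear_l[OF ht_ract_bilinear h] ht_coact[unfolded coact_def, THEN conjunct2]])
  show "lmap T HT (%t. lsw HT T t (%a t'. sw HT h (%b h'. tn H T (a ** b) (ract T t' h'))))"
   by (intro lin cl Tr2 ht_coact h; assumption)
  fix v w assume v: "v :< V" and w: "w :< W"
  have "lcoact T (ract T (B v w) h) = lsw HT V v (%a v'. lsw HT W (ract W w h) (%b w'. tn H T (a ** b) (B v' w')))"
   using ht_colin h v w by (simp add: ht_ract colin_def Wr)
  also have "... = lsw HT V v (%a v'. lsw HT W w (%b w'. sw HT h (%c h'. tn H T (a ** (b ** c)) (B v' (ract W w' h')))))"
   by (rule lsw_cong[OF Vr(2) v], rule lsw_ract[OF W h w mHT]) (intro lin cl Wr Tr w; assumption)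
  also have "... = lsw HT V v (%a v'. lsw HT W w (%b w'. sw HT h (%c h'. tn H T ((a ** b) ** c) (ract T (B v' w') h'))))"
   by (intro sw_cong[OF h] lsw_cong[OF Vr(2) v] lsw_cong[OF Wr(2) w]) (simp add: Hr.m_assoc ht_ract)
  also have "... = lsw HT T (B v w) (%a t'. sw HT h (%b h'. tn H T (a ** b) (ract T t' h')))"
   by (rule lsw_ht[OF v w mHT, symmetric]) (intro lin cl Tr2 h; assumption)
  finally show "lcoact T (ract T (B v w) h) = lsw HT T (B v w) (%a t'. sw HT h (%b h'. tn H T (a ** b) (ract T t' h')))" .
 qed
 also have "... = lsw HT T t (%a t'. lsw HT HU h (%b h'. tn H T (a ** b) (ract T t' h')))"
  using h by simp
 finally show "lcoact T (ract T t h) = lsw HT T t (%a t'. lsw HT HU h (%b h'. tn H T (a ** b) (ract T t' h')))" .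
qed

private abbreviation "cT \<equiv> htensor_bimodule K (hcop H) (bcop V) (bcop W)"

lemma ht_cop_same: "same_module cT T" "htensor (hcop H) (bcop V) (bcop W) = B"
proof -
 have a: "action_balance (hcop H) (bcop V) (bcop W) = action_balance H V W"
  by (simp add: action_balance_def)
 show "same_module cT T"
  using tensor_module_same[OF same_cop(2) same_cop(2), of V W]
  by (simp add: htensor_bimodule_def Let_def same_module_def a)
 show "htensor (hcop H) (bcop V) (bcop W) = B"
  using tensor_class_same[OF same_cop(2) same_cop(2), of V W] by (simp add: htensor_def fun_eq_iff a)
qed

private lemma cT_simps: "ts H cT = HT" "tn H cT = tn H T"
 "tlift cT = tlift T" "carrier cT = carrier T"
 using ht_cop_same(1) by (auto intro!: tensor_space_same tensor_same tensor_lift_same simp: same_module_def)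

text \<open>The flip passes through the three nested sums by linearity. The result is the left
  coaction of the tensor product formed over the co-opposite.\<close>

lemma flip_ht_rcoact:
 assumes t: "t :< T"
 shows "flip (rcoact T t) = lcoact cT t"
proof -
 let ?TH = "ts T H"
 have mTH: "kmod ?TH" by (intro cl Tr)
 have fl: "lmap ?TH HT flip" by (rule flip_linear(1)[OF Tr(1) modH])
 have rV: "v :< V ==> rcoact V v :< (ts V H)" for v
  using Vr(3) rcoact_linear[OF Vr(1)] linear_closed by (auto simp: coact_def)
 have rW: "w :< W ==> rcoact W w :< (ts W H)" for w
  using Wr(3) rcoact_linear[OF Wr(1)] linear_closed by (auto simp: coact_def)
 define R where "R v w = tlift ?TH (%v1 v2. tlift ?TH (%w1 w2. tn T H (B v1 w1) (v2 ** w2)) (rcoact W w)) (rcoact V v)" for v w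
 have Rin: "tlift ?TH (%w1 w2. tn T H (B v1 w1) (v2 ** w2)) (rcoact W w) :< ?TH"
  if "v1 :< V" "v2 : cH" "w :< W" for v1 v2 w
  using that by (intro ts_closed[OF Wr(1) modH rW _] mTH cl Tr modH)
 have Rc: "R v w :< ?TH" if "v :< V" "w :< W" for v w
  unfolding R_def using that by (intro ts_closed[OF Vr(1) modH rV _] mTH Rin)
 have tm: "t :< (tensor_module V W (action_balance H V W))" using t by (simp add: ht_simps)
 have "flip (rcoact T t) = flip (tlift ?TH R t)"
  using t by (simp add: ht_rcoact_def R_def[abs_def])
 also have "... = tlift HT (%v w. flip (R v w)) t"
  by (rule tm_push[OF Vr(1) Wr(1) tm mTH mHT Rc fl])
 also have "... = tlift HT (%v w. lsw HT (bcop V) v (%a v'. lsw HT (bcop W) w (%b w'. tn H T (a ** b) (B v' w')))) t"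
 proof (rule tm_cong[OF Vr(1) Wr(1) tm])
  fix v w assume v: "v :< V" and w: "w :< W"
  have in1: "flip (tlift ?TH (%w1 w2. tn T H (B v1 w1) (v2 ** w2)) (rcoact W w))
    = lsw HT (bcop W) w (%b w'. tn H T (v2 ** b) (B v1 w'))" if x: "v1 :< V" "v2 : cH" for v1 v2
  proof -
   have "flip (tlift ?TH (%w1 w2. tn T H (B v1 w1) (v2 ** w2)) (rcoact W w))
    = tlift HT (%w1 w2. flip (tn T H (B v1 w1) (v2 ** w2))) (rcoact W w)"
    using x by (intro ts_push[OF Wr(1) modH rW[OF w] mTH mHT _ fl] cl Tr)
   also have "... = lsw HT (bcop W) w (%b w'. tn H T (v2 ** b) (B v1 w'))"
    unfolding flip_tensor by (rule lsw_cop[OF Wr(3) w mHT, symmetric]) (intro lin cl Tr x; assumption)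
   finally show ?thesis .
  qed
  have "flip (R v w) = tlift HT (%v1 v2. flip (tlift ?TH (%w1 w2. tn T H (B v1 w1) (v2 ** w2)) (rcoact W w))) (rcoact V v)"
   unfolding R_def by (rule ts_push[OF Vr(1) modH rV[OF v] mTH mHT Rin[OF _ _ w] fl])
  also have "... = tlift HT (%v1 v2. lsw HT (bcop W) w (%b w'. tn H T (v2 ** b) (B v1 w'))) (rcoact V v)"
   by (rule ts_cong[OF Vr(1) modH rV[OF v]]) (rule in1)
  also have "... = lsw HT (bcop V) v (%a v'. lsw HT (bcop W) w (%b w'. tn H T (a ** b) (B v' w')))"
   using w by (intro lsw_cop[OF Vr(3) v mHT, symmetric] lin cl Tr Wr) (simp_all add: Tr linear_id)
  finally show "flip (R v w) = lsw HT (bcop V) v (%a v'. lsw HT (bcop W) w (%b w'. tn H T (a ** b) (B v' w')))" .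
 qed
 also have "... = lcoact cT t"
  using t unfolding hopf_loc.ht_lcoact_def[OF hopf_loc_cop bbi_cop[OF V] bbi_cop[OF W]]
  by (simp add: cT_simps ht_cop_same(2))
 finally show ?thesis .
qed

end

lemma coact_cop: "coalg.coact K (hcop H) X = coact X"
 by (simp add: coact_def coalg.coact_def[OF coalg_cop])

text \<open>The order of the factors is kept, as the co-opposite has the same product. Being an
  equality of records, this makes every left-handed fact about the tensor product over
  \<open>H\<close> available on the right.\<close>

lemma cop_ht:
 assumes V: "bbi V" and W: "bbi W"
 shows "bcop (V >< W) = htensor_bimodule K (hcop H) (bcop V) (bcop W)"
proof -
 let ?T = "V >< W" and ?cT = "htensor_bimodule K (hcop H) (bcop V) (bcop W)"
 note c = hopf_loc_cop bbi_cop[OF V] bbi_cop[OF W]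
 have s: "carrier ?cT = carrier ?T" "add ?cT = add ?T" "zero ?cT = zero ?T" "smult ?cT = smult ?T"
  using ht_cop_same(1)[OF V W] by (simp_all add: same_module_def)
 have lc: "lcoact (bcop X) = (\<lambda>v\<in>carrier X. flip (rcoact X v))" for X :: "('k, 'h, 'x) bimodule"
  by (simp add: bcop_def)
 have rc: "rcoact (bcop X) = (\<lambda>v\<in>carrier X. flip (lcoact X v))" for X :: "('k, 'h, 'x) bimodule"
  by (simp add: bcop_def)
 have tl: "tlift ?cT = tlift ?T" by (rule tensor_lift_same) (simp_all add: s)
 show ?thesis
 proof (rule bimodule.equality)
  show "lcoact (bcop ?T) = lcoact ?cT"
  proof (rule ext)
   fix t show "lcoact (bcop ?T) t = lcoact ?cT t"
   proof (cases "t :< ?T")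
    case True
    then show ?thesis by (simp add: lc flip_ht_rcoact[OF V W])
   next
    case False
    then show ?thesis by (simp add: lc hopf_loc.ht_lcoact_def[OF c] s)
   qed
  qed
  show "rcoact (bcop ?T) = rcoact ?cT"
  proof (rule ext)
   fix t show "rcoact (bcop ?T) t = rcoact ?cT t"
   proof (cases "t :< ?T")
    case True
    then have "flip (rcoact ?cT t) = lcoact ?T t"
     using hopf_loc.flip_ht_rcoact[OF c, of t] by (simp add: s cop_cop_hopf cop_cop_bimod V W)
    then have "rcoact ?cT t = flip (lcoact ?T t)" by (metis flip_flip)
    then show ?thesis using True by (simp add: rc)
   next
    case False
    then show ?thesis by (simp add: rc hopf_loc.ht_rcoact_def[OF c] s)
   qed
  qed
  show "lact (bcop ?T) = lact ?cT" "ract (bcop ?T) = ract ?cT"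
   by (simp_all add: hopf_loc.ht_lact_def[OF c] hopf_loc.ht_ract_def[OF c] ht_lact_def[OF V W] ht_ract_def[OF V W] s tl ht_cop_same(2)[OF V W])
 qed (simp_all add: s, simp_all add: htensor_bimodule_def Let_def tensor_module_def)
qed

lemma lsw_cop_ht:
 assumes V: "bbi V" and W: "bbi W" and v: "v :< V" and w: "w :< W" and M: "kmod M"
  and F: "bmap H (V >< W) M F"
 shows "lsw M (bcop (V >< W)) (ht V W v w) F =
  lsw M (bcop V) v (%a v'. lsw M (bcop W) w (%b w'. F (a ** b) (ht V W v' w')))"
 using hopf_loc.lsw_ht[OF hopf_loc_cop bbi_cop[OF V] bbi_cop[OF W], of v w M F] v w M F
 unfolding cop_ht[OF V W, symmetric] ht_cop_same(2)[OF V W] by simp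

lemma bbi_ht:
 assumes V: "bbi V" and W: "bbi W"
 shows "bbi (V >< W)"
proof -
 let ?T = "V >< W" and ?B = "ht V W"
 note c = hopf_loc_cop bbi_cop[OF V] bbi_cop[OF W]
 note Vr = bb_rules[OF V] and Wr = bb_rules[OF W] and Tr = ht_rules[OF V W]
 have lc2: "left_comodule K (hcop H) (bcop ?T)"
  using hopf_loc.ht_lc[OF c] by (simp add: cop_ht[OF V W])
 note cT = ht_coact[OF V W] and ccT = coact_lc_cop[OF lc2]
 let ?M = "ts H (ts ?T H)"
 let ?ten = "%x y z. tn H (ts ?T H) x (tn ?T H y z)"
 have mM: "kmod ?M" by (intro cl Tr)
 \<comment> \<open>On a pure tensor the left and right coactions of \<open>v\<close> and of
   \<open>w\<close> give four sums. They are permuted so that the compatibility axioms of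
   \<open>V\<close> and of \<open>W\<close> apply separately.\<close>
 have comm: "lsw ?M ?T t (%h x. lsw ?M (bcop ?T) x (%g y. ?ten h y g)) =
     lsw ?M (bcop ?T) t (%g x. lsw ?M ?T x (%h y. ?ten h y g))" if t: "t :< ?T" for t
 proof (rule ht_ext[OF V W mM _ _ _ t, of "%t. lsw ?M ?T t (%h x. lsw ?M (bcop ?T) x (%g y. ?ten h y g))"
    "%t. lsw ?M (bcop ?T) t (%g x. lsw ?M ?T x (%h y. ?ten h y g))"])
  have b1: "bmap H ?T ?M (%g y. ?ten h y g)" if "h : cH" for h
   by (intro lin cl Tr that; assumption)
  have lccT: "lmap ?T ?M (%t. lsw ?M (bcop ?T) t F)" if "bmap H ?T ?M F" for F
   using lsw_linear[OF ccT, of ?M F] that mM by simp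
  have b2: "bmap H ?T ?M (%g x. lsw ?M ?T x (%h y. ?ten h y g))"
   by (intro lin cl Tr cT; assumption)
  have b3: "bmap H ?T ?M (%h x. lsw ?M (bcop ?T) x (%g y. ?ten h y g))"
   by (rule bilinear_mapI, rule lccT, rule b1, assumption) (intro lin cl Tr ccT; simp add: Tr linear_id)
  show "lmap ?T ?M (%t. lsw ?M ?T t (%h x. lsw ?M (bcop ?T) x (%g y. ?ten h y g)))"
   by (intro lsw_linear cT b3 mM)
  show "lmap ?T ?M (%t. lsw ?M (bcop ?T) t (%g x. lsw ?M ?T x (%h y. ?ten h y g)))"
   by (rule lccT[OF b2])
  fix v w assume v: "v :< V" and w: "w :< W"
  have cV: "x :< V ==> x :< (bcop V)" and cW: "y :< W ==> y :< (bcop W)" for x y by simp_all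
  note l = bilinear_mapI trilinear_mapI linear_id linear_tensor_l linear_tensor_r linear_mult_l linear_mult_r
   cop_lsw(1,2)[OF Vr(3)] cop_lsw(1,2)[OF Wr(3)] lsw_linear_fun[OF Vr(2)] lsw_linear_fun[OF Wr(2)] lsw_linear_arg[OF Vr(2)] lsw_linear_arg[OF Wr(2)]
  have "lsw ?M ?T (?B v w) (%h x. lsw ?M (bcop ?T) x (%g y. ?ten h y g))
    = lsw ?M V v (%a v'. lsw ?M W w (%b w'. lsw ?M (bcop ?T) (?B v' w') (%g y. ?ten (a ** b) y g)))"
   by (rule lsw_ht[OF V W v w mM b3])
  also have "... = lsw ?M V v (%a v'. lsw ?M W w (%b w'. lsw ?M (bcop V) v' (%c v''. lsw ?M (bcop W) w' (%d w''. ?ten (a ** b) (?B v'' w'') (c ** d)))))"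
   by (rule lsw_cong[OF Vr(2) v], rule lsw_cong[OF Wr(2) w], rule lsw_cop_ht[OF V W _ _ mM], assumption, assumption)
    (intro b1 cl; assumption)
  also have "... = lsw ?M V v (%a v'. lsw ?M (bcop V) v' (%c v''. lsw ?M W w (%b w'. lsw ?M (bcop W) w' (%d w''. ?ten (a ** b) (?B v'' w'') (c ** d)))))"
   by (rule lsw_cong[OF Vr(2) v], rule lsw_swap[OF Wr(2) w Vr(3) _ mM]) (simp_all add: cop_lsw(3)[OF Wr(3)] tensor_closed Tr modH module_tensor_space)
  also have "... = lsw ?M (bcop V) v (%c v'. lsw ?M V v' (%a v''. lsw ?M W w (%b w'. lsw ?M (bcop W) w' (%d w''. ?ten (a ** b) (?B v'' w'') (c ** d)))))"
   by (rule bic_comm[OF bb_bic[OF V] v mM]) (intro l cop_lsw(3)[OF Vr(3)] cop_lsw(3)[OF Wr(3)] mM Tr cl w; assumption)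
  also have "... = lsw ?M (bcop V) v (%c v'. lsw ?M V v' (%a v''. lsw ?M (bcop W) w (%d w'. lsw ?M W w' (%b w''. ?ten (a ** b) (?B v'' w'') (c ** d)))))"
   by (rule lsw_cong[OF Vr(3) cV[OF v]], rule lsw_cong[OF Vr(2)], simp, rule bic_comm[OF bb_bic[OF W] w mM])
    (intro l cop_lsw(3)[OF Vr(3)] cop_lsw(3)[OF Wr(3)] mM Tr cl w; simp)
  also have "... = lsw ?M (bcop V) v (%c v'. lsw ?M (bcop W) w (%d w'. lsw ?M V v' (%a v''. lsw ?M W w' (%b w''. ?ten (a ** b) (?B v'' w'') (c ** d)))))"
   by (rule lsw_cong[OF Vr(3) cV[OF v]], rule lsw_swap[OF Vr(2) _ Wr(3) cW[OF w] mM], simp) 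
    (intro lsw_closed[OF Wr(2)] mM; simp add: tensor_closed Tr modH module_tensor_space)
  also have "... = lsw ?M (bcop V) v (%c v'. lsw ?M (bcop W) w (%d w'. lsw ?M ?T (?B v' w') (%h y. ?ten h y (c ** d))))"
   by (rule lsw_cong[OF Vr(3) cV[OF v]], rule lsw_cong[OF Wr(3) cW[OF w]], rule lsw_ht[OF V W _ _ mM, symmetric], simp, simp)
    (intro lin cl Tr; simp)
  also have "... = lsw ?M (bcop ?T) (?B v w) (%g x. lsw ?M ?T x (%h y. ?ten h y g))"
   by (rule lsw_cop_ht[OF V W v w mM b2, symmetric])
  finally show "lsw ?M ?T (?B v w) (%h x. lsw ?M (bcop ?T) x (%g y. ?ten h y g)) =
     lsw ?M (bcop ?T) (?B v w) (%g x. lsw ?M ?T x (%h y. ?ten h y g))" .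
 qed
 have "lcoact ?T : extensional (carrier ?T)" "rcoact ?T : extensional (carrier ?T)"
  by (simp_all add: ht_lcoact_def[OF V W] ht_rcoact_def[OF V W])
 with comm lc2 ht_lc[OF V W] have bic: "bic ?T" by (simp add: bicomodule_def Let_def)
 have e: "lact (htensor_bimodule K (hcop H) (bcop V) (bcop W)) = lact ?T"
  "ract (htensor_bimodule K (hcop H) (bcop V) (bcop W)) = ract ?T"
  unfolding cop_ht[OF V W, symmetric] by simp_all
 show ?thesis
  using bic ht_hopf_bimodule[OF V W] ht_colin_lact[OF V W] ht_colin_ract[OF V W]
   hopf_loc.ht_colin_lact[OF c] hopf_loc.ht_colin_ract[OF c]
  unfolding e cop_ht[OF V W, symmetric] by (simp add: bbi_def)
qed

end

section \<open>Morphisms\<close>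

definition lcolin ::
 "('k, 'l) ring_scheme \<Rightarrow> ('k, 'h) hopf \<Rightarrow> ('k, 'h, 'v) bimodule \<Rightarrow> ('k, 'h, 'w) bimodule \<Rightarrow> ('v \<Rightarrow> 'w) \<Rightarrow> bool" where
 "lcolin K H V W f \<longleftrightarrow> (\<forall>v\<in>carrier V.
   lcoact W (f v) = lsw (tensor_space K H W) V v (%h v'. tensor K H W h (f v')))"

context hopf_loc
begin

lemma lcolinD:
 assumes f: "lcolin K H V W f" "lmap V W f" and V: "coact V" and W: "coact W"
  and v: "v :< V" and M: "kmod M" and F: "bmap H W M F"
 shows "lsw M W (f v) F = lsw M V v (%h v'. F h (f v'))"
proof -
 note mW = coact_module[OF W]
 have "lsw M W (f v) F = tlift M F (lsw (ts H W) V v (%h v'. tn H W h (f v')))"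
  using f(1) v by (simp add: lsw_def lcolin_def)
 also have "... = lsw M V v (%h v'. tlift M F (tn H W h (f v')))"
  by (intro lsw_push[OF V v _ M _ linear_tl[OF modH mW M F]] cl mW linear_closed[OF f(2)])
 also have "... = lsw M V v (%h v'. F h (f v'))"
  by (intro lsw_cong[OF V v] tl_tensor[OF modH mW M F] linear_closed[OF f(2)])
 finally show ?thesis .
qed

lemma lcolin_id: "lcolin K H V V (%v. v)" if "coact V"
proof -
 have "tlift (ts H V) (tn H V) t = t" if t: "t :< (ts H V)" for t
  by (rule tensor_space_ext[OF modH coact_module[OF \<open>coact V\<close>] _ _ linear_id _ t])
   (simp_all add: linear_tl tl_tensor bilinear_tensor module_tensor_space modH coact_module[OF \<open>coact V\<close>])
 then show ?thesis using coact_mem[OF that] by (simp add: lcolin_def lsw_def)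
qed

lemma colin_pre:
 assumes m: "colin K H X' Y' P m" "bmap X' Y' P m" and f: "lcolin K H X X' f" "lmap X X' f"
  and g: "lcolin K H Y Y' g" "lmap Y Y' g" and c: "coact X" "coact X'" "coact Y" "coact Y'" "kmod P"
 shows "colin K H X Y P (%x y. m (f x) (g y))"
 unfolding colin_def
proof (intro ballI)
 fix x y assume x: "x :< X" and y: "y :< Y"
 let ?M = "ts H P"
 note mc = c(1-4)[THEN coact_module] c(5)
 have M: "kmod ?M" by (intro cl mc)
 note l = bmap_rules[OF m(2)] linear_closed[OF f(2)] linear_closed[OF g(2)]
 have "lcoact P (m (f x) (g y)) = lsw ?M X' (f x) (%a x'. lsw ?M Y' (g y) (%b y'. tn H P (a ** b) (m x' y')))"
  using m(1) l x y by (simp add: colin_def)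
 also have "... = lsw ?M X x (%a x'. lsw ?M Y' (g y) (%b y'. tn H P (a ** b) (m (f x') y')))"
  by (rule lcolinD[OF f c(1,2) x M]) (intro lin cl l mc c x y; assumption)
 also have "... = lsw ?M X x (%a x'. lsw ?M Y y (%b y'. tn H P (a ** b) (m (f x') (g y'))))"
  by (rule lsw_cong[OF c(1) x], rule lcolinD[OF g c(3,4) y M]) (intro lin cl l mc c x y; assumption)
 finally show "lcoact P (m (f x) (g y)) = lsw ?M X x (%a x'. lsw ?M Y y (%b y'. tn H P (a ** b) (m (f x') (g y'))))" .
qed

lemma lcolin_comp:
 assumes f: "lcolin K H V W f" "lmap V W f" and g: "lcolin K H W X g" "lmap W X g"
  and c: "coact V" "coact W" "coact X"
 shows "lcolin K H V X (%v. g (f v))"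
 unfolding lcolin_def
proof
 fix v assume v: "v :< V"
 note mc = c[THEN coact_module]
 have b: "bmap H W (ts H X) (%h v'. tn H X h (g v'))"
  by (intro lin cl mc g(2) linear_closed[OF g(2)]; assumption)
 have "lcoact X (g (f v)) = lsw (ts H X) W (f v) (%h v'. tn H X h (g v'))"
  using g(1) linear_closed[OF f(2) v] by (simp add: lcolin_def)
 also have "... = lsw (ts H X) V v (%h v'. tn H X h (g (f v')))"
  by (rule lcolinD[OF f c(1,2) v _ b]) (intro cl mc)
 finally show "lcoact X (g (f v)) = ..." .
qed

lemma lcolin_cong:
 assumes "!!v. v :< V ==> f v = g v" "coact V" "lcolin K H V W f"
 shows "lcolin K H V W g"
 unfolding lcolin_def
proof
 fix v assume v: "v :< V"
 have "lsw (ts H W) V v (%h v'. tn H W h (f v')) = lsw (ts H W) V v (%h v'. tn H W h (g v'))"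
  by (rule lsw_cong[OF assms(2) v]) (simp add: assms(1))
 then show "lcoact W (g v) = lsw (ts H W) V v (%h v'. tn H W h (g v'))"
  using bspec[OF assms(3)[unfolded lcolin_def] v] assms(1)[OF v] by simp
qed

text \<open>Colinearity of \<open>f\<close> at the element \<open>g w\<close>, followed by
  \<open>g\<close> on the second factor.\<close>

lemma lcolin_inverse:
 assumes f: "lcolin K H V W f" "lmap V W f" and g: "lmap W V g"
  and fg: "!!v. v :< V ==> g (f v) = v" "!!w. w :< W ==> f (g w) = w" and c: "coact V" "coact W"
 shows "lcolin K H W V g"
 unfolding lcolin_def
proof
 fix w assume w: "w :< W"
 note mc = c[THEN coact_module]
 have gw: "g w :< V" by (rule linear_closed[OF g w])
 have b: "bmap H W (ts H V) (%h v'. tn H V h (g v'))"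
  by (intro lin cl mc g linear_closed[OF g]; assumption)
 have "lsw (ts H V) W (f (g w)) (%h v'. tn H V h (g v')) = lsw (ts H V) V (g w) (%h v'. tn H V h (g (f v')))"
  by (rule lcolinD[OF f c gw _ b]) (intro cl mc)
 also have "... = lsw (ts H V) V (g w) (%h v'. tn H V h v')"
  by (rule lsw_cong[OF c(1) gw]) (simp add: fg)
 also have "... = lcoact V (g w)" using lcolin_id[OF c(1)] gw by (simp add: lcolin_def)
 finally show "lcoact V (g w) = lsw (ts H V) W w (%h v'. tn H V h (g v'))"
  using w by (simp add: fg)
qed

text \<open>The elementwise form of \<open>bicovariant_hom\<close>, with right colinearity expressed
  as left colinearity over the co-opposite.\<close>

definition bhom where
 "bhom V W f \<longleftrightarrow> f : extensional (carrier V) \<and> lmap V W f \<and>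
  (\<forall>h\<in>cH. \<forall>v\<in>carrier V. f (lact V h v) = lact W h (f v) \<and> f (ract V v h) = ract W (f v) h) \<and>
  lcolin K H V W f \<and> lcolin K (hcop H) (bcop V) (bcop W) f"

lemma bhom_iff:
 assumes V: "bbi V" and W: "bbi W"
 shows "f : bicovariant_hom K H V W \<longleftrightarrow> bhom V W f"
proof (cases "lmap V W f")
 case False then show ?thesis by (simp add: bicovariant_hom_def bhom_def)
next
 case True
 let ?WH = "ts W H" and ?HW = "ts H W"
 note Va = bb_rules[OF V] and Wa = bb_rules[OF W]
 have rV: "v :< V ==> rcoact V v :< (ts V H)" for v
  using Va(3) rcoact_linear[OF Va(1)] linear_closed by (auto simp: coact_def)
 have m: "kmod ?WH" "kmod ?HW" by (intro cl Wa)+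
 note fl = linear_closed[OF True]
 have "(lcoact (bcop W) (f v) = lsw ?HW (bcop V) v (%h v'. tn H W h (f v')))
   \<longleftrightarrow> (rcoact W (f v) = tlift ?WH (%v' h. tn W H (f v') h) (rcoact V v))" if v: "v :< V" for v
 proof -
  have "flip (tlift ?WH (%v' h. tn W H (f v') h) (rcoact V v)) = tlift ?HW (%v' h. flip (tn W H (f v') h)) (rcoact V v)"
   by (rule ts_push[OF Va(1) modH rV[OF v] m _ flip_linear(1)[OF Wa(1) modH]]) (intro cl fl Wa)
  also have "... = lsw ?HW (bcop V) v (%h v'. tn H W h (f v'))"
   unfolding flip_tensor
   by (rule lsw_cop[OF Va(3) v m(2), symmetric]) (intro lin cl fl True Wa; assumption)
  also
  note e = calculation
  have "lcoact (bcop W) (f v) = flip (rcoact W (f v))" using fl[OF v] by (simp add: bcop_def)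
  then show ?thesis unfolding e[symmetric] by (metis flip_flip)
 qed
 then show ?thesis
  using True by (auto simp: bicovariant_hom_def bhom_def lcolin_def lsw_def PiE_def linear_map_def)
qed

lemma bhom_linear: "bhom V W f ==> lmap V W f" by (simp add: bhom_def)
lemma bhom_closed: "bhom V W f ==> v :< V ==> f v :< W" by (rule linear_closed[OF bhom_linear])
lemma bhom_lact: "bhom V W f ==> h : cH ==> v :< V ==> f (lact V h v) = lact W h (f v)"
 and bhom_ract: "bhom V W f ==> h : cH ==> v :< V ==> f (ract V v h) = ract W (f v) h"
 by (simp_all add: bhom_def)

lemma bhom_restrict:
 assumes V: "bbi V" and l: "lmap V W f"
  and "!!h v. h : cH ==> v :< V ==> f (lact V h v) = lact W h (f v)"
  and "!!h v. h : cH ==> v :< V ==> f (ract V v h) = ract W (f v) h"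
  and c: "lcolin K H V W f" "lcolin K (hcop H) (bcop V) (bcop W) f"
 shows "bhom V W (\<lambda>v\<in>carrier V. f v)"
proof -
 note Va = bb_rules[OF V]
 have "lcolin K H V W (\<lambda>v\<in>carrier V. f v)"
  by (rule lcolin_cong[OF _ Va(2) c(1)]) simp
 moreover have "lcolin K (hcop H) (bcop V) (bcop W) (\<lambda>v\<in>carrier V. f v)"
  by (rule hopf_loc.lcolin_cong[OF hopf_loc_cop _ _ c(2)]) (simp_all add: coact_cop Va)
 ultimately show ?thesis
  using assms(3,4) restrict_linear[OF l Va(1)] by (simp add: bhom_def Va)
qed

text \<open>An inverse function inherits linearity, equivariance and colinearity. For each
  isomorphism it therefore suffices that one direction is a morphism and that a set-theoretic
  inverse exists.\<close>

lemma bhom_inverse: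
 assumes V: "bbi V" and W: "bbi W" and f: "bhom V W f" and g: "!!w. w :< W ==> g w :< V"
  and fg: "!!v. v :< V ==> g (f v) = v" "!!w. w :< W ==> f (g w) = w"
 shows "f : bicovariant_iso K H V W"
proof -
 note Va = bb_rules[OF V] and Wa = bb_rules[OF W]
 interpret V: module K V by (rule Va)
 interpret W: module K W by (rule Wa)
 note fl = bhom_linear[OF f]
 have gl: "lmap W V g"
 proof (rule linear_mapI[OF g])
  fix x y assume "x :< W" "y :< W"
  then show "g (x \<oplus>\<^bsub>W\<^esub> y) = g x \<oplus>\<^bsub>V\<^esub> g y"
   using fg(1)[of "g x \<oplus>\<^bsub>V\<^esub> g y"] by (simp add: linear_add[OF fl] g fg)
 next
  fix a x assume "a :< K" "x :< W"
  then show "g (a *[W] x) = a *[V] g x"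
   using fg(1)[of "a *[V] g x"] by (simp add: linear_smult[OF fl] g fg)
 qed
 have "bhom W V (\<lambda>w\<in>carrier W. g w)"
 proof (rule bhom_restrict[OF W gl])
  fix h w assume hw: "h : cH" "w :< W"
  show "g (lact W h w) = lact V h (g w)"
   using hw fg(1)[of "lact V h (g w)"] by (simp add: bhom_lact[OF f] g fg Va)
  show "g (ract W w h) = ract V (g w) h"
   using hw fg(1)[of "ract V (g w) h"] by (simp add: bhom_ract[OF f] g fg Va)
 next
  have f1: "lcolin K H V W f" "lcolin K (hcop H) (bcop V) (bcop W) f"
   using f by (simp_all add: bhom_def)
  show "lcolin K H W V g" by (rule lcolin_inverse[OF f1(1) fl gl fg Va(2) Wa(2)])
  show "lcolin K (hcop H) (bcop W) (bcop V) g"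
   by (rule hopf_loc.lcolin_inverse[OF hopf_loc_cop f1(2)]) (simp_all add: fl gl fg coact_cop Va Wa)
 qed
 then show ?thesis
  unfolding bicovariant_iso_def using bhom_iff[OF V W] bhom_iff[OF W V] f fg bhom_closed[OF f] g
  by (auto intro!: bexI[of _ "\<lambda>w\<in>carrier W. g w"])
qed

section \<open>Morphisms out of tensor products\<close>

lemma ht_lcolin:
 assumes V: "bbi V" and W: "bbi W" and P: "coact P" and f: "lmap (V >< W) P f"
  and c: "colin K H V W P (%v w. f (ht V W v w))"
 shows "lcolin K H (V >< W) P f"
 unfolding lcolin_def
proof
 fix t assume t: "t :< (V >< W)"
 note Va = bb_rules[OF V]
 note mP = coact_module[OF P]
 have M: "kmod (ts H P)" by (intro cl mP)
 have b: "bmap H (V >< W) (ts H P) (%h v'. tn H P h (f v'))"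
  by (intro lin cl mP f linear_closed[OF f]; assumption)
 show "lcoact P (f t) = lsw (ts H P) (V >< W) t (%h v'. tn H P h (f v'))"
 proof (rule ht_ext[OF V W M _ _ _ t, of "%t. lcoact P (f t)" "%t. lsw (ts H P) (V >< W) t (%h v'. tn H P h (f v'))"])
  show "lmap (V >< W) (ts H P) (%t. lcoact P (f t))"
   by (rule linear_compose[OF f P[unfolded coact_def, THEN conjunct2]])
  show "lmap (V >< W) (ts H P) (%t. lsw (ts H P) (V >< W) t (%h v'. tn H P h (f v')))"
   by (rule lsw_linear[OF ht_coact[OF V W] b M])
  fix v w assume "v :< V" "w :< W"
  then show "lcoact P (f (ht V W v w)) = lsw (ts H P) (V >< W) (ht V W v w) (%h v'. tn H P h (f v'))"
   using c by (simp add: lsw_ht[OF V W _ _ M b] colin_def)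
 qed
qed

text \<open>The common source of tensor products of morphisms, unitors, associators and the
  comparison map of the twist: a balanced, bicolinear \<open>F\<close> that respects the two outer
  actions induces a morphism.\<close>

lemma ht_bhom:
 assumes V: "bbi V" and W: "bbi W" and P: "bbi P" and F: "hbal V W P F"
  and l: "!!h v w. h : cH ==> v :< V ==> w :< W ==> F (lact V h v) w = lact P h (F v w)"
  and r: "!!h v w. h : cH ==> v :< V ==> w :< W ==> F v (ract W w h) = ract P (F v w) h"
  and c: "colin K H V W P F" "colin K (hcop H) (bcop V) (bcop W) (bcop P) F"
 shows "bhom (V >< W) P (\<lambda>t\<in>carrier (V >< W). tlift P F t)"
proof (rule bhom_restrict[OF bbi_ht[OF V W]])
 note Va = bb_rules[OF V] and Wa = bb_rules[OF W] and Tr = ht_rules[OF V W] and Pr = bb_rules[OF P]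
 note L = ht_lift(1)[OF V W Pr(1) F] and g = ht_lift(2)[OF V W Pr(1) F]
 show "lmap (V >< W) P (tlift P F)" by (rule L)
 fix h t assume h: "h : cH" and t: "t :< (V >< W)"
 show "tlift P F (lact (V >< W) h t) = lact P h (tlift P F t)"
  by (rule ht_ext[OF V W Pr(1) linear_compose[OF bilinear_r[OF ht_lact_bilinear[OF V W] h] L] linear_compose[OF L bilinear_r[OF bb_lact[OF P] h]] _ t])
   (simp add: ht_lact[OF V W] h g l Va)
 show "tlift P F (ract (V >< W) t h) = ract P (tlift P F t) h"
  by (rule ht_ext[OF V W Pr(1) linear_compose[OF bilinear_l[OF ht_ract_bilinear[OF V W] h] L] linear_compose[OF L bilinear_l[OF bb_ract[OF P] h]] _ t])
   (simp add: ht_ract[OF V W] h g r Wa)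
next
 note Va = bb_rules[OF V] and Wa = bb_rules[OF W] and Tr = ht_rules[OF V W] and Pr = bb_rules[OF P]
 note L = ht_lift(1)[OF V W Pr(1) F] and g = ht_lift(2)[OF V W Pr(1) F]
 have e: "F v w = tlift P F (ht V W v w)" if "v :< V" "w :< W" for v w
  using g that by simp
 show "lcolin K H (V >< W) P (tlift P F)"
  by (rule ht_lcolin[OF V W Pr(2) L colin_cong[THEN iffD1, OF e Va(2) Wa(2) c(1)]])
 note cV = bbi_cop[OF V] and cW = bbi_cop[OF W]
 have c2: "colin K (hcop H) (bcop V) (bcop W) (bcop P) (%v w. tlift P F (ht V W v w))"
  by (rule hopf_loc.colin_cong[THEN iffD1, OF hopf_loc_cop _ _ _ c(2)]) (simp_all add: e coact_cop Va Wa)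
 show "lcolin K (hcop H) (bcop (V >< W)) (bcop P) (tlift P F)"
  unfolding cop_ht[OF V W]
  by (rule hopf_loc.ht_lcolin[OF hopf_loc_cop cV cW])
   (simp_all add: coact_cop Pr cop_ht[OF V W, symmetric] L ht_cop_same(2)[OF V W] c2)
qed

lemma ht_colin_cop:
 assumes "bbi V" "bbi W"
 shows "colin K (hcop H) (bcop V) (bcop W) (bcop (V >< W)) (ht V W)"
 using hopf_loc.ht_colin[OF hopf_loc_cop bbi_cop[OF assms(1)] bbi_cop[OF assms(2)]]
 by (simp add: cop_ht[OF assms] ht_cop_same(2)[OF assms])

lemma ht_eval:
 assumes "bbi V" "bbi W" "kmod P" "hbal V W P F" "v :< V" "w :< W"
 shows "(\<lambda>t\<in>carrier (V >< W). tlift P F t) (ht V W v w) = F v w"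
 using ht_lift(2)[OF assms] ht_closed[OF assms(1,2,5,6)] by simp

lemma ht_ext3l:
 assumes V: "bbi V" and W: "bbi W" and U: "bbi U" and M: "kmod M"
  and f: "lmap ((V >< W) >< U) M f" and g: "lmap ((V >< W) >< U) M g"
  and eq: "!!v w x. v :< V ==> w :< W ==> x :< U ==>
   f (ht (V >< W) U (ht V W v w) x) = g (ht (V >< W) U (ht V W v w) x)"
  and t: "t :< ((V >< W) >< U)"
 shows "f t = g t"
proof (rule ht_ext[OF bbi_ht[OF V W] U M f g _ t])
 fix s x assume s: "s :< (V >< W)" and x: "x :< U"
 note l = bilinear_l[OF ht_bilinear[OF bbi_ht[OF V W] U] x]
 show "f (ht (V >< W) U s x) = g (ht (V >< W) U s x)"
  by (rule ht_ext[OF V W M linear_compose[OF l f] linear_compose[OF l g] _ s]) (rule eq[OF _ _ x])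
qed

lemma ht_ext3r:
 assumes V: "bbi V" and W: "bbi W" and U: "bbi U" and M: "kmod M"
  and f: "lmap (V >< (W >< U)) M f" and g: "lmap (V >< (W >< U)) M g"
  and eq: "!!v w x. v :< V ==> w :< W ==> x :< U ==>
   f (ht V (W >< U) v (ht W U w x)) = g (ht V (W >< U) v (ht W U w x))"
  and t: "t :< (V >< (W >< U))"
 shows "f t = g t"
proof (rule ht_ext[OF V bbi_ht[OF W U] M f g _ t])
 fix v s assume v: "v :< V" and s: "s :< (W >< U)"
 note l = bilinear_r[OF ht_bilinear[OF V bbi_ht[OF W U]] v]
 show "f (ht V (W >< U) v s) = g (ht V (W >< U) v s)"
  by (rule ht_ext[OF W U M linear_compose[OF l f] linear_compose[OF l g] _ s]) (rule eq[OF v])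
qed

lemma ht_ext4:
 assumes V: "bbi V" and W: "bbi W" and U: "bbi U" and X: "bbi X" and M: "kmod M"
  and f: "lmap (((V >< W) >< U) >< X) M f" and g: "lmap (((V >< W) >< U) >< X) M g"
  and eq: "!!v w y x. v :< V ==> w :< W ==> y :< U ==> x :< X ==>
   f (ht ((V >< W) >< U) X (ht (V >< W) U (ht V W v w) y) x) =
   g (ht ((V >< W) >< U) X (ht (V >< W) U (ht V W v w) y) x)"
  and t: "t :< (((V >< W) >< U) >< X)"
 shows "f t = g t"
proof (rule ht_ext[OF bbi_ht[OF bbi_ht[OF V W] U] X M f g _ t])
 fix s x assume s: "s :< ((V >< W) >< U)" and x: "x :< X"
 note l = bilinear_l[OF ht_bilinear[OF bbi_ht[OF bbi_ht[OF V W] U] X] x]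
 show "f (ht ((V >< W) >< U) X s x) = g (ht ((V >< W) >< U) X s x)"
  by (rule ht_ext3l[OF V W U M linear_compose[OF l f] linear_compose[OF l g] _ s]) (rule eq[OF _ _ _ x])
qed

section \<open>The monoidal category\<close>

lemma identity_map_apply: "v :< V ==> identity_map V v = v"
 by (simp add: identity_map_def)

lemma bhom_id: "bbi V ==> bhom V V (identity_map V)"
 unfolding identity_map_def
 by (rule bhom_restrict) (simp_all add: linear_id lcolin_id hopf_loc.lcolin_id[OF hopf_loc_cop] coact_cop bb_rules)

lemma bhom_compose:
 assumes V: "bbi V" and W: "bbi W" and U: "bbi U" and f: "bhom V W f" and g: "bhom W U g"
 shows "bhom V U (compose (carrier V) g f)"
proof -
 note c = bb_rules(2,3)[OF V] bb_rules(2,3)[OF W] bb_rules(2,3)[OF U]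
 note fl = bhom_linear[OF f] and gl = bhom_linear[OF g]
 have 1: "lcolin K H V W f" "lcolin K (hcop H) (bcop V) (bcop W) f"
   "lcolin K H W U g" "lcolin K (hcop H) (bcop W) (bcop U) g"
  using f g by (simp_all add: bhom_def)
 have "lcolin K (hcop H) (bcop V) (bcop U) (%v. g (f v))"
  by (rule hopf_loc.lcolin_comp[OF hopf_loc_cop 1(2) _ 1(4)]) (simp_all add: fl gl coact_cop c)
 then show ?thesis
  unfolding compose_def
  by (intro bhom_restrict[OF V] lcolin_comp[OF 1(1) fl 1(3) gl c(1,3,5)] linear_compose[OF fl gl])
   (simp_all add: bhom_lact[OF f] bhom_lact[OF g] bhom_ract[OF f] bhom_ract[OF g] bhom_closed[OF f])
qed

lemma category_ax: "bbi V ==> bbi W ==> bbi U ==> category_axioms K H V W U"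
 unfolding category_axioms_def by (simp add: bhom_iff bhom_id bhom_compose)

context
 fixes V :: "('k, 'h, 'v) bimodule" and W :: "('k, 'h, 'w) bimodule"
  and V' :: "('k, 'h, 'v1) bimodule" and W' :: "('k, 'h, 'w1) bimodule" and f g
 assumes V: "bbi V" and W: "bbi W" and V': "bbi V'" and W': "bbi W'" and f: "bhom V V' f" and g: "bhom W W' g"
begin

lemma htensor_map_bal: "hbal V W (V' >< W') (%v w. ht V' W' (f v) (g w))"
 by (intro hbalI lin ht_rules[OF V' W'] bhom_linear[OF f] bhom_linear[OF g] bhom_closed[OF f] bhom_closed[OF g])
  (simp_all add: bhom_lact[OF g] bhom_ract[OF f] ht_balance[OF V' W'] bhom_closed[OF f] bhom_closed[OF g])

lemma bhom_htensor_map: "bhom (V >< W) (V' >< W') (htensor_map K H V W V' W' f g)"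
 unfolding htensor_map_def
proof (rule ht_bhom[OF V W bbi_ht[OF V' W'] htensor_map_bal])
 note c = bb_rules(2,3)[OF V] bb_rules(2,3)[OF W] bb_rules(2,3)[OF V'] bb_rules(2,3)[OF W']
 note fl = bhom_linear[OF f] and gl = bhom_linear[OF g]
 have 1: "lcolin K H V V' f" "lcolin K (hcop H) (bcop V) (bcop V') f"
   "lcolin K H W W' g" "lcolin K (hcop H) (bcop W) (bcop W') g"
  using f g by (simp_all add: bhom_def)
 show "colin K H V W (V' >< W') (%v w. ht V' W' (f v) (g w))"
  by (rule colin_pre[OF ht_colin[OF V' W'] ht_bilinear[OF V' W'] 1(1) fl 1(3) gl]) (simp_all add: c ht_rules V' W')
 show "colin K (hcop H) (bcop V) (bcop W) (bcop (V' >< W')) (%v w. ht V' W' (f v) (g w))"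
  by (rule hopf_loc.colin_pre[OF hopf_loc_cop ht_colin_cop[OF V' W'] _ 1(2) _ 1(4)])
   (simp_all add: c coact_cop ht_rules V' W' ht_bilinear fl gl)
qed (simp_all add: bhom_lact[OF f] bhom_ract[OF g] ht_lact[OF V' W'] ht_ract[OF V' W'] bhom_closed[OF f] bhom_closed[OF g])

lemma htensor_map_gen: "v :< V ==> w :< W ==>
  htensor_map K H V W V' W' f g (ht V W v w) = ht V' W' (f v) (g w)"
 unfolding htensor_map_def by (rule ht_eval[OF V W ht_module[OF V' W'] htensor_map_bal])

end

lemmas htensor_map_linear = bhom_linear[OF bhom_htensor_map]

lemma bhom_eqI:
 assumes "bhom V W f" "bhom V W g" "!!v. v :< V ==> f v = g v" shows "f = g"
 using assms unfolding bhom_def by (intro extensionalityI[of _ "carrier V"]) auto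

lemma tensor_functor_ax:
 assumes "bbi V" "bbi V'" "bbi V''" "bbi W" "bbi W'" "bbi W''"
 shows "tensor_functor_axioms K H V V' V'' W W' W''"
proof -
 have 1: "htensor_map K H V W V W (identity_map V) (identity_map W) = identity_map (V >< W)"
 proof (rule bhom_eqI[OF bhom_htensor_map bhom_id])
  fix t assume t: "t :< (V >< W)"
  have "htensor_map K H V W V W (identity_map V) (identity_map W) t = t"
   by (rule ht_ext[OF assms(1,4) ht_module[OF assms(1,4)] htensor_map_linear linear_id _ t])
    (simp_all add: assms bhom_id htensor_map_gen, simp add: identity_map_def)
  then show "htensor_map K H V W V W (identity_map V) (identity_map W) t = identity_map (V >< W) t"
   using t by (simp add: identity_map_def)
 qed (simp_all add: assms bhom_id bbi_ht)
 have 2: "htensor_map K H V W V'' W'' (compose (carrier V) f' f) (compose (carrier W) g' g) =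
   compose (carrier (V >< W)) (htensor_map K H V' W' V'' W'' f' g') (htensor_map K H V W V' W' f g)"
  if f: "bhom V V' f" and g: "bhom W W' g" and f': "bhom V' V'' f'" and g': "bhom W' W'' g'" for f g f' g'
 proof -
  have fg: "bhom (V >< W) (V' >< W') (htensor_map K H V W V' W' f g)"
   by (rule bhom_htensor_map) (simp_all add: assms f g)
  have fg': "bhom (V' >< W') (V'' >< W'') (htensor_map K H V' W' V'' W'' f' g')"
   by (rule bhom_htensor_map) (simp_all add: assms f' g')
  note cf = bhom_compose[OF assms(1-3) f f'] and cg = bhom_compose[OF assms(4-6) g g']
  have ff: "bhom (V >< W) (V'' >< W'') (htensor_map K H V W V'' W'' (compose (carrier V) f' f) (compose (carrier W) g' g))"
   by (rule bhom_htensor_map) (simp_all add: assms cf cg)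
  have cc: "bhom (V >< W) (V'' >< W'') (compose (carrier (V >< W)) (htensor_map K H V' W' V'' W'' f' g') (htensor_map K H V W V' W' f g))"
   by (rule bhom_compose[OF _ _ _ fg fg']) (simp_all add: assms bbi_ht)
  show ?thesis
  proof (rule bhom_eqI[OF ff cc])
   fix t assume t: "t :< (V >< W)"
   show "htensor_map K H V W V'' W'' (compose (carrier V) f' f) (compose (carrier W) g' g) t =
    compose (carrier (V >< W)) (htensor_map K H V' W' V'' W'' f' g') (htensor_map K H V W V' W' f g) t"
   proof (rule ht_ext[OF assms(1,4) ht_module[OF assms(3,6)] bhom_linear[OF ff] bhom_linear[OF cc] _ t])
    fix v w assume "v :< V" "w :< W"
    then show "htensor_map K H V W V'' W'' (compose (carrier V) f' f) (compose (carrier W) g' g) (ht V W v w) =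
     compose (carrier (V >< W)) (htensor_map K H V' W' V'' W'' f' g') (htensor_map K H V W V' W' f g) (ht V W v w)"
     using htensor_map_gen[OF assms(1,4,3,6) cf cg, of v w] htensor_map_gen[OF assms(1,4,2,5) f g, of v w]
      htensor_map_gen[OF assms(2,5,3,6) f' g', of "f v" "g w"]
     by (simp add: compose_eq ht_closed assms bhom_closed[OF f] bhom_closed[OF g])
   qed
  qed
 qed
 show ?thesis
  unfolding tensor_functor_axioms_def
  using assms 1 2 by (simp add: bbi_iff bbi_ht bhom_iff bhom_htensor_map)
qed

section \<open>Unitors\<close>

lemma left_unitor_bal:
 assumes V: "bbi V" shows "hbal HU V V (%h v. lact V h v)"
 by (intro hbalI) (simp_all add: bb_lact[OF V] lact_mult[OF V])

lemma right_unitor_bal: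
 assumes V: "bbi V" shows "hbal V HU V (%v h. ract V v h)"
 by (intro hbalI) (simp_all add: bb_ract[OF V] ract_mult[OF V])

lemma left_unitor_gen:
 assumes V: "bbi V" and h: "h : cH" and v: "v :< V"
 shows "left_unitor K H V (ht HU V h v) = lact V h v"
 unfolding left_unitor_def using h v
 by (subst ht_eval[OF bbi_unit V bb_module[OF V] left_unitor_bal[OF V]]) simp_all

lemma right_unitor_gen:
 assumes V: "bbi V" and h: "h : cH" and v: "v :< V"
 shows "right_unitor K H V (ht V HU v h) = ract V v h"
 unfolding right_unitor_def using h v
 by (subst ht_eval[OF V bbi_unit bb_module[OF V] right_unitor_bal[OF V]]) simp_all

lemma bhom_left_unitor: assumes V: "bbi V" shows "bhom (HU >< V) V (left_unitor K H V)"
 unfolding left_unitor_def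
 by (rule ht_bhom[OF bbi_unit V V left_unitor_bal[OF V]])
  (use V in \<open>simp_all add: lact_mult lact_ract bbi_def cop_unit\<close>)

lemma bhom_right_unitor: assumes V: "bbi V" shows "bhom (V >< HU) V (right_unitor K H V)"
 unfolding right_unitor_def
 by (rule ht_bhom[OF V bbi_unit V right_unitor_bal[OF V]])
  (use V in \<open>simp_all add: ract_mult lact_ract bbi_def cop_unit\<close>)

text \<open>The inverse sends \<open>v\<close> to \<open>1 \<otimes> v\<close>, because
  \<open>h \<otimes> v = 1 \<otimes> hv\<close> by balance.\<close>

lemma left_unitor_iso:
 assumes V: "bbi V" shows "left_unitor K H V : bicovariant_iso K H (HU >< V) V"
proof (rule bhom_inverse[OF bbi_ht[OF bbi_unit V] V bhom_left_unitor[OF V], where g = "%v. ht HU V u v"])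
 note Va = bb_rules[OF V] and Tr = ht_rules[OF bbi_unit V]
 fix v assume v: "v :< V"
 show "ht HU V u v :< (HU >< V)" using v by (simp add: Tr)
 show "left_unitor K H V (ht HU V u v) = v" using v by (simp add: left_unitor_gen[OF V] lact_one[OF V])
next
 note Va = bb_rules[OF V] and Tr = ht_rules[OF bbi_unit V]
 fix t assume t: "t :< (HU >< V)"
 have uH: "u :< HU" by simp
 show "ht HU V u (left_unitor K H V t) = t"
 proof (rule ht_ext[OF bbi_unit V Tr(1) linear_compose[OF bhom_linear[OF bhom_left_unitor[OF V]] bilinear_r[OF ht_bilinear[OF bbi_unit V] uH]] linear_id _ t])
  fix h v assume hv: "h :< HU" "v :< V"
  then show "ht HU V u (left_unitor K H V (ht HU V h v)) = ht HU V h v"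
   using ht_balance[OF bbi_unit V uH _ hv(2), of h] by (simp add: left_unitor_gen[OF V] lact_one[OF V] Va)
 qed
qed

lemma right_unitor_iso:
 assumes V: "bbi V" shows "right_unitor K H V : bicovariant_iso K H (V >< HU) V"
proof (rule bhom_inverse[OF bbi_ht[OF V bbi_unit] V bhom_right_unitor[OF V], where g = "%v. ht V HU v u"])
 note Va = bb_rules[OF V] and Tr = ht_rules[OF V bbi_unit]
 fix v assume v: "v :< V"
 show "ht V HU v u :< (V >< HU)" using v by (simp add: Tr)
 show "right_unitor K H V (ht V HU v u) = v" using v by (simp add: right_unitor_gen[OF V] ract_one[OF V])
next
 note Va = bb_rules[OF V] and Tr = ht_rules[OF V bbi_unit]
 fix t assume t: "t :< (V >< HU)"
 have uH: "u :< HU" by simp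
 show "ht V HU (right_unitor K H V t) u = t"
 proof (rule ht_ext[OF V bbi_unit Tr(1) linear_compose[OF bhom_linear[OF bhom_right_unitor[OF V]] bilinear_l[OF ht_bilinear[OF V bbi_unit] uH]] linear_id _ t])
  fix v h assume hv: "v :< V" "h :< HU"
  then show "ht V HU (right_unitor K H V (ht V HU v h)) u = ht V HU v h"
   using ht_balance[OF V bbi_unit hv(1) _ uH, of h] by (simp add: right_unitor_gen[OF V] ract_one[OF V] Va)
 qed
qed

section \<open>The associator\<close>

context
 fixes V :: "('k, 'h, 'v) bimodule" and W :: "('k, 'h, 'w) bimodule" and U :: "('k, 'h, 'u) bimodule"
 assumes V: "bbi V" and W: "bbi W" and U: "bbi U"
begin

private lemmas VW = bbi_ht[OF V W] and WU = bbi_ht[OF W U]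
private lemmas Va = bb_rules[OF V] and Wa = bb_rules[OF W] and Ua = bb_rules[OF U]
private lemmas Ar = ht_rules[OF V W] ht_rules[OF W U] ht_rules[OF VW U] ht_rules[OF V WU]

private abbreviation "E v w x \<equiv> ht V (W >< U) v (ht W U w x)"
private abbreviation "E' v w x \<equiv> ht (V >< W) U (ht V W v w) x"

private lemma assoc_bal1: "x :< U ==> hbal V W (V >< (W >< U)) (%v w. E v w x)"
 by (intro hbalI lin Ar) (simp_all add: ht_balance[OF V WU] ht_lact[OF W U] Ar)

private lemma assoc_in: "x :< U ==> v :< V ==> w :< W ==>
  tlift (V >< (W >< U)) (%v w. E v w x) (ht V W v w) = E v w x"
 by (rule ht_lift(2)[OF V W ht_module[OF V WU] assoc_bal1])

private lemma assoc_bil: "bmap (V >< W) U (V >< (W >< U)) (%s x. tlift (V >< (W >< U)) (%v w. E v w x) s)"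
 by (intro bilinear_mapI ht_lift(1)[OF V W ht_module[OF V WU] assoc_bal1] ht_lift_fun[OF V W _ ht_module[OF V WU]] lin Ar; assumption)

private lemma assoc_bal: "hbal (V >< W) U (V >< (W >< U)) (%s x. tlift (V >< (W >< U)) (%v w. E v w x) s)"
proof (rule hbalI[OF assoc_bil])
 fix s h x assume s: "s :< (V >< W)" and h: "h : cH" and x: "x :< U"
 show "tlift (V >< (W >< U)) (%v w. E v w x) (ract (V >< W) s h) =
   tlift (V >< (W >< U)) (%v w. E v w (lact U h x)) s"
  by (rule ht_ext[OF V W ht_module[OF V WU] linear_compose[OF bilinear_l[OF ht_ract_bilinear[OF V W] h] ht_lift(1)[OF V W ht_module[OF V WU] assoc_bal1[OF x]]]
    ht_lift(1)[OF V W ht_module[OF V WU] assoc_bal1] _ s])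
   (simp_all add: Ua h x assoc_in ht_ract[OF V W] ht_balance[OF W U] Wa)
qed

lemma associator_eq: "associator K H V W U =
  (\<lambda>t\<in>carrier ((V >< W) >< U). tlift (V >< (W >< U)) (%s x. tlift (V >< (W >< U)) (%v w. E v w x) s) t)"
 by (simp add: associator_def Let_def)

lemma associator_gen: "v :< V ==> w :< W ==> x :< U ==> associator K H V W U (E' v w x) = E v w x"
 unfolding associator_eq
 by (subst ht_eval[OF VW U ht_module[OF V WU] assoc_bal]) (simp_all add: assoc_in Ar)

text \<open>On \<open>(v \<otimes> w) \<otimes> x\<close> the two bracketings give coaction factors
  \<open>a (b c)\<close> and \<open>(a b) c\<close>, so this is associativity of
  \<open>H\<close>.\<close>

private lemma assoc_colin: "colin K H (V >< W) U (V >< (W >< U)) (%s x. tlift (V >< (W >< U)) (%v w. E v w x) s)"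
 unfolding colin_def
proof (intro ballI)
 let ?P = "V >< (W >< U)"
 let ?M = "ts H ?P"
 let ?F = "%s x. tlift ?P (%v w. E v w x) s"
 fix s x assume s: "s :< (V >< W)" and x: "x :< U"
 have M: "kmod ?M" by (intro cl Ar)
 note cP = ht_coact[OF V WU] and cVW = ht_coact[OF V W]
 note Fl = bmap_rules[OF assoc_bil]
 have b: "bmap H (V >< W) ?M (%a s'. lsw ?M U x (%b x'. tn H ?P (a ** b) (?F s' x')))"
  by (intro lin cl Fl Ar Ua x; assumption)
 show "lcoact ?P (?F s x) = lsw ?M (V >< W) s (%a s'. lsw ?M U x (%b x'. tn H ?P (a ** b) (?F s' x')))"
 proof (rule ht_ext[OF V W M _ _ _ s, of "%s. lcoact ?P (?F s x)" "%s. lsw ?M (V >< W) s (%a s'. lsw ?M U x (%b x'. tn H ?P (a ** b) (?F s' x')))"])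
  show "lmap (V >< W) ?M (%s. lcoact ?P (?F s x))"
   by (rule linear_compose[OF bilinear_l[OF assoc_bil x] cP[unfolded coact_def, THEN conjunct2]])
  show "lmap (V >< W) ?M (%s. lsw ?M (V >< W) s (%a s'. lsw ?M U x (%b x'. tn H ?P (a ** b) (?F s' x'))))"
   by (rule lsw_linear[OF cVW b M])
  fix v w assume v: "v :< V" and w: "w :< W"
  have "lcoact ?P (?F (ht V W v w) x) = lsw ?M V v (%a v'. lsw ?M (W >< U) (ht W U w x) (%b t'. tn H ?P (a ** b) (ht V (W >< U) v' t')))"
   using ht_colin[OF V WU] v w x by (simp add: assoc_in colin_def Ar)
  also have "... = lsw ?M V v (%a v'. lsw ?M W w (%b w'. lsw ?M U x (%c x'. tn H ?P (a ** (b ** c)) (E v' w' x'))))"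
   by (rule lsw_cong[OF Va(2) v], rule lsw_ht[OF W U w x M]) (intro lin cl Ar; assumption)
  also have "... = lsw ?M V v (%a v'. lsw ?M W w (%b w'. lsw ?M U x (%c x'. tn H ?P ((a ** b) ** c) (?F (ht V W v' w') x'))))"
   by (intro lsw_cong[OF Va(2) v] lsw_cong[OF Wa(2) w] lsw_cong[OF Ua(2) x]) (simp add: Hr.m_assoc assoc_in)
  also have "... = lsw ?M (V >< W) (ht V W v w) (%a s'. lsw ?M U x (%b x'. tn H ?P (a ** b) (?F s' x')))"
   by (rule lsw_ht[OF V W v w M b, symmetric])
  finally show "lcoact ?P (?F (ht V W v w) x) = lsw ?M (V >< W) (ht V W v w) (%a s'. lsw ?M U x (%b x'. tn H ?P (a ** b) (?F s' x')))" .
 qed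
qed

lemma assoc_colin': "colin K H (V >< W) U (V >< (W >< U)) (%s x. tlift (V >< (W >< U)) (%v w. E v w x) s)"
 by (rule assoc_colin)

lemma bhom_associator: "bhom ((V >< W) >< U) (V >< (W >< U)) (associator K H V W U)"
 unfolding associator_eq
proof (rule ht_bhom[OF VW U bbi_ht[OF V WU] assoc_bal])
 let ?P = "V >< (W >< U)"
 fix h s x assume h: "h : cH" and s: "s :< (V >< W)" and x: "x :< U"
 note L = ht_lift(1)[OF V W ht_module[OF V WU] assoc_bal1]
 show "tlift ?P (%v w. E v w x) (lact (V >< W) h s) = lact ?P h (tlift ?P (%v w. E v w x) s)"
  by (rule ht_ext[OF V W ht_module[OF V WU] linear_compose[OF bilinear_r[OF ht_lact_bilinear[OF V W] h] L[OF x]]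
    linear_compose[OF L[OF x] bilinear_r[OF ht_lact_bilinear[OF V WU] h]] _ s])
   (simp add: ht_lact[OF V W] h x assoc_in ht_lact[OF V WU] Ar Va)
 show "tlift ?P (%v w. E v w (ract U x h)) s = ract ?P (tlift ?P (%v w. E v w x) s) h"
  by (rule ht_ext[OF V W ht_module[OF V WU] L[OF Ua(9)[OF h x]]
    linear_compose[OF L[OF x] bilinear_l[OF ht_ract_bilinear[OF V WU] h]] _ s])
   (simp add: ht_ract[OF V WU] h x assoc_in ht_ract[OF W U] Ar Ua)
next
 show "colin K H (V >< W) U (V >< (W >< U)) (%s x. tlift (V >< (W >< U)) (%v w. E v w x) s)" by (rule assoc_colin)
 let ?c = "hcop H"
 note c = bbi_cop[OF V] bbi_cop[OF W] bbi_cop[OF U]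
 have tl: "tlift (htensor_bimodule K ?c (bcop V) (htensor_bimodule K ?c (bcop W) (bcop U))) = tlift (V >< (W >< U))"
  unfolding cop_ht[OF W U, symmetric] cop_ht[OF V WU, symmetric] by simp
 show "colin K ?c (bcop (V >< W)) (bcop U) (bcop (V >< (W >< U)))
   (%s x. tlift (V >< (W >< U)) (%v w. E v w x) s)"
  using hopf_loc.assoc_colin'[OF hopf_loc_cop c]
  unfolding tl unfolding ht_cop_same(2)[OF W U] cop_ht[OF W U, symmetric] cop_ht[OF V W, symmetric]
   ht_cop_same(2)[OF V WU] cop_ht[OF V WU, symmetric] .
qed

private lemma inv_bal1: "v :< V ==> hbal W U ((V >< W) >< U) (%w x. E' v w x)"
 by (intro hbalI lin Ar) (simp_all add: ht_balance[OF VW U, symmetric] ht_ract[OF V W] Ar)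

private lemma inv_in: "x :< U ==> v :< V ==> w :< W ==>
  tlift ((V >< W) >< U) (%w x. E' v w x) (ht W U w x) = E' v w x"
 by (rule ht_lift(2)[OF W U ht_module[OF VW U] inv_bal1])

private lemma inv_bal: "hbal V (W >< U) ((V >< W) >< U) (%v s. tlift ((V >< W) >< U) (%w x. E' v w x) s)"
proof (rule hbalI)
 show "bmap V (W >< U) ((V >< W) >< U) (%v s. tlift ((V >< W) >< U) (%w x. E' v w x) s)"
  by (intro bilinear_mapI ht_lift(1)[OF W U ht_module[OF VW U] inv_bal1] ht_lift_fun[OF W U _ ht_module[OF VW U]] lin Ar; assumption)
 fix v h s assume v: "v :< V" and h: "h : cH" and s: "s :< (W >< U)"
 show "tlift ((V >< W) >< U) (%w x. E' (ract V v h) w x) s = tlift ((V >< W) >< U) (%w x. E' v w x) (lact (W >< U) h s)"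
  by (rule ht_ext[OF W U ht_module[OF VW U] ht_lift(1)[OF W U ht_module[OF VW U] inv_bal1]
    linear_compose[OF bilinear_r[OF ht_lact_bilinear[OF W U] h] ht_lift(1)[OF W U ht_module[OF VW U] inv_bal1[OF v]]] _ s])
   (simp_all add: Va h v inv_in ht_lact[OF W U] ht_balance[OF V W] Wa)
qed

text \<open>An inverse known explicitly on pure tensors. The second hexagon mentions the inverse
  associator through \<open>inv_into\<close> and is evaluated by means of this map.\<close>

definition "assoc_inv = tlift ((V >< W) >< U) (%v s. tlift ((V >< W) >< U) (%w x. E' v w x) s)"

lemma assoc_inv_linear: "lmap (V >< (W >< U)) ((V >< W) >< U) assoc_inv"
 unfolding assoc_inv_def by (rule ht_lift(1)[OF V WU ht_module[OF VW U] inv_bal])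

lemma assoc_inv_gen: "v :< V ==> w :< W ==> x :< U ==> assoc_inv (E v w x) = E' v w x"
 unfolding assoc_inv_def by (subst ht_lift(2)[OF V WU ht_module[OF VW U] inv_bal]) (simp_all add: inv_in Ar)

lemma assoc_inv_l: "t :< ((V >< W) >< U) ==> assoc_inv (associator K H V W U t) = t"
 by (rule ht_ext3l[OF V W U ht_module[OF VW U] linear_compose[OF bhom_linear[OF bhom_associator] assoc_inv_linear] linear_id])
  (simp_all add: associator_gen assoc_inv_gen)

lemma assoc_inv_r: "t :< (V >< (W >< U)) ==> associator K H V W U (assoc_inv t) = t"
 by (rule ht_ext3r[OF V W U ht_module[OF V WU] linear_compose[OF assoc_inv_linear bhom_linear[OF bhom_associator]] linear_id])
  (simp_all add: associator_gen assoc_inv_gen)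

lemma associator_iso: "associator K H V W U : bicovariant_iso K H ((V >< W) >< U) (V >< (W >< U))"
 by (rule bhom_inverse[OF bbi_ht[OF VW U] bbi_ht[OF V WU] bhom_associator _ assoc_inv_l assoc_inv_r])
  (rule linear_closed[OF assoc_inv_linear])

end

lemmas associator_linear = bhom_linear[OF bhom_associator]

lemma bbi_unitI [simp]: "bbi HU" by (rule bbi_unit)

section \<open>Naturality and coherence\<close>

lemma associator_ax:
 assumes b: "bbi V" "bbi V'" "bbi W" "bbi W'" "bbi U" "bbi U'"
 shows "associator_axioms K H V V' W W' U U'"
proof -
 have "associator K H V' W' U' (htensor_map K H (V >< W) U (V' >< W') U' (htensor_map K H V W V' W' f g) e t) =
     htensor_map K H V (W >< U) V' (W' >< U') f (htensor_map K H W U W' U' g e) (associator K H V W U t)"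
  if f: "bhom V V' f" and g: "bhom W W' g" and e: "bhom U U' e" and t: "t :< ((V >< W) >< U)" for f g e t
 proof -
  note fg = bhom_htensor_map[OF b(1,3,2,4) f g] and ge = bhom_htensor_map[OF b(3,5,4,6) g e]
  note VW = bbi_ht[OF b(1,3)] and WU = bbi_ht[OF b(3,5)] and VW' = bbi_ht[OF b(2,4)] and WU' = bbi_ht[OF b(4,6)]
  note l = bhom_htensor_map[OF VW b(5) VW' b(6) fg e, THEN bhom_linear] bhom_htensor_map[OF b(1) WU b(2) WU' f ge, THEN bhom_linear]
  show ?thesis
   by (rule ht_ext3l[OF b(1,3,5) ht_module[OF b(2) WU'] linear_compose[OF l(1) associator_linear[OF b(2,4,6)]]
     linear_compose[OF associator_linear[OF b(1,3,5)] l(2)] _ t])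
    (simp add: associator_gen b htensor_map_gen[OF VW b(5) VW' b(6) fg e] htensor_map_gen[OF b(1) WU b(2) WU' f ge] ht_closed
     htensor_map_gen[OF b(1,3,2,4) f g] htensor_map_gen[OF b(3,5,4,6) g e] bhom_closed[OF f] bhom_closed[OF g] bhom_closed[OF e])
 qed
 then show ?thesis
  unfolding associator_axioms_def Let_def using b by (simp add: bhom_iff associator_iso)
qed

lemma unit_ax:
 assumes b: "bbi V" "bbi V'" shows "unit_axioms K H V V'"
proof -
 have 1: "left_unitor K H V' (htensor_map K H HU V HU V' (identity_map HU) f t) = f (left_unitor K H V t)"
  if f: "bhom V V' f" and t: "t :< (HU >< V)" for f t
  by (rule ht_ext[OF bbi_unit b(1) bb_module[OF b(2)] linear_compose[OF htensor_map_linear[OF bbi_unit b(1) bbi_unit b(2) bhom_id[OF bbi_unit] f] bhom_linear[OF bhom_left_unitor[OF b(2)]]]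
    linear_compose[OF bhom_linear[OF bhom_left_unitor[OF b(1)]] bhom_linear[OF f]] _ t])
   (simp add: htensor_map_gen[OF bbi_unit b(1) bbi_unit b(2) bhom_id[OF bbi_unit] f] left_unitor_gen b bhom_closed[OF f] bhom_lact[OF f] identity_map_apply)
 have 2: "right_unitor K H V' (htensor_map K H V HU V' HU f (identity_map HU) t) = f (right_unitor K H V t)"
  if f: "bhom V V' f" and t: "t :< (V >< HU)" for f t
  by (rule ht_ext[OF b(1) bbi_unit bb_module[OF b(2)] linear_compose[OF htensor_map_linear[OF b(1) bbi_unit b(2) bbi_unit f bhom_id[OF bbi_unit]] bhom_linear[OF bhom_right_unitor[OF b(2)]]]
    linear_compose[OF bhom_linear[OF bhom_right_unitor[OF b(1)]] bhom_linear[OF f]] _ t])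
   (simp add: htensor_map_gen[OF b(1) bbi_unit b(2) bbi_unit f bhom_id[OF bbi_unit]] right_unitor_gen b bhom_closed[OF f] bhom_ract[OF f] identity_map_apply)
 show ?thesis
  unfolding unit_axioms_def Let_def
  using 1 2 b by (simp add: bbi_iff bhom_iff left_unitor_iso right_unitor_iso)
qed

text \<open>On pure tensors the two sides are \<open>v \<otimes> hw\<close> and
  \<open>vh \<otimes> w\<close>, which balance identifies.\<close>

lemma triangle_ax:
 assumes b: "bbi V" "bbi W" shows "triangle_axiom K H V W"
 unfolding triangle_axiom_def Let_def
proof
 fix t assume t: "t :< ((V >< HU) >< W)"
 note VI = bbi_ht[OF b(1) bbi_unit] and IW = bbi_ht[OF bbi_unit b(2)]
 note h1 = htensor_map_linear[OF b(1) IW b(1,2) bhom_id[OF b(1)] bhom_left_unitor[OF b(2)]]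
  and h2 = htensor_map_linear[OF VI b(2) b bhom_right_unitor[OF b(1)] bhom_id[OF b(2)]]
 show "htensor_map K H V (HU >< W) V W (identity_map V) (left_unitor K H W) (associator K H V HU W t) =
     htensor_map K H (V >< HU) W V W (right_unitor K H V) (identity_map W) t"
  by (rule ht_ext3l[OF b(1) bbi_unit b(2) ht_module[OF b] linear_compose[OF associator_linear[OF b(1) bbi_unit b(2)] h1] h2 _ t])
   (simp add: associator_gen b htensor_map_gen[OF b(1) IW b(1,2) bhom_id[OF b(1)] bhom_left_unitor[OF b(2)]]
    htensor_map_gen[OF VI b(2) b bhom_right_unitor[OF b(1)] bhom_id[OF b(2)]] ht_closed left_unitor_gen right_unitor_gen
    identity_map_apply ht_balance)
qed

lemma pentagon_ax:
 assumes b: "bbi V" "bbi W" "bbi U" "bbi X" shows "pentagon_axiom K H V W U X"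
 unfolding pentagon_axiom_def Let_def
proof
 fix t assume t: "t :< (((V >< W) >< U) >< X)"
 note VW = bbi_ht[OF b(1,2)] and WU = bbi_ht[OF b(2,3)] and UX = bbi_ht[OF b(3,4)]
 note WUX = bbi_ht[OF WU b(4)] and WUX' = bbi_ht[OF b(2) UX] and VWU = bbi_ht[OF VW b(3)] and VWU' = bbi_ht[OF b(1) WU]
 note m1 = b(1) WUX b(1) WUX' bhom_id[OF b(1)] bhom_associator[OF b(2,3,4)]
 note m2 = VWU b(4) VWU' b(4) bhom_associator[OF b(1,2,3)] bhom_id[OF b(4)]
 note l = linear_compose[OF associator_linear[OF VW b(3,4)] associator_linear[OF b(1,2) UX]]
  linear_compose[OF linear_compose[OF htensor_map_linear[OF m2] associator_linear[OF b(1) WU b(4)]] htensor_map_linear[OF m1]]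
 show "associator K H V W (U >< X) (associator K H (V >< W) U X t) =
     htensor_map K H V ((W >< U) >< X) V (W >< U >< X) (identity_map V) (associator K H W U X)
      (associator K H V (W >< U) X
       (htensor_map K H ((V >< W) >< U) X (V >< (W >< U)) X (associator K H V W U) (identity_map X) t))"
  by (rule ht_ext4[OF b ht_module[OF b(1) WUX'] l _ t])
   (simp add: associator_gen b bbi_ht ht_closed htensor_map_gen[OF m1] htensor_map_gen[OF m2] identity_map_apply)
qed

end

section \<open>The braiding\<close>

context hopf_loc
begin

abbreviation "LI \<equiv> left_invariant K H"
abbreviation "RI \<equiv> right_invariant K H"

lemma right_invariant_cop: "RI V = left_invariant K (hcop H) (bcop V)"
proof -
 have "rcoact V v = tn V H v u \<longleftrightarrow> flip (rcoact V v) = tn H V u v" for v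
  by (metis flip_flip flip_tensor)
 moreover have "lcoact (bcop V) = (\<lambda>v\<in>carrier V. flip (rcoact V v))" by (simp add: bcop_def)
 ultimately show ?thesis by (auto simp: right_invariant_def left_invariant_def)
qed

lemma left_invariant_cop:
 assumes "bbi V" shows "LI V = right_invariant K (hcop H) (bcop V)"
 using hopf_loc.right_invariant_cop[OF hopf_loc_cop, of "bcop V"]
 by (simp add: cop_cop_hopf cop_cop_bimod[OF assms])

lemma LI_mem: "v : LI V ==> v :< V" and RI_mem: "v : RI V ==> v :< V"
 by (simp_all add: left_invariant_def right_invariant_def)

lemma lsw_LI:
 assumes "v : LI V" "kmod V" "kmod M" "bmap H V M F"
 shows "lsw M V v F = F u v"
 using assms tl_tensor[OF modH assms(2-4), of u v] by (simp add: lsw_def left_invariant_def)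

lemma lsw_RI:
 assumes "v : RI V" "kmod V" "kmod M" "bmap H V M F"
 shows "lsw M (bcop V) v F = F u v"
 using hopf_loc.lsw_LI[OF hopf_loc_cop, of v "bcop V" M F] assms by (simp add: right_invariant_cop)

lemma LI_I:
 assumes c: "coact V" and v: "v :< V"
  and e: "lsw (ts H V) V v (tn H V) = tn H V u v"
 shows "v : LI V"
 using lcolin_id[OF c] v e by (simp add: left_invariant_def lcolin_def)

lemma RI_I:
 assumes c: "coact (bcop V)" and v: "v :< V"
  and e: "lsw (ts H V) (bcop V) v (tn H V) = tn H V u v"
 shows "v : RI V"
 unfolding right_invariant_cop
 by (rule hopf_loc.LI_I[OF hopf_loc_cop]) (simp_all add: coact_cop c v e)

section \<open>Projections on invariant elements, and the structure theorem for Hopf modules\<close>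

definition linv where "linv V v = lsw V V v (%a v'. lact V (S a) v')"
text \<open>The map \<open>v_0 S(v_1)\<close>. This is not the mirror image of \<open>linv\<close>
  under \<open>bcop\<close>, which would be the left action of the inverse antipode; it is chosen so
  that elements take the form \<open>w g\<close> with \<open>w\<close> right-invariant, as in the
  condition on the braiding.\<close>

definition rinv where "rinv V v = lsw V (bcop V) v (%a v'. ract V v' (S a))"

context
 fixes V :: "('k, 'h, 'v) bimodule"
 assumes V: "bbi V"
begin

private lemmas Vb = bb_rules[OF V] and lcV = bic_lc[OF bb_bic[OF V]] and clcV = bic_cop_lc[OF bb_bic[OF V]]

lemmas cop_lin = cop_lsw[OF Vb(3)]

lemma cop_cong: "v :< V ==> (!!h x. h : cH ==> x :< V ==> F h x = F' h x) ==>
  lsw M (bcop V) v F = lsw M (bcop V) v F'"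
 by (rule lsw_cong[OF Vb(3)]) simp_all

text \<open>In iterated right coactions the outer sum yields the outermost factor, hence the
  exchanged arguments on the right-hand side.\<close>

lemma lsw_cop_coassoc:
 assumes v: "v :< V" and M: "kmod M" and F: "trilinear_map H H V M F"
 shows "lsw M (bcop V) v (%h x. lsw M (bcop V) x (%g y. F h g y)) =
     lsw M (bcop V) v (%h x. sw M h (%a b. F b a x))"
proof -
 have "trilinear_map (hcop H) (hcop H) (bcop V) M F" using F by (simp add: trilinear_map_def)
 from coalg.lsw_coassoc[OF coalg_cop clcV _ M this, of v] v
 have "lsw M (bcop V) v (%h x. lsw M (bcop V) x (%g y. F h g y)) =
    lsw M (bcop V) v (%h x. csw M h (%a b. F a b x))" by simp
 also have "... = lsw M (bcop V) v (%h x. sw M h (%a b. F b a x))"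
  using F by (intro cop_cong v sw_cop_raw M bilinear_mapI) (auto simp: trilinear_map_def)
 finally show ?thesis .
qed

lemma lsw_cop_counit:
 assumes v: "v :< V" and M: "kmod M" and f: "lmap V M f"
 shows "lsw M (bcop V) v (%h x. eps h *[M] f x) = f v"
 using coalg.lsw_counit[OF coalg_cop clcV _ M, of v f] v f by simp

lemma lsw_cop_lact:
 assumes h: "h : cH" and v: "v :< V" and M: "kmod M" and F: "bmap H V M F"
 shows "lsw M (bcop V) (lact V h v) F = sw M h (%h' a. lsw M (bcop V) v (%b v'. F (a ** b) (lact V h' v')))"
proof -
 note Fr = linear_bil_l[OF F] linear_bil_r[OF F]
 have "lsw M (bcop V) (lact V h v) F = csw M h (%a h'. lsw M (bcop V) v (%b v'. F (a ** b) (lact V h' v')))"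
  using hopf_loc.lsw_lact[OF hopf_loc_cop bbi_cop[OF V], of h v M F] h v M F by simp
 also have "... = sw M h (%h' a. lsw M (bcop V) v (%b v'. F (a ** b) (lact V h' v')))"
  by (rule sw_cop_raw[OF h M]) (intro lin cl Fr Vb cop_lin M v; assumption)
 finally show ?thesis .
qed

lemma lsw_cop_ract:
 assumes h: "h : cH" and v: "v :< V" and M: "kmod M" and F: "bmap H V M F"
 shows "lsw M (bcop V) (ract V v h) F = lsw M (bcop V) v (%a v'. sw M h (%h' b. F (a ** b) (ract V v' h')))"
proof -
 note Fr = linear_bil_l[OF F] linear_bil_r[OF F]
 have "lsw M (bcop V) (ract V v h) F = lsw M (bcop V) v (%a v'. csw M h (%b h'. F (a ** b) (ract V v' h')))"
  using hopf_loc.lsw_ract[OF hopf_loc_cop bbi_cop[OF V], of h v M F] h v M F by simp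
 also have "... = lsw M (bcop V) v (%a v'. sw M h (%h' b. F (a ** b) (ract V v' h')))"
  by (rule cop_cong[OF v], rule sw_cop_raw[OF h M]) (intro lin cl Fr Vb M; assumption)
 finally show ?thesis .
qed

lemma linv_linear: "lmap V V (linv V)"
 unfolding linv_def[abs_def] by (intro lin cl Vb; assumption)

lemma rinv_linear: "lmap V V (rinv V)"
 unfolding rinv_def[abs_def] by (intro lin cop_lin cl Vb; assumption)

lemma linv_lin: "lmap X V f ==> lmap X V (%x. linv V (f x))"
 by (rule linear_compose[OF _ linv_linear])

lemma linv_closed: "v :< V ==> linv V v :< V" by (rule linear_closed[OF linv_linear])
lemma rinv_closed: "v :< V ==> rinv V v :< V" by (rule linear_closed[OF rinv_linear])

text \<open>As \<open>S\<close> reverses coproducts, the coaction of \<open>S(v_-1) v_0\<close> is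
  \<open>S(v_-2) v_-1 \<otimes> S(v_-3) v_0\<close>, and the antipode axiom collapses the first
  factor to the unit.\<close>

lemma linv_LI:
 assumes v: "v :< V" shows "linv V v : LI V"
proof (rule LI_I[OF Vb(2) linv_closed[OF v]])
 let ?M = "ts H V" and ?F = "tn H V"
 have M: "kmod ?M" by (intro cl Vb)
 note F = bilinear_tensor[OF modH Vb(1)]
 note R = lin cl Vb
 have "lsw ?M V (linv V v) ?F = lsw ?M V v (%a v'. lsw ?M V (lact V (S a) v') ?F)"
  unfolding linv_def by (rule lsw_push[OF Vb(2) v Vb(1) M _ lsw_linear[OF Vb(2) F M]]) (intro Vb cl; assumption)
 also have "... = lsw ?M V v (%a v'. sw ?M (S a) (%s s'. lsw ?M V v' (%b v''. ?F (s ** b) (lact V s' v''))))"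
  by (intro lsw_cong[OF Vb(2) v] lsw_lact[OF V _ _ M F] S_closed; assumption)
 also have "... = lsw ?M V v (%a v'. sw ?M a (%a1 a2. lsw ?M V v' (%b v''. ?F (S a2 ** b) (lact V (S a1) v''))))"
  by (rule lsw_cong[OF Vb(2) v], rule S_comult[OF _ M], assumption) (intro R; assumption)
 also have "... = lsw ?M V v (%a v'. lsw ?M V v' (%b v''. sw ?M a (%a1 a2. ?F (S a2 ** b) (lact V (S a1) v''))))"
  by (rule lsw_cong[OF Vb(2) v], rule lsw_sw_swap[OF Vb(2) _ _ M, symmetric], assumption, assumption) (intro cl Vb; assumption)
 also have "... = lsw ?M V v (%x v'. sw ?M x (%a b. sw ?M a (%a1 a2. ?F (S a2 ** b) (lact V (S a1) v'))))"
  by (rule lsw_coassoc[OF lcV v M, symmetric]) (intro R; assumption)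
 also have "... = lsw ?M V v (%x v'. sw ?M x (%a1 y. sw ?M y (%a2 b. ?F (S a2 ** b) (lact V (S a1) v'))))"
  by (rule lsw_cong[OF Vb(2) v], rule sw_coassoc[OF _ M], assumption) (intro R; assumption)
 also have "... = lsw ?M V v (%x v'. sw ?M x (%a1 y. eps y *[?M] ?F u (lact V (S a1) v')))"
  by (rule lsw_cong[OF Vb(2) v], rule sw_cong, assumption, rule antipode_l[OF _ M], assumption) (intro R; assumption)
 also have "... = lsw ?M V v (%x v'. ?F u (lact V (S x) v'))"
  by (rule lsw_cong[OF Vb(2) v], rule sw_counit_r[OF _ M], assumption) (intro R; assumption)
 also have "... = ?F u (linv V v)"
  unfolding linv_def
  by (rule lsw_push[symmetric, OF Vb(2) v Vb(1) M _ bilinear_r[OF F Hr.one_closed]]) (intro Vb cl; assumption)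
 finally show "lsw ?M V (linv V v) ?F = ?F u (linv V v)" .
qed

lemma linv_recon:
 assumes v: "v :< V" shows "lsw V V v (%a v'. lact V a (linv V v')) = v"
proof -
 note R = lin cl Vb
 have "lsw V V v (%a v'. lact V a (linv V v')) = lsw V V v (%a v'. lsw V V v' (%b v''. lact V (a ** S b) v''))"
 proof (rule lsw_cong[OF Vb(2) v])
  fix a v' assume a: "a : cH" and v': "v' :< V"
  have "lact V a (linv V v') = lsw V V v' (%b v''. lact V a (lact V (S b) v''))"
   unfolding linv_def by (rule lsw_push[OF Vb(2) v' Vb(1) Vb(1) _ bilinear_r[OF bb_lact[OF V] a]]) (intro Vb cl; assumption)
  also have "... = lsw V V v' (%b v''. lact V (a ** S b) v'')"
   by (rule lsw_cong[OF Vb(2) v']) (simp add: lact_mult[OF V] a)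
  finally show "lact V a (linv V v') = lsw V V v' (%b v''. lact V (a ** S b) v'')" .
 qed
 also have "... = lsw V V v (%x v'. sw V x (%a b. lact V (a ** S b) v'))"
  by (rule lsw_coassoc[OF lcV v Vb(1), symmetric]) (intro R; assumption)
 also have "... = lsw V V v (%x v'. eps x *[V] lact V u v')"
  by (rule lsw_cong[OF Vb(2) v], rule antipode_r[OF _ Vb(1)], assumption) (intro R; assumption)
 also have "... = lact V u v"
  by (rule lsw_counit[OF lcV v Vb(1)]) (intro R)
 finally show ?thesis using v by (simp add: lact_one[OF V])
qed

lemma linv_fix: "v : LI V ==> linv V v = v"
proof -
 assume v: "v : LI V"
 have "linv V v = lact V (S u) v" unfolding linv_def
  by (rule lsw_LI[OF v Vb(1) Vb(1)]) (intro lin cl Vb; assumption)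
 then show ?thesis using LI_mem[OF v] by (simp add: S_one lact_one[OF V])
qed

text \<open>\<open>S(h_1 v_-1) h_2 v_0\<close> is \<open>S(v_-1) S(h_1) h_2 v_0\<close>, where the
  antipode axiom removes \<open>h\<close>.\<close>

lemma linv_lact:
 assumes h: "h : cH" and v: "v :< V" shows "linv V (lact V h v) = eps h *[V] linv V v"
proof -
 note R = lin cl Vb
 have "linv V (lact V h v) = sw V h (%a h'. lsw V V v (%b v'. lact V (S (a ** b)) (lact V h' v')))"
  unfolding linv_def by (rule lsw_lact[OF V h v Vb(1)]) (intro R; assumption)
 also have "... = sw V h (%a h'. lsw V V v (%b v'. lact V (S b ** (S a ** h')) v'))"
  by (intro sw_cong[OF h] lsw_cong[OF Vb(2) v]) (simp add: S_mult lact_mult[OF V, symmetric] Hr.m_assoc)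
 also have "... = eps h *[V] lsw V V v (%b v'. lact V (S b ** u) v')"
  by (rule antipode_l[OF h Vb(1)]) (intro R v; assumption)
 also have "lsw V V v (%b v'. lact V (S b ** u) v') = linv V v"
  unfolding linv_def by (rule lsw_cong[OF Vb(2) v]) simp
 finally show ?thesis .
qed

text \<open>The right action of \<open>H\<close>, seen through the projection, is the right adjoint
  action. This links the compact form of the braiding with the one that contains
  \<open>S\<close>.\<close>

lemma linv_ract:
 assumes h: "h : cH" and v: "v :< V"
 shows "linv V (ract V v h) = sw V h (%a b. lact V (S a) (ract V (linv V v) b))"
proof -
 note R = lin cl Vb
 have "linv V (ract V v h) = lsw V V v (%a v'. sw V h (%b h'. lact V (S (a ** b)) (ract V v' h')))"
  unfolding linv_def by (rule lsw_ract[OF V h v Vb(1)]) (intro R; assumption)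
 also have "... = sw V h (%b h'. lsw V V v (%a v'. lact V (S (a ** b)) (ract V v' h')))"
  by (rule lsw_sw_swap[OF Vb(2) v h Vb(1)]) (intro cl Vb; assumption)
 also have "... = sw V h (%b h'. lsw V V v (%a v'. lact V (S b) (ract V (lact V (S a) v') h')))"
  by (intro sw_cong[OF h] lsw_cong[OF Vb(2) v]) (simp add: S_mult lact_mult[OF V] lact_ract[OF V] Vb)
 also have "... = sw V h (%a b. lact V (S a) (ract V (linv V v) b))"
  unfolding linv_def
  by (rule sw_cong[OF h], rule lsw_push[symmetric, OF Vb(2) v Vb(1) Vb(1)]) (intro R; assumption)+
 finally show ?thesis .
qed

lemma rinv_RI:
 assumes v: "v :< V" shows "rinv V v : RI V"
proof (rule RI_I[OF Vb(3) rinv_closed[OF v]])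
 let ?M = "ts H V" and ?F = "tn H V" and ?W = "bcop V"
 have M: "kmod ?M" by (intro cl Vb)
 note F = bilinear_tensor[OF modH Vb(1)]
 note R = lin cl cop_lin Vb
 have "lsw ?M ?W (rinv V v) ?F = lsw ?M ?W v (%a v'. lsw ?M ?W (ract V v' (S a)) ?F)"
  unfolding rinv_def using v
  by (intro lsw_push[OF Vb(3) _ Vb(1) M _ cop_lin(1)[OF M linear_id F]]) (simp_all add: Vb)
 also have "... = lsw ?M ?W v (%a v'. lsw ?M ?W v' (%b v''. sw ?M (S a) (%h' c. ?F (b ** c) (ract V v'' h'))))"
  by (intro cop_cong[OF v] lsw_cop_ract[OF _ _ M F] S_closed; assumption)
 also have "... = lsw ?M ?W v (%a v'. lsw ?M ?W v' (%b v''. sw ?M a (%c h'. ?F (b ** S c) (ract V v'' (S h')))))"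
  by (rule cop_cong[OF v], rule cop_cong, assumption, rule S_comult[OF _ M], assumption) (intro R; assumption)
 also have "... = lsw ?M ?W v (%x v'. sw ?M x (%b a. sw ?M a (%c h'. ?F (b ** S c) (ract V v' (S h')))))"
  by (rule lsw_cop_coassoc[OF v M]) (intro R; assumption)
 also have "... = lsw ?M ?W v (%x v'. sw ?M x (%y h'. sw ?M y (%b c. ?F (b ** S c) (ract V v' (S h')))))"
  by (rule cop_cong[OF v], rule sw_coassoc[OF _ M, symmetric], assumption) (intro R; assumption)
 also have "... = lsw ?M ?W v (%x v'. sw ?M x (%y h'. eps y *[?M] ?F u (ract V v' (S h'))))"
  by (rule cop_cong[OF v], rule sw_cong, assumption, rule antipode_r[OF _ M], assumption) (intro R; assumption)
 also have "... = lsw ?M ?W v (%x v'. ?F u (ract V v' (S x)))"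
  by (rule cop_cong[OF v], rule sw_counit_l[OF _ M], assumption) (intro R; assumption)
 also have "... = ?F u (rinv V v)"
  unfolding rinv_def using v
  by (intro lsw_push[symmetric, OF Vb(3) _ Vb(1) M _ bilinear_r[OF F Hr.one_closed]]) (simp_all add: Vb)
 finally show "lsw ?M ?W (rinv V v) ?F = ?F u (rinv V v)" .
qed

lemma rinv_recon:
 assumes v: "v :< V" shows "lsw V (bcop V) v (%a v'. ract V (rinv V v') a) = v"
proof -
 let ?W = "bcop V"
 note R = lin cl cop_lin Vb
 have "lsw V ?W v (%a v'. ract V (rinv V v') a) = lsw V ?W v (%a v'. lsw V ?W v' (%b v''. ract V v'' (S b ** a)))"
 proof (rule cop_cong[OF v])
  fix a v' assume a: "a : cH" and v': "v' :< V"
  have "ract V (rinv V v') a = lsw V ?W v' (%b v''. ract V (ract V v'' (S b)) a)"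
   unfolding rinv_def using v' 
   by (intro lsw_push[OF Vb(3) _ Vb(1) Vb(1) _ bilinear_l[OF bb_ract[OF V] a]]) (simp_all add: Vb)
  also have "... = lsw V ?W v' (%b v''. ract V v'' (S b ** a))"
   by (rule cop_cong[OF v']) (simp add: ract_mult[OF V] a)
  finally show "ract V (rinv V v') a = lsw V ?W v' (%b v''. ract V v'' (S b ** a))" .
 qed
 also have "... = lsw V ?W v (%x v'. sw V x (%b a. ract V v' (S b ** a)))"
  by (rule lsw_cop_coassoc[OF v Vb(1)]) (intro R; assumption)
 also have "... = lsw V ?W v (%x v'. eps x *[V] ract V v' u)"
  by (rule cop_cong[OF v], rule antipode_l[OF _ Vb(1)], assumption) (intro R; assumption)
 also have "... = ract V v u"
  by (rule lsw_cop_counit[OF v Vb(1)]) (intro R)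
 finally show ?thesis using v by (simp add: ract_one[OF V])
qed

text \<open>From \<open>v = v_-1 P(v_0)\<close>: the products \<open>h v\<close> with
  \<open>v\<close> left-invariant span the bimodule. This is the generating half of the structure
  theorem for Hopf modules.\<close>

lemma span_left:
 assumes M: "kmod M" and f: "lmap V M f" and g: "lmap V M g"
  and eq: "!!h v. h : cH ==> v : LI V ==> f (lact V h v) = g (lact V h v)" and v: "v :< V"
 shows "f v = g v"
proof -
 have "phi v = lsw M V v (%a v'. phi (lact V a (linv V v')))" if "lmap V M phi" for phi
  by (subst linv_recon[OF v, symmetric], rule lsw_push[OF Vb(2) v Vb(1) M _ that]) (intro Vb linv_closed; assumption)
 from this[OF f] this[OF g] show ?thesis
  by (simp add: lsw_cong[OF Vb(2) v eq[OF _ linv_LI]])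
qed

lemma span_right:
 assumes M: "kmod M" and f: "lmap V M f" and g: "lmap V M g"
  and eq: "!!h v. h : cH ==> v : RI V ==> f (ract V v h) = g (ract V v h)" and v: "v :< V"
 shows "f v = g v"
proof -
 have "phi v = lsw M (bcop V) v (%a v'. phi (ract V (rinv V v') a))" if "lmap V M phi" for phi
  using lsw_push[OF Vb(3) _ Vb(1) M _ that, of v "%a v'. ract V (rinv V v') a"] v
  by (simp add: rinv_recon Vb rinv_closed)
 from this[OF f] this[OF g] show ?thesis
  by (simp add: cop_cong[OF v eq[OF _ rinv_RI]])
qed

text \<open>The left coaction of a right-invariant element has right-invariant second components:
  after the coactions are exchanged, the right coaction contained in \<open>rinv\<close> acts on
  \<open>v\<close> itself and is trivial there.\<close>

lemma RI_coact:
 assumes v: "v : RI V" and M: "kmod M" and F: "bmap H V M F"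
 shows "lsw M V v (%b w. F b (rinv V w)) = lsw M V v F"
proof -
 note vm = RI_mem[OF v]
 note Fr = linear_bil_l[OF F] linear_bil_r[OF F]
 note R = lin cl cop_lin Vb Fr M
 have "lsw M V v (%b w. F b (rinv V w)) = lsw M V v (%b w. lsw M (bcop V) w (%c w'. F b (ract V w' (S c))))"
  unfolding rinv_def
  by (rule lsw_cong[OF Vb(2) vm], rule lsw_push[OF Vb(3) _ Vb(1) M _ bilinear_r[OF F]]) (simp_all add: Vb)
 also have "... = lsw M (bcop V) v (%c w. lsw M V w (%b w'. F b (ract V w' (S c))))"
  by (rule bic_comm[OF bb_bic[OF V] vm M]) (intro R; assumption)
 also have "... = lsw M V v (%b w'. F b (ract V w' (S u)))"
  by (rule lsw_RI[OF v Vb(1) M]) (intro R; assumption)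
 also have "... = lsw M V v F"
  by (rule lsw_cong[OF Vb(2) vm]) (simp add: S_one ract_one[OF V])
 finally show ?thesis .
qed

end

lemma lcolin_LI:
 assumes f: "lcolin K H V W f" "lmap V W f" and m: "kmod V" "kmod W" and v: "v : LI V"
 shows "f v : LI W"
proof -
 note vm = LI_mem[OF v]
 have "lcoact W (f v) = lsw (ts H W) V v (%h v'. tn H W h (f v'))"
  using f(1) vm by (simp add: lcolin_def)
 also have "... = tn H W u (f v)"
  by (rule lsw_LI[OF v m(1)]) (intro cl lin m f linear_closed[OF f(2)]; assumption)+
 finally show ?thesis using linear_closed[OF f(2) vm] by (simp add: left_invariant_def)
qed

lemma bhom_LI: "bbi V ==> bbi W ==> bhom V W f ==> v : LI V ==> f v : LI W"
 by (rule lcolin_LI) (simp_all add: bhom_def bb_module)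

lemma bhom_RI: "bbi V ==> bbi W ==> bhom V W f ==> v : RI V ==> f v : RI W"
 unfolding right_invariant_cop
 by (rule hopf_loc.lcolin_LI[OF hopf_loc_cop]) (simp_all add: bhom_def bb_module)

lemma ht_LI:
 assumes V: "bbi V" and W: "bbi W" and v: "v : LI V" and w: "w : LI W"
 shows "ht V W v w : LI (V >< W)"
proof -
 let ?M = "ts H (V >< W)"
 note Vb = bb_rules[OF V] and Wb = bb_rules[OF W] and Tr = ht_rules[OF V W]
 note vm = LI_mem[OF v] and wm = LI_mem[OF w]
 have M: "kmod ?M" by (intro cl Tr)
 have "lcoact (V >< W) (ht V W v w) = lsw ?M V v (%a v'. lsw ?M W w (%b w'. tn H (V >< W) (a ** b) (ht V W v' w')))"
  using ht_colin[OF V W] vm wm by (simp add: colin_def)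
 also have "... = lsw ?M W w (%b w'. tn H (V >< W) (u ** b) (ht V W v w'))"
  by (rule lsw_LI[OF v Vb(1) M]) (intro lin cl Wb Tr wm; assumption)
 also have "... = tn H (V >< W) (u ** u) (ht V W v w)"
  by (rule lsw_LI[OF w Wb(1) M]) (intro lin cl Wb Tr vm; assumption)
 finally show ?thesis using vm wm Tr by (simp add: left_invariant_def)
qed

lemma ht_RI: "bbi V ==> bbi W ==> v : RI V ==> w : RI W ==> ht V W v w : RI (V >< W)"
 using hopf_loc.ht_LI[OF hopf_loc_cop bbi_cop bbi_cop, of V W v w]
 by (simp add: right_invariant_cop cop_ht[symmetric] ht_cop_same(2))

text \<open>The condition defining the braiding concerns only these elements. Since they span, it
  determines the braiding, and identities of maps on the tensor product may be checked on
  them.\<close>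

lemma span_ht:
 assumes V: "bbi V" and W: "bbi W" and M: "kmod M"
  and f: "lmap (V >< W) M f" and g: "lmap (V >< W) M g"
  and eq: "!!h v w k. h : cH ==> k : cH ==> v : LI V ==> w : RI W ==>
   f (ht V W (lact V h v) (ract W w k)) = g (ht V W (lact V h v) (ract W w k))"
  and t: "t :< (V >< W)"
 shows "f t = g t"
proof (rule ht_ext[OF V W M f g _ t])
 fix x y assume x: "x :< V" and y: "y :< W"
 note B = ht_bilinear[OF V W]
 show "f (ht V W x y) = g (ht V W x y)"
 proof (rule span_left[OF V M linear_compose[OF bilinear_l[OF B y] f] linear_compose[OF bilinear_l[OF B y] g] _ x])
  fix h v assume h: "h : cH" and v: "v : LI V"
  have hv: "lact V h v :< V" using bb_rules(8)[OF V h LI_mem[OF v]] .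
  show "f (ht V W (lact V h v) y) = g (ht V W (lact V h v) y)"
   by (rule span_right[OF W M linear_compose[OF bilinear_r[OF B hv] f] linear_compose[OF bilinear_r[OF B hv] g] _ y])
    (rule eq[OF h _ v])
 qed
qed

end

section \<open>Construction of the braiding\<close>

context hopf_loc
begin

context
 fixes V :: "('k, 'h, 'v) bimodule" and W :: "('k, 'h, 'w) bimodule"
 assumes V: "bbi V" and W: "bbi W"
begin

private lemmas Vc = bb_rules[OF V] linv_lin[OF V] linv_closed[OF V] and Wc = bb_rules[OF W]
 and Tc = ht_rules[OF W V] and WVc = bbi_ht[OF W V] and VWc = bbi_ht[OF V W]
private abbreviation "Bb \<equiv> ht W V"
private abbreviation "Mb \<equiv> W >< V"
private abbreviation "cW \<equiv> bcop W"

text \<open>The map \<open>v_-1 w_0 \<otimes> P(v_0 w_1)\<close>. By \<open>linv_ract\<close> it is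
  the formula with \<open>S(w_1)\<close>, but in this form balance follows at once from the
  colinearity of the actions.\<close>

definition braid_formula where
 "braid_formula v w = lsw Mb V v (%a v'. lsw Mb cW w (%x w'. Bb (lact W a w') (linv V (ract V v' x))))"

private lemma mM: "kmod Mb" by (rule Tc)

private lemmas R = lin cl Vc Wc Tc cop_lin[OF W]

lemma braid_formula_bilinear: "bmap V W Mb braid_formula"
 unfolding braid_formula_def[abs_def] by (intro R; assumption)

lemma braid_formula_bal: "hbal V W Mb braid_formula"
proof (rule hbalI[OF braid_formula_bilinear])
 fix v h w assume v: "v :< V" and h: "h : cH" and w: "w :< W"
 have "braid_formula (ract V v h) w = lsw Mb V v (%a v'. sw Mb h (%b h'. lsw Mb cW w (%x w'. Bb (lact W (a ** b) w') (linv V (ract V (ract V v' h') x)))))"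
  unfolding braid_formula_def by (rule lsw_ract[OF V h v mM]) (intro R w; assumption)
 also have "... = lsw Mb V v (%a v'. sw Mb h (%b h'. lsw Mb cW w (%x w'. Bb (lact W a (lact W b w')) (linv V (ract V v' (h' ** x))))))"
  by (intro lsw_cong[OF Vc(2) v] sw_cong[OF h] cop_cong[OF W w]) (simp add: lact_mult[OF W] ract_mult[OF V])
 also have "... = braid_formula v (lact W h w)"
  unfolding braid_formula_def
  by (rule lsw_cong[OF Vc(2) v], rule lsw_cop_lact[OF W h w mM, symmetric]) (intro R; assumption)
 finally show "braid_formula (ract V v h) w = braid_formula v (lact W h w)" .
qed

lemma braid_formula_gen:
 assumes h: "h : cH" and g: "g : cH" and v: "v : LI V" and w: "w : RI W"
 shows "braid_formula (lact V h v) (ract W w g) = Bb (lact W h w) (ract V v g)"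
proof -
 note vm = LI_mem[OF v] and wm = RI_mem[OF w]
 interpret M: module K Mb by (rule mM)
 have 1: "lsw Mb cW (ract W w g) (%x w'. Bb (lact W a w') (linv V (ract V v' x))) = sw Mb g (%g' d. Bb (lact W a (ract W w g')) (linv V (ract V v' (u ** d))))"
  if a: "a : cH" and v': "v' :< V" for a v'
 proof -
  have "lsw Mb cW (ract W w g) (%x w'. Bb (lact W a w') (linv V (ract V v' x)))
    = lsw Mb cW w (%c w'. sw Mb g (%g' d. Bb (lact W a (ract W w' g')) (linv V (ract V v' (c ** d)))))"
   by (rule lsw_cop_ract[OF W g wm mM]) (intro R a v'; assumption)
  also have "... = sw Mb g (%g' d. Bb (lact W a (ract W w g')) (linv V (ract V v' (u ** d))))"
   by (rule lsw_RI[OF w Wc(1) mM]) (intro R a v' g; assumption)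
  finally show ?thesis .
 qed
 have "braid_formula (lact V h v) (ract W w g)
   = sw Mb h (%a h'. lsw Mb V v (%b v'. lsw Mb cW (ract W w g) (%x w'. Bb (lact W (a ** b) w') (linv V (ract V (lact V h' v') x)))))"
  unfolding braid_formula_def by (rule lsw_lact[OF V h vm mM]) (intro R wm g; assumption)
 also have "... = sw Mb h (%a h'. lsw Mb cW (ract W w g) (%x w'. Bb (lact W (a ** u) w') (linv V (ract V (lact V h' v) x))))"
  by (rule sw_cong[OF h], rule lsw_LI[OF v Vc(1) mM]) (intro R wm g; assumption)
 also have "... = sw Mb h (%a h'. sw Mb g (%g' d. Bb (lact W (a ** u) (ract W w g')) (linv V (ract V (lact V h' v) (u ** d)))))"
  by (rule sw_cong[OF h], rule 1) (intro R vm; assumption)+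
 \<comment> \<open>The projection turns the left factor \<open>h'\<close> into
   \<open>eps h'\<close>, by \<open>linv_lact\<close>.\<close>
 also have "... = sw Mb h (%a h'. sw Mb g (%g' d. eps h' *[Mb] Bb (lact W a (ract W w g')) (linv V (ract V v d))))"
  by (intro sw_cong[OF h] sw_cong[OF g])
   (simp add: vm wm Vc Wc lact_ract[OF V] linv_lact[OF V] linear_smult[OF bilinear_r[OF ht_bilinear[OF W V]]])
 also have "... = sw Mb h (%a h'. eps h' *[Mb] sw Mb g (%g' d. Bb (lact W a (ract W w g')) (linv V (ract V v d))))"
  by (rule sw_cong[OF h], rule sw_push[OF g mM mM, symmetric]) (intro R mM vm wm; assumption)+
 also have "... = sw Mb g (%g' d. Bb (lact W h (ract W w g')) (linv V (ract V v d)))"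
  by (rule sw_counit_r[OF h mM]) (intro R vm wm g)
 also have "... = sw Mb g (%g' y. sw Mb y (%c d. Bb (lact W h (ract W w g')) (lact V (S c) (ract V v d))))"
 proof (rule sw_cong[OF g])
  fix g' y assume g': "g' : cH" and y: "y : cH"
  have "linv V (ract V v y) = sw V y (%c d. lact V (S c) (ract V v d))"
   by (simp add: linv_ract[OF V y vm] linv_fix[OF V v])
  then show "Bb (lact W h (ract W w g')) (linv V (ract V v y)) = sw Mb y (%c d. Bb (lact W h (ract W w g')) (lact V (S c) (ract V v d)))"
   using sw_push[OF y Vc(1) mM _ bilinear_r[OF ht_bilinear[OF W V]], of "%c d. lact V (S c) (ract V v d)" "lact W h (ract W w g')"]
   by (simp add: Vc Wc g' h vm wm)
 qed
 also have "... = sw Mb g (%x d. sw Mb x (%g' c. Bb (lact W h (ract W w g')) (lact V (S c) (ract V v d))))"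
  by (rule sw_coassoc[OF g mM, symmetric]) (intro R vm wm h; assumption)
 \<comment> \<open>In \<open>h w g_1 \<otimes> S(g_2) v g_3\<close> the factor \<open>S(g_2)\<close>
   crosses the tensor sign by balance, meets \<open>g_1\<close>, and the two cancel.\<close>
 also have "... = sw Mb g (%x d. sw Mb x (%g' c. Bb (lact W h (ract W w (g' ** S c))) (ract V v d)))"
 proof (rule sw_cong[OF g], rule sw_cong)
  fix x d g' c assume x: "x : cH" and d: "d : cH" and g': "g' : cH" and c: "c : cH"
  have "Bb (lact W h (ract W w (g' ** S c))) (ract V v d) = Bb (ract W (lact W h (ract W w g')) (S c)) (ract V v d)"
   using g' c h wm by (simp add: ract_mult[OF W] lact_ract[OF W] Wc)
  also have "... = Bb (lact W h (ract W w g')) (lact V (S c) (ract V v d))"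
   by (rule ht_balance[OF W V]) (simp_all add: Wc Vc h g' c d wm vm)
  finally show "Bb (lact W h (ract W w g')) (lact V (S c) (ract V v d)) = Bb (lact W h (ract W w (g' ** S c))) (ract V v d)" by simp
 qed
 also have "... = sw Mb g (%x d. eps x *[Mb] Bb (lact W h (ract W w u)) (ract V v d))"
  by (rule sw_cong[OF g], rule antipode_r[OF _ mM], assumption) (intro R vm wm h; assumption)
 also have "... = Bb (lact W h (ract W w u)) (ract V v g)"
  by (rule sw_counit_l[OF g mM]) (intro R vm wm h)
 finally show ?thesis by (simp add: ract_one[OF W] wm)
qed

lemma is_braiding_formula: "is_braiding K H V W (\<lambda>t\<in>carrier (V >< W). tlift Mb braid_formula t)"
 unfolding is_braiding_def
 by (intro conjI ballI restrict_extensional restrict_linear[OF ht_lift(1)[OF V W mM braid_formula_bal] ht_module[OF V W]])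
  (simp only: ht_eval[OF V W mM braid_formula_bal Vc(8)[OF _ LI_mem] Wc(9)[OF _ RI_mem]] braid_formula_gen)

lemma is_braiding_unique:
 assumes p: "is_braiding K H V W \<Psi>" and q: "is_braiding K H V W \<Psi>'" shows "\<Psi> = \<Psi>'"
proof (rule extensionalityI)
 show "\<Psi> : extensional (carrier (V >< W))" "\<Psi>' : extensional (carrier (V >< W))"
  using p q by (simp_all add: is_braiding_def)
 fix t assume t: "t :< (V >< W)"
 show "\<Psi> t = \<Psi>' t"
  by (rule span_ht[OF V W mM _ _ _ t]) (use p q in \<open>simp_all add: is_braiding_def\<close>)
qed

lemma braiding_unique: "\<exists>!\<Psi>. is_braiding K H V W \<Psi>"
 using is_braiding_formula is_braiding_unique by blast

lemma is_braiding_braiding: "is_braiding K H V W (braiding K H V W)"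
 unfolding braiding_def by (rule theI'[OF braiding_unique])

lemma braiding_linear: "lmap (V >< W) Mb (braiding K H V W)"
 using is_braiding_braiding by (simp add: is_braiding_def)

lemma braiding_gen:
 "h : cH ==> g : cH ==> v : LI V ==> w : RI W ==>
  braiding K H V W (ht V W (lact V h v) (ract W w g)) = Bb (lact W h w) (ract V v g)"
 using is_braiding_braiding by (simp add: is_braiding_def)

lemma braiding_gen_l:
 "h : cH ==> v : LI V ==> w : RI W ==> braiding K H V W (ht V W (lact V h v) w) = Bb (lact W h w) v"
 using braiding_gen[of h u v w] by (simp add: ract_one[OF W] ract_one[OF V] RI_mem LI_mem)

lemma braiding_gen_r:
 "g : cH ==> v : LI V ==> w : RI W ==> braiding K H V W (ht V W v (ract W w g)) = Bb w (ract V v g)"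
 using braiding_gen[of u g v w] by (simp add: lact_one[OF W] lact_one[OF V] RI_mem LI_mem)

lemma braiding_lact:
 assumes h: "h : cH" and t: "t :< (V >< W)"
 shows "braiding K H V W (lact (V >< W) h t) = lact Mb h (braiding K H V W t)"
 by (rule span_ht[OF V W mM linear_compose[OF bilinear_r[OF ht_lact_bilinear[OF V W] h] braiding_linear]
    linear_compose[OF braiding_linear bilinear_r[OF ht_lact_bilinear[OF W V] h]] _ t])
  (simp add: ht_lact V W Vc Wc LI_mem RI_mem h lact_mult[symmetric] braiding_gen del: lact_mult)

lemma braiding_ract:
 assumes h: "h : cH" and t: "t :< (V >< W)"
 shows "braiding K H V W (ract (V >< W) t h) = ract Mb (braiding K H V W t) h"
 by (rule span_ht[OF V W mM linear_compose[OF bilinear_l[OF ht_ract_bilinear[OF V W] h] braiding_linear]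
    linear_compose[OF braiding_linear bilinear_l[OF ht_ract_bilinear[OF W V] h]] _ t])
  (simp add: ht_ract V W Vc Wc LI_mem RI_mem h ract_mult[symmetric] braiding_gen)

lemma braiding_lcolin: "lcolin K H (V >< W) Mb (braiding K H V W)"
 unfolding lcolin_def
proof
 let ?N = "ts H Mb" and ?F = "tn H Mb" and ?b = "braiding K H V W" and ?B = "ht V W"
 fix t assume t: "t :< (V >< W)"
 have N: "kmod ?N" by (intro cl Tc)
 note Tc' = ht_rules[OF V W]
 note F = bilinear_tensor[OF modH mM]
 have b: "bmap H (V >< W) ?N (%h t. ?F h (?b t))"
  by (intro lin cl mM braiding_linear linear_closed[OF braiding_linear]; assumption)
 show "lcoact Mb (?b t) = lsw ?N (V >< W) t (%h t. ?F h (?b t))"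
 proof (rule span_ht[OF V W N _ _ _ t, of "%t. lcoact Mb (?b t)" "%t. lsw ?N (V >< W) t (%h t. ?F h (?b t))"])
  show "lmap (V >< W) ?N (%t. lcoact Mb (?b t))"
   by (rule linear_compose[OF braiding_linear ht_coact[OF W V, unfolded coact_def, THEN conjunct2]])
  show "lmap (V >< W) ?N (%t. lsw ?N (V >< W) t (%h t. ?F h (?b t)))"
   by (rule lsw_linear[OF ht_coact[OF V W] b N])
  fix h v w g assume h: "h : cH" and g: "g : cH" and v: "v : LI V" and w: "w : RI W"
  note vm = LI_mem[OF v] and wm = RI_mem[OF w]
  note Q = rinv_closed[OF W] linear_compose[OF _ rinv_linear[OF W]]
   have "lcoact Mb (Bb (lact W h w) (ract V v g)) = lsw ?N W (lact W h w) (%b w'. lsw ?N V (ract V v g) (%c v'. ?F (b ** c) (Bb w' v')))"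
   using ht_colin[OF W V] h g vm wm by (simp add: colin_def Vc Wc)
  also have "... = sw ?N h (%h1 h2. lsw ?N W w (%b w'. lsw ?N V (ract V v g) (%c v'. ?F ((h1 ** b) ** c) (Bb (lact W h2 w') v'))))"
   by (rule lsw_lact[OF W h wm N]) (intro R N vm g; assumption)
  also have "... = sw ?N h (%h1 h2. lsw ?N W w (%b w'. lsw ?N V v (%c v'. sw ?N g (%g1 g2. ?F ((h1 ** b) ** (c ** g1)) (Bb (lact W h2 w') (ract V v' g2))))))"
   by (rule sw_cong[OF h], rule lsw_cong[OF Wc(2) wm], rule lsw_ract[OF V g vm N]) (intro R N; assumption)
  also have "... = sw ?N h (%h1 h2. lsw ?N W w (%b w'. sw ?N g (%g1 g2. ?F ((h1 ** b) ** (u ** g1)) (Bb (lact W h2 w') (ract V v g2)))))"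
   by (rule sw_cong[OF h], rule lsw_cong[OF Wc(2) wm], rule lsw_LI[OF v Vc(1) N]) (intro R N g; assumption)
  \<comment> \<open>The braiding is known only for a right-invariant second factor, and the
    summation variable \<open>w'\<close> is not syntactically one. \<open>RI_coact\<close> allows it
    to be replaced by its projection, and the projection to be removed again afterwards.\<close>
  also have "... = sw ?N h (%h1 h2. lsw ?N W w (%b w'. sw ?N g (%g1 g2. ?F ((h1 ** u) ** (b ** g1)) (Bb (lact W h2 (rinv W w')) (ract V v g2)))))"
  proof (rule sw_cong[OF h])
   fix h1 h2 assume h1: "h1 : cH" "h2 : cH"
   have "lsw ?N W w (%b w'. sw ?N g (%g1 g2. ?F ((h1 ** b) ** (u ** g1)) (Bb (lact W h2 w') (ract V v g2))))
     = lsw ?N W w (%b w'. sw ?N g (%g1 g2. ?F ((h1 ** b) ** (u ** g1)) (Bb (lact W h2 (rinv W w')) (ract V v g2))))"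
    by (rule RI_coact[OF W w N, symmetric]) (intro R N g h1 vm; assumption)
   then show "lsw ?N W w (%b w'. sw ?N g (%g1 g2. ?F ((h1 ** b) ** (u ** g1)) (Bb (lact W h2 w') (ract V v g2))))
    = lsw ?N W w (%b w'. sw ?N g (%g1 g2. ?F ((h1 ** u) ** (b ** g1)) (Bb (lact W h2 (rinv W w')) (ract V v g2))))"
    using h1 by (simp add: Hr.m_assoc cong: lsw_cong[OF Wc(2) wm] sw_cong[OF g])
  qed
  also have "... = sw ?N h (%h1 h2. lsw ?N W w (%b w'. sw ?N g (%g1 g2. ?F ((h1 ** u) ** (b ** g1)) (?b (?B (lact V h2 v) (ract W (rinv W w') g2))))))"
   by (intro sw_cong[OF h] lsw_cong[OF Wc(2) wm] sw_cong[OF g]) (simp add: braiding_gen[OF _ _ v rinv_RI[OF W]])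
  also have "... = sw ?N h (%h1 h2. lsw ?N W w (%b w'. sw ?N g (%g1 g2. ?F ((h1 ** u) ** (b ** g1)) (?b (?B (lact V h2 v) (ract W w' g2))))))"
   by (rule sw_cong[OF h], rule RI_coact[OF W w N])
    (intro lin cl Vc Wc Tc Tc' N vm g linear_compose[OF _ braiding_linear] linear_closed[OF braiding_linear]; assumption)
  also have "... = sw ?N h (%h1 h2. lsw ?N W (ract W w g) (%c w'. ?F ((h1 ** u) ** c) (?b (?B (lact V h2 v) w'))))"
   by (rule sw_cong[OF h], rule lsw_ract[OF W g wm N, symmetric])
    (intro lin cl Vc Wc Tc Tc' N vm g linear_compose[OF _ braiding_linear] linear_closed[OF braiding_linear]; assumption)
  also have "... = sw ?N h (%h1 h2. lsw ?N V v (%b v'. lsw ?N W (ract W w g) (%c w'. ?F ((h1 ** b) ** c) (?b (?B (lact V h2 v') w')))))"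
   by (rule sw_cong[OF h], rule lsw_LI[OF v Vc(1) N, symmetric])
    (intro lin cl Vc Wc Tc Tc' N wm g linear_compose[OF _ braiding_linear] linear_closed[OF braiding_linear]; assumption)
  also have "... = lsw ?N V (lact V h v) (%b v'. lsw ?N W (ract W w g) (%c w'. ?F (b ** c) (?b (?B v' w'))))"
   by (rule lsw_lact[OF V h vm N, symmetric])
    (intro lin cl Vc Wc Tc Tc' N wm g linear_compose[OF _ braiding_linear] linear_closed[OF braiding_linear]; assumption)
  also have "... = lsw ?N (V >< W) (?B (lact V h v) (ract W w g)) (%h t. ?F h (?b t))"
   by (rule lsw_ht[OF V W _ _ N b, symmetric]) (intro Vc Wc vm wm h g)+
  finally show "lcoact Mb (?b (?B (lact V h v) (ract W w g))) = lsw ?N (V >< W) (?B (lact V h v) (ract W w g)) (%h t. ?F h (?b t))"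
   by (simp add: braiding_gen h g v w)
 qed
qed

end

text \<open>The braiding of the co-opposite Hopf algebra is the inverse braiding.\<close>

lemma braiding_cop_left_inverse:
 assumes V: "bbi V" and W: "bbi W" and t: "t :< (V >< W)"
 shows "braiding K (hcop H) (bcop W) (bcop V) (braiding K H V W t) = t"
proof -
 note c = hopf_loc_cop bbi_cop[OF W] bbi_cop[OF V]
 have l: "lmap (W >< V) (V >< W) (braiding K (hcop H) (bcop W) (bcop V))"
  using hopf_loc.braiding_linear[OF c] unfolding cop_ht[OF W V, symmetric] cop_ht[OF V W, symmetric] by simp
 show ?thesis
 proof (rule span_ht[OF V W ht_module[OF V W] linear_compose[OF braiding_linear[OF V W] l] linear_id _ t])
  fix h v w k assume a: "h : cH" "k : cH" "v : LI V" "w : RI W"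
  from hopf_loc.braiding_gen[OF c, of h k w v] a
  show "braiding K (hcop H) (bcop W) (bcop V) (braiding K H V W (ht V W (lact V h v) (ract W w k))) =
    ht V W (lact V h v) (ract W w k)"
   by (simp add: braiding_gen[OF V W] right_invariant_cop left_invariant_cop[OF V] ht_cop_same(2)[OF V W] ht_cop_same(2)[OF W V])
 qed
qed

lemma braiding_cop_right_inverse:
 assumes V: "bbi V" and W: "bbi W" and t: "t :< (W >< V)"
 shows "braiding K H V W (braiding K (hcop H) (bcop W) (bcop V) t) = t"
proof -
 have "t :< (htensor_bimodule K (hcop H) (bcop W) (bcop V))"
  using t unfolding cop_ht[OF W V, symmetric] by simp
 from hopf_loc.braiding_cop_left_inverse[OF hopf_loc_cop bbi_cop[OF W] bbi_cop[OF V] this]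
 show ?thesis by (simp add: cop_cop_hopf cop_cop_bimod V W)
qed

text \<open>Right colinearity is obtained indirectly: the inverse of the braiding is the braiding of
  the co-opposite, which is left colinear there, and an inverse of a colinear map is
  colinear.\<close>

lemma braiding_bhom:
 assumes V: "bbi V" and W: "bbi W"
 shows "bhom (V >< W) (W >< V) (braiding K H V W)"
proof -
 let ?c = "braiding K (hcop H) (bcop W) (bcop V)"
 note c = hopf_loc_cop bbi_cop[OF W] bbi_cop[OF V]
 have l: "lmap (W >< V) (V >< W) ?c"
  using hopf_loc.braiding_linear[OF c] unfolding cop_ht[OF W V, symmetric] cop_ht[OF V W, symmetric] by simp
 have lc: "lcolin K (hcop H) (bcop (W >< V)) (bcop (V >< W)) ?c"
  using hopf_loc.braiding_lcolin[OF c] unfolding cop_ht[OF W V, symmetric] cop_ht[OF V W, symmetric] .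
 have "lcolin K (hcop H) (bcop (V >< W)) (bcop (W >< V)) (braiding K H V W)"
  by (rule hopf_loc.lcolin_inverse[OF hopf_loc_cop lc])
   (simp_all add: l braiding_linear V W braiding_cop_left_inverse braiding_cop_right_inverse coact_cop bb_rules bbi_ht)
 then show ?thesis
  using is_braiding_braiding[OF V W] braiding_lcolin[OF V W] braiding_lact[OF V W] braiding_ract[OF V W] braiding_linear[OF V W]
  by (simp add: bhom_def is_braiding_def)
qed

lemma braiding_iso:
 assumes V: "bbi V" and W: "bbi W"
 shows "braiding K H V W : bicovariant_iso K H (V >< W) (W >< V)"
proof (rule bhom_inverse[OF bbi_ht[OF V W] bbi_ht[OF W V] braiding_bhom[OF V W] _ braiding_cop_left_inverse[OF V W] braiding_cop_right_inverse[OF V W]])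
 fix t assume "t :< (W >< V)"
 moreover have "lmap (W >< V) (V >< W) (braiding K (hcop H) (bcop W) (bcop V))"
  using hopf_loc.braiding_linear[OF hopf_loc_cop bbi_cop[OF W] bbi_cop[OF V]] unfolding cop_ht[OF W V, symmetric] cop_ht[OF V W, symmetric] by simp
 ultimately show "braiding K (hcop H) (bcop W) (bcop V) t :< (V >< W)"
  by (rule linear_closed[rotated])
qed

section \<open>Naturality of the braiding and the hexagons\<close>

lemma braiding_ax:
 assumes b: "bbi V" "bbi V'" "bbi W" "bbi W'"
 shows "braiding_axioms K H V V' W W'"
proof -
 have "braiding K H V' W' (htensor_map K H V W V' W' f g t) = htensor_map K H W V W' V' g f (braiding K H V W t)"
  if f: "bhom V V' f" and g: "bhom W W' g" and t: "t :< (V >< W)" for f g t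
 proof (rule span_ht[OF b(1,3) ht_module[OF b(4,2)] linear_compose[OF htensor_map_linear[OF b(1,3,2,4) f g] braiding_linear[OF b(2,4)]]
    linear_compose[OF braiding_linear[OF b(1,3)] htensor_map_linear[OF b(3,1,4,2) g f]] _ t])
  fix h v w k assume a: "h : cH" "k : cH" "v : LI V" "w : RI W"
  then show "braiding K H V' W' (htensor_map K H V W V' W' f g (ht V W (lact V h v) (ract W w k))) =
     htensor_map K H W V W' V' g f (braiding K H V W (ht V W (lact V h v) (ract W w k)))"
   by (simp add: htensor_map_gen[OF b(1,3,2,4) f g] htensor_map_gen[OF b(3,1,4,2) g f] braiding_gen b LI_mem RI_mem
     bb_rules bhom_lact[OF f] bhom_ract[OF f] bhom_lact[OF g] bhom_ract[OF g] bhom_LI[OF b(1,2) f] bhom_RI[OF b(3,4) g])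
 qed
 then show ?thesis
  unfolding braiding_axioms_def using b by (simp add: braiding_unique braiding_iso bhom_iff)
qed

text \<open>It suffices to take \<open>h v \<otimes> w \<otimes> x k\<close> with \<open>v\<close>
  left-invariant and \<open>w\<close>, \<open>x\<close> right-invariant: a right factor of
  \<open>w\<close> is moved on to the third argument by balance. Then \<open>w \<otimes> x\<close>
  is right-invariant too, and every braiding involved is given by its defining condition.\<close>

lemma hexagon1:
 assumes b: "bbi V" "bbi W" "bbi U" and t: "t :< ((V >< W) >< U)"
 shows "associator K H W U V (braiding K H V (W >< U) (associator K H V W U t)) =
     htensor_map K H W (V >< U) W (U >< V) (identity_map W) (braiding K H V U)
      (associator K H W V U
       (htensor_map K H (V >< W) U (W >< V) U (braiding K H V W) (identity_map U) t))"
proof -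
 note VWc = bbi_ht[OF b(1,2)] and WU = bbi_ht[OF b(2,3)] and WVc = bbi_ht[OF b(2,1)] and VU = bbi_ht[OF b(1,3)] and UV = bbi_ht[OF b(3,1)]
 note r = bb_rules[OF b(1)] bb_rules[OF b(2)] bb_rules[OF b(3)] ht_closed LI_mem RI_mem b VWc WU WVc VU UV
 note m1 = b(2) VU b(2) UV bhom_id[OF b(2)] braiding_bhom[OF b(1,3)]
  and m2 = VWc b(3) WVc b(3) braiding_bhom[OF b(1,2)] bhom_id[OF b(3)]
 define f where "f t = associator K H W U V (braiding K H V (W >< U) (associator K H V W U t))" for t
 define g where "g t = htensor_map K H W (V >< U) W (U >< V) (identity_map W) (braiding K H V U)
      (associator K H W V U (htensor_map K H (V >< W) U (W >< V) U (braiding K H V W) (identity_map U) t))" for t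
 have fl: "lmap ((V >< W) >< U) (W >< (U >< V)) f"
  unfolding f_def[abs_def] by (rule linear_compose[OF linear_compose[OF associator_linear[OF b] braiding_linear[OF b(1) WU]] associator_linear[OF b(2,3,1)]])
 have gl: "lmap ((V >< W) >< U) (W >< (U >< V)) g"
  unfolding g_def[abs_def] by (rule linear_compose[OF linear_compose[OF htensor_map_linear[OF m2] associator_linear[OF b(2,1,3)]] htensor_map_linear[OF m1]])
 have M: "kmod (W >< (U >< V))" by (rule ht_module[OF b(2) UV])
 have gen: "f (ht (V >< W) U (ht V W (lact V h v) w) (ract U x k)) = g (ht (V >< W) U (ht V W (lact V h v) w) (ract U x k))"
  if h: "h : cH" and k: "k : cH" and v: "v : LI V" and w: "w : RI W" and x: "x : RI U" for h k v w x
 proof -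
  have "f (ht (V >< W) U (ht V W (lact V h v) w) (ract U x k))
   = associator K H W U V (braiding K H V (W >< U) (ht V (W >< U) (lact V h v) (ract (W >< U) (ht W U w x) k)))"
   by (simp add: f_def associator_gen ht_ract r h k v w x)
  also have "... = ht W (U >< V) (lact W h w) (ht U V x (ract V v k))"
   by (simp add: braiding_gen ht_RI ht_lact associator_gen r h k v w x)
  also have "... = g (ht (V >< W) U (ht V W (lact V h v) w) (ract U x k))"
   by (simp add: g_def htensor_map_gen[OF m2] htensor_map_gen[OF m1] braiding_gen_l braiding_gen_r associator_gen identity_map_apply r h k v w x)
  finally show ?thesis .
 qed
 have "f t = g t"
 proof (rule ht_ext3l[OF b M fl gl _ t])
  fix v w x assume v: "v :< V" and w: "w :< W" and x: "x :< U"
  note B1 = ht_bilinear[OF b(1,2)] and B2 = ht_bilinear[OF VWc b(3)]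
  have l1: "lmap V ((V >< W) >< U) (%v. ht (V >< W) U (ht V W v w) x)"
   by (rule linear_compose[OF bilinear_l[OF B1 w] bilinear_l[OF B2 x]])
  show "f (ht (V >< W) U (ht V W v w) x) = g (ht (V >< W) U (ht V W v w) x)"
  proof (rule span_left[OF b(1) M linear_compose[OF l1 fl] linear_compose[OF l1 gl] _ v])
   fix h v assume h: "h : cH" and v: "v : LI V"
   have hv: "lact V h v :< V" by (simp add: h v r)
   have l2: "lmap W ((V >< W) >< U) (%w. ht (V >< W) U (ht V W (lact V h v) w) x)"
    by (rule linear_compose[OF bilinear_r[OF B1 hv] bilinear_l[OF B2 x]])
   show "f (ht (V >< W) U (ht V W (lact V h v) w) x) = g (ht (V >< W) U (ht V W (lact V h v) w) x)"
   proof (rule span_right[OF b(2) M linear_compose[OF l2 fl] linear_compose[OF l2 gl] _ w])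
    fix k w assume k: "k : cH" and w: "w : RI W"
    have vw: "ht V W (lact V h v) w :< (V >< W)" by (simp add: hv w r)
    have kx: "lact U k x :< U" by (simp add: k x r)
    have e: "ht (V >< W) U (ht V W (lact V h v) (ract W w k)) x = ht (V >< W) U (ht V W (lact V h v) w) (lact U k x)"
     using ht_balance[OF VWc b(3) vw k x] ht_ract[OF b(1,2) k hv RI_mem[OF w]] by simp
    show "f (ht (V >< W) U (ht V W (lact V h v) (ract W w k)) x) = g (ht (V >< W) U (ht V W (lact V h v) (ract W w k)) x)"
     unfolding e
     by (rule span_right[OF b(3) M linear_compose[OF bilinear_r[OF B2 vw] fl] linear_compose[OF bilinear_r[OF B2 vw] gl] _ kx])
      (rule gen[OF h _ v w])
   qed
  qed
 qed
 then show ?thesis by (simp add: f_def g_def)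
qed

text \<open>The counterpart with \<open>v\<close> and \<open>w\<close> left-invariant, so that
  \<open>v \<otimes> w\<close> is left-invariant; a left factor of \<open>w\<close> is moved back to
  the first argument.\<close>

lemma hexagon2:
 assumes b: "bbi V" "bbi W" "bbi U" and t: "t :< ((V >< W) >< U)"
 shows "braiding K H (V >< W) U t =
     associator K H U V W
      (htensor_map K H (V >< U) W (U >< V) W (braiding K H V U) (identity_map W)
       (inv_into (carrier ((V >< U) >< W)) (associator K H V U W)
        (htensor_map K H V (W >< U) V (U >< W) (identity_map V) (braiding K H W U)
         (associator K H V W U t))))"
proof -
 note VWc = bbi_ht[OF b(1,2)] and WU = bbi_ht[OF b(2,3)] and UW = bbi_ht[OF b(3,2)] and VU = bbi_ht[OF b(1,3)] and UV = bbi_ht[OF b(3,1)]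
 note r = bb_rules[OF b(1)] bb_rules[OF b(2)] bb_rules[OF b(3)] ht_closed LI_mem RI_mem b VWc WU UW VU UV
 note m1 = VU b(2) UV b(2) braiding_bhom[OF b(1,3)] bhom_id[OF b(2)]
  and m2 = b(1) WU b(1) UW bhom_id[OF b(1)] braiding_bhom[OF b(2,3)]
 define f where "f = braiding K H (V >< W) U"
 define g where "g t = associator K H U V W (htensor_map K H (V >< U) W (U >< V) W (braiding K H V U) (identity_map W)
    (assoc_inv V U W (htensor_map K H V (W >< U) V (U >< W) (identity_map V) (braiding K H W U) (associator K H V W U t))))" for t
 note l0 = linear_compose[OF associator_linear[OF b] htensor_map_linear[OF m2]]
 have inv: "inv_into (carrier ((V >< U) >< W)) (associator K H V U W) s = assoc_inv V U W s" if s: "s :< (V >< (U >< W))" for s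
  by (rule inv_into_f_eq)
   (auto intro!: inj_on_inverseI[of _ "assoc_inv V U W"] linear_closed[OF assoc_inv_linear[OF b(1,3,2)]]
    simp: assoc_inv_l[OF b(1,3,2)] assoc_inv_r[OF b(1,3,2)] s)
 have fl: "lmap ((V >< W) >< U) (U >< (V >< W)) f"
  unfolding f_def by (rule braiding_linear[OF VWc b(3)])
 have gl: "lmap ((V >< W) >< U) (U >< (V >< W)) g"
  unfolding g_def[abs_def]
  by (rule linear_compose[OF linear_compose[OF linear_compose[OF l0 assoc_inv_linear[OF b(1,3,2)]] htensor_map_linear[OF m1]] associator_linear[OF b(3,1,2)]])
 have M: "kmod (U >< (V >< W))" by (rule ht_module[OF b(3) VWc])
 have gen: "f (ht (V >< W) U (ht V W (lact V h v) w) (ract U x k)) = g (ht (V >< W) U (ht V W (lact V h v) w) (ract U x k))"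
  if h: "h : cH" and k: "k : cH" and v: "v : LI V" and w: "w : LI W" and x: "x : RI U" for h k v w x
 proof -
  have "f (ht (V >< W) U (ht V W (lact V h v) w) (ract U x k))
   = braiding K H (V >< W) U (ht (V >< W) U (lact (V >< W) h (ht V W v w)) (ract U x k))"
   by (simp add: f_def ht_lact r h k v w x)
  also have "... = ht U (V >< W) (lact U h x) (ht V W v (ract W w k))"
   by (simp add: braiding_gen ht_LI ht_ract r h k v w x)
  also have "... = g (ht (V >< W) U (ht V W (lact V h v) w) (ract U x k))"
   by (simp add: g_def htensor_map_gen[OF m2] htensor_map_gen[OF m1] braiding_gen_l braiding_gen_r associator_gen assoc_inv_gen identity_map_apply r h k v w x)
  finally show ?thesis .
 qed
 have "f t = g t"
 proof (rule ht_ext3l[OF b M fl gl _ t])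
  fix v w x assume v: "v :< V" and w: "w :< W" and x: "x :< U"
  note B1 = ht_bilinear[OF b(1,2)] and B2 = ht_bilinear[OF VWc b(3)]
  have l2: "lmap W ((V >< W) >< U) (%w. ht (V >< W) U (ht V W v w) x)"
   by (rule linear_compose[OF bilinear_r[OF B1 v] bilinear_l[OF B2 x]])
  show "f (ht (V >< W) U (ht V W v w) x) = g (ht (V >< W) U (ht V W v w) x)"
  proof (rule span_left[OF b(2) M linear_compose[OF l2 fl] linear_compose[OF l2 gl] _ w])
   fix k w assume k: "k : cH" and w: "w : LI W"
   note wm = LI_mem[OF w]
   have vk: "ract V v k :< V" by (simp add: k v r)
   have e: "ht V W v (lact W k w) = ht V W (ract V v k) w"
    by (rule ht_balance[OF b(1,2) v k wm, symmetric])
   have l1: "lmap V ((V >< W) >< U) (%v. ht (V >< W) U (ht V W v w) x)"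
    by (rule linear_compose[OF bilinear_l[OF B1 wm] bilinear_l[OF B2 x]])
   show "f (ht (V >< W) U (ht V W v (lact W k w)) x) = g (ht (V >< W) U (ht V W v (lact W k w)) x)"
    unfolding e
   proof (rule span_left[OF b(1) M linear_compose[OF l1 fl] linear_compose[OF l1 gl] _ vk])
    fix h v assume h: "h : cH" and v: "v : LI V"
    have vw: "ht V W (lact V h v) w :< (V >< W)" by (simp add: h v w r)
    show "f (ht (V >< W) U (ht V W (lact V h v) w) x) = g (ht (V >< W) U (ht V W (lact V h v) w) x)"
     by (rule span_right[OF b(3) M linear_compose[OF bilinear_r[OF B2 vw] fl] linear_compose[OF bilinear_r[OF B2 vw] gl] _ x])
      (rule gen[OF h _ v w])
   qed
  qed
 qed
 then show ?thesis using linear_closed[OF l0 t] by (simp add: f_def g_def inv)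
qed

lemma hexagon_ax: "bbi V ==> bbi W ==> bbi U ==> hexagon_axioms K H V W U"
 unfolding hexagon_axioms_def Let_def by (intro conjI ballI hexagon1 hexagon2)

lemma braided_monoidal_ax:
 assumes "bbi V" "bbi V'" "bbi V''" "bbi W" "bbi W'" "bbi W''" "bbi U" "bbi U'" "bbi X"
 shows "braided_monoidal_axioms K H V V' V'' W W' W'' U U' X"
 unfolding braided_monoidal_axioms_def
 by (intro conjI category_ax tensor_functor_ax associator_ax unit_ax pentagon_ax triangle_ax braiding_ax hexagon_ax assms)

end

section \<open>Twisting bilinear maps by functionals\<close>

text \<open>Functionals on \<open>H \<otimes> H\<close> act on bilinear maps through the left
  coactions of both arguments; composing two such twists corresponds to convolution of the
  functionals.\<close>

definition tw where
 "tw phi X Y P m x y = lsw P X x (%a x'. lsw P Y y (%b y'. phi a b *[P] m x' y'))"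

abbreviation "ctw phi X Y \<equiv> tw phi (bcop X) (bcop Y)"

context coalg
begin

text \<open>Six arguments are what two coactions applied to each of two elements produce: four
  factors from \<open>H\<close> and the two remaining vectors.\<close>

definition hexa_map where
 "hexa_map A B C D E F M G' \<longleftrightarrow>
  (\<forall>b\<in>carrier B. \<forall>c\<in>carrier C. \<forall>d\<in>carrier D. \<forall>e\<in>carrier E. \<forall>f\<in>carrier F. lmap A M (%a. G' a b c d e f)) \<and>
  (\<forall>a\<in>carrier A. \<forall>c\<in>carrier C. \<forall>d\<in>carrier D. \<forall>e\<in>carrier E. \<forall>f\<in>carrier F. lmap B M (%b. G' a b c d e f)) \<and>
  (\<forall>a\<in>carrier A. \<forall>b\<in>carrier B. \<forall>d\<in>carrier D. \<forall>e\<in>carrier E. \<forall>f\<in>carrier F. lmap C M (%c. G' a b c d e f)) \<and>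
  (\<forall>a\<in>carrier A. \<forall>b\<in>carrier B. \<forall>c\<in>carrier C. \<forall>e\<in>carrier E. \<forall>f\<in>carrier F. lmap D M (%d. G' a b c d e f)) \<and>
  (\<forall>a\<in>carrier A. \<forall>b\<in>carrier B. \<forall>c\<in>carrier C. \<forall>d\<in>carrier D. \<forall>f\<in>carrier F. lmap E M (%e. G' a b c d e f)) \<and>
  (\<forall>a\<in>carrier A. \<forall>b\<in>carrier B. \<forall>c\<in>carrier C. \<forall>d\<in>carrier D. \<forall>e\<in>carrier E. lmap F M (%f. G' a b c d e f))"

lemma hexa_mapI [lin]:
 assumes "!!b c d e f. b :< B ==> c :< C ==> d :< D ==> e :< E ==> f :< F ==> lmap A M (%a. G' a b c d e f)"
  "!!a c d e f. a :< A ==> c :< C ==> d :< D ==> e :< E ==> f :< F ==> lmap B M (%b. G' a b c d e f)"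
  "!!a b d e f. a :< A ==> b :< B ==> d :< D ==> e :< E ==> f :< F ==> lmap C M (%c. G' a b c d e f)"
  "!!a b c e f. a :< A ==> b :< B ==> c :< C ==> e :< E ==> f :< F ==> lmap D M (%d. G' a b c d e f)"
  "!!a b c d f. a :< A ==> b :< B ==> c :< C ==> d :< D ==> f :< F ==> lmap E M (%e. G' a b c d e f)"
  "!!a b c d e. a :< A ==> b :< B ==> c :< C ==> d :< D ==> e :< E ==> lmap F M (%f. G' a b c d e f)"
 shows "hexa_map A B C D E F M G'"
 using assms by (simp add: hexa_map_def)

lemma hexa_mapD:
 assumes "hexa_map A B C D E F M G'"
 shows "b :< B ==> c :< C ==> d :< D ==> e :< E ==> f :< F ==> lmap A M (%a. G' a b c d e f)"
  "a :< A ==> c :< C ==> d :< D ==> e :< E ==> f :< F ==> lmap B M (%b. G' a b c d e f)"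
  "a :< A ==> b :< B ==> d :< D ==> e :< E ==> f :< F ==> lmap C M (%c. G' a b c d e f)"
  "a :< A ==> b :< B ==> c :< C ==> e :< E ==> f :< F ==> lmap D M (%d. G' a b c d e f)"
  "a :< A ==> b :< B ==> c :< C ==> d :< D ==> f :< F ==> lmap E M (%e. G' a b c d e f)"
  "a :< A ==> b :< B ==> c :< C ==> d :< D ==> e :< E ==> lmap F M (%f. G' a b c d e f)"
 using assms by (simp_all add: hexa_map_def)

lemma hexa_closed:
 "hexa_map A B C D E F M G' ==> a :< A ==> b :< B ==> c :< C ==> d :< D ==> e :< E ==> f :< F ==> G' a b c d e f :< M"
 by (rule linear_closed[OF hexa_mapD(1)])

lemma lsw2_coassoc:
 assumes X: "lc X" and Y: "lc Y" and x: "x :< X" and y: "y :< Y" and M: "kmod M"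
  and G': "hexa_map H H H H X Y M G'"
 shows "lsw M X x (%a x'. lsw M Y y (%b y'. lsw M X x' (%c x''. lsw M Y y' (%d y''. G' a c b d x'' y'')))) =
  lsw M X x (%a x'. lsw M Y y (%b y'. sw M a (%a1 a2. sw M b (%b1 b2. G' a1 a2 b1 b2 x' y'))))"
proof -
 note cX = coact_lc[OF X] and cY = coact_lc[OF Y]
 note D = hexa_mapD[OF G'] and C = hexa_closed[OF G']
 note R = bilinear_mapI trilinear_mapI lsw_linear_fun lsw_linear_arg sw_linear_fun sw_linear_arg D linear_id lsw_closed sw_closed C cX cY M
 have "lsw M X x (%a x'. lsw M Y y (%b y'. lsw M X x' (%c x''. lsw M Y y' (%d y''. G' a c b d x'' y'')))) =
   lsw M X x (%a x'. lsw M X x' (%c x''. lsw M Y y (%b y'. lsw M Y y' (%d y''. G' a c b d x'' y''))))"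
  by (rule lsw_cong[OF cX x], rule lsw_swap[OF cY y cX _ M], assumption) (intro R; assumption)
 also have "... = lsw M X x (%a x'. sw M a (%a1 a2. lsw M Y y (%b y'. lsw M Y y' (%d y''. G' a1 a2 b d x' y''))))"
  by (rule lsw_coassoc[OF X x M, symmetric]) (intro R y; assumption)
 also have "... = lsw M X x (%a x'. sw M a (%a1 a2. lsw M Y y (%b y'. sw M b (%b1 b2. G' a1 a2 b1 b2 x' y'))))"
  by (rule lsw_cong[OF cX x], rule sw_cong, assumption, rule lsw_coassoc[OF Y y M, symmetric]) (intro R; assumption)
 also have "... = lsw M X x (%a x'. lsw M Y y (%b y'. sw M a (%a1 a2. sw M b (%b1 b2. G' a1 a2 b1 b2 x' y'))))"
  by (rule lsw_cong[OF cX x], rule lsw_sw_swap[OF cY y _ M, symmetric], assumption) (intro R; assumption)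
 finally show ?thesis .
qed

lemma lsw2_comm:
 assumes X: "bic X" and Y: "bic Y" and x: "x :< X" and y: "y :< Y" and M: "kmod M"
  and G': "hexa_map H H H H X Y M G'"
 shows "lsw M X x (%a x'. lsw M Y y (%b y'. lsw M (bcop X) x' (%c x''. lsw M (bcop Y) y' (%d y''. G' a b c d x'' y'')))) =
  lsw M (bcop X) x (%c x'. lsw M (bcop Y) y (%d y'. lsw M X x' (%a x''. lsw M Y y' (%b y''. G' a b c d x'' y''))))"
proof -
 note cX = bic_coact[OF X] and cY = bic_coact[OF Y] and ccX = bic_cop_coact[OF X] and ccY = bic_cop_coact[OF Y]
 note D = hexa_mapD[OF G'] and C = hexa_closed[OF G']
 have c: "z :< X ==> z :< (bcop X)" "w :< Y ==> w :< (bcop Y)" for z w by simp_all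
 note R = bilinear_mapI trilinear_mapI cop_lsw[OF ccX] cop_lsw[OF ccY] lsw_linear_fun[OF cX] lsw_linear_fun[OF cY] lsw_linear_arg[OF cX] lsw_linear_arg[OF cY]
  D linear_id lsw_closed[OF cX] lsw_closed[OF cY] C M
 have "lsw M X x (%a x'. lsw M Y y (%b y'. lsw M (bcop X) x' (%c x''. lsw M (bcop Y) y' (%d y''. G' a b c d x'' y'')))) =
   lsw M X x (%a x'. lsw M (bcop X) x' (%c x''. lsw M Y y (%b y'. lsw M (bcop Y) y' (%d y''. G' a b c d x'' y''))))"
  by (rule lsw_cong[OF cX x], rule lsw_swap[OF cY y ccX _ M], simp) (intro R; simp)
 also have "... = lsw M (bcop X) x (%c x'. lsw M X x' (%a x''. lsw M Y y (%b y'. lsw M (bcop Y) y' (%d y''. G' a b c d x'' y''))))"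
  by (rule bic_comm[OF X x M]) (intro R y; assumption)
 also have "... = lsw M (bcop X) x (%c x'. lsw M X x' (%a x''. lsw M (bcop Y) y (%d y'. lsw M Y y' (%b y''. G' a b c d x'' y''))))"
  by (rule lsw_cong[OF ccX c(1)[OF x]], rule lsw_cong[OF cX], simp, rule bic_comm[OF Y y M]) (intro R; simp)
 also have "... = lsw M (bcop X) x (%c x'. lsw M (bcop Y) y (%d y'. lsw M X x' (%a x''. lsw M Y y' (%b y''. G' a b c d x'' y''))))"
  by (rule lsw_cong[OF ccX c(1)[OF x]], rule lsw_swap[OF cX _ ccY c(2)[OF y] M], simp) (intro R; simp)
 finally show ?thesis .
qed

lemma sw2_smult:
 assumes M: "kmod M" and a: "a : cH" and b: "b : cH" and n: "n :< M"
  and k: "!!a1 a2 b1 b2. a1 : cH ==> a2 : cH ==> b1 : cH ==> b2 : cH ==> k a1 a2 b1 b2 :< K"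
 shows "sw M a (%a1 a2. sw M b (%b1 b2. k a1 a2 b1 b2 *[M] n)) = sw G a (%a1 a2. sw G b (%b1 b2. k a1 a2 b1 b2)) *[M] n"
proof -
 note l = bilinear_l[OF bilinear_smult[OF M] n]
 have "sw G a (%a1 a2. sw G b (%b1 b2. k a1 a2 b1 b2)) *[M] n = sw M a (%a1 a2. sw G b (%b1 b2. k a1 a2 b1 b2) *[M] n)"
  by (rule sw_push[OF a modG M _ l]) (intro sw_closed b modG; simp add: k)
 also have "... = sw M a (%a1 a2. sw M b (%b1 b2. k a1 a2 b1 b2 *[M] n))"
  by (rule sw_cong[OF a], rule sw_push[OF b modG M _ l]) (simp add: k)
 finally show ?thesis by simp
qed

lemma tw_bilinear:
 assumes phi: "bmap H H G phi" and X: "coact X" and Y: "coact Y" and P: "kmod P" and m: "bmap X Y P m"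
 shows "bmap X Y P (tw phi X Y P m)"
 unfolding tw_def[abs_def]
 by (intro lin bmap_rules[OF m] linear_bil_l[OF phi] linear_bil_r[OF phi] P X Y cl
   bilinear_closed[OF phi, simplified]; assumption)

lemma tw_cong:
 assumes "coact X" "coact Y" "!!x y. x :< X ==> y :< Y ==> m x y = m' x y" "x :< X" "y :< Y"
 shows "tw phi X Y P m x y = tw phi X Y P m' x y"
 unfolding tw_def by (intro lsw_cong assms(1,2,4,5)) (simp add: assms(3))

lemma tw_push:
 assumes phi: "bmap H H G phi" and X: "coact X" and Y: "coact Y" and P: "kmod P" and Q: "kmod Q"
  and m: "!!x y. x :< X ==> y :< Y ==> m x y :< P" and f: "lmap P Q f"
  and x: "x :< X" and y: "y :< Y"
 shows "f (tw phi X Y P m x y) = tw phi X Y Q (%x y. f (m x y)) x y"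
proof -
 interpret P: module K P by (rule P)
 note phic = bilinear_closed[OF phi, simplified]
 have "f (tw phi X Y P m x y) = lsw Q X x (%a x'. f (lsw P Y y (%b y'. phi a b *[P] m x' y')))"
  unfolding tw_def by (rule lsw_push[OF X x P Q _ f]) (intro lsw_closed[OF Y y P] P.smult_closed phic m)
 also have "... = lsw Q X x (%a x'. lsw Q Y y (%b y'. f (phi a b *[P] m x' y')))"
  by (rule lsw_cong[OF X x], rule lsw_push[OF Y y P Q _ f]) (intro P.smult_closed phic m)
 also have "... = tw phi X Y Q (%x y. f (m x y)) x y"
  unfolding tw_def by (intro lsw_cong[OF X x] lsw_cong[OF Y y] linear_smult[OF f] m phic)
 finally show ?thesis .
qed

text \<open>By coassociativity the composite is the twist by the convolution of \<open>phi\<close>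
  and \<open>psi\<close>, which is the counit of \<open>H \<otimes> H\<close>.\<close>

lemma tw_inverse:
 assumes phi: "bmap H H G phi" and psi: "bmap H H G psi"
  and inv: "!!h g. h : cH ==> g : cH ==> sw G h (%a h'. sw G g (%b g'. phi a b \<star> psi h' g')) = eps h \<star> eps g"
  and X: "lc X" and Y: "lc Y" and P: "kmod P" and m: "bmap X Y P m" and x: "x :< X" and y: "y :< Y"
 shows "tw phi X Y P (tw psi X Y P m) x y = m x y"
proof -
 interpret P: module K P by (rule P)
 note cX = coact_lc[OF X] and cY = coact_lc[OF Y]
 note mr = bmap_rules[OF m]
 note phir = bmap_rules[OF phi, simplified]
 note psir = bmap_rules[OF psi, simplified]
 note R = lin cl mr phir psir cX cY P P.smult_closed K.m_closed
 have "tw phi X Y P (tw psi X Y P m) x y =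
   lsw P X x (%a x'. lsw P Y y (%b y'. lsw P X x' (%a2 x''. lsw P Y y' (%b2 y''. (phi a b \<star> psi a2 b2) *[P] m x'' y''))))"
  unfolding tw_def[of phi]
 proof (rule lsw_cong[OF cX x], rule lsw_cong[OF cY y])
  fix a x' b y' assume a: "a : cH" and x': "x' :< X" and b: "b : cH" and y': "y' :< Y"
  have "phi a b *[P] tw psi X Y P m x' y' = tw psi X Y P (%x y. phi a b *[P] m x y) x' y'"
   by (rule tw_push[OF psi cX cY P P _ bilinear_r[OF bilinear_smult[OF P]] x' y']) (simp_all add: mr phir a b)
  also have "... = lsw P X x' (%a2 x''. lsw P Y y' (%b2 y''. (phi a b \<star> psi a2 b2) *[P] m x'' y''))"
   unfolding tw_def by (intro lsw_cong[OF cX x'] lsw_cong[OF cY y'])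
    (simp add: phir psir mr a b P.smult_assoc1[symmetric] K.m_comm)
  finally show "phi a b *[P] tw psi X Y P m x' y' = ..." .
 qed
 also have "... = lsw P X x (%a x'. lsw P Y y (%b y'. sw P a (%a1 a2. sw P b (%b1 b2. (phi a1 b1 \<star> psi a2 b2) *[P] m x' y'))))"
  by (rule lsw2_coassoc[OF X Y x y P]) (intro R; assumption)
 also have "... = lsw P X x (%a x'. lsw P Y y (%b y'. eps b *[P] (eps a *[P] m x' y')))"
  by (intro lsw_cong[OF cX x] lsw_cong[OF cY y])
   (simp add: sw2_smult[OF P] mr phir psir inv P.smult_assoc1[symmetric] K.m_comm)
 also have "... = lsw P X x (%a x'. eps a *[P] m x' y)"
  by (rule lsw_cong[OF cX x], rule lsw_counit[OF Y y P]) (intro R; assumption)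
 also have "... = m x y"
  by (rule lsw_counit[OF X x P]) (intro R y)
 finally show ?thesis .
qed

lemma tw_comm:
 assumes phi: "bmap H H G phi" and psi: "bmap H H G psi"
  and X: "bic X" and Y: "bic Y" and P: "kmod P" and m: "bmap X Y P m" and x: "x :< X" and y: "y :< Y"
 shows "tw phi X Y P (ctw psi X Y P m) x y = ctw psi X Y P (tw phi X Y P m) x y"
proof -
 interpret P: module K P by (rule P)
 note cX = bic_coact[OF X] and cY = bic_coact[OF Y] and ccX = bic_cop_coact[OF X] and ccY = bic_cop_coact[OF Y]
 note mr = bmap_rules[OF m]
 note phir = bmap_rules[OF phi, simplified]
 note psir = bmap_rules[OF psi, simplified]
 note R = lin cl mr phir psir P P.smult_closed K.m_closed
 have "tw phi X Y P (ctw psi X Y P m) x y =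
   lsw P X x (%a x'. lsw P Y y (%b y'. lsw P (bcop X) x' (%c x''. lsw P (bcop Y) y' (%d y''. (phi a b \<star> psi c d) *[P] m x'' y''))))"
  unfolding tw_def[of phi]
 proof (rule lsw_cong[OF cX x], rule lsw_cong[OF cY y])
  fix a x' b y' assume a: "a : cH" and x': "x' :< X" and b: "b : cH" and y': "y' :< Y"
  have x'': "x' :< (bcop X)" and y'': "y' :< (bcop Y)" using x' y' by simp_all
  have "phi a b *[P] ctw psi X Y P m x' y' = ctw psi X Y P (%x y. phi a b *[P] m x y) x' y'"
   by (rule tw_push[OF psi ccX ccY P P _ bilinear_r[OF bilinear_smult[OF P]] x'' y'']) (simp_all add: mr phir a b)
  also have "... = lsw P (bcop X) x' (%c x''. lsw P (bcop Y) y' (%d y''. (phi a b \<star> psi c d) *[P] m x'' y''))"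
   unfolding tw_def by (intro lsw_cong[OF ccX x''] lsw_cong[OF ccY y''])
    (simp add: phir psir mr a b P.smult_assoc1[symmetric] K.m_comm)
  finally show "phi a b *[P] ctw psi X Y P m x' y' = ..." .
 qed
 also have "... = lsw P (bcop X) x (%c x'. lsw P (bcop Y) y (%d y'. lsw P X x' (%a x''. lsw P Y y' (%b y''. (phi a b \<star> psi c d) *[P] m x'' y''))))"
  by (rule lsw2_comm[OF X Y x y P]) (intro R; assumption)
 also have "... = ctw psi X Y P (tw phi X Y P m) x y"
  unfolding tw_def[of psi]
 proof (rule lsw_cong[OF ccX], simp add: x, rule lsw_cong[OF ccY], simp add: y)
  fix c x' d y' assume c: "c : cH" and x': "x' :< (bcop X)" and d: "d : cH" and y': "y' :< (bcop Y)"
  then have x'': "x' :< X" and y'': "y' :< Y" by simp_all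
  have "psi c d *[P] tw phi X Y P m x' y' = tw phi X Y P (%x y. psi c d *[P] m x y) x' y'"
   by (rule tw_push[OF phi cX cY P P _ bilinear_r[OF bilinear_smult[OF P]] x'' y'']) (simp_all add: mr psir c d)
  also have "... = lsw P X x' (%a x''. lsw P Y y' (%b y''. (phi a b \<star> psi c d) *[P] m x'' y''))"
   unfolding tw_def by (intro lsw_cong[OF cX x''] lsw_cong[OF cY y''])
    (simp add: phir psir mr c d P.smult_assoc1[symmetric] K.m_comm)
  finally show "lsw P X x' (%a x''. lsw P Y y' (%b y''. (phi a b \<star> psi c d) *[P] m x'' y'')) = psi c d *[P] tw phi X Y P m x' y'" by simp
 qed
 finally show ?thesis .
qed

end

context hopf_loc
begin

lemma tw_natural:
 assumes phi: "bmap H H G phi" and c: "coact X" "coact X'" "coact Y" "coact Y'" "kmod P" "kmod P'"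
  and m: "bmap X Y P m" and m': "bmap X' Y' P' m'"
  and f: "lmap P P' f" and g: "lcolin K H X X' g" "lmap X X' g" and k: "lcolin K H Y Y' k" "lmap Y Y' k"
  and e: "!!x y. x :< X ==> y :< Y ==> f (m x y) = m' (g x) (k y)"
  and x: "x :< X" and y: "y :< Y"
 shows "f (tw phi X Y P m x y) = tw phi X' Y' P' m' (g x) (k y)"
proof -
 note phir = bmap_rules[OF phi, simplified]
 note mr = bmap_rules[OF m']
 note l = linear_closed[OF g(2)] linear_closed[OF k(2)]
 have "f (tw phi X Y P m x y) = tw phi X Y P' (%x y. f (m x y)) x y"
  by (rule tw_push[OF phi c(1,3,5,6) bilinear_closed[OF m] f x y])
 also have "... = lsw P' X x (%a x'. lsw P' Y y (%b y'. phi a b *[P'] m' (g x') (k y')))"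
  unfolding tw_def by (intro lsw_cong[OF c(1) x] lsw_cong[OF c(3) y]) (simp add: e)
 also have "... = lsw P' X x (%a x'. lsw P' Y' (k y) (%b y'. phi a b *[P'] m' (g x') y'))"
  by (rule lsw_cong[OF c(1) x], rule lcolinD[OF k c(3,4) y c(6), symmetric]) (intro lin cl mr phir l c; assumption)
 also have "... = tw phi X' Y' P' m' (g x) (k y)"
  unfolding tw_def by (rule lcolinD[OF g c(1,2) x c(6), symmetric]) (intro lin cl mr phir l c y; assumption)
 finally show ?thesis .
qed

text \<open>The right twist involves only right coactions, and these commute with the left ones, so
  left colinearity over the same \<open>H\<close> survives. For the left twist this fails, and the
  product of \<open>H\<close> has to change.\<close>

lemma tw_colin_cop:
 assumes phi: "bmap H H G phi" and X: "bic X" and Y: "bic Y" and P: "bic P" and m: "bmap X Y P m"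
  and c: "colin K H X Y P m"
 shows "colin K H X Y P (ctw phi X Y P m)"
 unfolding colin_def
proof (intro ballI)
 fix x y assume x: "x :< X" and y: "y :< Y"
 note cX = bic_coact[OF X] and cY = bic_coact[OF Y] and ccX = bic_cop_coact[OF X] and ccY = bic_cop_coact[OF Y] and cP = bic_coact[OF P]
 note mP = coact_module[OF cP]
 let ?M = "ts H P" and ?t = "tn H P"
 have M: "kmod ?M" by (intro cl mP)
 interpret M: module K ?M by (rule M)
 note mr = bmap_rules[OF m]
 note phir = bmap_rules[OF phi, simplified]
 note R = lin cl mr phir mP M M.smult_closed
 have x': "x :< (bcop X)" and y': "y :< (bcop Y)" using x y by simp_all
 have "lcoact P (ctw phi X Y P m x y) = ctw phi X Y ?M (%x y. lcoact P (m x y)) x y"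
  by (rule tw_push[OF phi ccX ccY mP M _ cP[unfolded coact_def, THEN conjunct2] x' y']) (simp add: mr)
 also have "... = lsw ?M (bcop X) x (%c x'. lsw ?M (bcop Y) y (%d y'. lsw ?M X x' (%a x''. lsw ?M Y y' (%b y''. phi c d *[?M] ?t (a ** b) (m x'' y'')))))"
  unfolding tw_def
 proof (rule lsw_cong[OF ccX x'], rule lsw_cong[OF ccY y'])
  fix c x' d y' assume c': "c : cH" and x': "x' :< (bcop X)" and d: "d : cH" and y': "y' :< (bcop Y)"
  then have x'': "x' :< X" and y'': "y' :< Y" by simp_all
  have l: "lmap ?M ?M (%t. phi c d *[?M] t)" using phir c' d by (intro lin M) simp_all
  have "phi c d *[?M] lcoact P (m x' y') = phi c d *[?M] lsw ?M X x' (%a x''. lsw ?M Y y' (%b y''. ?t (a ** b) (m x'' y'')))"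
   using c x'' y'' by (simp add: colin_def)
  also have "... = lsw ?M X x' (%a x''. phi c d *[?M] lsw ?M Y y' (%b y''. ?t (a ** b) (m x'' y'')))"
   by (rule lsw_push[OF cX x'' M M _ l]) (intro R y'' cY; assumption)
  also have "... = lsw ?M X x' (%a x''. lsw ?M Y y' (%b y''. phi c d *[?M] ?t (a ** b) (m x'' y'')))"
   by (rule lsw_cong[OF cX x''], rule lsw_push[OF cY y'' M M _ l]) (intro R; assumption)
  finally show "phi c d *[?M] lcoact P (m x' y') = ..." .
 qed
 also have "... = lsw ?M X x (%a x'. lsw ?M Y y (%b y'. lsw ?M (bcop X) x' (%c x''. lsw ?M (bcop Y) y' (%d y''. phi c d *[?M] ?t (a ** b) (m x'' y'')))))"
  by (rule lsw2_comm[OF X Y x y M, symmetric]) (intro R; assumption)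
 also have "... = lsw ?M X x (%a x'. lsw ?M Y y (%b y'. ?t (a ** b) (ctw phi X Y P m x' y')))"
 proof (rule lsw_cong[OF cX x], rule lsw_cong[OF cY y])
  fix a x' b y' assume a: "a : cH" and x': "x' :< X" and b: "b : cH" and y': "y' :< Y"
  have "?t (a ** b) (ctw phi X Y P m x' y') = ctw phi X Y ?M (%x y. ?t (a ** b) (m x y)) x' y'"
   using a b x' y' by (intro tw_push[OF phi ccX ccY mP M _ bilinear_r[OF bilinear_tensor[OF modH mP]]]) (simp_all add: mr)
  then show "lsw ?M (bcop X) x' (%c x''. lsw ?M (bcop Y) y' (%d y''. phi c d *[?M] ?t (a ** b) (m x'' y''))) = ?t (a ** b) (ctw phi X Y P m x' y')"
   by (simp add: tw_def)
 qed
 finally show "lcoact P (ctw phi X Y P m x y) = ..." .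
qed

end

lemma (in monoid) mult_eq_swap:
 assumes "a :< G" "b :< G" "c :< G" "d :< G" "ci :< G" "bi :< G"
  and e: "a \<otimes> b = c \<otimes> d" and "ci \<otimes> c = \<one>" "b \<otimes> bi = \<one>"
 shows "ci \<otimes> a = d \<otimes> bi"
proof -
 have ab: "a \<otimes> b \<otimes> bi = a" using assms(1,2,6,9) by (simp add: m_assoc)
 have "ci \<otimes> a = ci \<otimes> (c \<otimes> d \<otimes> bi)" unfolding e[symmetric] ab ..
 also have "... = (ci \<otimes> c) \<otimes> (d \<otimes> bi)" using assms(1-6) by (simp add: m_assoc)
 finally show ?thesis using assms(1-6,8) by simp
qed

lemma (in monoid) mult_eq_inverse:
 assumes "a :< G" "b :< G" "c :< G" "d :< G" "ai :< G" "bi :< G" "ci :< G" "di :< G"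
  and e: "a \<otimes> b = c \<otimes> d" and i: "ai \<otimes> a = \<one>" "bi \<otimes> b = \<one>" "c \<otimes> ci = \<one>" "d \<otimes> di = \<one>"
 shows "bi \<otimes> ai = di \<otimes> ci"
proof -
 have "(bi \<otimes> ai) \<otimes> (a \<otimes> b) = bi \<otimes> ((ai \<otimes> a) \<otimes> b)" using assms(1-8) by (simp add: m_assoc)
 then have 1: "(bi \<otimes> ai) \<otimes> (a \<otimes> b) = \<one>" using assms(1-8) i by simp
 have "(c \<otimes> d) \<otimes> (di \<otimes> ci) = c \<otimes> ((d \<otimes> di) \<otimes> ci)" using assms(1-8) by (simp add: m_assoc)
 then have 2: "(c \<otimes> d) \<otimes> (di \<otimes> ci) = \<one>" using assms(1-8) i by simp
 have "bi \<otimes> ai = (bi \<otimes> ai) \<otimes> ((a \<otimes> b) \<otimes> (di \<otimes> ci))" unfolding e using assms(1-8) 2 by simp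
 also have "... = ((bi \<otimes> ai) \<otimes> (a \<otimes> b)) \<otimes> (di \<otimes> ci)" using assms(1-8) by (simp add: m_assoc)
 finally show ?thesis using 1 assms(1-8) by simp
qed

section \<open>Convolution of trilinear functionals\<close>

context hopf_loc
begin

lemma sw_closedK [cl]:
 assumes "h : cH" "!!a b. a : cH ==> b : cH ==> F a b :< K"
 shows "sw G h F :< K"
 using sw_closed[OF assms(1) modG] assms(2) by simp

lemma sw_multK:
 assumes h: "h : cH" and k: "k :< K" and F: "!!a b. a : cH ==> b : cH ==> F a b :< K"
 shows "k \<star> sw G h F = sw G h (%a b. k \<star> F a b)" "sw G h F \<star> k = sw G h (%a b. F a b \<star> k)"
  "k *[G] sw G h F = sw G h (%a b. k *[G] F a b)"
 using sw_push[OF h modG modG _ linear_multK_r[OF linear_id k], of F]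
  sw_push[OF h modG modG _ linear_multK_l[OF linear_id k], of F] F by simp_all

text \<open>
  For trilinear functionals on \<open>H\<close> under convolution, the cocycle identity is an equation \<open>a b = c d\<close>
  between invertible elements; the identities for \<open>\<chi>\<^sup>-\<^sup>1\<close> and the mixed ones follow by rearranging it.
\<close>

definition conv3 where
 "conv3 phi psi h g f = sw G h (%h1 h2. sw G g (%g1 g2. sw G f (%f1 f2. phi h1 g1 f1 \<star> psi h2 g2 f2)))"

abbreviation "tri phi \<equiv> trilinear_map H H H G phi"

lemma triD:
 assumes "tri phi"
 shows "lmap X H k ==> b : cH ==> c : cH ==> lmap X G (%x. phi (k x) b c)"
  "lmap X H k ==> a : cH ==> c : cH ==> lmap X G (%x. phi a (k x) c)"
  "lmap X H k ==> a : cH ==> b : cH ==> lmap X G (%x. phi a b (k x))"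
  "a : cH ==> b : cH ==> c : cH ==> phi a b c :< K"
 using linear_compose[OF _ trilinear_1[OF assms]] linear_compose[OF _ trilinear_2[OF assms]]
  linear_compose[OF _ trilinear_3[OF assms]] trilinear_closed[OF assms] by auto

text \<open>At \<open>chi\<close> these four are, in this order, the factors of the cocycle identity
  written as an equation between two convolution products.\<close>

abbreviation "fA c \<equiv> %h g f. c h g \<star> eps f"
abbreviation "fB c \<equiv> %h g f. c (h ** g) f"
abbreviation "fC c \<equiv> %h g f. eps h \<star> c g f"
abbreviation "fD c \<equiv> %h g f. c h (g ** f)"

lemma conv3_tri: assumes "tri phi" "tri psi" shows "tri (conv3 phi psi)"
 unfolding conv3_def[abs_def] by (intro lin cl triD[OF assms(1)] triD[OF assms(2)]; assumption)

lemma conv3_cong: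
 assumes "!!a b c. a : cH ==> b : cH ==> c : cH ==> phi a b c = phi' a b c"
  "!!a b c. a : cH ==> b : cH ==> c : cH ==> psi a b c = psi' a b c"
  "h : cH" "g : cH" "f : cH"
 shows "conv3 phi psi h g f = conv3 phi' psi' h g f"
 unfolding conv3_def by (intro sw_cong assms(3-5)) (simp add: assms(1,2))

text \<open>Coassociativity in two arguments at once; the sums are first interleaved so that those
  over one argument are adjacent, and then restored.\<close>

lemma sw2_coassoc:
 assumes h: "h : cH" and g: "g : cH" and M: "kmod M" and F: "hexa_map H H H H H H M F"
 shows "sw M h (%x c. sw M g (%y d. sw M x (%a1 a2. sw M y (%b1 b2. F a1 a2 b1 b2 c d)))) =
  sw M h (%a1 x. sw M g (%b1 y. sw M x (%a2 c. sw M y (%b2 d. F a1 a2 b1 b2 c d))))"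
proof -
 note D = hexa_mapD[OF F] and C = hexa_closed[OF F]
 note R = bilinear_mapI trilinear_mapI sw_linear_fun sw_linear_arg D linear_id sw_closed C M
 have "sw M h (%x c. sw M g (%y d. sw M x (%a1 a2. sw M y (%b1 b2. F a1 a2 b1 b2 c d)))) =
   sw M h (%x c. sw M x (%a1 a2. sw M g (%y d. sw M y (%b1 b2. F a1 a2 b1 b2 c d))))"
  by (rule sw_cong[OF h], rule sw_swap[OF g _ M], assumption) (intro R; assumption)
 also have "... = sw M h (%a1 x. sw M x (%a2 c. sw M g (%y d. sw M y (%b1 b2. F a1 a2 b1 b2 c d))))"
  by (rule sw_coassoc[OF h M]) (intro R g; assumption)
 also have "... = sw M h (%a1 x. sw M x (%a2 c. sw M g (%b1 y. sw M y (%b2 d. F a1 a2 b1 b2 c d))))"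
  by (rule sw_cong[OF h], rule sw_cong, assumption, rule sw_coassoc[OF g M]) (intro R; assumption)
 also have "... = sw M h (%a1 x. sw M g (%b1 y. sw M x (%a2 c. sw M y (%b2 d. F a1 a2 b1 b2 c d))))"
  by (rule sw_cong[OF h], rule sw_swap[OF _ g M], assumption) (intro R; assumption)
 finally show ?thesis .
qed

lemma conv3_assoc:
 assumes t: "tri phi" "tri psi" "tri \<theta>" and h: "h : cH" and g: "g : cH" and f: "f : cH"
 shows "conv3 (conv3 phi psi) \<theta> h g f = conv3 phi (conv3 psi \<theta>) h g f"
proof -
 note r = triD[OF t(1)] triD[OF t(2)] triD[OF t(3)]
 note R = lin cl r
 note M = modG
 let ?F = "%h1 h2 g1 g2 h3 g3 f1 f2 f3. phi h1 g1 f1 \<star> (psi h2 g2 f2 \<star> \<theta> h3 g3 f3)"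
 let ?E = "%h1 h2 g1 g2 h3 g3. sw G f (%f1 z. sw G z (%f2 f3. ?F h1 h2 g1 g2 h3 g3 f1 f2 f3))"
 have "conv3 (conv3 phi psi) \<theta> h g f = sw G h (%x h3. sw G g (%y g3. sw G f (%z f3. sw G x (%h1 h2. sw G y (%g1 g2. sw G z (%f1 f2. ?F h1 h2 g1 g2 h3 g3 f1 f2 f3))))))"
  unfolding conv3_def
 proof (rule sw_cong[OF h], rule sw_cong[OF g], rule sw_cong[OF f])
  fix x h3 y g3 z f3 assume a: "x : cH" "h3 : cH" "y : cH" "g3 : cH" "z : cH" "f3 : cH"
  note k = r(12)[OF a(2,4,6)]
  have "sw G x (%h1 h2. sw G y (%g1 g2. sw G z (%f1 f2. phi h1 g1 f1 \<star> psi h2 g2 f2))) \<star> \<theta> h3 g3 f3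
    = sw G x (%h1 h2. sw G y (%g1 g2. sw G z (%f1 f2. phi h1 g1 f1 \<star> psi h2 g2 f2)) \<star> \<theta> h3 g3 f3)"
   by (rule sw_multK(2)[OF a(1) k]) (simp add: r | intro R a; assumption)+
  also have "... = sw G x (%h1 h2. sw G y (%g1 g2. sw G z (%f1 f2. phi h1 g1 f1 \<star> psi h2 g2 f2) \<star> \<theta> h3 g3 f3))"
   by (rule sw_cong[OF a(1)], rule sw_multK(2)[OF a(3) k]) (simp add: r | intro R a; assumption)+
  also have "... = sw G x (%h1 h2. sw G y (%g1 g2. sw G z (%f1 f2. (phi h1 g1 f1 \<star> psi h2 g2 f2) \<star> \<theta> h3 g3 f3)))"
   by (rule sw_cong[OF a(1)], rule sw_cong[OF a(3)], rule sw_multK(2)[OF a(5) k]) (simp add: r | intro R a; assumption)+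
  also have "... = sw G x (%h1 h2. sw G y (%g1 g2. sw G z (%f1 f2. ?F h1 h2 g1 g2 h3 g3 f1 f2 f3)))"
   using a by (intro sw_cong) (simp_all add: r K.m_assoc)
  finally show "sw G x (%h1 h2. sw G y (%g1 g2. sw G z (%f1 f2. phi h1 g1 f1 \<star> psi h2 g2 f2))) \<star> \<theta> h3 g3 f3 = ..." .
 qed
 also have "... = sw G h (%x h3. sw G g (%y g3. sw G x (%h1 h2. sw G f (%z f3. sw G y (%g1 g2. sw G z (%f1 f2. ?F h1 h2 g1 g2 h3 g3 f1 f2 f3))))))"
  by (rule sw_cong[OF h], rule sw_cong[OF g], rule sw_swap[OF f _ M], assumption) (simp, intro R; assumption)
 also have "... = sw G h (%x h3. sw G g (%y g3. sw G x (%h1 h2. sw G y (%g1 g2. sw G f (%z f3. sw G z (%f1 f2. ?F h1 h2 g1 g2 h3 g3 f1 f2 f3))))))"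
  by (rule sw_cong[OF h], rule sw_cong[OF g], rule sw_cong, assumption, rule sw_swap[OF f _ M], assumption) (simp, intro R; assumption)
 also have "... = sw G h (%x h3. sw G g (%y g3. sw G x (%h1 h2. sw G y (%g1 g2. ?E h1 h2 g1 g2 h3 g3))))"
  by (rule sw_cong[OF h], rule sw_cong[OF g], rule sw_cong, assumption, rule sw_cong, assumption, rule sw_coassoc[OF f M]) (intro R; assumption)
 also have "... = sw G h (%h1 x. sw G g (%g1 y. sw G x (%h2 h3. sw G y (%g2 g3. ?E h1 h2 g1 g2 h3 g3))))"
  by (rule sw2_coassoc[OF h g M]) (intro R f; assumption)
 also have "... = sw G h (%h1 x. sw G g (%g1 y. sw G x (%h2 h3. sw G f (%f1 z. sw G y (%g2 g3. sw G z (%f2 f3. ?F h1 h2 g1 g2 h3 g3 f1 f2 f3))))))"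
  by (rule sw_cong[OF h], rule sw_cong[OF g], rule sw_cong, assumption, rule sw_swap[OF _ f M], assumption) (simp, intro R; assumption)
 also have "... = sw G h (%h1 x. sw G g (%g1 y. sw G f (%f1 z. sw G x (%h2 h3. sw G y (%g2 g3. sw G z (%f2 f3. ?F h1 h2 g1 g2 h3 g3 f1 f2 f3))))))"
  by (rule sw_cong[OF h], rule sw_cong[OF g], rule sw_swap[OF _ f M], assumption) (simp, intro R; assumption)
 also have "... = conv3 phi (conv3 psi \<theta>) h g f"
  unfolding conv3_def
 proof (rule sw_cong[OF h], rule sw_cong[OF g], rule sw_cong[OF f])
  fix h1 x g1 y f1 z assume a: "h1 : cH" "x : cH" "g1 : cH" "y : cH" "f1 : cH" "z : cH"
  note k = r(4)[OF a(1,3,5)]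
  have "phi h1 g1 f1 \<star> sw G x (%h2 h3. sw G y (%g2 g3. sw G z (%f2 f3. psi h2 g2 f2 \<star> \<theta> h3 g3 f3)))
    = sw G x (%h2 h3. phi h1 g1 f1 \<star> sw G y (%g2 g3. sw G z (%f2 f3. psi h2 g2 f2 \<star> \<theta> h3 g3 f3)))"
   by (rule sw_multK(1)[OF a(2) k]) (simp add: r | intro R a; assumption)+
  also have "... = sw G x (%h2 h3. sw G y (%g2 g3. phi h1 g1 f1 \<star> sw G z (%f2 f3. psi h2 g2 f2 \<star> \<theta> h3 g3 f3)))"
   by (rule sw_cong[OF a(2)], rule sw_multK(1)[OF a(4) k]) (simp add: r | intro R a; assumption)+
  also have "... = sw G x (%h2 h3. sw G y (%g2 g3. sw G z (%f2 f3. ?F h1 h2 g1 g2 h3 g3 f1 f2 f3)))"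
   by (rule sw_cong[OF a(2)], rule sw_cong[OF a(4)], rule sw_multK(1)[OF a(6) k]) (simp add: r | intro R a; assumption)+
  finally show "sw G x (%h2 h3. sw G y (%g2 g3. sw G z (%f2 f3. ?F h1 h2 g1 g2 h3 g3 f1 f2 f3))) =
    phi h1 g1 f1 \<star> sw G x (%h2 h3. sw G y (%g2 g3. sw G z (%f2 f3. psi h2 g2 f2 \<star> \<theta> h3 g3 f3)))" by simp
 qed
 finally show ?thesis .
qed

definition "eps3 a b c = eps a \<star> (eps b \<star> eps c)"

lemma eps3_tri: "tri eps3"
 unfolding eps3_def[abs_def] by (intro lin cl; assumption)

lemma sw_eps_l:
 assumes h: "h : cH" and f: "lmap H G f" and k: "k :< K"
 shows "sw G h (%a b. (k \<star> eps a) \<star> f b) = k \<star> f h"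
proof -
 note fc = linear_closed[OF f, simplified]
 have "sw G h (%a b. (k \<star> eps a) \<star> f b) = sw G h (%a b. eps a *[G] (k \<star> f b))"
  by (intro sw_cong[OF h]) (simp add: fc k K.m_ac)
 also have "... = k \<star> f h" by (rule sw_counit_l[OF h modG]) (intro lin f k)
 finally show ?thesis .
qed

lemma sw_eps_r:
 assumes h: "h : cH" and f: "lmap H G f" and k: "k :< K"
 shows "sw G h (%a b. f a \<star> (k \<star> eps b)) = f h \<star> k"
proof -
 note fc = linear_closed[OF f, simplified]
 have "sw G h (%a b. f a \<star> (k \<star> eps b)) = sw G h (%a b. eps b *[G] (f a \<star> k))"
  by (intro sw_cong[OF h]) (simp add: fc k K.m_ac)
 also have "... = f h \<star> k" by (rule sw_counit_r[OF h modG]) (intro lin f k)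
 finally show ?thesis .
qed

lemma conv3_eps_l:
 assumes t: "tri phi" and h: "h : cH" and g: "g : cH" and f: "f : cH"
 shows "conv3 eps3 phi h g f = phi h g f"
proof -
 note R = lin cl triD[OF t] and r = triD(4)[OF t]
 have "conv3 eps3 phi h g f = sw G h (%h1 h2. sw G g (%g1 g2. sw G f (%f1 f2. ((eps h1 \<star> eps g1) \<star> eps f1) \<star> phi h2 g2 f2)))"
  unfolding conv3_def eps3_def by (intro sw_cong h g f) (simp add: r K.m_assoc)
 also have "... = sw G h (%h1 h2. sw G g (%g1 g2. (eps h1 \<star> eps g1) \<star> phi h2 g2 f))"
  by (rule sw_cong[OF h], rule sw_cong[OF g], rule sw_eps_l[OF f]) (intro R; assumption)+
 also have "... = sw G h (%h1 h2. eps h1 \<star> phi h2 g f)"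
  by (rule sw_cong[OF h], rule sw_eps_l[OF g]) (intro R f; assumption)+
 also have "... = sw G h (%h1 h2. (\<one>\<^bsub>K\<^esub> \<star> eps h1) \<star> phi h2 g f)"
  by (intro sw_cong[OF h]) simp
 also have "... = \<one>\<^bsub>K\<^esub> \<star> phi h g f"
  by (rule sw_eps_l[OF h]) (intro R f g; assumption)+
 finally show ?thesis using r h g f by simp
qed

lemma conv3_eps_r:
 assumes t: "tri phi" and h: "h : cH" and g: "g : cH" and f: "f : cH"
 shows "conv3 phi eps3 h g f = phi h g f"
proof -
 note R = lin cl triD[OF t] and r = triD(4)[OF t]
 have "conv3 phi eps3 h g f = sw G h (%h1 h2. sw G g (%g1 g2. sw G f (%f1 f2. phi h1 g1 f1 \<star> ((eps h2 \<star> eps g2) \<star> eps f2))))"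
  unfolding conv3_def eps3_def by (intro sw_cong h g f) (simp add: r K.m_assoc)
 also have "... = sw G h (%h1 h2. sw G g (%g1 g2. phi h1 g1 f \<star> (eps h2 \<star> eps g2)))"
  by (rule sw_cong[OF h], rule sw_cong[OF g], rule sw_eps_r[OF f]) (intro R; assumption)+
 also have "... = sw G h (%h1 h2. phi h1 g f \<star> eps h2)"
  by (rule sw_cong[OF h], rule sw_eps_r[OF g]) (intro R f; assumption)+
 also have "... = sw G h (%h1 h2. phi h1 g f \<star> (\<one>\<^bsub>K\<^esub> \<star> eps h2))"
  by (intro sw_cong[OF h]) simp
 also have "... = phi h g f \<star> \<one>\<^bsub>K\<^esub>"
  by (rule sw_eps_r[OF h]) (intro R f g; assumption)+
 finally show ?thesis using r h g f by simp
qed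

text \<open>Functionals that agree on \<open>H\<close> have to be equal as HOL functions before they
  can be elements of a monoid; restriction achieves this.\<close>

definition "res3 phi = (\<lambda>h\<in>cH. \<lambda>g\<in>cH. \<lambda>f\<in>cH. phi h g f)"

lemma res3_apply [simp]: "h : cH ==> g : cH ==> f : cH ==> res3 phi h g f = phi h g f"
 by (simp add: res3_def)

lemma res3_eqI: "(!!h g f. h : cH ==> g : cH ==> f : cH ==> phi h g f = psi h g f) ==> res3 phi = res3 psi"
 unfolding res3_def by (intro restrict_ext) simp

lemma tri_cong:
 assumes "!!a b c. a : cH ==> b : cH ==> c : cH ==> phi a b c = phi' a b c" "tri phi"
 shows "tri phi'"
proof (rule trilinear_mapI)
 fix b c assume "b : cH" "c : cH"
 then show "lmap H G (%a. phi' a b c)" "lmap H G (%a. phi' b a c)" "lmap H G (%a. phi' b c a)"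
  using linear_cong[OF _ modH, of "%a. phi a b c" "%a. phi' a b c" G] linear_cong[OF _ modH, of "%a. phi b a c" "%a. phi' b a c" G]
   linear_cong[OF _ modH, of "%a. phi b c a" "%a. phi' b c a" G] assms(1) assms(2)[unfolded trilinear_map_def] by auto
qed

lemma tri_res3: "tri phi ==> tri (res3 phi)"
 by (rule tri_cong[of phi]) simp_all

definition "conv_monoid = \<lparr>carrier = {phi. tri phi \<and> res3 phi = phi}, mult = \<lambda>phi psi. res3 (conv3 phi psi), one = res3 eps3\<rparr>"

abbreviation conv_mult (infixl "*." 70) where "x *. y \<equiv> x \<otimes>\<^bsub>conv_monoid\<^esub> y"

lemma res3_res3 [simp]: "res3 (res3 phi) = res3 phi"
 by (rule res3_eqI) simp

lemma conv_monoid: "monoid conv_monoid"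
proof (rule monoidI)
 fix x y z assume "x :< conv_monoid" "y :< conv_monoid" "z :< conv_monoid"
 then have t: "tri x" "tri y" "tri z" "res3 x = x" by (simp_all add: conv_monoid_def)
 show "x *. y :< conv_monoid" using t by (simp add: conv_monoid_def tri_res3 conv3_tri)
 show "x *. y *. z = x *. (y *. z)"
  unfolding conv_monoid_def monoid.simps
 proof (rule res3_eqI)
  fix h g f assume a: "h : cH" "g : cH" "f : cH"
  have "conv3 (res3 (conv3 x y)) z h g f = conv3 (conv3 x y) z h g f" by (rule conv3_cong[OF _ _ a]) simp_all
  moreover have "conv3 x (res3 (conv3 y z)) h g f = conv3 x (conv3 y z) h g f" by (rule conv3_cong[OF _ _ a]) simp_all
  ultimately show "conv3 (res3 (conv3 x y)) z h g f = conv3 x (res3 (conv3 y z)) h g f"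
   using conv3_assoc[OF t(1-3) a] by simp
 qed
 have "res3 (conv3 (res3 eps3) x) = res3 x"
 proof (rule res3_eqI)
  fix h g f assume a: "h : cH" "g : cH" "f : cH"
  have "conv3 (res3 eps3) x h g f = conv3 eps3 x h g f" by (rule conv3_cong[OF _ _ a]) simp_all
  then show "conv3 (res3 eps3) x h g f = x h g f" using conv3_eps_l[OF t(1) a] by simp
 qed
 then show "\<one>\<^bsub>conv_monoid\<^esub> *. x = x" using t by (simp add: conv_monoid_def)
 have "res3 (conv3 x (res3 eps3)) = res3 x"
 proof (rule res3_eqI)
  fix h g f assume a: "h : cH" "g : cH" "f : cH"
  have "conv3 x (res3 eps3) h g f = conv3 x eps3 h g f" by (rule conv3_cong[OF _ _ a]) simp_all
  then show "conv3 x (res3 eps3) h g f = x h g f" using conv3_eps_r[OF t(1) a] by simp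
 qed
 then show "x *. \<one>\<^bsub>conv_monoid\<^esub> = x" using t by (simp add: conv_monoid_def)
qed (simp add: conv_monoid_def tri_res3 eps3_tri)

lemma conv_monoid_mult: "res3 phi *. res3 psi = res3 (conv3 phi psi)"
 unfolding conv_monoid_def monoid.simps by (rule res3_eqI, rule conv3_cong) simp_all

lemma conv_monoid_mem: "tri phi ==> res3 phi :< conv_monoid"
 by (simp add: conv_monoid_def tri_res3)

end

section \<open>Cocycles\<close>

text \<open>\<open>chi\<close> is taken as a function of two arguments and its inverse
  \<open>chi'\<close> as a datum. With both given, the locale can be instantiated at the
  co-opposite, and at the twist, with the two exchanged.\<close>

locale cocyc = hopf_loc K H for K :: "('k, 'l) ring_scheme" and H :: "('k, 'h) hopf" +
 fixes chi chi' :: "'h \<Rightarrow> 'h \<Rightarrow> 'k"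
 assumes chi_bil: "bilinear_map K H H G chi" and chi'_bil: "bilinear_map K H H G chi'"
  and inv1: "!!h g. h :< H ==> g :< H ==> sw G h (%a h'. sw G g (%b g'. chi a b \<otimes>\<^bsub>K\<^esub> chi' h' g')) = eps h \<otimes>\<^bsub>K\<^esub> eps g"
  and inv2: "!!h g. h :< H ==> g :< H ==> sw G h (%a h'. sw G g (%b g'. chi' a b \<otimes>\<^bsub>K\<^esub> chi h' g')) = eps h \<otimes>\<^bsub>K\<^esub> eps g"
  and coc: "!!h g f. h :< H ==> g :< H ==> f :< H ==>
   sw G g (%g1 g2. sw G f (%f1 f2. chi g1 f1 \<otimes>\<^bsub>K\<^esub> chi h (g2 ** f2))) = sw G h (%h1 h2. sw G g (%g1 g2. chi h1 g1 \<otimes>\<^bsub>K\<^esub> chi (h2 ** g2) f))"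
  and unit_1: "!!h. h :< H ==> chi u h = eps h"
begin

lemma chi_lin [lin]:
 "lmap X H f ==> b : cH ==> lmap X G (%x. chi (f x) b)"
 "lmap X H f ==> b : cH ==> lmap X G (%x. chi b (f x))"
 "lmap X H f ==> b : cH ==> lmap X G (%x. chi' (f x) b)"
 "lmap X H f ==> b : cH ==> lmap X G (%x. chi' b (f x))"
 by (rule linear_bil_l[OF chi_bil] linear_bil_r[OF chi_bil] linear_bil_l[OF chi'_bil] linear_bil_r[OF chi'_bil]; assumption)+

lemma chi_closed [simp, cl]:
 "a : cH ==> b : cH ==> chi a b :< K" "a : cH ==> b : cH ==> chi' a b :< K"
 using bilinear_closed[OF chi_bil] bilinear_closed[OF chi'_bil] by simp_all

lemma tri_ABCD:
 assumes c: "bmap H H G c"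
 shows "tri (fA c)" "tri (fB c)" "tri (fC c)" "tri (fD c)"
 by (intro lin cl bmap_rules[OF c, simplified]; assumption)+

text \<open>Each of the four functionals is the pullback of \<open>c\<close> along a coalgebra map
  from \<open>H \<otimes> H \<otimes> H\<close> to \<open>H \<otimes> H\<close>, so it takes
  convolution inverses to convolution inverses.\<close>

lemma cA:
 assumes "!!h g. h : cH ==> g : cH ==> sw G h (%a h'. sw G g (%b g'. c a b \<star> d h' g')) = eps h \<star> eps g"
  and c: "bmap H H G c" and d: "bmap H H G d"
 shows "res3 (fA c) *. res3 (fA d) = \<one>\<^bsub>conv_monoid\<^esub>"
  "res3 (fB c) *. res3 (fB d) = \<one>\<^bsub>conv_monoid\<^esub>"
  "res3 (fC c) *. res3 (fC d) = \<one>\<^bsub>conv_monoid\<^esub>"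
  "res3 (fD c) *. res3 (fD d) = \<one>\<^bsub>conv_monoid\<^esub>"
proof -
 note R = lin cl bmap_rules[OF c, simplified]
   bmap_rules[OF d, simplified]
 note cc = bilinear_closed[OF c, simplified] bilinear_closed[OF d, simplified]
 note M = modG
 have one: "\<one>\<^bsub>conv_monoid\<^esub> = res3 eps3" by (simp add: conv_monoid_def)
 show "res3 (fA c) *. res3 (fA d) = \<one>\<^bsub>conv_monoid\<^esub>"
  unfolding conv_monoid_mult one
 proof (rule res3_eqI)
  fix h g f assume h: "h : cH" and g: "g : cH" and f: "f : cH"
  have "conv3 (fA c) (fA d) h g f
    = sw G h (%h1 h2. sw G g (%g1 g2. sw G f (%f1 f2. ((c h1 g1 \<star> d h2 g2) \<star> eps f1) \<star> eps f2)))"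
   unfolding conv3_def by (intro sw_cong h g f) (simp add: cc K.m_ac)
  also have "... = sw G h (%h1 h2. sw G g (%g1 g2. (c h1 g1 \<star> d h2 g2) \<star> eps f))"
   by (rule sw_cong[OF h], rule sw_cong[OF g], rule sw_eps_l[OF f]) (intro R; assumption)+
  also have "... = sw G h (%h1 h2. sw G g (%g1 g2. (c h1 g1 \<star> d h2 g2) *[G] eps f))" by simp
  also have "... = sw G h (%h1 h2. sw G g (%g1 g2. c h1 g1 \<star> d h2 g2)) *[G] eps f"
   by (rule sw2_smult[OF M h g]) (simp_all add: f cc)
  also have "... = eps3 h g f" by (simp add: assms(1) eps3_def h g f K.m_assoc)
  finally show "conv3 (fA c) (fA d) h g f = eps3 h g f" .
 qed
 show "res3 (fC c) *. res3 (fC d) = \<one>\<^bsub>conv_monoid\<^esub>"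
  unfolding conv_monoid_mult one
 proof (rule res3_eqI)
  fix h g f assume h: "h : cH" and g: "g : cH" and f: "f : cH"
  have "conv3 (fC c) (fC d) h g f
    = sw G h (%h1 h2. sw G g (%g1 g2. sw G f (%f1 f2. (c g1 f1 \<star> d g2 f2) *[G] (eps h1 \<star> eps h2))))"
   unfolding conv3_def by (intro sw_cong h g f) (simp add: cc K.m_ac)
  also have "... = sw G h (%h1 h2. sw G g (%g1 g2. sw G f (%f1 f2. c g1 f1 \<star> d g2 f2)) *[G] (eps h1 \<star> eps h2))"
   by (rule sw_cong[OF h], rule sw2_smult[OF M g f]) (simp_all add: cc)
  also have "... = sw G h (%h1 h2. eps h1 *[G] ((eps g \<star> eps f) \<star> eps h2))"
   by (intro sw_cong[OF h]) (simp add: assms(1) g f K.m_ac)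
  also have "... = (eps g \<star> eps f) \<star> eps h" by (rule sw_counit_l[OF h M]) (intro R f g)
  finally show "conv3 (fC c) (fC d) h g f = eps3 h g f"
   by (simp add: eps3_def h g f K.m_ac)
 qed
 show "res3 (fB c) *. res3 (fB d) = \<one>\<^bsub>conv_monoid\<^esub>"
  unfolding conv_monoid_mult one
 proof (rule res3_eqI)
  fix h g f assume h: "h : cH" and g: "g : cH" and f: "f : cH"
  have "conv3 (fB c) (fB d) h g f = sw G (h ** g) (%p q. sw G f (%f1 f2. c p f1 \<star> d q f2))"
   unfolding conv3_def by (rule sw_mult[OF h g M, symmetric]) (intro R f; assumption)
  then show "conv3 (fB c) (fB d) h g f = eps3 h g f"
   using h g f by (simp add: assms(1) eps3_def K.m_assoc)
 qed
 show "res3 (fD c) *. res3 (fD d) = \<one>\<^bsub>conv_monoid\<^esub>"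
  unfolding conv_monoid_mult one
 proof (rule res3_eqI)
  fix h g f assume h: "h : cH" and g: "g : cH" and f: "f : cH"
  have "conv3 (fD c) (fD d) h g f = sw G h (%h1 h2. sw G (g ** f) (%p q. c h1 p \<star> d h2 q))"
   unfolding conv3_def by (rule sw_cong[OF h], rule sw_mult[OF g f M, symmetric]) (intro R; assumption)
  then show "conv3 (fD c) (fD d) h g f = eps3 h g f"
   using h g f by (simp add: assms(1) eps3_def K.m_assoc)
 qed
qed

lemma AB_CD: "res3 (fA chi) *. res3 (fB chi)
  = res3 (fC chi) *. res3 (fD chi)"
 unfolding conv_monoid_mult
proof (rule res3_eqI)
 fix h g f assume h: "h : cH" and g: "g : cH" and f: "f : cH"
 have "conv3 (fA chi) (fB chi) h g f = sw G h (%h1 h2. sw G g (%g1 g2. chi h1 g1 \<star> chi (h2 ** g2) f))"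
  unfolding conv3_def by (rule sw_cong[OF h], rule sw_cong[OF g], rule sw_eps_l[OF f]) (intro lin cl; assumption)+
 also have "... = sw G g (%g1 g2. sw G f (%f1 f2. chi g1 f1 \<star> chi h (g2 ** f2)))" by (rule coc[OF h g f, symmetric])
 also have "... = sw G h (%h1 h2. eps h1 *[G] sw G g (%g1 g2. sw G f (%f1 f2. chi g1 f1 \<star> chi h2 (g2 ** f2))))"
  by (rule sw_counit_l[OF h modG, symmetric]) (intro lin cl g f; assumption)
 also have "... = sw G h (%h1 h2. sw G g (%g1 g2. eps h1 *[G] sw G f (%f1 f2. chi g1 f1 \<star> chi h2 (g2 ** f2))))"
  by (rule sw_cong[OF h], rule sw_multK(3)[OF g]) (simp add: chi_closed f | intro lin cl f; assumption)+
 also have "... = sw G h (%h1 h2. sw G g (%g1 g2. sw G f (%f1 f2. eps h1 *[G] (chi g1 f1 \<star> chi h2 (g2 ** f2)))))"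
  by (rule sw_cong[OF h], rule sw_cong[OF g], rule sw_multK(3)[OF f]) (simp add: chi_closed | intro lin cl; assumption)+
 also have "... = conv3 (fC chi) (fD chi) h g f"
  unfolding conv3_def by (intro sw_cong h g f) (simp add: chi_closed K.m_assoc)
 finally show "conv3 (fA chi) (fB chi) h g f = conv3 (fC chi) (fD chi) h g f" .
qed

interpretation cm: monoid conv_monoid by (rule conv_monoid)

lemmas mem = tri_ABCD[OF chi_bil, THEN conv_monoid_mem] tri_ABCD[OF chi'_bil, THEN conv_monoid_mem]
lemmas i1 = cA[OF inv1 chi_bil chi'_bil] and i2 = cA[OF inv2 chi'_bil chi_bil]

lemma res3_eqD: "res3 phi = res3 psi ==> h : cH ==> g : cH ==> f : cH ==> phi h g f = psi h g f"
 using res3_apply[of h g f phi] res3_apply[of h g f psi] by simp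

text \<open>Solving the cocycle identity \<open>A B = C D\<close> for \<open>C^-1 A = D B^-1\<close>
  yields an identity that mixes \<open>chi\<close> and its inverse. It is what makes
  \<open>U\<close> invertible.\<close>

lemma cocycle_swap1:
 assumes h: "h : cH" and g: "g : cH" and f: "f : cH"
 shows "sw G g (%g1 g2. chi' g1 f \<star> chi h g2) = sw G h (%h1 h2. sw G g (%g1 g2. sw G f (%f1 f2. chi h1 (g1 ** f1) \<star> chi' (h2 ** g2) f2)))"
proof -
 have "conv3 (fC chi') (fA chi) h g f = conv3 (fD chi) (fB chi') h g f"
  by (rule res3_eqD[OF cm.mult_eq_swap[OF mem(1-4) mem(7) mem(6) AB_CD i2(3) i1(2), unfolded conv_monoid_mult] h g f])
 moreover have "conv3 (fC chi') (fA chi) h g f = sw G g (%g1 g2. chi' g1 f \<star> chi h g2)"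
 proof -
  have "conv3 (fC chi') (fA chi) h g f =
    sw G h (%h1 h2. sw G g (%g1 g2. sw G f (%f1 f2. (eps h1 \<star> chi' g1 f1) \<star> (chi h2 g2 \<star> eps f2))))" by (simp add: conv3_def)
  also have "... = sw G h (%h1 h2. sw G g (%g1 g2. (eps h1 \<star> chi' g1 f) \<star> chi h2 g2))"
   by (rule sw_cong[OF h], rule sw_cong[OF g], rule sw_eps_r[OF f]) (intro lin cl; assumption)+
  also have "... = sw G h (%h1 h2. sw G g (%g1 g2. eps h1 *[G] (chi' g1 f \<star> chi h2 g2)))"
   by (intro sw_cong h g) (simp add: chi_closed f K.m_assoc)
  also have "... = sw G h (%h1 h2. eps h1 *[G] sw G g (%g1 g2. chi' g1 f \<star> chi h2 g2))"
   by (rule sw_cong[OF h], rule sw_multK(3)[OF g, symmetric]) (simp add: chi_closed f | intro lin cl f; assumption)+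
  also have "... = sw G g (%g1 g2. chi' g1 f \<star> chi h g2)"
   by (rule sw_counit_l[OF h modG]) (intro lin cl g f; assumption)
  finally show ?thesis .
 qed
 ultimately show ?thesis by (simp add: conv3_def)
qed

text \<open>Inverting both sides of \<open>A B = C D\<close>. The inverse satisfies the cocycle
  identity with reversed coproducts, which is the one for the co-opposite.\<close>

lemma coc_inverse:
 assumes h: "h : cH" and g: "g : cH" and f: "f : cH"
 shows "sw G g (%g1 g2. sw G f (%f1 f2. chi' g2 f2 \<star> chi' h (g1 ** f1))) = sw G h (%h1 h2. sw G g (%g1 g2. chi' h2 g2 \<star> chi' (h1 ** g1) f))"
proof -
 have "conv3 (fB chi') (fA chi') h g f = conv3 (fD chi') (fC chi') h g f"
  by (rule res3_eqD[OF cm.mult_eq_inverse[OF mem AB_CD i2(1,2) i1(3,4), unfolded conv_monoid_mult] h g f])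
 moreover have "conv3 (fB chi') (fA chi') h g f = sw G h (%h1 h2. sw G g (%g1 g2. chi' h2 g2 \<star> chi' (h1 ** g1) f))"
 proof -
  have "conv3 (fB chi') (fA chi') h g f = sw G h (%h1 h2. sw G g (%g1 g2. chi' (h1 ** g1) f \<star> chi' h2 g2))"
   unfolding conv3_def by (rule sw_cong[OF h], rule sw_cong[OF g], rule sw_eps_r[OF f]) (intro lin cl; assumption)+
  also have "... = sw G h (%h1 h2. sw G g (%g1 g2. chi' h2 g2 \<star> chi' (h1 ** g1) f))"
   by (intro sw_cong h g) (simp add: chi_closed f K.m_comm)
  finally show ?thesis .
 qed
 moreover have "conv3 (fD chi') (fC chi') h g f = sw G g (%g1 g2. sw G f (%f1 f2. chi' g2 f2 \<star> chi' h (g1 ** f1)))"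
 proof -
  have "conv3 (fD chi') (fC chi') h g f =
   sw G h (%h1 h2. sw G g (%g1 g2. sw G f (%f1 f2. eps h2 *[G] (chi' g2 f2 \<star> chi' h1 (g1 ** f1)))))"
   unfolding conv3_def by (intro sw_cong h g f) (simp add: chi_closed K.m_ac)
  also have "... = sw G h (%h1 h2. sw G g (%g1 g2. eps h2 *[G] sw G f (%f1 f2. chi' g2 f2 \<star> chi' h1 (g1 ** f1))))"
   by (rule sw_cong[OF h], rule sw_cong[OF g], rule sw_multK(3)[OF f, symmetric]) (simp add: chi_closed | intro lin cl; assumption)+
  also have "... = sw G h (%h1 h2. eps h2 *[G] sw G g (%g1 g2. sw G f (%f1 f2. chi' g2 f2 \<star> chi' h1 (g1 ** f1))))"
   by (rule sw_cong[OF h], rule sw_multK(3)[OF g, symmetric]) (simp add: chi_closed f | intro lin cl f; assumption)+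
  also have "... = sw G g (%g1 g2. sw G f (%f1 f2. chi' g2 f2 \<star> chi' h (g1 ** f1)))"
   by (rule sw_counit_r[OF h modG]) (intro lin cl g f; assumption)
  finally show ?thesis .
 qed
 ultimately show ?thesis by simp
qed

text \<open>Normalisation in the second argument follows from that in the first. The cocycle
  identity at \<open>g = f = 1\<close> says that \<open>chi(-, 1)\<close> is idempotent under
  convolution; being invertible, it is the counit.\<close>

lemma unit_r: assumes h: "h : cH" shows "chi h u = eps h"
proof -
 note M = modG and uH = Hr.one_closed
 have 1: "chi x u = sw G x (%a b. chi a u \<star> chi b u)" if x: "x : cH" for x
 proof -
  have "sw G u (%g1 g2. sw G u (%f1 f2. chi g1 f1 \<star> chi x (g2 ** f2))) = sw G u (%f1 f2. chi u f1 \<star> chi x (u ** f2))"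
   by (rule sw_one[OF M]) (intro lin cl x; assumption)
  also have "... = chi u u \<star> chi x (u ** u)" by (rule sw_one[OF M]) (intro lin cl x; assumption)
  also have "... = chi x u" using x by (simp add: unit_1 chi_closed)
  finally have L: "sw G u (%g1 g2. sw G u (%f1 f2. chi g1 f1 \<star> chi x (g2 ** f2))) = chi x u" .
  have "sw G x (%h1 h2. sw G u (%g1 g2. chi h1 g1 \<star> chi (h2 ** g2) u)) = sw G x (%h1 h2. chi h1 u \<star> chi (h2 ** u) u)"
   by (rule sw_cong[OF x], rule sw_one[OF M]) (intro lin cl; assumption)
  also have "... = sw G x (%h1 h2. chi h1 u \<star> chi h2 u)" by (intro sw_cong[OF x]) simp
  finally show ?thesis using L coc[OF x uH uH] by simp
 qed
 have 2: "sw G x (%a b. chi' a u \<star> chi b u) = eps x" if x: "x : cH" for x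
 proof -
  have "sw G x (%a b. chi' a u \<star> chi b u) = sw G x (%a b. sw G u (%c d. chi' a c \<star> chi b d))"
   by (rule sw_cong[OF x], rule sw_one[OF M, symmetric]) (intro lin cl; assumption)
  then show ?thesis using inv2[OF x uH] x by simp
 qed
 have "eps h = sw G h (%a r. chi' a u \<star> sw G r (%b c. chi b u \<star> chi c u))"
  unfolding 2[OF h, symmetric] by (intro sw_cong[OF h]) (simp add: 1[symmetric])
 also have "... = sw G h (%a r. sw G r (%b c. chi' a u \<star> (chi b u \<star> chi c u)))"
  by (rule sw_cong[OF h], rule sw_multK(1)) (simp add: chi_closed)+
 also have "... = sw G h (%r c. sw G r (%a b. chi' a u \<star> (chi b u \<star> chi c u)))"
  by (rule sw_coassoc[OF h M, symmetric]) (intro lin cl; assumption)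
 also have "... = sw G h (%r c. sw G r (%a b. (chi' a u \<star> chi b u) \<star> chi c u))"
  by (intro sw_cong[OF h], rule sw_cong, assumption) (simp add: chi_closed K.m_assoc)
 also have "... = sw G h (%r c. sw G r (%a b. chi' a u \<star> chi b u) \<star> chi c u)"
  by (rule sw_cong[OF h], rule sw_multK(2)[symmetric]) (simp add: chi_closed)+
 also have "... = sw G h (%r c. eps r *[G] chi c u)"
  by (intro sw_cong[OF h]) (simp add: 2)
 also have "... = chi h u" by (rule sw_counit_l[OF h M]) (intro lin cl)
 finally show ?thesis by simp
qed

lemma unit_inv: assumes h: "h : cH" shows "chi' u h = eps h" "chi' h u = eps h"
proof -
 note M = modG and uH = Hr.one_closed
 have "eps h = sw G u (%a b. sw G h (%c d. chi a c \<star> chi' b d))" using inv1[OF uH h] h by simp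
 also have "... = sw G h (%c d. chi u c \<star> chi' u d)" by (rule sw_one[OF M]) (intro lin cl h; assumption)
 also have "... = sw G h (%c d. eps c *[G] chi' u d)" by (intro sw_cong[OF h]) (simp add: unit_1)
 also have "... = chi' u h" by (rule sw_counit_l[OF h M]) (intro lin cl)
 finally show "chi' u h = eps h" by simp
 have "eps h = sw G h (%a b. sw G u (%c d. chi a c \<star> chi' b d))" using inv1[OF h uH] h by simp
 also have "... = sw G h (%a b. chi a u \<star> chi' b u)"
  by (rule sw_cong[OF h], rule sw_one[OF M]) (intro lin cl; assumption)
 also have "... = sw G h (%a b. eps a *[G] chi' b u)" by (intro sw_cong[OF h]) (simp add: unit_r)
 also have "... = chi' h u" by (rule sw_counit_l[OF h M]) (intro lin cl)
 finally show "chi' h u = eps h" by simp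
qed

lemmas unit = unit_1 unit_r unit_inv

text \<open>Passing to the co-opposite reverses convolution, so \<open>chi'\<close> and
  \<open>chi\<close> remain mutually inverse, and the cocycle identity required of
  \<open>chi'\<close> is \<open>coc_inverse\<close>.\<close>

lemma cocyc_cop: "cocyc K (hcop H) chi' chi"
proof (rule cocyc.intro[OF hopf_loc_cop cocyc_axioms.intro])
 have c: "csw G h F = sw G h (%a b. F b a)" if "h : cH" "bmap H H G F" for h F
  by (rule sw_cop_raw[OF that(1) modG that(2)])
 have cc: "csw G h (%a h'. csw G g (%b g'. F a h' b g')) = sw G h (%h' a. sw G g (%g' b. F a h' b g'))"
  if h: "h : cH" and g: "g : cH"
   and D1: "!!b c d. b : cH ==> c : cH ==> d : cH ==> lmap H G (%a. F a b c d)"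
   "!!a c d. a : cH ==> c : cH ==> d : cH ==> lmap H G (%b. F a b c d)"
   "!!a b d. a : cH ==> b : cH ==> d : cH ==> lmap H G (%c. F a b c d)"
   "!!a b c. a : cH ==> b : cH ==> c : cH ==> lmap H G (%d. F a b c d)" for h g F
 proof -
  have "csw G h (%a h'. csw G g (%b g'. F a h' b g')) = csw G h (%a h'. sw G g (%g' b. F a h' b g'))"
  proof (rule coalg.sw_cong[OF coalg_cop])
   fix a h' assume "a :< (hcop H)" "h' :< (hcop H)"
   then show "csw G g (%b g'. F a h' b g') = sw G g (%g' b. F a h' b g')"
    by (intro c[OF g] bilinear_mapI D1) simp_all
  qed (simp add: h)
  also have "... = sw G h (%h' a. sw G g (%g' b. F a h' b g'))"
   by (rule c[OF h]) (intro lin cl D1 g; assumption)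
  finally show ?thesis .
 qed
 show "bmap (hcop H) (hcop H) G chi'" "bmap (hcop H) (hcop H) G chi"
  by (simp_all add: chi_bil chi'_bil)
 fix h g f assume "h :< (hcop H)" "g :< (hcop H)"
 then have h: "h : cH" and g: "g : cH" by simp_all
 have "csw G h (%a h'. csw G g (%b g'. chi' a b \<star> chi h' g')) = sw G h (%h' a. sw G g (%g' b. chi' a b \<star> chi h' g'))"
  by (rule cc[OF h g]; (intro lin cl; assumption))
 also have "... = sw G h (%h' a. sw G g (%g' b. chi h' g' \<star> chi' a b))"
  by (intro sw_cong[OF h] sw_cong[OF g]) (simp add: K.m_comm)
 finally show "csw G h (%a h'. csw G g (%b g'. chi' a b \<star> chi h' g')) = counit (hcop H) h \<star> counit (hcop H) g"
  using inv1[OF h g] by simp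
 have "csw G h (%a h'. csw G g (%b g'. chi a b \<star> chi' h' g')) = sw G h (%h' a. sw G g (%g' b. chi a b \<star> chi' h' g'))"
  by (rule cc[OF h g]; (intro lin cl; assumption))
 also have "... = sw G h (%h' a. sw G g (%g' b. chi' h' g' \<star> chi a b))"
  by (intro sw_cong[OF h] sw_cong[OF g]) (simp add: K.m_comm)
 finally show "csw G h (%a h'. csw G g (%b g'. chi a b \<star> chi' h' g')) = counit (hcop H) h \<star> counit (hcop H) g"
  using inv2[OF h g] by simp
 assume "f :< (hcop H)" then have f: "f : cH" by simp
 show "csw G g (%g1 g2. csw G f (%f1 f2. chi' g1 f1 \<star> chi' h (mult (hcop H) g2 f2))) =
   csw G h (%h1 h2. csw G g (%g1 g2. chi' h1 g1 \<star> chi' (mult (hcop H) h2 g2) f))"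
 proof -
  have "csw G g (%g1 g2. csw G f (%f1 f2. chi' g1 f1 \<star> chi' h (g2 ** f2)))
    = sw G g (%g2 g1. sw G f (%f2 f1. chi' g1 f1 \<star> chi' h (g2 ** f2)))"
   by (rule cc[OF g f]; (intro lin cl h; assumption))
  moreover have "csw G h (%h1 h2. csw G g (%g1 g2. chi' h1 g1 \<star> chi' (h2 ** g2) f))
    = sw G h (%h2 h1. sw G g (%g2 g1. chi' h1 g1 \<star> chi' (h2 ** g2) f))"
   by (rule cc[OF h g]; (intro lin cl f; assumption))
  ultimately show ?thesis unfolding hcop_simps by (simp only: coc_inverse[OF h g f])
 qed
qed (simp_all add: unit)

text \<open>Both composites expand to the sum of \<open>omega(a, b, d)\<close> times the common
  value \<open>n (m x' y') z'\<close>. Here \<open>omega\<close> comes out as one side of the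
  cocycle identity for the first composite and as the other side for the second.\<close>

lemma tw_assoc:
 assumes l: "lc X" "lc Y" "lc Z" and c: "coact P" "coact P'" and Q: "kmod Q"
  and m: "bmap X Y P m" "colin K H X Y P m" and n: "bmap P Z Q n"
  and m': "bmap Y Z P' m'" "colin K H Y Z P' m'" and n': "bmap X P' Q n'"
  and e: "!!x y z. x :< X ==> y :< Y ==> z :< Z ==> n (m x y) z = n' x (m' y z)"
  and x: "x :< X" and y: "y :< Y" and z: "z :< Z"
 shows "tw chi P Z Q n (tw chi X Y P m x y) z = tw chi X P' Q n' x (tw chi Y Z P' m' y z)"
proof -
 interpret Q: module K Q by (rule Q)
 note cX = coact_lc[OF l(1)] and cY = coact_lc[OF l(2)] and cZ = coact_lc[OF l(3)]
 note mP = coact_module[OF c(1)] and mP' = coact_module[OF c(2)]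
 note mr = bmap_rules[OF m(1)]
  and nr = bmap_rules[OF n]
  and mr' = bmap_rules[OF m'(1)]
  and nr' = bmap_rules[OF n']
 note R = lin cl mr nr mr' nr' cX cY cZ c Q Q.smult_closed mP mP'
 have sl: "lmap Q Q (%t. k *[Q] t)" if "k :< K" for k
  using that by (intro lin Q)
 let ?\<omega> = "%a b d. sw G a (%a1 a2. sw G b (%b1 b2. chi a1 b1 \<star> chi (a2 ** b2) d))"
 have "tw chi P Z Q n (tw chi X Y P m x y) z = lsw Q X x (%a x'. lsw Q Y y (%b y'. chi a b *[Q] tw chi P Z Q n (m x' y') z))"
  using tw_push[OF chi_bil cX cY mP Q mr(3) bilinear_l[OF tw_bilinear[OF chi_bil c(1) cZ Q n] z] x y] by (simp add: tw_def)
 also have "... = lsw Q X x (%a x'. lsw Q Y y (%b y'. lsw Q X x' (%a2 x''. lsw Q Y y' (%b2 y''. chi a b *[Q] lsw Q Z z (%d z'. chi (a2 ** b2) d *[Q] n (m x'' y'') z')))))"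
 proof (rule lsw_cong[OF cX x], rule lsw_cong[OF cY y])
  fix a x' b y' assume a: "a : cH" and x': "x' :< X" and b: "b : cH" and y': "y' :< Y"
  have "tw chi P Z Q n (m x' y') z = lsw Q X x' (%a2 x''. lsw Q Y y' (%b2 y''. lsw Q Z z (%d z'. chi (a2 ** b2) d *[Q] n (m x'' y'') z')))"
   unfolding tw_def by (rule colinD[OF m(2) cX cY c(1) m(1) Q _ x' y']) (intro R z; assumption)
  then have "chi a b *[Q] tw chi P Z Q n (m x' y') z = lsw Q X x' (%a2 x''. chi a b *[Q] lsw Q Y y' (%b2 y''. lsw Q Z z (%d z'. chi (a2 ** b2) d *[Q] n (m x'' y'') z')))"
   by (simp only:) (rule lsw_push[OF cX x' Q Q _ sl], (intro R z y' a b; assumption)+)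
  also have "... = lsw Q X x' (%a2 x''. lsw Q Y y' (%b2 y''. chi a b *[Q] lsw Q Z z (%d z'. chi (a2 ** b2) d *[Q] n (m x'' y'') z')))"
   by (rule lsw_cong[OF cX x'], rule lsw_push[OF cY y' Q Q _ sl]) (intro R z a b; assumption)+
  finally show "chi a b *[Q] tw chi P Z Q n (m x' y') z = ..." .
 qed
 also have "... = lsw Q X x (%a x'. lsw Q Y y (%b y'. sw Q a (%a1 a2. sw Q b (%b1 b2. chi a1 b1 *[Q] lsw Q Z z (%d z'. chi (a2 ** b2) d *[Q] n (m x' y') z')))))"
  by (rule lsw2_coassoc[OF l(1,2) x y Q]) (intro R z; assumption)
 also have "... = lsw Q X x (%a x'. lsw Q Y y (%b y'. lsw Q Z z (%d z'. ?\<omega> a b d *[Q] n (m x' y') z')))"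
 proof (rule lsw_cong[OF cX x], rule lsw_cong[OF cY y])
  fix a x' b y' assume a: "a : cH" and x': "x' :< X" and b: "b : cH" and y': "y' :< Y"
  let ?f = "%a1 a2 b1 b2 d z'. (chi a1 b1 \<star> chi (a2 ** b2) d) *[Q] n (m x' y') z'"
  have "sw Q a (%a1 a2. sw Q b (%b1 b2. chi a1 b1 *[Q] lsw Q Z z (%d z'. chi (a2 ** b2) d *[Q] n (m x' y') z')))
    = sw Q a (%a1 a2. sw Q b (%b1 b2. lsw Q Z z (%d z'. chi a1 b1 *[Q] (chi (a2 ** b2) d *[Q] n (m x' y') z'))))"
   by (rule sw_cong[OF a], rule sw_cong[OF b], rule lsw_push[OF cZ z Q Q _ sl]) (intro R x' y'; assumption)+
  also have "... = sw Q a (%a1 a2. sw Q b (%b1 b2. lsw Q Z z (%d z'. ?f a1 a2 b1 b2 d z')))"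
   by (intro sw_cong[OF a] sw_cong[OF b] lsw_cong[OF cZ z]) (simp add: Q.smult_assoc1 mr nr x' y')
  also have "... = sw Q a (%a1 a2. lsw Q Z z (%d z'. sw Q b (%b1 b2. ?f a1 a2 b1 b2 d z')))"
   by (rule sw_cong[OF a], rule lsw_sw_swap[OF cZ z b Q, symmetric]) (intro R x' y'; assumption)
  also have "... = lsw Q Z z (%d z'. sw Q a (%a1 a2. sw Q b (%b1 b2. ?f a1 a2 b1 b2 d z')))"
   by (rule lsw_sw_swap[OF cZ z a Q, symmetric]) (intro R x' y' b; assumption)
  also have "... = lsw Q Z z (%d z'. ?\<omega> a b d *[Q] n (m x' y') z')"
   by (rule lsw_cong[OF cZ z], rule sw2_smult[OF Q a b]) (intro R x' y'; assumption)+
  finally show "sw Q a (%a1 a2. sw Q b (%b1 b2. chi a1 b1 *[Q] lsw Q Z z (%d z'. chi (a2 ** b2) d *[Q] n (m x' y') z'))) = ..." .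
 qed
 finally have L: "tw chi P Z Q n (tw chi X Y P m x y) z = lsw Q X x (%a x'. lsw Q Y y (%b y'. lsw Q Z z (%d z'. ?\<omega> a b d *[Q] n (m x' y') z')))" .
 have "tw chi X P' Q n' x (tw chi Y Z P' m' y z) = lsw Q X x (%a x'. lsw Q P' (tw chi Y Z P' m' y z) (%p p'. chi a p *[Q] n' x' p'))"
  by (simp add: tw_def[of _ X])
 also have "... = lsw Q X x (%a x'. lsw Q Y y (%b y'. lsw Q Z z (%d z'. ?\<omega> a b d *[Q] n (m x' y') z')))"
 proof (rule lsw_cong[OF cX x])
  fix a x' assume a: "a : cH" and x': "x' :< X"
  let ?phi = "%q. lsw Q P' q (%p p'. chi a p *[Q] n' x' p')"
  have phib: "bmap H P' Q (%p p'. chi a p *[Q] n' x' p')" by (intro R a x'; assumption)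
  have phil: "lmap P' Q ?phi" by (rule lsw_linear[OF c(2) phib Q])
  have "?phi (tw chi Y Z P' m' y z) = lsw Q Y y (%b y'. lsw Q Z z (%d z'. chi b d *[Q] ?phi (m' y' z')))"
   using tw_push[OF chi_bil cY cZ mP' Q mr'(3) phil y z] by (simp add: tw_def)
  also have "... = lsw Q Y y (%b y'. lsw Q Z z (%d z'. lsw Q Y y' (%b2 y''. lsw Q Z z' (%d2 z''. chi b d *[Q] (chi a (b2 ** d2) *[Q] n' x' (m' y'' z''))))))"
  proof (rule lsw_cong[OF cY y], rule lsw_cong[OF cZ z])
   fix b y' d z' assume b: "b : cH" and y': "y' :< Y" and d: "d : cH" and z': "z' :< Z"
   have "?phi (m' y' z') = lsw Q Y y' (%b2 y''. lsw Q Z z' (%d2 z''. chi a (b2 ** d2) *[Q] n' x' (m' y'' z'')))"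
    by (rule colinD[OF m'(2) cY cZ c(2) m'(1) Q phib y' z'])
   then have "chi b d *[Q] ?phi (m' y' z') = lsw Q Y y' (%b2 y''. chi b d *[Q] lsw Q Z z' (%d2 z''. chi a (b2 ** d2) *[Q] n' x' (m' y'' z'')))"
    by (simp only:) (rule lsw_push[OF cY y' Q Q _ sl], (intro R z' y' a b d x'; assumption)+)
   also have "... = lsw Q Y y' (%b2 y''. lsw Q Z z' (%d2 z''. chi b d *[Q] (chi a (b2 ** d2) *[Q] n' x' (m' y'' z''))))"
    by (rule lsw_cong[OF cY y'], rule lsw_push[OF cZ z' Q Q _ sl]) (intro R z' a b d x'; assumption)+
   finally show "chi b d *[Q] ?phi (m' y' z') = ..." .
  qed
  also have "... = lsw Q Y y (%b y'. lsw Q Z z (%d z'. sw Q b (%b1 b2. sw Q d (%d1 d2. chi b1 d1 *[Q] (chi a (b2 ** d2) *[Q] n' x' (m' y' z'))))))"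
   by (rule lsw2_coassoc[OF l(2,3) y z Q]) (intro R a x'; assumption)
  also have "... = lsw Q Y y (%b y'. lsw Q Z z (%d z'. ?\<omega> a b d *[Q] n (m x' y') z'))"
  proof (rule lsw_cong[OF cY y], rule lsw_cong[OF cZ z])
   fix b y' d z' assume b: "b : cH" and y': "y' :< Y" and d: "d : cH" and z': "z' :< Z"
   have "sw Q b (%b1 b2. sw Q d (%d1 d2. chi b1 d1 *[Q] (chi a (b2 ** d2) *[Q] n' x' (m' y' z'))))
    = sw Q b (%b1 b2. sw Q d (%d1 d2. (chi b1 d1 \<star> chi a (b2 ** d2)) *[Q] n (m x' y') z'))"
    by (intro sw_cong[OF b] sw_cong[OF d]) (simp add: Q.smult_assoc1 mr nr x' y' z' a e[symmetric])
   also have "... = sw G b (%b1 b2. sw G d (%d1 d2. chi b1 d1 \<star> chi a (b2 ** d2))) *[Q] n (m x' y') z'"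
    by (rule sw2_smult[OF Q b d]) (intro R x' y' z' a; assumption)+
   also have "... = ?\<omega> a b d *[Q] n (m x' y') z'" by (simp only: coc[OF a b d])
   finally show "sw Q b (%b1 b2. sw Q d (%d1 d2. chi b1 d1 *[Q] (chi a (b2 ** d2) *[Q] n' x' (m' y' z')))) = ..." .
  qed
  finally show "?phi (tw chi Y Z P' m' y z) = ..." .
 qed
 finally show ?thesis using L by simp
qed

end

section \<open>The antipode of the twisted Hopf algebra\<close>

context hopf_loc
begin

lemma sw_smultM:
 assumes h: "h : cH" and M: "kmod M" and v: "v :< M" and F: "!!a b. a : cH ==> b : cH ==> F a b :< K"
 shows "sw G h F *[M] v = sw M h (%a b. F a b *[M] v)"
 by (rule sw_push[OF h modG M _ bilinear_l[OF bilinear_smult[OF M] v]]) (simp add: F)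

lemma sw4:
 assumes m: "m : cH" and M: "kmod M"
  and q: "!!b c d. b : cH ==> c : cH ==> d : cH ==> lmap H M (%a. X a b c d)"
   "!!a c d. a : cH ==> c : cH ==> d : cH ==> lmap H M (%b. X a b c d)"
   "!!a b d. a : cH ==> b : cH ==> d : cH ==> lmap H M (%c. X a b c d)"
   "!!a b c. a : cH ==> b : cH ==> c : cH ==> lmap H M (%d. X a b c d)"
 shows "sw M m (%a b. sw M a (%a1 a2. sw M b (%b1 b2. X a1 a2 b1 b2))) = sw M m (%a1 r. sw M r (%q b2. sw M q (%a2 b1. X a1 a2 b1 b2)))"
proof -
 note R = lin cl q linear_closed[OF q(1)] M
 have "sw M m (%a b. sw M a (%a1 a2. sw M b (%b1 b2. X a1 a2 b1 b2))) = sw M m (%a1 r. sw M r (%a2 b. sw M b (%b1 b2. X a1 a2 b1 b2)))"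
  by (rule sw_coassoc[OF m M]) (intro R; assumption)
 also have "... = sw M m (%a1 r. sw M r (%q b2. sw M q (%a2 b1. X a1 a2 b1 b2)))"
  by (rule sw_cong[OF m], rule sw_coassoc[OF _ M, symmetric], assumption) (intro R; assumption)
 finally show ?thesis .
qed

text \<open>In the first equation both sides are \<open>X m_1 (S m_4) m_2 (S m_3)\<close>, in the
  second \<open>X (S m_2) m_3 (S m_1) m_4\<close>. The right-hand sides consist of coproducts, as
  identities for twisted products need; on the left, factors which the antipode cancels are
  adjacent.\<close>

lemma antipode_sandwich:
 assumes m: "m : cH" and M: "kmod M"
  and q: "!!b c d. b : cH ==> c : cH ==> d : cH ==> lmap H M (%a. X a b c d)"
   "!!a c d. a : cH ==> c : cH ==> d : cH ==> lmap H M (%b. X a b c d)"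
   "!!a b d. a : cH ==> b : cH ==> d : cH ==> lmap H M (%c. X a b c d)"
   "!!a b c. a : cH ==> b : cH ==> c : cH ==> lmap H M (%d. X a b c d)"
 shows "sw M m (%a r. sw M r (%b c. sw M b (%b1 b2. X a (S c) b1 (S b2)))) = sw M m (%a b. sw M a (%a1 a2. sw M (S b) (%b1 b2. X a1 b1 a2 b2)))"
  "sw M m (%a r. sw M r (%b c. sw M b (%b1 b2. X (S b1) b2 (S a) c))) = sw M m (%a b. sw M (S a) (%a1 a2. sw M b (%b1 b2. X a1 b1 a2 b2)))"
proof -
 note r = linear_compose[OF _ q(1)] linear_compose[OF _ q(2)] linear_compose[OF _ q(3)] linear_compose[OF _ q(4)]
 note R = lin cl r linear_closed[OF q(1)] M
 have "sw M m (%a b. sw M a (%a1 a2. sw M (S b) (%b1 b2. X a1 b1 a2 b2))) = sw M m (%a b. sw M a (%a1 a2. sw M b (%b1 b2. X a1 (S b2) a2 (S b1))))"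
  by (rule sw_cong[OF m], rule sw_cong, assumption, rule S_comult[OF _ M], assumption) (intro R; assumption)
 also have "... = sw M m (%a r. sw M r (%b c. sw M b (%b1 b2. X a (S c) b1 (S b2))))"
  by (rule sw4[OF m M]) (intro R; assumption)+
 finally show "sw M m (%a r. sw M r (%b c. sw M b (%b1 b2. X a (S c) b1 (S b2)))) = sw M m (%a b. sw M a (%a1 a2. sw M (S b) (%b1 b2. X a1 b1 a2 b2)))" ..
 have "sw M m (%a b. sw M (S a) (%a1 a2. sw M b (%b1 b2. X a1 b1 a2 b2))) = sw M m (%a b. sw M a (%a1 a2. sw M b (%b1 b2. X (S a2) b1 (S a1) b2)))"
  by (rule sw_cong[OF m], rule S_comult[OF _ M], assumption) (intro R; assumption)
 also have "... = sw M m (%a r. sw M r (%b c. sw M b (%b1 b2. X (S b1) b2 (S a) c)))"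
  by (rule sw4[OF m M]) (intro R; assumption)+
 finally show "sw M m (%a r. sw M r (%b c. sw M b (%b1 b2. X (S b1) b2 (S a) c))) = sw M m (%a b. sw M (S a) (%a1 a2. sw M b (%b1 b2. X a1 b1 a2 b2)))" ..
qed

end

context cocyc
begin

definition "U h = sw G h (%a b. chi a (S b))"
text \<open>The explicit candidate for the convolution inverse of \<open>U\<close>.\<close>

definition "Ui h = sw G h (%a b. chi' (S a) b)"

lemma U_lin [lin]: "lmap X H f ==> lmap X G (%x. U (f x))" "lmap X H f ==> lmap X G (%x. Ui (f x))"
 unfolding U_def Ui_def by (intro lin cl; assumption)+

lemma U_closed [simp, cl]: "h : cH ==> U h :< K" "h : cH ==> Ui h :< K"
 using linear_closed[OF U_lin(1)[OF linear_id]] linear_closed[OF U_lin(2)[OF linear_id]] by auto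

text \<open>The product \<open>chi(m_1, S m_2) chi'(S m_3, m_4)\<close> is the left side of the
  mixed identity with \<open>g\<close> in the image of \<open>S\<close>. On its right side
  \<open>h_2 g_2\<close> cancels by the antipode axiom, \<open>chi'(1, -)\<close> is the counit,
  then \<open>g_1 f_1\<close> cancels and \<open>chi(-, 1)\<close> is the counit.\<close>

lemma U_Ui: assumes m: "m : cH" shows "sw G m (%a b. U a \<star> Ui b) = eps m"
proof -
 note M = modG
 note R = lin cl
 let ?Y = "%h1 w z f1 f2. chi h1 (S z ** f1) \<star> chi' w f2"
 have "sw G m (%a b. U a \<star> Ui b) = sw G m (%a b. sw G a (%a1 a2. sw G b (%b1 b2. chi a1 (S a2) \<star> chi' (S b1) b2)))"
 proof (rule sw_cong[OF m])
  fix a b assume a: "a : cH" and b: "b : cH"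
  have "U a \<star> Ui b = sw G a (%a1 a2. chi a1 (S a2) \<star> Ui b)"
   unfolding U_def by (rule sw_multK(2)[OF a]) (simp_all add: b)
  also have "... = sw G a (%a1 a2. sw G b (%b1 b2. chi a1 (S a2) \<star> chi' (S b1) b2))"
   unfolding Ui_def by (rule sw_cong[OF a], rule sw_multK(1)[OF b]) simp_all
  finally show "U a \<star> Ui b = ..." .
 qed
 also have "... = sw G m (%h r. sw G r (%z f. sw G z (%z1 z2. chi h (S z1) \<star> chi' (S z2) f)))"
  by (rule sw4[OF m M]) (intro R; assumption)+
 \<comment> \<open>The two middle factors are recombined into the coproduct of \<open>S z\<close>,
   the shape to which \<open>cocycle_swap1\<close> applies. The antipode reverses the coproduct, so
   \<open>g_1\<close> is the later of the two.\<close>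
 also have "... = sw G m (%h r. sw G r (%z f. sw G (S z) (%g1 g2. chi' g1 f \<star> chi h g2)))"
 proof (rule sw_cong[OF m], rule sw_cong, assumption)
  fix h r z f assume a: "h : cH" "r : cH" "z : cH" "f : cH"
  have "sw G (S z) (%g1 g2. chi' g1 f \<star> chi h g2) = sw G z (%z1 z2. chi' (S z2) f \<star> chi h (S z1))"
   by (rule S_comult[OF a(3) M]) (intro R a; assumption)
  also have "... = sw G z (%z1 z2. chi h (S z1) \<star> chi' (S z2) f)"
   by (intro sw_cong a(3)) (simp add: a K.m_comm)
  finally show "sw G z (%z1 z2. chi h (S z1) \<star> chi' (S z2) f) = sw G (S z) (%g1 g2. chi' g1 f \<star> chi h g2)" by simp
 qed
 also have "... = sw G m (%h r. sw G r (%z f. sw G h (%h1 h2. sw G z (%z1 z2. sw G f (%f1 f2. ?Y h1 (h2 ** S z1) z2 f1 f2)))))"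
 proof (rule sw_cong[OF m], rule sw_cong, assumption)
  fix h r z f assume a: "h : cH" "r : cH" "z : cH" "f : cH"
  have "sw G (S z) (%g1 g2. chi' g1 f \<star> chi h g2) = sw G h (%h1 h2. sw G (S z) (%g1 g2. sw G f (%f1 f2. chi h1 (g1 ** f1) \<star> chi' (h2 ** g2) f2)))"
   by (rule cocycle_swap1[OF a(1) S_closed[OF a(3)] a(4)])
  also have "... = sw G h (%h1 h2. sw G z (%z1 z2. sw G f (%f1 f2. ?Y h1 (h2 ** S z1) z2 f1 f2)))"
   by (rule sw_cong[OF a(1)], rule S_comult[OF a(3) M]) (intro R a; assumption)
  finally show "sw G (S z) (%g1 g2. chi' g1 f \<star> chi h g2) = ..." .
 qed
 also have "... = sw G m (%h r. sw G h (%h1 h2. sw G r (%z f. sw G z (%z1 z2. sw G f (%f1 f2. ?Y h1 (h2 ** S z1) z2 f1 f2)))))"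
  by (rule sw_cong[OF m], rule sw_swap[OF _ _ M], assumption, assumption) (simp, intro R; assumption)
 also have "... = sw G m (%h1 t. sw G t (%h2 r. sw G r (%z f. sw G z (%z1 z2. sw G f (%f1 f2. ?Y h1 (h2 ** S z1) z2 f1 f2)))))"
  by (rule sw_coassoc[OF m M]) (intro R; assumption)
 also have "... = sw G m (%h1 t. sw G t (%h2 r. sw G r (%z1 s. sw G s (%z2 f. sw G f (%f1 f2. ?Y h1 (h2 ** S z1) z2 f1 f2)))))"
  by (rule sw_cong[OF m], rule sw_cong, assumption, rule sw_coassoc[OF _ M], assumption) (intro R; assumption)
 also have "... = sw G m (%h1 t. sw G t (%p s. sw G p (%h2 z1. sw G s (%z2 f. sw G f (%f1 f2. ?Y h1 (h2 ** S z1) z2 f1 f2)))))"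
  by (rule sw_cong[OF m], rule sw_coassoc[OF _ M, symmetric], assumption) (intro R; assumption)
 also have "... = sw G m (%h1 t. sw G t (%p s. eps p *[G] sw G s (%z2 f. sw G f (%f1 f2. ?Y h1 u z2 f1 f2))))"
  by (rule sw_cong[OF m], rule sw_cong, assumption, rule antipode_r[OF _ M], assumption) (intro R; assumption)
 also have "... = sw G m (%h1 t. sw G t (%z f. sw G f (%f1 f2. ?Y h1 u z f1 f2)))"
  by (rule sw_cong[OF m], rule sw_counit_l[OF _ M], assumption) (intro R; assumption)
 also have "... = sw G m (%h1 t. sw G t (%z f. chi h1 (S z ** f)))"
 proof (rule sw_cong[OF m], rule sw_cong, assumption)
  fix h t z f assume a: "h : cH" "t : cH" "z : cH" "f : cH"
  have "sw G f (%f1 f2. ?Y h u z f1 f2) = sw G f (%f1 f2. eps f2 *[G] chi h (S z ** f1))"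
   by (rule sw_cong[OF a(4)]) (simp add: unit a K.m_comm)
  also have "... = chi h (S z ** f)" by (rule sw_counit_r[OF a(4) M]) (intro R a; assumption)
  finally show "sw G f (%f1 f2. ?Y h u z f1 f2) = chi h (S z ** f)" .
 qed
 also have "... = sw G m (%h t. eps t *[G] eps h)"
 proof (rule sw_cong[OF m])
  fix h t assume a: "h : cH" "t : cH"
  have "sw G t (%z f. chi h (S z ** f)) = eps t *[G] chi h u" by (rule antipode_l[OF a(2) M]) (intro R a; assumption)
  then show "sw G t (%z f. chi h (S z ** f)) = eps t *[G] eps h" using a by (simp add: unit)
 qed
 also have "... = eps m" by (rule sw_counit_r[OF m M]) (intro R)
 finally show ?thesis .
qed

end

text \<open>The previous identity for the co-opposite, evaluated at \<open>S m\<close>. Composition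
  with \<open>S\<close> turns the \<open>U\<close> of the co-opposite into \<open>Ui\<close> and its
  \<open>Ui\<close> into \<open>U\<close>.\<close>

lemma (in cocyc) Ui_U: assumes m: "m : cH" shows "sw G m (%a b. Ui a \<star> U b) = eps m"
proof -
 interpret c: cocyc K "hcop H" chi' chi by (rule cocyc_cop)
 note M = modG and Sm = S_closed[OF m]
 let ?S = "antipode (hcop H)"
 have SS: "?S (S b) = b" if "b : cH" for b
  using S_inj[of "?S (S b)" b] S_inv[of "S b"] that by simp
 have Sl: "lmap X H f ==> lmap X H (%x. ?S (f x))" for X f
  using c.linear_antipode[of X f] by simp
 have Sc: "a : cH ==> ?S a : cH" for a using c.S_closed by simp
 note R = lin cl Sl Sc
 have 1: "c.U (S x) = Ui x" if x: "x : cH" for x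
 proof -
  have "c.U (S x) = sw G (S x) (%a b. chi' b (?S a))"
   unfolding c.U_def by (rule sw_cop_raw[OF S_closed[OF x] M]) (intro R; assumption)
  also have "... = sw G x (%a b. chi' (S a) (?S (S b)))" by (rule S_comult[OF x M]) (intro R; assumption)
  finally show ?thesis unfolding Ui_def using x by (simp add: SS cong: sw_cong)
 qed
 have 2: "c.Ui (S x) = U x" if x: "x : cH" for x
 proof -
  have "c.Ui (S x) = sw G (S x) (%a b. chi (?S b) a)"
   unfolding c.Ui_def by (rule sw_cop_raw[OF S_closed[OF x] M]) (intro R; assumption)
  also have "... = sw G x (%a b. chi (?S (S a)) (S b))" by (rule S_comult[OF x M]) (intro R; assumption)
  finally show ?thesis unfolding U_def using x by (simp add: SS cong: sw_cong)
 qed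
 have Ul: "lmap X H f ==> lmap X G (%x. c.U (f x))" "lmap X H f ==> lmap X G (%x. c.Ui (f x))" for X f
  using c.U_lin[of X f] by simp_all
 have "eps m = csw G (S m) (%a b. c.U a \<star> c.Ui b)" using c.U_Ui[of "S m"] m by simp
 also have "... = sw G (S m) (%a b. c.U b \<star> c.Ui a)"
  by (rule sw_cop_raw[OF Sm M]) (intro lin cl Ul; simp)
 also have "... = sw G m (%a b. c.U (S a) \<star> c.Ui (S b))"
  by (rule S_comult[OF m M]) (intro lin cl Ul; simp)
 also have "... = sw G m (%a b. Ui a \<star> U b)" by (rule sw_cong[OF m]) (simp add: 1 2)
 finally show ?thesis by simp
qed

section \<open>Twisting from both sides\<close>

definition ftw where
 "ftw phi psi X Y P m = tw phi X Y P (ctw psi X Y P m)"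

lemma tw_module: "add P = add P' ==> zero P = zero P' ==> smult P = smult P' ==> tw phi X Y P m = tw phi X Y P' m"
 by (simp add: tw_def lsw_def tensor_lift_def fun_eq_iff)

lemma tw_copP [simp]: "tw phi X Y (bcop P) m = tw phi X Y P m"
 by (rule tw_module) simp_all

context hopf_loc
begin

lemma bil_copD: "bmap X Y P m ==> bmap (bcop X) (bcop Y) P m"
 by (simp add: bilinear_map_def linear_map_def)

lemma ftw_inner_bil:
 assumes psi: "bmap H H G psi" and X: "bic X" and Y: "bic Y" and P: "kmod P" and m: "bmap X Y P m"
 shows "bmap X Y P (ctw psi X Y P m)"
 using tw_bilinear[OF psi bic_cop_coact[OF X] bic_cop_coact[OF Y] P bil_copD[OF m]]
 by (simp add: bilinear_map_def linear_map_def)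

lemma ftw_bilinear:
 assumes phi: "bmap H H G phi" and psi: "bmap H H G psi" and X: "bic X" and Y: "bic Y" and P: "kmod P" and m: "bmap X Y P m"
 shows "bmap X Y P (ftw phi psi X Y P m)"
 unfolding ftw_def[abs_def] by (rule tw_bilinear[OF phi bic_coact[OF X] bic_coact[OF Y] P ftw_inner_bil[OF psi X Y P m]])

lemma ftw_cong:
 assumes X: "bic X" and Y: "bic Y" and e: "!!x y. x :< X ==> y :< Y ==> m x y = m' x y" and x: "x :< X" and y: "y :< Y"
 shows "ftw phi psi X Y P m x y = ftw phi psi X Y P m' x y"
 unfolding ftw_def
 by (rule tw_cong[OF bic_coact[OF X] bic_coact[OF Y] tw_cong[OF bic_cop_coact[OF X] bic_cop_coact[OF Y]] x y]) (simp_all add: e)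

lemma lcolin_cop_D: "lmap X X' g ==> lmap (bcop X) (bcop X') g"
 by (simp add: linear_map_def)

lemma ftw_natural:
 assumes phi: "bmap H H G phi" and psi: "bmap H H G psi" and b: "bic X" "bic X'" "bic Y" "bic Y'" "kmod P" "kmod P'"
  and m: "bmap X Y P m" and m': "bmap X' Y' P' m'"
  and f: "lmap P P' f"
  and g: "lcolin K H X X' g" "lcolin K (hcop H) (bcop X) (bcop X') g" "lmap X X' g"
  and k: "lcolin K H Y Y' k" "lcolin K (hcop H) (bcop Y) (bcop Y') k" "lmap Y Y' k"
  and e: "!!x y. x :< X ==> y :< Y ==> f (m x y) = m' (g x) (k y)"
  and x: "x :< X" and y: "y :< Y"
 shows "f (ftw phi psi X Y P m x y) = ftw phi psi X' Y' P' m' (g x) (k y)"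
 unfolding ftw_def
proof (rule tw_natural[OF phi bic_coact[OF b(1)] bic_coact[OF b(2)] bic_coact[OF b(3)] bic_coact[OF b(4)] b(5,6)
  ftw_inner_bil[OF psi b(1,3,5) m] ftw_inner_bil[OF psi b(2,4,6) m'] f g(1,3) k(1,3) _ x y])
 fix x y assume a: "x :< X" "y :< Y"
 show "f (ctw psi X Y P m x y) = ctw psi X' Y' P' m' (g x) (k y)"
  by (rule hopf_loc.tw_natural[OF hopf_loc_cop, of psi "bcop X" "bcop X'" "bcop Y" "bcop Y'" P P' m m' f g k])
   (simp_all add: a e psi b coact_cop bic_cop_coact bil_copD m m' f g k lcolin_cop_D)
qed

lemma tw_LI_l:
 assumes phi: "bmap H H G phi" and phiu: "!!b. b : cH ==> phi u b = eps b" and X: "coact X" and Y: "lc Y" and P: "kmod P"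
  and m: "bmap X Y P m" and x: "x : LI X" and y: "y :< Y"
 shows "tw phi X Y P m x y = m x y"
proof -
 note cY = coact_lc[OF Y] and mX = coact_module[OF X]
 note mr = bmap_rules[OF m]
 have "tw phi X Y P m x y = lsw P Y y (%b y'. phi u b *[P] m x y')"
  unfolding tw_def by (rule lsw_LI[OF x mX P])
   (intro lin cl mr P cY y bmap_rules[OF phi, simplified] module.smult_closed[OF P]; assumption)
 also have "... = lsw P Y y (%b y'. eps b *[P] m x y')" by (rule lsw_cong[OF cY y]) (simp add: phiu)
 also have "... = m x y" by (rule lsw_counit[OF Y y P]) (intro mr lin LI_mem[OF x])
 finally show ?thesis .
qed

lemma tw_LI_r:
 assumes phi: "bmap H H G phi" and phiu: "!!b. b : cH ==> phi b u = eps b" and X: "lc X" and Y: "coact Y" and P: "kmod P"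
  and m: "bmap X Y P m" and x: "x :< X" and y: "y : LI Y"
 shows "tw phi X Y P m x y = m x y"
proof -
 note cX = coact_lc[OF X] and mY = coact_module[OF Y]
 note mr = bmap_rules[OF m]
 have "tw phi X Y P m x y = lsw P X x (%a x'. phi a u *[P] m x' y)"
  unfolding tw_def by (rule lsw_cong[OF cX x], rule lsw_LI[OF y mY P])
   (intro lin cl mr P bmap_rules[OF phi, simplified]; assumption)
 also have "... = lsw P X x (%a x'. eps a *[P] m x' y)" by (rule lsw_cong[OF cX x]) (simp add: phiu)
 also have "... = m x y" by (rule lsw_counit[OF X x P]) (intro mr lin LI_mem[OF y])
 finally show ?thesis .
qed

end

context cocyc
begin

lemma cop_lc: "bic X ==> left_comodule K (hcop H) (bcop X)"
 by (simp add: bicomodule_def)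

lemma cop_tw_LI_l:
 assumes X: "bic X" and Y: "bic Y" and P: "kmod P" and m: "bmap X Y P m" and x: "x : RI X" and y: "y :< Y"
 shows "ctw chi' X Y P m x y = m x y"
 using hopf_loc.tw_LI_l[OF hopf_loc_cop, of chi' "bcop X" "bcop Y" P m x y] chi'_bil unit X Y P bil_copD[OF m] x y
 by (simp add: coact_cop bic_cop_coact cop_lc right_invariant_cop)

lemma cop_tw_LI_r:
 assumes X: "bic X" and Y: "bic Y" and P: "kmod P" and m: "bmap X Y P m" and x: "x :< X" and y: "y : RI Y"
 shows "ctw chi' X Y P m x y = m x y"
 using hopf_loc.tw_LI_r[OF hopf_loc_cop, of chi' "bcop X" "bcop Y" P m x y] chi'_bil unit X Y P bil_copD[OF m] x y
 by (simp add: coact_cop bic_cop_coact cop_lc right_invariant_cop)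

abbreviation "ft \<equiv> ftw chi chi'"

text \<open>One invariant argument per side is enough: the left coaction of \<open>x\<close> puts
  the unit into \<open>chi\<close>, the right coaction of \<open>y\<close> puts it into
  \<open>chi'\<close>, and both are normalised.\<close>

lemma ftw_LI_RI:
 assumes X: "bic X" and Y: "bic Y" and P: "kmod P" and m: "bmap X Y P m" and x: "x : LI X" and y: "y : RI Y"
 shows "ft X Y P m x y = m x y"
 unfolding ftw_def
 using tw_LI_l[OF chi_bil unit(1) bic_coact[OF X] bic_lc[OF Y] P ftw_inner_bil[OF chi'_bil X Y P m] x RI_mem[OF y]]
  cop_tw_LI_r[OF X Y P m LI_mem[OF x] y] by simp

lemma ftw_RI_LI:
 assumes X: "bic X" and Y: "bic Y" and P: "kmod P" and m: "bmap X Y P m" and x: "x : RI X" and y: "y : LI Y"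
 shows "ft X Y P m x y = m x y"
 unfolding ftw_def
 using tw_LI_r[OF chi_bil unit(2) bic_lc[OF X] bic_coact[OF Y] P ftw_inner_bil[OF chi'_bil X Y P m] RI_mem[OF x] y]
  cop_tw_LI_l[OF X Y P m x LI_mem[OF y]] by simp

lemma one_LI: "u : LI HU" and one_RI: "u : RI HU"
 using H_hopf by (simp_all add: left_invariant_def right_invariant_def hopf_algebra_def)

lemma ftw_one_l:
 assumes Y: "bic Y" and P: "kmod P" and m: "bmap H Y P m" and y: "y :< Y"
 shows "ft HU Y P m u y = m u y"
 unfolding ftw_def
 using tw_LI_l[OF chi_bil unit(1) coact_unit bic_lc[OF Y] P ftw_inner_bil[OF chi'_bil bic_unit Y P] one_LI y]
  cop_tw_LI_l[OF bic_unit Y P _ one_RI y, of m] m by simp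

lemma ftw_one_r:
 assumes X: "bic X" and P: "kmod P" and m: "bmap X H P m" and x: "x :< X"
 shows "ft X HU P m x u = m x u"
 unfolding ftw_def
 using tw_LI_r[OF chi_bil unit(2) bic_lc[OF X] coact_unit P ftw_inner_bil[OF chi'_bil X bic_unit P] x one_LI]
  cop_tw_LI_r[OF X bic_unit P _ x one_RI, of m] m by simp

lemma cop_tw_inverse:
 assumes X: "bic X" and Y: "bic Y" and P: "kmod P" and m: "bmap X Y P m" and x: "x :< X" and y: "y :< Y"
 shows "ctw chi X Y P (ctw chi' X Y P m) x y = m x y"
  "ctw chi' X Y P (ctw chi X Y P m) x y = m x y"
proof -
 interpret c: cocyc K "hcop H" chi' chi by (rule cocyc_cop)
 show "ctw chi X Y P (ctw chi' X Y P m) x y = m x y"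
  using c.tw_inverse[OF c.chi'_bil c.chi_bil c.inv2 cop_lc[OF X] cop_lc[OF Y] P bil_copD[OF m], of x y] x y by simp
 show "ctw chi' X Y P (ctw chi X Y P m) x y = m x y"
  using c.tw_inverse[OF c.chi_bil c.chi'_bil c.inv1 cop_lc[OF X] cop_lc[OF Y] P bil_copD[OF m], of x y] x y by simp
qed

lemma ftw_comm:
 assumes X: "bic X" and Y: "bic Y" and P: "kmod P" and m: "bmap X Y P m" and x: "x :< X" and y: "y :< Y"
 shows "ft X Y P m x y = ctw chi' X Y P (tw chi X Y P m) x y"
 unfolding ftw_def by (rule tw_comm[OF chi_bil chi'_bil X Y P m x y])

text \<open>Undoes one half of the two-sided twist. For the product of \<open>H\<close> this gives
  the two exchange rules \<open>bul_circ\<close> and \<open>bul_star\<close>.\<close>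

lemma tw_ftw:
 assumes X: "bic X" and Y: "bic Y" and P: "kmod P" and m: "bmap X Y P m" and x: "x :< X" and y: "y :< Y"
 shows "tw chi' X Y P (ft X Y P m) x y = ctw chi' X Y P m x y"
  "ctw chi X Y P (ft X Y P m) x y = tw chi X Y P m x y"
proof -
 show "tw chi' X Y P (ft X Y P m) x y = ctw chi' X Y P m x y"
  unfolding ftw_def[abs_def] by (rule tw_inverse[OF chi'_bil chi_bil inv2 bic_lc[OF X] bic_lc[OF Y] P ftw_inner_bil[OF chi'_bil X Y P m] x y])
 have "ctw chi X Y P (ft X Y P m) x y = ctw chi X Y P (ctw chi' X Y P (tw chi X Y P m)) x y"
  by (rule tw_cong[OF bic_cop_coact[OF X] bic_cop_coact[OF Y]]) (simp_all add: x y ftw_comm[OF X Y P m])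
 also have "... = tw chi X Y P m x y"
  by (rule cop_tw_inverse(1)[OF X Y P tw_bilinear[OF chi_bil bic_coact[OF X] bic_coact[OF Y] P m] x y])
 finally show "ctw chi X Y P (ft X Y P m) x y = tw chi X Y P m x y" .
qed

lemma ftw_inverse:
 assumes X: "bic X" and Y: "bic Y" and P: "kmod P" and m: "bmap X Y P m" and x: "x :< X" and y: "y :< Y"
 shows "ftw chi' chi X Y P (ft X Y P m) x y = m x y"
proof -
 have "ftw chi' chi X Y P (ft X Y P m) x y = tw chi' X Y P (tw chi X Y P m) x y"
  unfolding ftw_def[of chi'] by (rule tw_cong[OF bic_coact[OF X] bic_coact[OF Y] _ x y]) (rule tw_ftw(2)[OF X Y P m])
 also have "... = m x y" by (rule tw_inverse[OF chi'_bil chi_bil inv2 bic_lc[OF X] bic_lc[OF Y] P m x y])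
 finally show ?thesis .
qed

text \<open>\<open>tw_assoc\<close> is applied twice. Over the co-opposite it shows that the right
  twists again satisfy the associativity constraint; they are still left colinear by
  \<open>tw_colin_cop\<close>, so \<open>tw_assoc\<close> over \<open>H\<close> applies to
  them.\<close>

lemma ftw_assoc:
 assumes b: "bic X" "bic Y" "bic Z" "bic P" "bic P'" and Q: "kmod Q"
  and m: "bmap X Y P m" "colin K H X Y P m" "colin K (hcop H) (bcop X) (bcop Y) (bcop P) m"
  and n: "bmap P Z Q n"
  and m': "bmap Y Z P' m'" "colin K H Y Z P' m'" "colin K (hcop H) (bcop Y) (bcop Z) (bcop P') m'"
  and n': "bmap X P' Q n'"
  and e: "!!x y z. x :< X ==> y :< Y ==> z :< Z ==> n (m x y) z = n' x (m' y z)"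
  and x: "x :< X" and y: "y :< Y" and z: "z :< Z"
 shows "ft P Z Q n (ft X Y P m x y) z = ft X P' Q n' x (ft Y Z P' m' y z)"
 unfolding ftw_def
proof (rule tw_assoc[OF bic_lc[OF b(1)] bic_lc[OF b(2)] bic_lc[OF b(3)] bic_coact[OF b(4)] bic_coact[OF b(5)] Q
  ftw_inner_bil[OF chi'_bil b(1,2) bic_module[OF b(4)] m(1)] tw_colin_cop[OF chi'_bil b(1,2,4) m(1,2)]
  ftw_inner_bil[OF chi'_bil b(4,3) Q n]
  ftw_inner_bil[OF chi'_bil b(2,3) bic_module[OF b(5)] m'(1)] tw_colin_cop[OF chi'_bil b(2,3,5) m'(1,2)]
  ftw_inner_bil[OF chi'_bil b(1,5) Q n'] _ x y z])
 fix x y z assume a: "x :< X" "y :< Y" "z :< Z"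
 have bc: "bmap X Y P m ==> bmap (bcop X) (bcop Y) (bcop P) m" for X Y P and m :: "'z1 \<Rightarrow> 'z2 \<Rightarrow> 'z3"
  by (simp add: bilinear_map_def linear_map_def)
 show "ctw chi' P Z Q n (ctw chi' X Y P m x y) z =
   ctw chi' X P' Q n' x (ctw chi' Y Z P' m' y z)"
  using cocyc.tw_assoc[OF cocyc_cop cop_lc[OF b(1)] cop_lc[OF b(2)] cop_lc[OF b(3)] _ _ Q _ m(3) bil_copD[OF n] _ m'(3) bil_copD[OF n'], of x y z]
   m(1) m'(1) a e b by (simp add: coact_cop bic_cop_coact bc)
qed

end

section \<open>The twisted Hopf algebra\<close>

lemma coalgebra_same: "same_coalg H H' ==> coassociative_coalgebra K H = coassociative_coalgebra K H'"
 unfolding coassociative_coalgebra_def same_coalg_def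
 using tensor_space_same[of H H' H H' K] tensor_space_same[of H H' "tensor_space K H H" "tensor_space K H H" K]
  tensor_same[of H H' H H' K] tensor_same[of H H' "tensor_space K H H" "tensor_space K H H" K]
  linear_map_same[of H H' "tensor_space K H H" "tensor_space K H H" K "comult H"]
  linear_map_same[of H H' "ground_module K" "ground_module K" K "counit H"]
 by (simp add: sweedler2_def tensor_lift_def same_module_def)

lemma same_coalg_sym: "same_coalg H H' ==> same_coalg H' H"
 by (simp add: same_coalg_def same_module_def)

lemma same_coalg_cop: "same_coalg H H' ==> same_coalg (hcop H) (hcop H')"
 by (simp add: same_coalg_def same_module_def fun_eq_iff)

lemma bicomodule_same:
 fixes K :: "('k, 'l) ring_scheme" and H :: "('k, 'h) hopf"
 assumes s: "same_coalg H H'" shows "bicomodule K H V = bicomodule K H' V"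
proof -
 have h: "same_module H H'" using s by (simp add: same_coalg_def)
 have "tensor_space K V H = tensor_space K V H'" "tensor K V H = tensor K V H'"
  "tensor_space K H (tensor_space K V H') = tensor_space K H' (tensor_space K V H')"
  "tensor K H (tensor_space K V H') = tensor K H' (tensor_space K V H')"
  by (simp_all add: tensor_space_same tensor_same h)
 then show ?thesis
  unfolding bicomodule_def left_comodule_same[OF s] left_comodule_same[OF same_coalg_cop[OF s]] by simp
qed

text \<open>The twist is described by its coalgebra, unit and product on the carrier. A description
  by properties allows \<open>H\<close> in turn to be regarded as a twist of \<open>H'\<close>,
  which an equality with one particular record would not.\<close>

locale twist_mult = cocyc K H chi chi' for K :: "('k, 'l) ring_scheme" and H :: "('k, 'h) hopf" and chi chi' +
 fixes H' :: "('k, 'h) hopf"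
 assumes same: "same_coalg H H'" and one': "one H' = u"
  and mult': "!!x y. x :< H ==> y :< H ==> x \<otimes>\<^bsub>H'\<^esub> y = ft HU HU H (%x y. x ** y) x y"
begin

abbreviation bul (infixl "\<bullet>" 70) where "x \<bullet> y \<equiv> x \<otimes>\<^bsub>H'\<^esub> y"

lemma same_simps [simp]: "carrier H' = cH" "add H' = add H" "zero H' = zero H" "smult H' = smult H"
 "comult H' = comult H" "counit H' = eps"
 using same by (simp_all add: same_coalg_def same_module_def)

lemma same_mod: "same_module H' H" by (simp add: same_module_def)

lemma same_tensor [simp]:
 "ts H' V = ts H V" "ts V H' = ts V H"
 "tn H' V = tn H V" "tn V H' = tn V H"
 by (simp_all add: tensor_space_same tensor_same same_mod)

lemma same_linear [simp]: "lmap H' V = lmap H V" "lmap V H' = lmap V H"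
 "bmap H' V W = bmap H V W" "bmap V H' W = bmap V H W"
 "bmap V W H' = bmap V W H"
 by (simp_all add: fun_eq_iff linear_map_def bilinear_map_def)

lemma same_sw [simp]: "sweedler2 M H' = sweedler2 M H" "sweedler2 H' C = sweedler2 H C" "tlift H' = tlift H"
 by (simp_all add: fun_eq_iff sweedler2_def tensor_lift_def)

lemma mH: "bmap HU HU H (%x y. x ** y)"
 using mult_bilinear by (simp add: mult_bilinear[unfolded eta_contract_eq])

lemma tw_HU:
 "x : cH ==> y : cH ==> tw phi HU HU P m x y = sw P x (%a x'. sw P y (%b y'. phi a b *[P] m x' y'))"
 by (simp add: tw_def)

lemma tw_copHU:
 assumes phi: "bmap H H G phi" and P: "kmod P" and m: "bmap H H P m" and x: "x : cH" and y: "y : cH"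
 shows "ctw phi HU HU P m x y = sw P x (%x1 x2. sw P y (%y1 y2. phi x2 y2 *[P] m x1 y1))"
proof -
 note R = lin cl bmap_rules[OF m] P bmap_rules[OF phi, simplified] module.smult_closed[OF P]
 interpret c: hopf_loc K "hcop H" by (rule hopf_loc_cop)
 have 1: "csw P y (%b y'. phi a b *[P] m x' y') = sw P y (%y1 y2. phi a y2 *[P] m x' y1)"
  if "a : cH" "x' : cH" for a x'
  by (rule sw_cop_raw[OF y P]) (intro R that; assumption)
 have "ctw phi HU HU P m x y = csw P x (%a x'. csw P y (%b y'. phi a b *[P] m x' y'))"
  unfolding tw_def cop_unit using x y by simp
 also have "... = csw P x (%a x'. sw P y (%y1 y2. phi a y2 *[P] m x' y1))"
  by (rule c.sw_cong) (simp_all add: x 1)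
 also have "... = sw P x (%x1 x2. sw P y (%y1 y2. phi x2 y2 *[P] m x1 y1))"
  by (rule sw_cop_raw[OF x P]) (intro R y; assumption)
 finally show ?thesis .
qed

lemma bul_bil: "bmap H H H (mult H')"
proof -
 have "bmap HU HU H (ft HU HU H (%x y. x ** y))"
  by (rule ftw_bilinear[OF chi_bil chi'_bil bic_unit bic_unit modH mH])
 then have f: "bmap H H H (ft HU HU H (%x y. x ** y))" by simp
 have "x \<bullet> y = ft HU HU H (%x y. x ** y) x y" if "x : cH" "y : cH" for x y by (rule mult'[OF that])
 then show ?thesis using f by (simp add: bilinear_map_def linear_map_def Pi_iff)
qed

lemma bul_lin [lin]: "lmap X H f ==> b : cH ==> lmap X H (%x. f x \<bullet> b)"
 "lmap X H f ==> b : cH ==> lmap X H (%x. b \<bullet> f x)"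
 by (rule linear_bil_l[OF bul_bil] linear_bil_r[OF bul_bil]; assumption)+

lemma bul_closed [simp, cl]: "a : cH ==> b : cH ==> a \<bullet> b : cH"
 by (rule bilinear_closed[OF bul_bil])

text \<open>The factor \<open>chi'\<close> in the twisted product is removed by convolving with
  \<open>chi\<close> on the right. Together with \<open>bul_circ\<close>, where \<open>chi\<close>
  is removed on the left, this is how the two products are exchanged from here on.\<close>

lemma bul_star:
 assumes a: "a : cH" and b: "b : cH"
 shows "sw H a (%a1 a2. sw H b (%b1 b2. chi a2 b2 *[H] (a1 \<bullet> b1))) = sw H a (%a1 a2. sw H b (%b1 b2. chi a1 b1 *[H] (a2 ** b2)))"
proof -
 have "ctw chi HU HU H (mult H') a b = ctw chi HU HU H (ft HU HU H (%x y. x ** y)) a b"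
  by (rule tw_cong[OF bic_cop_coact[OF bic_unit] bic_cop_coact[OF bic_unit]]) (simp_all add: mult' a b)
 then show ?thesis
  using tw_ftw(2)[OF bic_unit bic_unit modH mH, of a b] a b
  by (simp add: tw_copHU[OF chi_bil modH bul_bil a b] tw_HU)
qed

lemma bul_circ:
 assumes a: "a : cH" and b: "b : cH"
 shows "sw H a (%a1 a2. sw H b (%b1 b2. chi' a1 b1 *[H] (a2 \<bullet> b2))) = sw H a (%a1 a2. sw H b (%b1 b2. chi' a2 b2 *[H] (a1 ** b1)))"
proof -
 have "tw chi' HU HU H (mult H') a b = tw chi' HU HU H (ft HU HU H (%x y. x ** y)) a b"
  by (rule tw_cong[OF coact_unit coact_unit]) (simp_all add: mult' a b)
 then show ?thesis
  using tw_ftw(1)[OF bic_unit bic_unit modH mH, of a b] a b mult_bilinear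
  by (simp add: tw_copHU[OF chi'_bil modH _ a b] tw_HU)
qed

text \<open>The right twist keeps left colinearity over \<open>H\<close>. The left twist puts
  \<open>chi(a_1, b_1)\<close> in front of the coaction factor \<open>a_2 b_2\<close>, and
  exchanging this for \<open>a_1 \<bullet> b_1\<close> and \<open>chi(a_2, b_2)\<close> produces the
  coaction factor over \<open>H'\<close>.\<close>

lemma ftw_colin:
 assumes X: "bic X" and Y: "bic Y" and P: "bic P" and m: "bmap X Y P m" and c: "colin K H X Y P m"
 shows "colin K H' X Y P (ft X Y P m)"
 unfolding colin_def same_tensor
proof (intro ballI)
 fix x y assume x: "x :< X" and y: "y :< Y"
 define T where "T = ts H P"
 define t where "t = tn H P"
 define n where "n = ctw chi' X Y P m"
 note mP = bic_module[OF P] and cX = bic_coact[OF X] and cY = bic_coact[OF Y] and cP = bic_coact[OF P]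
 have mT: "kmod T" unfolding T_def by (intro cl mP)
 interpret T: module K T by (rule mT)
 have tb: "bmap H P T t" unfolding T_def t_def by (rule bilinear_tensor[OF modH mP])
 have n: "bmap X Y P n" unfolding n_def by (rule ftw_inner_bil[OF chi'_bil X Y mP m])
 have nc: "colin K H X Y P n" unfolding n_def by (rule tw_colin_cop[OF chi'_bil X Y P m c])
 note tr = bmap_rules[OF tb]
 note nr = bmap_rules[OF n]
 note R = lin cl tr nr cX cY mT mP T.smult_closed
 have sl: "lmap T T (%t. k *[T] t)" if "k :< K" for k using that by (intro lin mT)
 have lP: "lmap P T (lcoact P)" using cP by (simp add: coact_def T_def)
 have ts: "sw T a (%a1 a2. sw T b (%b1 b2. k a1 a2 b1 b2 *[T] t (f a1 a2 b1 b2) w)) = t (sw H a (%a1 a2. sw H b (%b1 b2. k a1 a2 b1 b2 *[H] f a1 a2 b1 b2))) w"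
  if a: "a : cH" "b : cH" "w :< P"
   and k: "!!a1 a2 b1 b2. a1 : cH ==> a2 : cH ==> b1 : cH ==> b2 : cH ==> k a1 a2 b1 b2 :< K \<and> f a1 a2 b1 b2 : cH" for a b w k f
 proof -
  note l = bilinear_l[OF tb a(3)]
  have "t (sw H a (%a1 a2. sw H b (%b1 b2. k a1 a2 b1 b2 *[H] f a1 a2 b1 b2))) w = sw T a (%a1 a2. t (sw H b (%b1 b2. k a1 a2 b1 b2 *[H] f a1 a2 b1 b2)) w)"
   by (rule sw_push[OF a(1) modH mT _ l]) (rule sw_closed[OF a(2) modH], simp add: k)
  also have "... = sw T a (%a1 a2. sw T b (%b1 b2. t (k a1 a2 b1 b2 *[H] f a1 a2 b1 b2) w))"
   by (rule sw_cong[OF a(1)], rule sw_push[OF a(2) modH mT _ l]) (simp add: k)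
  also have "... = sw T a (%a1 a2. sw T b (%b1 b2. k a1 a2 b1 b2 *[T] t (f a1 a2 b1 b2) w))"
   by (intro sw_cong a linear_smult[OF l]) (simp_all add: k)
  finally show ?thesis ..
 qed
 have "lcoact P (ft X Y P m x y) = tw chi X Y T (%x y. lcoact P (n x y)) x y"
  unfolding ftw_def n_def[symmetric] by (rule tw_push[OF chi_bil cX cY mP mT _ lP x y]) (rule nr)
 also have "... = lsw T X x (%a x'. lsw T Y y (%b y'. chi a b *[T] lsw T X x' (%c x''. lsw T Y y' (%d y''. t (c ** d) (n x'' y'')))))"
  unfolding tw_def by (intro lsw_cong[OF cX x] lsw_cong[OF cY y]) (use nc in \<open>simp add: colin_def T_def t_def\<close>)
 also have "... = lsw T X x (%a x'. lsw T Y y (%b y'. lsw T X x' (%c x''. lsw T Y y' (%d y''. chi a b *[T] t (c ** d) (n x'' y'')))))"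
 proof (rule lsw_cong[OF cX x], rule lsw_cong[OF cY y])
  fix a x' b y' assume a: "a : cH" "x' :< X" "b : cH" "y' :< Y"
  note l = sl[OF chi_closed(1)[OF a(1,3)]]
  have "chi a b *[T] lsw T X x' (%c x''. lsw T Y y' (%d y''. t (c ** d) (n x'' y''))) = lsw T X x' (%c x''. chi a b *[T] lsw T Y y' (%d y''. t (c ** d) (n x'' y'')))"
   by (rule lsw_push[OF cX a(2) mT mT _ l]) (intro R a; assumption)
  also have "... = lsw T X x' (%c x''. lsw T Y y' (%d y''. chi a b *[T] t (c ** d) (n x'' y'')))"
   by (rule lsw_cong[OF cX a(2)], rule lsw_push[OF cY a(4) mT mT _ l]) (intro R a; assumption)
  finally show "chi a b *[T] lsw T X x' (%c x''. lsw T Y y' (%d y''. t (c ** d) (n x'' y''))) = ..." .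
 qed
 also have "... = lsw T X x (%a x'. lsw T Y y (%b y'. sw T a (%a1 a2. sw T b (%b1 b2. chi a1 b1 *[T] t (a2 ** b2) (n x' y')))))"
  by (rule lsw2_coassoc[OF bic_lc[OF X] bic_lc[OF Y] x y mT]) (intro R; assumption)
 \<comment> \<open>After this exchange \<open>chi\<close> carries the inner indices; coassociativity
   then lets it twist the vectors that remain.\<close>
 also have "... = lsw T X x (%a x'. lsw T Y y (%b y'. sw T a (%a1 a2. sw T b (%b1 b2. chi a2 b2 *[T] t (a1 \<bullet> b1) (n x' y')))))"
  by (intro lsw_cong[OF cX x] lsw_cong[OF cY y]) (simp add: ts nr bul_star)
 also have "... = lsw T X x (%a x'. lsw T Y y (%b y'. lsw T X x' (%c x''. lsw T Y y' (%d y''. chi c d *[T] t (a \<bullet> b) (n x'' y'')))))"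
  by (rule lsw2_coassoc[OF bic_lc[OF X] bic_lc[OF Y] x y mT, symmetric]) (intro R; assumption)
 also have "... = lsw T X x (%a x'. lsw T Y y (%b y'. t (a \<bullet> b) (ft X Y P m x' y')))"
 proof (rule lsw_cong[OF cX x], rule lsw_cong[OF cY y])
  fix a x' b y' assume a: "a : cH" "x' :< X" "b : cH" "y' :< Y"
  have "t (a \<bullet> b) (ft X Y P m x' y') = tw chi X Y T (%x y. t (a \<bullet> b) (n x y)) x' y'"
   unfolding ftw_def n_def[symmetric]
   by (rule tw_push[OF chi_bil cX cY mP mT _ bilinear_r[OF tb] a(2,4)]) (intro nr bul_closed a; assumption)+
  then show "lsw T X x' (%c x''. lsw T Y y' (%d y''. chi c d *[T] t (a \<bullet> b) (n x'' y''))) = t (a \<bullet> b) (ft X Y P m x' y')"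
   by (simp add: tw_def)
 qed
 finally show "lcoact P (ft X Y P m x y) = lsw (ts H P) X x (%a x'. lsw (ts H P) Y y (%b y'. tn H P (a \<bullet> b) (ft X Y P m x' y')))"
  by (simp add: T_def t_def)
qed

text \<open>Expanding \<open>U\<close>, the sum is
  \<open>chi(m_2, S m_3) (m_1 \<bullet> S m_4)\<close>. The exchange rule makes it
  \<open>chi(m_1, S m_4) m_2 S(m_3)\<close>, the antipode of \<open>H\<close> cancels the middle,
  and what remains is \<open>U\<close>.\<close>

lemma antipode_N:
 assumes m: "m : cH"
 shows "sw H m (%a r. sw H r (%b c. U b *[H] (a \<bullet> S c))) = U m *[H] u"
proof -
 note M = modH and R = lin cl modH
 have "sw H m (%a r. sw H r (%b c. U b *[H] (a \<bullet> S c))) = sw H m (%a r. sw H r (%b c. sw H b (%b1 b2. chi b1 (S b2) *[H] (a \<bullet> S c))))"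
  unfolding U_def by (intro sw_cong m sw_smultM M) simp_all
 also have "... = sw H m (%a b. sw H a (%a1 a2. sw H (S b) (%b1 b2. chi a2 b2 *[H] (a1 \<bullet> b1))))"
  by (rule antipode_sandwich(1)[OF m M]) (intro R; assumption)+
 also have "... = sw H m (%a b. sw H a (%a1 a2. sw H (S b) (%b1 b2. chi a1 b1 *[H] (a2 ** b2))))"
  by (intro sw_cong[OF m] bul_star) simp_all
 also have "... = sw H m (%a r. sw H r (%b c. sw H b (%b1 b2. chi a (S c) *[H] (b1 ** S b2))))"
  by (rule antipode_sandwich(1)[OF m M, symmetric]) (intro R; assumption)+
 also have "... = sw H m (%a r. sw H r (%b c. eps b *[H] (chi a (S c) *[H] u)))"
  by (rule sw_cong[OF m], rule sw_cong, assumption, rule antipode_r[OF _ M], assumption) (intro R; assumption)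
 also have "... = sw H m (%a r. chi a (S r) *[H] u)"
  by (rule sw_cong[OF m], rule sw_counit_l[OF _ M], assumption) (intro R; assumption)
 also have "... = U m *[H] u"
  unfolding U_def by (rule sw_smultM[OF m M, symmetric]) simp_all
 finally show ?thesis .
qed

lemma antipode_N':
 assumes m: "m : cH"
 shows "sw H m (%a r. sw H r (%b c. Ui b *[H] (S a \<bullet> c))) = Ui m *[H] u"
proof -
 note M = modH and R = lin cl modH
 have "sw H m (%a r. sw H r (%b c. Ui b *[H] (S a \<bullet> c))) = sw H m (%a r. sw H r (%b c. sw H b (%b1 b2. chi' (S b1) b2 *[H] (S a \<bullet> c))))"
  unfolding Ui_def by (intro sw_cong m sw_smultM M) simp_all
 also have "... = sw H m (%a b. sw H (S a) (%a1 a2. sw H b (%b1 b2. chi' a1 b1 *[H] (a2 \<bullet> b2))))"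
  by (rule antipode_sandwich(2)[OF m M]) (intro R; assumption)+
 also have "... = sw H m (%a b. sw H (S a) (%a1 a2. sw H b (%b1 b2. chi' a2 b2 *[H] (a1 ** b1))))"
  by (intro sw_cong[OF m] bul_circ) simp_all
 also have "... = sw H m (%a r. sw H r (%b c. sw H b (%b1 b2. chi' (S a) c *[H] (S b1 ** b2))))"
  by (rule antipode_sandwich(2)[OF m M, symmetric]) (intro R; assumption)+
 also have "... = sw H m (%a r. sw H r (%b c. eps b *[H] (chi' (S a) c *[H] u)))"
  by (rule sw_cong[OF m], rule sw_cong, assumption, rule antipode_l[OF _ M], assumption) (intro R; assumption)
 also have "... = sw H m (%a r. chi' (S a) r *[H] u)"
  by (rule sw_cong[OF m], rule sw_counit_l[OF _ M], assumption) (intro R; assumption)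
 also have "... = Ui m *[H] u"
  unfolding Ui_def by (rule sw_smultM[OF m M, symmetric]) simp_all
 finally show ?thesis .
qed

end

context hopf_loc
begin

text \<open>The identity map of \<open>H\<close> convolved with \<open>p\<close> on the left and
  \<open>q\<close> on the right. The antipode of the twist is \<open>S\<close> after this map for
  \<open>U\<close> and its inverse, so its bijectivity reduces to that of the conjugation.\<close>

definition "conj_fun p q h = sw H h (%a r. sw H r (%b c. (p a \<star> q c) *[H] b))"

lemma conj_fun_lin:
 assumes p: "lmap H G p" and q: "lmap H G q" and f: "lmap X H f"
 shows "lmap X H (%x. conj_fun p q (f x))"
 unfolding conj_fun_def
 by (intro lin cl f modH linear_compose[OF _ p] linear_compose[OF _ q] linear_closed[OF p, simplified] linear_closed[OF q, simplified]; assumption)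

text \<open>The composite is \<open>p'(h_1) p(h_2) h_3 q(h_4) q'(h_5)\<close>, in which both outer
  pairs are convolution inverses.\<close>

lemma conj_fun_inverse:
 assumes l: "lmap H G p" "lmap H G q" "lmap H G p'" "lmap H G q'"
  and e: "!!h. h : cH ==> sw G h (%a b. p' a \<star> p b) = eps h" "!!h. h : cH ==> sw G h (%a b. q a \<star> q' b) = eps h"
  and h: "h : cH"
 shows "conj_fun p q (conj_fun p' q' h) = h"
proof -
 note M = modH
 note k = linear_closed[OF l(1), simplified] linear_closed[OF l(2), simplified] linear_closed[OF l(3), simplified] linear_closed[OF l(4), simplified]
 note R = lin cl M linear_compose[OF _ l(1)] linear_compose[OF _ l(2)] linear_compose[OF _ l(3)] linear_compose[OF _ l(4)] k
 note cl' = conj_fun_lin[OF l(1,2) linear_id]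
 let ?X = "%a d e f c. ((p' a \<star> p d) \<star> (q f \<star> q' c)) *[H] e"
 have "conj_fun p q (conj_fun p' q' h) = sw H h (%a r. conj_fun p q (sw H r (%b c. (p' a \<star> q' c) *[H] b)))"
  unfolding conj_fun_def[of p' q'] by (rule sw_push[OF h M M _ cl']) (intro R; assumption)
 also have "... = sw H h (%a r. sw H r (%b c. conj_fun p q ((p' a \<star> q' c) *[H] b)))"
  by (rule sw_cong[OF h], rule sw_push[OF _ M M _ cl'], assumption) (intro R; assumption)
 also have "... = sw H h (%a r. sw H r (%b c. sw H b (%d s. sw H s (%e f. ?X a d e f c))))"
 proof (rule sw_cong[OF h], rule sw_cong, assumption)
  fix a r b c assume a: "a : cH" "r : cH" "b : cH" "c : cH"
  have kk: "p' a \<star> q' c :< K" using a k by simp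
  have "conj_fun p q ((p' a \<star> q' c) *[H] b) = (p' a \<star> q' c) *[H] conj_fun p q b"
   by (rule linear_smult[OF cl' a(3) kk])
  also have "... = sw H b (%d s. (p' a \<star> q' c) *[H] sw H s (%e f. (p d \<star> q f) *[H] e))"
   unfolding conj_fun_def by (rule sw_push[OF a(3) M M]) (intro R a kk; assumption)+
  also have "... = sw H b (%d s. sw H s (%e f. (p' a \<star> q' c) *[H] ((p d \<star> q f) *[H] e)))"
   by (rule sw_cong[OF a(3)], rule sw_push[OF _ M M], assumption) (intro R a kk; assumption)+
  also have "... = sw H b (%d s. sw H s (%e f. ?X a d e f c))"
   by (intro sw_cong a) (simp_all add: Hm.smult_assoc1[symmetric] k a K.m_ac)
  finally show "conj_fun p q ((p' a \<star> q' c) *[H] b) = ..." .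
 qed
 also have "... = sw H h (%a r. sw H r (%d t. sw H t (%s c. sw H s (%e f. ?X a d e f c))))"
  by (rule sw_cong[OF h], rule sw_coassoc[OF _ M], assumption) (intro R; assumption)
 also have "... = sw H h (%w t. sw H w (%a d. sw H t (%s c. sw H s (%e f. ?X a d e f c))))"
  by (rule sw_coassoc[OF h M, symmetric]) (intro R; assumption)
 also have "... = sw H h (%w t. sw H w (%a d. sw H t (%e v. sw H v (%f c. ?X a d e f c))))"
  by (rule sw_cong[OF h], rule sw_cong, assumption, rule sw_coassoc[OF _ M], assumption) (intro R; assumption)
 also have "... = sw H h (%w t. sw H w (%a d. sw H t (%e v. eps v *[H] ((p' a \<star> p d) *[H] e))))"
 proof (rule sw_cong[OF h], rule sw_cong, assumption, rule sw_cong, assumption)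
  fix w t a d x v assume a: "w : cH" "t : cH" "a : cH" "d : cH" "x : cH" "v : cH"
  have "sw H v (%f c. ?X a d x f c) = sw H v (%f c. (q f \<star> q' c) *[H] ((p' a \<star> p d) *[H] x))"
   by (intro sw_cong a) (simp add: Hm.smult_assoc1[symmetric] k a K.m_ac)
  also have "... = sw G v (%f c. q f \<star> q' c) *[H] ((p' a \<star> p d) *[H] x)"
   by (rule sw_push[symmetric, OF a(6) modG M _ bilinear_l[OF bilinear_smult[OF M]]]) (simp_all add: k a)
  finally show "sw H v (%f c. ?X a d x f c) = eps v *[H] ((p' a \<star> p d) *[H] x)" by (simp add: e a)
 qed
 also have "... = sw H h (%w t. sw H w (%a d. (p' a \<star> p d) *[H] t))"
  by (rule sw_cong[OF h], rule sw_cong, assumption, rule sw_counit_r[OF _ M], assumption) (intro R; assumption)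
 also have "... = sw H h (%w t. eps w *[H] t)"
 proof (rule sw_cong[OF h])
  fix w t assume a: "w : cH" "t : cH"
  have "sw H w (%a d. (p' a \<star> p d) *[H] t) = sw G w (%a d. p' a \<star> p d) *[H] t"
   by (rule sw_push[symmetric, OF a(1) modG M _ bilinear_l[OF bilinear_smult[OF M] a(2)]]) (simp add: k)
  then show "sw H w (%a d. (p' a \<star> p d) *[H] t) = eps w *[H] t" by (simp add: e a)
 qed
 also have "... = h" by (rule sw_counit_l[OF h M linear_id])
 finally show ?thesis .
qed

end

lemma (in cocyc) conj_fun_bij: "bij_betw (conj_fun U Ui) (cH) (cH)"
proof -
 note l = U_lin[OF linear_id]
 show ?thesis
  by (rule bij_betw_byWitness[where f' = "conj_fun Ui U"])
   (auto simp: conj_fun_inverse[OF l(2,1,1,2) U_Ui U_Ui] conj_fun_inverse[OF l(1,2,2,1) Ui_U Ui_U]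
    intro: linear_closed[OF conj_fun_lin[OF l(1,2) linear_id]] linear_closed[OF conj_fun_lin[OF l(2,1) linear_id]])
qed

lemma (in cocyc) S_conj_fun:
 assumes h: "h : cH"
 shows "S (conj_fun U Ui h) = sw H h (%a r. sw H r (%b c. (U a \<star> Ui c) *[H] S b))"
proof -
 note M = modH
 have "S (conj_fun U Ui h) = sw H h (%a r. S (sw H r (%b c. (U a \<star> Ui c) *[H] b)))"
  unfolding conj_fun_def by (rule sw_push[OF h M M _ antipode_linear]) (intro lin cl M; assumption)
 also have "... = sw H h (%a r. sw H r (%b c. S ((U a \<star> Ui c) *[H] b)))"
  by (rule sw_cong[OF h], rule sw_push[OF _ M M _ antipode_linear], assumption) (intro lin cl M; assumption)
 also have "... = sw H h (%a r. sw H r (%b c. (U a \<star> Ui c) *[H] S b))"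
  by (intro sw_cong h linear_smult[OF antipode_linear]) simp_all
 finally show ?thesis .
qed

section \<open>The Hopf algebra axioms for the twist\<close>

context twist_mult
begin

lemma cmH: "colin K H HU HU HU (%x y. x ** y)" "colin K (hcop H) (bcop HU) (bcop HU) (bcop HU) (%x y. x ** y)"
 using colin_mult hopf_loc.colin_mult[OF hopf_loc_cop] by (simp_all add: cop_unit)

lemma ft_HU: "ft X Y HU m = ft X Y H m"
 unfolding ftw_def tw_module[of HU H, OF unit_bimodule_simps(2-4)] ..

lemma bul_assoc:
 assumes "x : cH" "y : cH" "z : cH"
 shows "(x \<bullet> y) \<bullet> z = x \<bullet> (y \<bullet> z)"
proof -
 have b: "bmap HU HU HU (%x y. x ** y)" using mH by simp
 have "ft HU HU H (%x y. x ** y) (ft HU HU HU (%x y. x ** y) x y) z = ft HU HU H (%x y. x ** y) x (ft HU HU HU (%x y. x ** y) y z)"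
  by (rule ftw_assoc[OF bic_unit bic_unit bic_unit bic_unit bic_unit modH b cmH mH b cmH mH])
   (use assms in \<open>simp_all add: Hr.m_assoc\<close>)
 then show ?thesis using assms by (simp add: mult'[symmetric] ft_HU)
qed

lemma bul_one: "x : cH ==> u \<bullet> x = x" "x : cH ==> x \<bullet> u = x"
 using ftw_one_l[OF bic_unit modH, of "%x y. x ** y" x] ftw_one_r[OF bic_unit modH, of "%x y. x ** y" x] mH
 by (simp_all add: mult')

text \<open>Applying the counit removes the product: the right twist leaves \<open>chi'\<close>, and
  the left twist convolves it with \<open>chi\<close>.\<close>

lemma bul_counit:
 assumes x: "x : cH" and y: "y : cH"
 shows "eps (x \<bullet> y) = eps x \<star> eps y"
proof -
 have le: "lmap H G eps" by (intro lin)
 have b: "bmap H H G (%x y. eps (x ** y))" by (intro lin cl; assumption)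
 have "eps (x \<bullet> y) = tw chi HU HU G (%x y. eps (ctw chi' HU HU H (%x y. x ** y) x y)) x y"
  unfolding mult'[OF x y] ftw_def
  by (rule tw_push[OF chi_bil coact_unit coact_unit modH modG _ le])
   (use x y bilinear_closed[OF ftw_inner_bil[OF chi'_bil bic_unit bic_unit modH mH]] in simp_all)
 also have "... = tw chi HU HU G chi' x y"
 proof (rule tw_cong[OF coact_unit coact_unit])
  fix x y assume "x :< HU" "y :< HU"
  then have a: "x : cH" "y : cH" by simp_all
  have "eps (ctw chi' HU HU H (%x y. x ** y) x y) = ctw chi' HU HU G (%x y. eps (x ** y)) x y"
   by (rule coalg.tw_push[OF coalg_cop])
    (use a chi'_bil bic_cop_coact[OF bic_unit] le in \<open>simp_all add: coact_cop modH modG\<close>)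
  also have "... = sw G x (%x1 x2. sw G y (%y1 y2. eps y1 *[G] (eps x1 \<star> chi' x2 y2)))"
   unfolding tw_copHU[OF chi'_bil modG b a] by (intro sw_cong a) (simp add: K.m_ac)
  also have "... = sw G x (%x1 x2. eps x1 \<star> chi' x2 y)"
   by (rule sw_cong[OF a(1)], rule sw_counit_l[OF a(2) modG]) (intro lin cl; assumption)
  also have "... = chi' x y"
   using sw_counit_l[OF a(1) modG, of "%x. chi' x y"] a by (simp add: chi_lin linear_id)
  finally show "eps (ctw chi' HU HU H (%x y. x ** y) x y) = chi' x y" .
 qed (simp_all add: x y)
 also have "... = eps x \<star> eps y" using inv1[OF x y] x y by (simp add: tw_HU)
 finally show ?thesis .
qed

text \<open>Multiplicativity of the coproduct is colinearity of the product, so it is an instance of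
  \<open>ftw_colin\<close>.\<close>

lemma bul_comult:
 assumes h: "h : cH" and g: "g : cH"
 shows "comult H (h \<bullet> g) = sw (ts H H) h (%h1 h2. sw (ts H H) g (%g1 g2. tn H H (h1 \<bullet> g1) (h2 \<bullet> g2)))"
proof -
 have b: "bmap HU HU HU (%x y. x ** y)" using mH by simp
 note c = ftw_colin[OF bic_unit bic_unit bic_unit b cmH(1), unfolded colin_def, simplified, rule_format, OF h g]
 show ?thesis using c h g by (simp add: ft_HU mult'[symmetric] cong: sw_cong)
qed

lemma twist_hopf:
 assumes anti: "!!h. h : cH ==> antipode H' h = S (conj_fun U Ui h)"
 shows "hopf_algebra K H'"
proof -
 note l = U_lin[OF linear_id]
 note M = modH
 note cf = conj_fun_lin[OF l]
 have mH': "kmod H'" by (rule module_same[OF _ M]) (simp add: same_module_def)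
 interpret H': module K H' by (rule mH')
 have "ring H'"
 proof (rule ringI)
  show "monoid H'" by (rule monoidI) (simp_all add: one' bul_assoc bul_one)
  show "abelian_group H'" ..
 next
  fix x y z assume "x :< H'" "y :< H'" "z :< H'"
  then show "(x \<oplus>\<^bsub>H'\<^esub> y) \<otimes>\<^bsub>H'\<^esub> z = x \<otimes>\<^bsub>H'\<^esub> z \<oplus>\<^bsub>H'\<^esub> y \<otimes>\<^bsub>H'\<^esub> z" "z \<otimes>\<^bsub>H'\<^esub> (x \<oplus>\<^bsub>H'\<^esub> y) = z \<otimes>\<^bsub>H'\<^esub> x \<oplus>\<^bsub>H'\<^esub> z \<otimes>\<^bsub>H'\<^esub> y"
   using linear_add[OF bilinear_l[OF bul_bil, of z]] linear_add[OF bilinear_r[OF bul_bil, of z]] by simp_all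
 qed
 then have alg: "associative_algebra K H'" by (simp add: associative_algebra_def mH' bul_bil)
 have coalg: "coassociative_coalgebra K H'" using H_coalg by (simp only: coalgebra_same[OF same])
 have S'l: "lmap H H (antipode H')"
  by (subst linear_cong[OF anti M]) (simp_all, intro lin cf)
 have S': "antipode H' h = sw H h (%a r. sw H r (%b c. (U a \<star> Ui c) *[H] S b))" if "h : cH" for h
  using anti[OF that] S_conj_fun[OF that] by simp
 note R = lin cl M
 \<comment> \<open>The sum is \<open>h_1 \<bullet> U(h_2) S(h_3) Ui(h_4)\<close>. By
   \<open>antipode_N\<close> the first three factors collapse to \<open>U\<close>, which then
   cancels against \<open>Ui\<close>.\<close>
 have r: "sw H h (%a b. a \<bullet> antipode H' b) = eps h *[H] u" if h: "h : cH" for h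
 proof -
  have "sw H h (%a b. a \<bullet> antipode H' b) = sw H h (%a r. sw H r (%x s. sw H s (%y z. (U x \<star> Ui z) *[H] (a \<bullet> S y))))"
  proof (rule sw_cong[OF h])
   fix a r assume a: "a : cH" "r : cH"
   note la = bilinear_r[OF bul_bil a(1)]
   have "a \<bullet> antipode H' r = sw H r (%x s. a \<bullet> sw H s (%y z. (U x \<star> Ui z) *[H] S y))"
    unfolding S'[OF a(2)] by (rule sw_push[OF a(2) M M _ la]) (intro R; assumption)
   also have "... = sw H r (%x s. sw H s (%y z. a \<bullet> ((U x \<star> Ui z) *[H] S y)))"
    by (rule sw_cong[OF a(2)], rule sw_push[OF _ M M _ la], assumption) (intro R; assumption)
   also have "... = sw H r (%x s. sw H s (%y z. (U x \<star> Ui z) *[H] (a \<bullet> S y)))"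
    by (intro sw_cong a linear_smult[OF la]) simp_all
   finally show "a \<bullet> antipode H' r = ..." .
  qed
  also have "... = sw H h (%a r. sw H r (%p z. sw H p (%x y. (U x \<star> Ui z) *[H] (a \<bullet> S y))))"
   by (rule sw_cong[OF h], rule sw_coassoc[OF _ M, symmetric], assumption) (intro R; assumption)
  also have "... = sw H h (%q z. sw H q (%a p. sw H p (%x y. (U x \<star> Ui z) *[H] (a \<bullet> S y))))"
   by (rule sw_coassoc[OF h M, symmetric]) (intro R; assumption)
  also have "... = sw H h (%q z. (U q \<star> Ui z) *[H] u)"
  proof (rule sw_cong[OF h])
   fix q z assume a: "q : cH" "z : cH"
   have lz: "lmap H H (%v. Ui z *[H] v)" by (intro R a)
   have "sw H q (%a p. sw H p (%x y. (U x \<star> Ui z) *[H] (a \<bullet> S y))) = sw H q (%a p. sw H p (%x y. Ui z *[H] (U x *[H] (a \<bullet> S y))))"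
    by (intro sw_cong a) (simp_all add: a Hm.smult_assoc1[symmetric] K.m_comm)
   also have "... = sw H q (%a p. Ui z *[H] sw H p (%x y. U x *[H] (a \<bullet> S y)))"
    by (rule sw_cong[OF a(1)], rule sw_push[OF _ M M _ lz, symmetric], assumption) (intro R; assumption)
   also have "... = Ui z *[H] sw H q (%a p. sw H p (%x y. U x *[H] (a \<bullet> S y)))"
    by (rule sw_push[OF a(1) M M _ lz, symmetric]) (intro R; assumption)
   also have "... = (U q \<star> Ui z) *[H] u"
    using a by (simp add: antipode_N Hm.smult_assoc1[symmetric] K.m_comm)
   finally show "sw H q (%a p. sw H p (%x y. (U x \<star> Ui z) *[H] (a \<bullet> S y))) = (U q \<star> Ui z) *[H] u" .
  qed
  also have "... = sw G h (%q z. U q \<star> Ui z) *[H] u" by (rule sw_smultM[OF h M, symmetric]) simp_all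
  finally show ?thesis by (simp add: U_Ui h)
 qed
 \<comment> \<open>Here the last three factors of \<open>U(h_1) S(h_2) Ui(h_3) \<bullet> h_4\<close>
   collapse to \<open>Ui\<close>, by \<open>antipode_N'\<close>.\<close>
 have l: "sw H h (%a b. antipode H' a \<bullet> b) = eps h *[H] u" if h: "h : cH" for h
 proof -
  have "sw H h (%a b. antipode H' a \<bullet> b) = sw H h (%r d. sw H r (%x s. sw H s (%y z. (U x \<star> Ui z) *[H] (S y \<bullet> d))))"
  proof (rule sw_cong[OF h])
   fix r d assume a: "r : cH" "d : cH"
   note la = bilinear_l[OF bul_bil a(2)]
   have "antipode H' r \<bullet> d = sw H r (%x s. sw H s (%y z. (U x \<star> Ui z) *[H] S y) \<bullet> d)"
    unfolding S'[OF a(1)] by (rule sw_push[OF a(1) M M _ la]) (intro R; assumption)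
   also have "... = sw H r (%x s. sw H s (%y z. ((U x \<star> Ui z) *[H] S y) \<bullet> d))"
    by (rule sw_cong[OF a(1)], rule sw_push[OF _ M M _ la], assumption) (intro R; assumption)
   also have "... = sw H r (%x s. sw H s (%y z. (U x \<star> Ui z) *[H] (S y \<bullet> d)))"
    by (intro sw_cong a linear_smult[OF la]) simp_all
   finally show "antipode H' r \<bullet> d = ..." .
  qed
  also have "... = sw H h (%x p. sw H p (%s d. sw H s (%y z. (U x \<star> Ui z) *[H] (S y \<bullet> d))))"
   by (rule sw_coassoc[OF h M]) (intro R; assumption)
  also have "... = sw H h (%x p. sw H p (%y t. sw H t (%z d. (U x \<star> Ui z) *[H] (S y \<bullet> d))))"
   by (rule sw_cong[OF h], rule sw_coassoc[OF _ M], assumption) (intro R; assumption)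
  also have "... = sw H h (%x q. (U x \<star> Ui q) *[H] u)"
  proof (rule sw_cong[OF h])
   fix x q assume a: "x : cH" "q : cH"
   have lz: "lmap H H (%v. U x *[H] v)" by (intro R a)
   have "sw H q (%y t. sw H t (%z d. (U x \<star> Ui z) *[H] (S y \<bullet> d))) = sw H q (%y t. sw H t (%z d. U x *[H] (Ui z *[H] (S y \<bullet> d))))"
    by (intro sw_cong a) (simp_all add: a Hm.smult_assoc1[symmetric])
   also have "... = sw H q (%y t. U x *[H] sw H t (%z d. Ui z *[H] (S y \<bullet> d)))"
    by (rule sw_cong[OF a(2)], rule sw_push[OF _ M M _ lz, symmetric], assumption) (intro R; assumption)
   also have "... = U x *[H] sw H q (%y t. sw H t (%z d. Ui z *[H] (S y \<bullet> d)))"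
    by (rule sw_push[OF a(2) M M _ lz, symmetric]) (intro R; assumption)
   also have "... = (U x \<star> Ui q) *[H] u"
    using a by (simp add: antipode_N' Hm.smult_assoc1[symmetric])
   finally show "sw H q (%y t. sw H t (%z d. (U x \<star> Ui z) *[H] (S y \<bullet> d))) = (U x \<star> Ui q) *[H] u" .
  qed
  also have "... = sw G h (%q z. U q \<star> Ui z) *[H] u" by (rule sw_smultM[OF h M, symmetric]) simp_all
  finally show ?thesis by (simp add: U_Ui h)
 qed
 have bij: "bij_betw (antipode H') (cH) (cH)"
  using bij_betw_trans[OF conj_fun_bij S_bij] bij_betw_cong[of "cH" "antipode H'" "S \<circ> conj_fun U Ui"] anti by simp
 show ?thesis
  unfolding hopf_algebra_def
  using alg coalg S'l r l bij H_hopf by (simp add: bul_comult bul_counit one' hopf_algebra_def)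
qed

end

section \<open>The twisting functor\<close>

text \<open>What \<open>ftw\<close> reads from a bimodule: the vector space and the coactions.
  Twisting changes only the actions, so twisted and untwisted bimodules may be interchanged inside
  \<open>ftw\<close>.\<close>

definition same_bicom :: "('k, 'h, 'v) bimodule \<Rightarrow> ('k, 'h, 'v) bimodule \<Rightarrow> bool" where
 "same_bicom X X' \<longleftrightarrow> same_module X X' \<and> lcoact X = lcoact X' \<and> rcoact X = rcoact X'"

lemma same_bicom_refl [simp]: "same_bicom X X" by (simp add: same_bicom_def)

lemma same_bicom_cop: "same_bicom X X' ==> same_bicom (bcop X) (bcop X')"
 by (simp add: same_bicom_def same_module_def bcop_def)

lemma lsw_same: "same_bicom X X' ==> same_module M M' ==> lsw M X v F = lsw M' X' v F"
 by (simp add: lsw_def same_bicom_def same_module_def tensor_lift_def)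

lemma ftw_same:
 assumes "same_bicom X X'" "same_bicom Y Y'" "same_module P P'"
 shows "ftw phi psi X Y P m = ftw phi psi X' Y' P' m"
 using assms by (simp add: ftw_def tw_def fun_eq_iff lsw_same[OF assms(1,3)] lsw_same[OF assms(2,3)]
  lsw_same[OF same_bicom_cop[OF assms(1)] assms(3)] lsw_same[OF same_bicom_cop[OF assms(2)] assms(3)] same_module_def)

lemma left_comodule_same_bicom: "same_bicom V V' ==> left_comodule K H V ==> left_comodule K H V'"
 unfolding left_comodule_def
 using module_same[of V V'] tensor_space_same[of H H V V' K] tensor_space_same[of H H "tensor_space K H V" "tensor_space K H V'" K]
  tensor_same[of H H V V' K] tensor_same[of H H "tensor_space K H V" "tensor_space K H V'" K]
 by (auto simp: same_bicom_def same_module_def lsw_def tensor_lift_def linear_map_def)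

lemma same_bicom_sym: "same_bicom V V' ==> same_bicom V' V"
 by (simp add: same_bicom_def same_module_def)

lemma bicomodule_same_bicom:
 assumes s: "same_bicom V V'" and V: "bicomodule K H V" shows "bicomodule K H V'"
proof -
 have h: "same_module V V'" and e: "lcoact V' = lcoact V" "rcoact V' = rcoact V" "carrier V' = carrier V"
  using s by (simp_all add: same_bicom_def same_module_def)
 have t: "tensor_space K V H = tensor_space K V' H" "tensor K V H = tensor K V' H"
  by (simp_all add: tensor_space_same tensor_same h)
 show ?thesis
  using V left_comodule_same_bicom[OF s, of K H] left_comodule_same_bicom[OF same_bicom_cop[OF s], of K "hcop H"]
  unfolding bicomodule_def Let_def t
  by (simp add: e lsw_same[OF same_bicom_sym[OF s] same_module_refl] lsw_same[OF same_bicom_cop[OF same_bicom_sym[OF s]] same_module_refl])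
qed

lemma colin_same_bicom:
 assumes "same_bicom X X'" "same_bicom Y Y'" "same_bicom P P'" shows "colin K H X Y P m = colin K H X' Y' P' m"
proof -
 have t: "tensor_space K H P = tensor_space K H P'" "tensor K H P = tensor K H P'"
  using assms(3) by (simp_all add: same_bicom_def tensor_space_same tensor_same)
 show ?thesis
  unfolding colin_def t using assms
  by (simp add: lsw_same[OF assms(1) same_module_refl] lsw_same[OF assms(2) same_module_refl]) (simp add: same_bicom_def same_module_def)
qed

lemma lcolin_same_bicom:
 assumes "same_bicom X X'" "same_bicom P P'" shows "lcolin K H X P f = lcolin K H X' P' f"
proof -
 have t: "tensor_space K H P = tensor_space K H P'" "tensor K H P = tensor K H P'"
  using assms(2) by (simp_all add: same_bicom_def tensor_space_same tensor_same)
 show ?thesis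
  unfolding lcolin_def t using assms
  by (simp add: lsw_same[OF assms(1) same_module_refl]) (simp add: same_bicom_def same_module_def)
qed

text \<open>The twisting functor with both functionals as parameters, so that the functor back from
  \<open>H'\<close> is the same construction with \<open>chi\<close> and \<open>chi'\<close>
  exchanged.\<close>

definition twb where
 "twb phi psi H V = V\<lparr>lact := \<lambda>h\<in>carrier H. \<lambda>v\<in>carrier V. ftw phi psi (unit_bimodule H) V V (lact V) h v,
   ract := \<lambda>v\<in>carrier V. \<lambda>h\<in>carrier H. ftw phi psi V (unit_bimodule H) V (ract V) v h\<rparr>"

lemma same_twb: "same_bicom V (twb phi psi H V)"
 by (simp add: twb_def same_bicom_def same_module_def)

lemma twb_simps [simp]: "carrier (twb phi psi H V) = carrier V" "add (twb phi psi H V) = add V" "zero (twb phi psi H V) = zero V"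
 "smult (twb phi psi H V) = smult V" "lcoact (twb phi psi H V) = lcoact V" "rcoact (twb phi psi H V) = rcoact V"
 "h :< H ==> v :< V ==> lact (twb phi psi H V) h v = ftw phi psi (unit_bimodule H) V V (lact V) h v"
 "h :< H ==> v :< V ==> ract (twb phi psi H V) v h = ftw phi psi V (unit_bimodule H) V (ract V) v h"
 by (simp_all add: twb_def)

text \<open>Adds that \<open>H'\<close> is a Hopf algebra, with no formula for its antipode. The
  resulting situation is symmetric in \<open>H\<close> and \<open>H'\<close> and stable under
  co-opposites.\<close>

locale tpair = twist_mult K H chi chi' H' for K :: "('k, 'l) ring_scheme" and H :: "('k, 'h) hopf" and chi chi' and H' +
 assumes H'_hopf: "hopf_algebra K H'"
begin

lemma T: "hopf_loc K H'"
 using H'_hopf by (simp add: hopf_loc_def hopf_loc_axioms_def ground_axioms)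

abbreviation "bbi' \<equiv> hopf_loc.bbi K H'"
abbreviation "bhom' \<equiv> hopf_loc.bhom K H'"
abbreviation "HU' \<equiv> unit_bimodule H'"
abbreviation "tb \<equiv> twb chi chi' H"

lemma same_HU: "same_bicom HU HU'"
 by (simp add: same_bicom_def same_module_def)

lemma ftw_cop:
 assumes X: "bic X" and Y: "bic Y" and P: "kmod P" and m: "bmap X Y P m" and x: "x :< X" and y: "y :< Y"
 shows "ftw chi' chi (bcop X) (bcop Y) P m x y = ft X Y P m x y"
proof -
 have e: "bcop (bcop X) = X" "bcop (bcop Y) = Y"
  using X Y by (simp_all add: bicomodule_def bcop_cop)
 show ?thesis unfolding ftw_def e by (rule tw_comm[OF chi_bil chi'_bil X Y P m x y, symmetric])
qed

lemma push2:
 assumes l: "lmap H G l" and a: "a : cH" and b: "b : cH"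
  and k: "!!a1 a2 b1 b2. a1 : cH ==> a2 : cH ==> b1 : cH ==> b2 : cH ==> k a1 a2 b1 b2 :< K \<and> f a1 a2 b1 b2 : cH"
 shows "l (sw H a (%a1 a2. sw H b (%b1 b2. k a1 a2 b1 b2 *[H] f a1 a2 b1 b2))) = sw G a (%a1 a2. sw G b (%b1 b2. k a1 a2 b1 b2 \<star> l (f a1 a2 b1 b2)))"
proof -
 have "l (sw H a (%a1 a2. sw H b (%b1 b2. k a1 a2 b1 b2 *[H] f a1 a2 b1 b2))) = sw G a (%a1 a2. l (sw H b (%b1 b2. k a1 a2 b1 b2 *[H] f a1 a2 b1 b2)))"
  by (rule sw_push[OF a modH modG _ l]) (rule sw_closed[OF b modH], simp add: k)
 also have "... = sw G a (%a1 a2. sw G b (%b1 b2. l (k a1 a2 b1 b2 *[H] f a1 a2 b1 b2)))"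
  by (rule sw_cong[OF a], rule sw_push[OF b modH modG _ l]) (simp add: k)
 also have "... = sw G a (%a1 a2. sw G b (%b1 b2. k a1 a2 b1 b2 \<star> l (f a1 a2 b1 b2)))"
  by (intro sw_cong a b) (simp add: linear_smult[OF l] k)
 finally show ?thesis .
qed

text \<open>The cocycle identity of \<open>chi'\<close> for the product of \<open>H'\<close> becomes
  \<open>coc_inverse\<close> through \<open>bul_circ\<close>, and \<open>ftw_inverse\<close>
  recovers the product of \<open>H\<close> from that of \<open>H'\<close>.\<close>

lemma tpair_sym: "tpair K H' chi' chi H"
proof -
 have c: "cocyc K H' chi' chi"
 proof (rule cocyc.intro[OF T], unfold_locales)
  fix h g f assume "h :< H'" "g :< H'" "f :< H'"
  then have h: "h : cH" and g: "g : cH" and f: "f : cH" by simp_all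
  have "sw G g (%g1 g2. sw G f (%f1 f2. chi' g1 f1 \<star> chi' h (g2 \<bullet> f2))) = sw G g (%g1 g2. sw G f (%f1 f2. chi' g2 f2 \<star> chi' h (g1 ** f1)))"
   using push2[OF bilinear_r[OF chi'_bil h] g f, of "%g1 g2 f1 f2. chi' g1 f1" "%g1 g2 f1 f2. g2 \<bullet> f2"]
    push2[OF bilinear_r[OF chi'_bil h] g f, of "%g1 g2 f1 f2. chi' g2 f2" "%g1 g2 f1 f2. g1 ** f1"]
   by (simp add: bul_circ[OF g f])
  also have "... = sw G h (%h1 h2. sw G g (%g1 g2. chi' h2 g2 \<star> chi' (h1 ** g1) f))" by (rule coc_inverse[OF h g f])
  also have "... = sw G h (%h1 h2. sw G g (%g1 g2. chi' h1 g1 \<star> chi' (h2 \<bullet> g2) f))"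
   using push2[OF bilinear_l[OF chi'_bil f] h g, of "%g1 g2 f1 f2. chi' g1 f1" "%g1 g2 f1 f2. g2 \<bullet> f2"]
    push2[OF bilinear_l[OF chi'_bil f] h g, of "%g1 g2 f1 f2. chi' g2 f2" "%g1 g2 f1 f2. g1 ** f1"]
   by (simp add: bul_circ[OF h g])
  finally show "sweedler2 G H' g (%g1 g2. sweedler2 G H' f (%f1 f2. chi' g1 f1 \<star> chi' h (g2 \<bullet> f2))) =
   sweedler2 G H' h (%h1 h2. sweedler2 G H' g (%g1 g2. chi' h1 g1 \<star> chi' (h2 \<bullet> g2) f))" by simp
 qed (simp_all add: chi_bil chi'_bil inv1 inv2 one' unit)
 have "twist_mult_axioms H' chi' chi H"
 proof (rule twist_mult_axioms.intro)
  show "same_coalg H' H" by (rule same_coalg_sym[OF same])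
  show "u = one H'" by (simp add: one')
  fix x y assume "x :< H'" "y :< H'"
  then have x: "x :< HU" and y: "y :< HU" by simp_all
  have "x ** y = ftw chi' chi HU HU H (ft HU HU H (%x y. x ** y)) x y"
   by (rule ftw_inverse[OF bic_unit bic_unit modH mH x y, symmetric])
  also have "... = ftw chi' chi HU HU H (%x y. x \<bullet> y) x y"
   by (rule ftw_cong[OF bic_unit bic_unit _ x y]) (simp add: mult')
  also have "... = ftw chi' chi HU' HU' H' (%x y. x \<bullet> y) x y"
   by (simp add: ftw_same[OF same_HU same_HU, of H H'] same_module_def)
  finally show "x ** y = ftw chi' chi HU' HU' H' (%x y. x \<bullet> y) x y" .
 qed
 then show ?thesis using c H_hopf by (simp add: tpair_def twist_mult_def tpair_axioms_def)
qed

lemma tpair_cop: "tpair K (hcop H) chi' chi (hcop H')"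
proof -
 have "twist_mult_axioms (hcop H) chi' chi (hcop H')"
 proof (rule twist_mult_axioms.intro)
  show "same_coalg (hcop H) (hcop H')" by (rule same_coalg_cop[OF same])
  show "one (hcop H') = one (hcop H)" by (simp add: one')
  fix x y assume "x :< (hcop H)" "y :< (hcop H)"
  then have x: "x : cH" and y: "y : cH" by simp_all
  have "ftw chi' chi (bcop HU) (bcop HU) (hcop H) (%x y. x ** y) x y = ftw chi' chi (bcop HU) (bcop HU) H (%x y. x ** y) x y"
   by (simp add: ftw_same[OF same_bicom_refl same_bicom_refl, of "hcop H" H])
  then show "x \<otimes>\<^bsub>hcop H'\<^esub> y = ftw chi' chi (unit_bimodule (hcop H)) (unit_bimodule (hcop H)) (hcop H) (%x y. x \<otimes>\<^bsub>hcop H\<^esub> y) x y"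
   using ftw_cop[OF bic_unit bic_unit modH mH] mult' x y by (simp add: cop_unit)
 qed
 then show ?thesis using cocyc_cop hopf_loc.hopf_cop[OF T] by (simp add: tpair_def twist_mult_def tpair_axioms_def)
qed

text \<open>Seen from the co-opposite, \<open>ft\<close> is again a twist of the same kind, with the
  two halves exchanged; since they commute, \<open>ftw_colin\<close> for the co-opposite pair
  applies.\<close>

lemma ftw_colin_cop:
 assumes X: "bic X" and Y: "bic Y" and P: "bic P" and m: "bmap X Y P m"
  and c: "colin K (hcop H) (bcop X) (bcop Y) (bcop P) m"
 shows "colin K (hcop H') (bcop X) (bcop Y) (bcop P) (ft X Y P m)"
proof -
 interpret c: tpair K "hcop H" chi' chi "hcop H'" by (rule tpair_cop)
 interpret d: hopf_loc K "hcop H'" by (rule c.T)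
 have m': "bmap (bcop X) (bcop Y) (bcop P) m" using m by (simp add: bilinear_map_def linear_map_def)
 have "colin K (hcop H') (bcop X) (bcop Y) (bcop P) (ftw chi' chi (bcop X) (bcop Y) (bcop P) m)"
  by (rule c.ftw_colin[OF bic_cop[OF X] bic_cop[OF Y] bic_cop[OF P] m' c])
 moreover have "d.coact (bcop X)" "d.coact (bcop Y)"
  using bic_cop_coact[OF X] bic_cop_coact[OF Y] by (simp_all add: d.coact_def coact_def)
 moreover have "ftw chi' chi (bcop X) (bcop Y) (bcop P) m x y = ft X Y P m x y"
  if "x :< (bcop X)" "y :< (bcop Y)" for x y
  using ftw_cop[OF X Y bic_module[OF P] m, of x y] that ftw_same[of "bcop X" "bcop X" "bcop Y" "bcop Y" "bcop P" P chi' chi m] by simp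
 ultimately show ?thesis using d.colin_cong[of "bcop X" "bcop Y"] by blast
qed

lemma bbiD:
 assumes V: "bbi V"
 shows "bmap HU V V (lact V)" "bmap V HU V (ract V)"
  "colin K H HU V V (lact V)" "colin K H V HU V (ract V)"
  "colin K (hcop H) (bcop HU) (bcop V) (bcop V) (lact V)"
  "colin K (hcop H) (bcop V) (bcop HU) (bcop V) (ract V)"
 using V bb_lact[OF V] bb_ract[OF V] by (simp_all add: bbi_def cop_unit)

text \<open>The axioms for \<open>hgv\<close>, \<open>vhg\<close> and \<open>hvg\<close> are
  associativity constraints, hence three instances of \<open>ftw_assoc\<close>. Bicovariance is
  colinearity of the two twisted actions on both sides.\<close>

lemma twb_bbi:
 assumes V: "bbi V" shows "bbi' (tb V)"
proof -
 interpret T: hopf_loc K H' by (rule T)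
 interpret Tc: hopf_loc K "hcop H'" by (rule T.hopf_loc_cop)
 note b = bb_bic[OF V] and mV = bb_module[OF V] and bU = bic_unit
 note d = bbiD[OF V]
 note l = ftw_bilinear[OF chi_bil chi'_bil bU b mV d(1)] and r = ftw_bilinear[OF chi_bil chi'_bil b bU mV d(2)]
 note lc = bilinear_closed[OF l, simplified] and rc = bilinear_closed[OF r, simplified]
 have mT: "kmod (tb V)" using module_same[of V "tb V"] mV by (simp add: same_module_def)
 have bl: "bmap H V V (lact (tb V))" using bilinear_cong[OF _ modH mV, of "lact (tb V)" "ft HU V V (lact V)" V] l by simp
 have br: "bmap V H V (ract (tb V))" using bilinear_cong[OF _ mV modH, of "ract (tb V)" "ft V HU V (ract V)" V] r by simp
 have mH': "bmap HU HU HU (%x y. x ** y)" using mH by simp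
 have a1: "lact (tb V) (h \<bullet> g) v = lact (tb V) h (lact (tb V) g v)" if a: "h : cH" "g : cH" "v :< V" for h g v
  using ftw_assoc[OF bU bU b bU b mV mH' cmH d(1) d(1,3,5) d(1), of h g v] a
  by (simp add: lact_mult[OF V] lc ft_HU mult'[symmetric])
 have a2: "ract (tb V) v (h \<bullet> g) = ract (tb V) (ract (tb V) v h) g" if a: "h : cH" "g : cH" "v :< V" for h g v
  using ftw_assoc[OF b bU bU b bU mV d(2,4,6) d(2) mH' cmH d(2), of v h g] a
  by (simp add: ract_mult[OF V] rc ft_HU mult'[symmetric])
 have a3: "ract (tb V) (lact (tb V) h v) g = lact (tb V) h (ract (tb V) v g)" if a: "h : cH" "g : cH" "v :< V" for h g v
  using ftw_assoc[OF bU b bU b b mV d(1,3,5) d(2) d(2,4,6) d(1), of h v g] a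
  by (simp add: lact_ract[OF V] rc lc)
 have hb: "hopf_bimodule K H' (tb V)"
  unfolding hopf_bimodule_def
 proof (intro conjI ballI)
  show "lact (tb V) : carrier H' \<rightarrow>\<^sub>E carrier (tb V) \<rightarrow>\<^sub>E carrier (tb V)"
   using lc by (simp add: twb_def)
  show "ract (tb V) : carrier (tb V) \<rightarrow>\<^sub>E carrier H' \<rightarrow>\<^sub>E carrier (tb V)"
   using rc by (simp add: twb_def)
  show "bmap H' (tb V) (tb V) (lact (tb V))" "bmap (tb V) H' (tb V) (ract (tb V))"
   using bl br by (simp_all add: bilinear_map_def linear_map_def)
  fix v assume v: "v :< (tb V)"
  show "lact (tb V) (one H') v = v" "ract (tb V) v (one H') = v"
   using v ftw_one_l[OF b mV, of "lact V" v] ftw_one_r[OF b mV, of "ract V" v] d(1,2) by (simp_all add: one' lact_one[OF V] ract_one[OF V])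
 qed (use a1 a2 a3 mT in simp_all)
 have ct: "T.coact X = coact X" "Tc.coact X = coact X" for X :: "('k, 'h, 'z) bimodule"
  by (simp_all add: coact_def T.coact_def Tc.coact_def)
 show ?thesis
  unfolding T.bbi_def
 proof (intro conjI)
  show "bicomodule K H' (tb V)"
   using bicomodule_same_bicom[OF same_twb b] by (simp only: bicomodule_same[OF same])
  note e1 = colin_same_bicom[OF same_HU same_twb same_twb, symmetric]
   and e2 = colin_same_bicom[OF same_twb same_HU same_twb, symmetric]
   and e3 = colin_same_bicom[OF same_bicom_cop[OF same_HU] same_bicom_cop[OF same_twb] same_bicom_cop[OF same_twb], symmetric]
   and e4 = colin_same_bicom[OF same_bicom_cop[OF same_twb] same_bicom_cop[OF same_HU] same_bicom_cop[OF same_twb], symmetric]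
  have cc: "colin K H' HU V V (lact (tb V)) = colin K H' HU V V (ft HU V V (lact V))"
   "colin K H' V HU V (ract (tb V)) = colin K H' V HU V (ft V HU V (ract V))"
   by (rule T.colin_cong; simp add: ct coact_unit bb_coact[OF V])+
  have cd: "colin K (hcop H') (bcop HU) (bcop V) (bcop V) (lact (tb V)) = colin K (hcop H') (bcop HU) (bcop V) (bcop V) (ft HU V V (lact V))"
   "colin K (hcop H') (bcop V) (bcop HU) (bcop V) (ract (tb V)) = colin K (hcop H') (bcop V) (bcop HU) (bcop V) (ft V HU V (ract V))"
   by (rule Tc.colin_cong; simp add: ct bic_cop_coact[OF bU] bb_cop_coact[OF V])+
  show "colin K H' HU' (tb V) (tb V) (lact (tb V))"
   unfolding e1 cc by (rule ftw_colin[OF bU b b d(1,3)])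
  show "colin K H' (tb V) HU' (tb V) (ract (tb V))"
   unfolding e2 cc by (rule ftw_colin[OF b bU b d(2,4)])
  show "colin K (hcop H') (unit_bimodule (hcop H')) (bcop (tb V)) (bcop (tb V)) (lact (tb V))"
   unfolding cop_unit[symmetric] e3 cd by (rule ftw_colin_cop[OF bU b b d(1,5)])
  show "colin K (hcop H') (bcop (tb V)) (unit_bimodule (hcop H')) (bcop (tb V)) (ract (tb V))"
   unfolding cop_unit[symmetric] e4 cd by (rule ftw_colin_cop[OF b bU b d(2,6)])
 qed (rule hb)
qed

lemma twb_bhom:
 assumes V: "bbi V" and W: "bbi W" and f: "bhom V W f"
 shows "bhom' (tb V) (tb W) f"
proof -
 note d = bbiD[OF V] and e = bbiD[OF W] and fl = bhom_linear[OF f]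
 note bV = bb_bic[OF V] and bW = bb_bic[OF W] and mV = bb_module[OF V] and mW = bb_module[OF W]
 have fc: "lcolin K H V W f" "lcolin K (hcop H) (bcop V) (bcop W) f" and fe: "f : extensional (carrier V)"
  using f by (simp_all add: bhom_def)
 have i: "lcolin K H HU HU (%x. x)" "lcolin K (hcop H) (bcop HU) (bcop HU) (%x. x)" "lmap HU HU (%x. x)"
  using lcolin_id[OF coact_unit] hopf_loc.lcolin_id[OF hopf_loc_cop, of "bcop HU"] bic_cop_coact[OF bic_unit]
  by (simp_all add: coact_cop linear_id)
 have "lcolin K H' V W f = lcolin K H V W f" "lcolin K (hcop H') (bcop V) (bcop W) f = lcolin K (hcop H) (bcop V) (bcop W) f"
  by (simp_all add: lcolin_def)
 then have lc: "lcolin K H' (tb V) (tb W) f" "lcolin K (hcop H') (bcop (tb V)) (bcop (tb W)) f"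
  using fc by (simp_all add: lcolin_same_bicom[OF same_twb same_twb, symmetric]
   lcolin_same_bicom[OF same_bicom_cop[OF same_twb] same_bicom_cop[OF same_twb], symmetric])
 have a: "f (ft HU V V (lact V) h v) = ft HU W W (lact W) h (f v)" if "h : cH" "v :< V" for h v
  by (rule ftw_natural[OF chi_bil chi'_bil bic_unit bic_unit bV bW mV mW d(1) e(1) fl i fc fl]) (simp_all add: that bhom_lact[OF f])
 have b: "f (ft V HU V (ract V) v h) = ft W HU W (ract W) (f v) h" if "h : cH" "v :< V" for h v
  by (rule ftw_natural[OF chi_bil chi'_bil bV bW bic_unit bic_unit mV mW d(2) e(2) fl fc fl i]) (simp_all add: that bhom_ract[OF f])
 show ?thesis
  unfolding hopf_loc.bhom_def[OF T]
  using lc fe fl a b linear_closed[OF fl] by (simp add: linear_map_def)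
qed

text \<open>Untwisting returns the old actions on the carriers. As these are extensional, the result
  is equality of bimodules, so that twisting is a bijection on objects.\<close>

lemma twb_inverse:
 assumes V: "bbi V" shows "twb chi' chi H' (tb V) = V"
proof -
 note d = bbiD[OF V] and bV = bb_bic[OF V] and mV = bb_module[OF V]
 have ex: "lact V : cH \<rightarrow>\<^sub>E carrier V \<rightarrow>\<^sub>E carrier V" "ract V : carrier V \<rightarrow>\<^sub>E cH \<rightarrow>\<^sub>E carrier V"
  using bb_bimodule[OF V] by (simp_all add: hopf_bimodule_def)
 have l: "ftw chi' chi HU' (tb V) (tb V) (lact (tb V)) h v = lact V h v" if a: "h : cH" "v :< V" for h v
 proof -
  have "ftw chi' chi HU' (tb V) (tb V) (lact (tb V)) h v = ftw chi' chi HU V V (lact (tb V)) h v"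
   by (simp add: ftw_same[OF same_HU same_twb, of V "tb V", symmetric] same_module_def)
  also have "... = ftw chi' chi HU V V (ft HU V V (lact V)) h v"
   by (rule ftw_cong[OF bic_unit bV]) (simp_all add: a)
  also have "... = lact V h v"
   by (rule ftw_inverse[OF bic_unit bV mV d(1)]) (simp_all add: a)
  finally show ?thesis .
 qed
 have r: "ftw chi' chi (tb V) HU' (tb V) (ract (tb V)) v h = ract V v h" if a: "h : cH" "v :< V" for h v
 proof -
  have "ftw chi' chi (tb V) HU' (tb V) (ract (tb V)) v h = ftw chi' chi V HU V (ract (tb V)) v h"
   by (simp add: ftw_same[OF same_twb same_HU, of V "tb V", symmetric] same_module_def)
  also have "... = ftw chi' chi V HU V (ft V HU V (ract V)) v h"
   by (rule ftw_cong[OF bV bic_unit]) (simp_all add: a)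
  also have "... = ract V v h"
   by (rule ftw_inverse[OF bV bic_unit mV d(2)]) (simp_all add: a)
  finally show ?thesis .
 qed
 have "(\<lambda>h\<in>carrier H'. \<lambda>v\<in>carrier (tb V). ftw chi' chi HU' (tb V) (tb V) (lact (tb V)) h v) = lact V"
  using ex(1) l by (intro ext) (auto simp: restrict_def PiE_def extensional_def Pi_iff fun_eq_iff)
 moreover have "(\<lambda>v\<in>carrier (tb V). \<lambda>h\<in>carrier H'. ftw chi' chi (tb V) HU' (tb V) (ract (tb V)) v h) = ract V"
  using ex(2) r by (intro ext) (auto simp: restrict_def PiE_def extensional_def Pi_iff fun_eq_iff)
 ultimately show ?thesis
  unfolding twb_def[of _ _ H'] by (simp add: twb_def)
qed

lemma twb_bij: "bij_betw tb {V :: ('k, 'h, 'v) bimodule. bbi V} {V. bbi' V}"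
proof -
 interpret s: tpair K H' chi' chi H by (rule tpair_sym)
 show ?thesis
  by (rule bij_betw_byWitness[where f' = "twb chi' chi H'"])
   (auto simp: twb_inverse twb_bbi intro: s.twb_inverse s.twb_bbi)
qed

lemma twb_bhom_iff:
 assumes V: "bbi V" and W: "bbi W"
 shows "bhom' (tb V) (tb W) f \<longleftrightarrow> bhom V W f"
proof
 interpret s: tpair K H' chi' chi H by (rule tpair_sym)
 assume "bhom' (tb V) (tb W) f"
 from s.twb_bhom[OF twb_bbi[OF V] twb_bbi[OF W] this] show "bhom V W f"
  by (simp add: twb_inverse V W)
qed (rule twb_bhom[OF V W])

end

section \<open>The monoidal structure of the twisting functor\<close>

text \<open>A linear map may be moved inside the twist without any colinearity, because the
  coactions summed over are those of the arguments.\<close>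

lemma (in cocyc) ftw_push:
 assumes X: "bic X" and Y: "bic Y" and P: "kmod P" and Q: "kmod Q" and m: "bmap X Y P m" and f: "lmap P Q f"
  and x: "x :< X" and y: "y :< Y"
 shows "f (ft X Y P m x y) = ft X Y Q (%x y. f (m x y)) x y"
proof -
 note cX = bic_coact[OF X] and cY = bic_coact[OF Y]
 have "f (ft X Y P m x y) = tw chi X Y Q (%x y. f (ctw chi' X Y P m x y)) x y"
  unfolding ftw_def by (rule tw_push[OF chi_bil cX cY P Q _ f x y]) (rule bilinear_closed[OF ftw_inner_bil[OF chi'_bil X Y P m]])
 also have "... = ft X Y Q (%x y. f (m x y)) x y"
  unfolding ftw_def
  by (rule tw_cong[OF cX cY _ x y], rule coalg.tw_push[OF coalg_cop])
   (use bilinear_closed[OF m] f P Q chi'_bil in \<open>simp_all add: coact_cop bic_cop_coact X Y\<close>)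
 finally show ?thesis .
qed

lemma tensor_lift_twb [simp]: "tlift (twb phi psi H V) = tlift V"
 by (simp add: fun_eq_iff tensor_lift_def)

context tpair
begin

interpretation T: hopf_loc K H' by (rule T)

abbreviation "hT V W \<equiv> htensor_bimodule K H' (tb V) (tb W)"

text \<open>The comparison map is the twist of the universal bilinear map
  \<open>V \<times> W \<rightarrow> V \<otimes> W\<close> over \<open>H\<close>, made into a map on
  the tensor product over \<open>H'\<close>.\<close>

definition "cm V W = (\<lambda>t\<in>carrier (hT V W). tlift (V >< W) (ft V W (V >< W) (ht V W)) t)"

lemma tb_linear [simp]: "lmap (tb V) M = lmap V M" "lmap M (tb V) = lmap M V"
 by (simp_all add: fun_eq_iff linear_map_def)

lemma tb_bilinear [simp]: "bmap (tb V) M P = bmap V M P" "bmap M (tb V) P = bmap M V P"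
 "bmap M P (tb V) = bmap M P V"
 by (simp_all add: fun_eq_iff bilinear_map_def)

lemma ftw_tb: "ftw phi psi (tb V) (tb W) P m = ftw phi psi V W P m"
 by (rule ftw_same[OF same_twb same_twb same_module_refl, symmetric])

context
 fixes V :: "('k, 'h, 'v) bimodule" and W :: "('k, 'h, 'w) bimodule"
 assumes V: "bbi V" and W: "bbi W"
begin

lemmas VW_rules = bb_bic[OF V] bb_bic[OF W] ht_module[OF V W] ht_bilinear[OF V W]
lemmas ht_colins = ht_colin[OF V W] ht_colin_cop[OF V W]

lemma cm_bil: "bmap V W (V >< W) (ft V W (V >< W) (ht V W))"
 by (rule ftw_bilinear[OF chi_bil chi'_bil VW_rules])

text \<open>The relation \<open>vh \<otimes> w = v \<otimes> hw\<close> is itself an associativity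
  constraint between the right action, the left action and the universal map, so twisting preserves
  it. Equivariance in \<open>cm_bhom\<close> arises in the same way.\<close>

lemma cm_bal: "T.hbal (tb V) (tb W) (V >< W) (ft V W (V >< W) (ht V W))"
proof (rule T.hbalI)
 fix v h w assume "v :< (tb V)" "h :< H'" "w :< (tb W)"
 then have a: "v :< V" "h : cH" "w :< W" by simp_all
 note d = bbiD[OF V] and e = bbiD[OF W]
 have "ft V W (V >< W) (ht V W) (ft V HU V (ract V) v h) w = ft V W (V >< W) (ht V W) v (ft HU W W (lact W) h w)"
  by (rule ftw_assoc[OF VW_rules(1) bic_unit VW_rules(2,1,2,3) d(2,4,6) VW_rules(4) e(1,3,5) VW_rules(4)])
   (use a ht_balance[OF V W] in simp_all)
 then show "ft V W (V >< W) (ht V W) (ract (tb V) v h) w = ft V W (V >< W) (ht V W) v (lact (tb W) h w)"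
  using a by simp
qed (simp add: cm_bil)

lemma cm_gen: "v :< V ==> w :< W ==> cm V W (htensor H' (tb V) (tb W) v w) = ft V W (V >< W) (ht V W) v w"
 unfolding cm_def using T.ht_eval[OF twb_bbi[OF V] twb_bbi[OF W] VW_rules(3) cm_bal, of v w] by simp

lemma cm_bhom: "bhom' (hT V W) (tb (V >< W)) (cm V W)"
proof -
 note P = bbi_ht[OF V W] and M = VW_rules(3) and B = VW_rules(4) and hc = ht_colins
 note d = bbiD[OF V] and e = bbiD[OF W] and p = bbiD[OF P]
 note bV = VW_rules(1) and bW = VW_rules(2) and bP = bb_bic[OF P]
 have "bhom' (hT V W) (tb (V >< W)) (\<lambda>t\<in>carrier (hT V W). tlift (tb (V >< W)) (ft V W (V >< W) (ht V W)) t)"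
 proof (rule T.ht_bhom[OF twb_bbi[OF V] twb_bbi[OF W] twb_bbi[OF P]])
  show "T.hbal (tb V) (tb W) (tb (V >< W)) (ft V W (V >< W) (ht V W))"
   using cm_bal by (simp add: T.hbal_def)
  show "colin K H' (tb V) (tb W) (tb (V >< W)) (ft V W (V >< W) (ht V W))"
   unfolding colin_same_bicom[OF same_twb same_twb same_twb, symmetric]
   by (rule ftw_colin[OF bV bW bP B hc(1)])
  show "colin K (hcop H') (bcop (tb V)) (bcop (tb W)) (bcop (tb (V >< W))) (ft V W (V >< W) (ht V W))"
   unfolding colin_same_bicom[OF same_bicom_cop[OF same_twb] same_bicom_cop[OF same_twb] same_bicom_cop[OF same_twb], symmetric]
   by (rule ftw_colin_cop[OF bV bW bP B hc(2)])
  fix h v w assume "h :< H'" "v :< (tb V)" "w :< (tb W)"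
  then have a: "h : cH" "v :< V" "w :< W" by simp_all
  have "ft V W (V >< W) (ht V W) (ft HU V V (lact V) h v) w = ft HU (V >< W) (V >< W) (lact (V >< W)) h (ft V W (V >< W) (ht V W) v w)"
   by (rule ftw_assoc[OF bic_unit bV bW bV bP M d(1,3,5) B B hc p(1)]) (use a ht_lact[OF V W] in simp_all)
  then show "ft V W (V >< W) (ht V W) (lact (tb V) h v) w = lact (tb (V >< W)) h (ft V W (V >< W) (ht V W) v w)"
   using a by (simp add: bilinear_closed[OF cm_bil])
  have "ft (V >< W) HU (V >< W) (ract (V >< W)) (ft V W (V >< W) (ht V W) v w) h = ft V W (V >< W) (ht V W) v (ft W HU W (ract W) w h)"
   by (rule ftw_assoc[OF bV bW bic_unit bP bW M B hc p(2) e(2,4,6) B]) (use a ht_ract[OF V W] in simp_all)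
  then show "ft V W (V >< W) (ht V W) v (ract (tb W) w h) = ract (tb (V >< W)) (ft V W (V >< W) (ht V W) v w) h"
   using a by (simp add: bilinear_closed[OF cm_bil])
 qed
 then show ?thesis by (simp add: cm_def)
qed

lemma cm_linear: "lmap (hT V W) (V >< W) (cm V W)"
 using T.bhom_linear[OF cm_bhom] by simp

lemma hT_bbi: "bbi' (hT V W)"
 by (rule T.bbi_ht[OF twb_bbi[OF V] twb_bbi[OF W]])

end

text \<open>The inverse is the comparison map of the symmetric pair, applied to the twisted
  bimodules. Moving it inside the twist on pure tensors leaves two opposite twists of the universal
  map over \<open>H'\<close>, which cancel.\<close>

lemma cm_inverse:
 assumes V: "bbi V" and W: "bbi W" and t: "t :< (hT V W)"
 shows "tpair.cm K H' chi' chi H (tb V) (tb W) (cm V W t) = t"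
proof -
 interpret s: tpair K H' chi' chi H by (rule tpair_sym)
 note tV = twb_bbi[OF V] and tW = twb_bbi[OF W]
 have sl: "lmap (V >< W) (hT V W) (s.cm (tb V) (tb W))"
  using s.cm_linear[OF tV tW] by (simp add: twb_inverse V W)
 have mT: "kmod (hT V W)" by (rule T.ht_module[OF tV tW])
 show ?thesis
 proof (rule T.ht_ext[OF tV tW mT linear_compose[OF cm_linear[OF V W] sl] linear_id _ t])
  fix v w assume "v :< (tb V)" "w :< (tb W)"
  then have a: "v :< V" "w :< W" by simp_all
  have "s.cm (tb V) (tb W) (cm V W (htensor H' (tb V) (tb W) v w)) = s.cm (tb V) (tb W) (ft V W (V >< W) (ht V W) v w)"
   by (simp add: cm_gen[OF V W] a)
  also have "... = ft V W (hT V W) (%v w. s.cm (tb V) (tb W) (ht V W v w)) v w"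
   by (rule ftw_push[OF bb_bic[OF V] bb_bic[OF W] ht_module[OF V W] mT ht_bilinear[OF V W] sl a])
  also have "... = ft V W (hT V W) (ftw chi' chi V W (hT V W) (htensor H' (tb V) (tb W))) v w"
  proof (rule ftw_cong[OF bb_bic[OF V] bb_bic[OF W] _ a])
   fix v w assume "v :< V" "w :< W"
   then show "s.cm (tb V) (tb W) (ht V W v w) = ftw chi' chi V W (hT V W) (htensor H' (tb V) (tb W)) v w"
    using s.cm_gen[OF tV tW, of v w] by (simp add: twb_inverse V W ftw_tb)
  qed
  also have "... = htensor H' (tb V) (tb W) v w"
   using s.ftw_inverse[OF T.bb_bic[OF tV] T.bb_bic[OF tW] mT T.ht_bilinear[OF tV tW], of v w] a by (simp add: ftw_tb)
  finally show "s.cm (tb V) (tb W) (cm V W (htensor H' (tb V) (tb W) v w)) = htensor H' (tb V) (tb W) v w" .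
 qed
qed

lemma cm_iso:
 assumes V: "bbi V" and W: "bbi W" shows "cm V W : bicovariant_iso K H' (hT V W) (tb (V >< W))"
proof -
 interpret s: tpair K H' chi' chi H by (rule tpair_sym)
 note tV = twb_bbi[OF V] and tW = twb_bbi[OF W]
 show ?thesis
 proof (rule T.bhom_inverse[OF hT_bbi[OF V W] twb_bbi[OF bbi_ht[OF V W]] cm_bhom[OF V W], where g = "s.cm (tb V) (tb W)"])
  fix t assume "t :< (tb (V >< W))"
  then have t: "t :< (V >< W)" by simp
  show "s.cm (tb V) (tb W) t :< (hT V W)"
   using linear_closed[OF s.cm_linear[OF tV tW]] t by (simp add: twb_inverse V W)
  show "cm V W (s.cm (tb V) (tb W) t) = t"
   using s.cm_inverse[OF tV tW, of t] t by (simp add: twb_inverse V W)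
 qed (rule cm_inverse[OF V W])
qed

lemma cm_natural:
 assumes V: "bbi V" and W: "bbi W" and V': "bbi V'" and W': "bbi W'" and f: "bhom V V' f" and g: "bhom W W' g" and t: "t :< (hT V W)"
 shows "cm V' W' (htensor_map K H' (tb V) (tb W) (tb V') (tb W') f g t) = htensor_map K H V W V' W' f g (cm V W t)"
proof -
 note tb = twb_bbi[OF V] twb_bbi[OF W] twb_bbi[OF V'] twb_bbi[OF W'] twb_bhom[OF V V' f] twb_bhom[OF W W' g]
 note l = linear_compose[OF T.htensor_map_linear[OF tb] cm_linear[OF V' W']] linear_compose[OF cm_linear[OF V W] htensor_map_linear[OF V W V' W' f g]]
 show ?thesis
 proof (rule T.ht_ext[OF tb(1,2) ht_module[OF V' W'] l _ t])
  fix v w assume "v :< (tb V)" "w :< (tb W)"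
  then have a: "v :< V" "w :< W" by simp_all
  have fg: "lcolin K H V V' f" "lcolin K (hcop H) (bcop V) (bcop V') f" "lmap V V' f"
   "lcolin K H W W' g" "lcolin K (hcop H) (bcop W) (bcop W') g" "lmap W W' g"
   using f g by (simp_all add: bhom_def)
  have "htensor_map K H V W V' W' f g (ft V W (V >< W) (ht V W) v w) = ft V' W' (V' >< W') (ht V' W') (f v) (g w)"
   by (rule ftw_natural[OF chi_bil chi'_bil bb_bic[OF V] bb_bic[OF V'] bb_bic[OF W] bb_bic[OF W'] ht_module[OF V W] ht_module[OF V' W']
    ht_bilinear[OF V W] ht_bilinear[OF V' W'] htensor_map_linear[OF V W V' W' f g] fg _ a]) (rule htensor_map_gen[OF V W V' W' f g])
  then show "cm V' W' (htensor_map K H' (tb V) (tb W) (tb V') (tb W') f g (htensor H' (tb V) (tb W) v w)) =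
    htensor_map K H V W V' W' f g (cm V W (htensor H' (tb V) (tb W) v w))"
   by (simp add: T.htensor_map_gen[OF tb] a cm_gen[OF V W] cm_gen[OF V' W'] bhom_closed[OF f] bhom_closed[OF g])
 qed
qed

text \<open>The universal maps satisfy the constraint that the associator sends
  \<open>(v \<otimes> w) \<otimes> x\<close> to \<open>v \<otimes> (w \<otimes> x)\<close>.
  Absorbing the associator into the outer map makes this an associativity constraint, and its
  twisted form is the coherence condition.\<close>

lemma cm_assoc:
 assumes V: "bbi V" and W: "bbi W" and Z: "bbi Z" and t: "t :< (htensor_bimodule K H' (hT V W) (tb Z))"
 shows "associator K H V W Z (cm (V >< W) Z (htensor_map K H' (hT V W) (tb Z) (tb (V >< W)) (tb Z) (cm V W) (identity_map (tb Z)) t)) =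
  cm V (W >< Z) (htensor_map K H' (tb V) (hT W Z) (tb V) (tb (W >< Z)) (identity_map (tb V)) (cm W Z) (associator K H' (tb V) (tb W) (tb Z) t))"
proof -
 note VW = bbi_ht[OF V W] and WU = bbi_ht[OF W Z]
 note b = bb_bic[OF V] bb_bic[OF W] bb_bic[OF Z] bb_bic[OF VW] bb_bic[OF WU]
 note tV = twb_bbi[OF V] and tW = twb_bbi[OF W] and tU = twb_bbi[OF Z]
 note m1 = hT_bbi[OF V W] tU twb_bbi[OF VW] tU cm_bhom[OF V W] T.bhom_id[OF tU]
 note m2 = tV hT_bbi[OF W Z] tV twb_bbi[OF WU] T.bhom_id[OF tV] cm_bhom[OF W Z]
 note al = associator_linear[OF V W Z]
 note l1 = linear_compose[OF linear_compose[OF T.htensor_map_linear[OF m1] cm_linear[OF VW Z]] al]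
 note l2 = linear_compose[OF linear_compose[OF T.associator_linear[OF tV tW tU] T.htensor_map_linear[OF m2]] cm_linear[OF V WU]]
 note mZ = ht_module[OF V WU]
 have n: "bmap (V >< W) Z (V >< (W >< Z)) (%s x. associator K H V W Z (ht (V >< W) Z s x))"
  by (intro bilinear_mapI linear_compose[OF bilinear_l[OF ht_bilinear[OF VW Z]] al] linear_compose[OF bilinear_r[OF ht_bilinear[OF VW Z]] al])
 show ?thesis
 proof (rule T.ht_ext3l[OF tV tW tU mZ l1 l2 _ t])
  fix v w x assume "v :< (tb V)" "w :< (tb W)" "x :< (tb Z)"
  then have a: "v :< V" "w :< W" "x :< Z" by simp_all
  note h1 = T.ht_closed[OF tV tW, of v w, simplified, OF a(1,2)] and h2 = T.ht_closed[OF tW tU, of w x, simplified, OF a(2,3)]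
  note f1 = bilinear_closed[OF cm_bil[OF V W] a(1,2)] and f2 = bilinear_closed[OF cm_bil[OF W Z] a(2,3)]
  have "associator K H V W Z (ft (V >< W) Z ((V >< W) >< Z) (ht (V >< W) Z) (ft V W (V >< W) (ht V W) v w) x)
    = ft (V >< W) Z (V >< (W >< Z)) (%s x. associator K H V W Z (ht (V >< W) Z s x)) (ft V W (V >< W) (ht V W) v w) x"
   by (rule ftw_push[OF b(4,3) ht_module[OF VW Z] mZ ht_bilinear[OF VW Z] al f1 a(3)])
  also have "... = ft V (W >< Z) (V >< (W >< Z)) (ht V (W >< Z)) v (ft W Z (W >< Z) (ht W Z) w x)"
   by (rule ftw_assoc[OF b mZ ht_bilinear[OF V W] ht_colins[OF V W] n ht_bilinear[OF W Z] ht_colins[OF W Z] ht_bilinear[OF V WU] _ a])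
    (rule associator_gen[OF V W Z])
  finally show "associator K H V W Z (cm (V >< W) Z (htensor_map K H' (hT V W) (tb Z) (tb (V >< W)) (tb Z) (cm V W) (identity_map (tb Z)) (htensor H' (hT V W) (tb Z) (htensor H' (tb V) (tb W) v w) x))) =
   cm V (W >< Z) (htensor_map K H' (tb V) (hT W Z) (tb V) (tb (W >< Z)) (identity_map (tb V)) (cm W Z) (associator K H' (tb V) (tb W) (tb Z) (htensor H' (hT V W) (tb Z) (htensor H' (tb V) (tb W) v w) x)))"
   using a h1 h2 f1 f2
   by (simp add: T.htensor_map_gen[OF m1] T.htensor_map_gen[OF m2] T.associator_gen[OF tV tW tU] identity_map_apply
    cm_gen[OF V W] cm_gen[OF W Z] cm_gen[OF VW Z] cm_gen[OF V WU])
 qed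
qed

lemma tb_unit: "tb HU = HU'"
proof -
 have 1: "ft HU HU HU (lact HU) h x = h \<bullet> x" "ft HU HU HU (ract HU) h x = h \<bullet> x" if "h : cH" "x : cH" for h x
  using ftw_cong[OF bic_unit bic_unit, of "lact HU" "%x y. x ** y" h x chi chi' H] ftw_cong[OF bic_unit bic_unit, of "ract HU" "%x y. x ** y" h x chi chi' H] that
  by (simp_all add: ft_HU mult')
 have l: "(\<lambda>h\<in>cH. \<lambda>x\<in>carrier HU. ft HU HU HU (lact HU) h x) = (\<lambda>h\<in>cH. \<lambda>x\<in>cH. h \<bullet> x)"
  "(\<lambda>x\<in>carrier HU. \<lambda>h\<in>cH. ft HU HU HU (ract HU) x h) = (\<lambda>h\<in>cH. \<lambda>x\<in>cH. h \<bullet> x)"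
  unfolding unit_bimodule_simps(1) by (intro restrict_ext 1; assumption)+
 show ?thesis
  unfolding twb_def l by (rule bimodule.equality) (simp_all add: unit_bimodule_def)
qed

text \<open>The action is the universal map followed by the unitor, so pushing the unitor through
  the twist turns the comparison map into the twisted action.\<close>

lemma cm_left_unit:
 assumes V: "bbi V" and t: "t :< (htensor_bimodule K H' HU' (tb V))"
 shows "left_unitor K H V (cm HU V t) = left_unitor K H' (tb V) t"
proof -
 note tV = twb_bbi[OF V] and lV = bhom_linear[OF bhom_left_unitor[OF V]] and mV = bb_module[OF V]
 have l: "lmap (htensor_bimodule K H' HU' (tb V)) V (left_unitor K H' (tb V))"
  using T.bhom_linear[OF T.bhom_left_unitor[OF tV]] by simp
 show ?thesis
 proof (rule T.ht_ext[OF T.bbi_unit tV mV linear_compose[OF cm_linear[OF bbi_unit V, unfolded tb_unit] lV] l _ t])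
  fix h v assume "h :< HU'" "v :< (tb V)"
  then have a: "h : cH" "v :< V" by simp_all
  have "left_unitor K H V (ft HU V (HU >< V) (ht HU V) h v) = ft HU V V (%h v. left_unitor K H V (ht HU V h v)) h v"
   by (rule ftw_push[OF bic_unit bb_bic[OF V] ht_module[OF bbi_unit V] mV ht_bilinear[OF bbi_unit V] lV]) (simp_all add: a)
  also have "... = ft HU V V (lact V) h v"
   by (rule ftw_cong[OF bic_unit bb_bic[OF V]]) (simp_all add: a left_unitor_gen[OF V])
  finally show "left_unitor K H V (cm HU V (htensor H' HU' (tb V) h v)) = left_unitor K H' (tb V) (htensor H' HU' (tb V) h v)"
   using cm_gen[OF bbi_unit V, of h v] a by (simp add: tb_unit T.left_unitor_gen[OF tV])
 qed
qed

lemma cm_right_unit: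
 assumes V: "bbi V" and t: "t :< (htensor_bimodule K H' (tb V) HU')"
 shows "right_unitor K H V (cm V HU t) = right_unitor K H' (tb V) t"
proof -
 note tV = twb_bbi[OF V] and lV = bhom_linear[OF bhom_right_unitor[OF V]] and mV = bb_module[OF V]
 have l: "lmap (htensor_bimodule K H' (tb V) HU') V (right_unitor K H' (tb V))"
  using T.bhom_linear[OF T.bhom_right_unitor[OF tV]] by simp
 show ?thesis
 proof (rule T.ht_ext[OF tV T.bbi_unit mV linear_compose[OF cm_linear[OF V bbi_unit, unfolded tb_unit] lV] l _ t])
  fix v h assume "h :< HU'" "v :< (tb V)"
  then have a: "h : cH" "v :< V" by simp_all
  have "right_unitor K H V (ft V HU (V >< HU) (ht V HU) v h) = ft V HU V (%v h. right_unitor K H V (ht V HU v h)) v h"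
   by (rule ftw_push[OF bb_bic[OF V] bic_unit ht_module[OF V bbi_unit] mV ht_bilinear[OF V bbi_unit] lV]) (simp_all add: a)
  also have "... = ft V HU V (ract V) v h"
   by (rule ftw_cong[OF bb_bic[OF V] bic_unit]) (simp_all add: a right_unitor_gen[OF V])
  finally show "right_unitor K H V (cm V HU (htensor H' (tb V) HU' v h)) = right_unitor K H' (tb V) (htensor H' (tb V) HU' v h)"
   using cm_gen[OF V bbi_unit, of v h] a by (simp add: tb_unit T.right_unitor_gen[OF tV])
 qed
qed

lemma tb_LI: "T.LI (tb V) = LI V" "T.RI (tb V) = RI V"
proof -
 have "tn H (tb V) = tn H V" "tn (tb V) H = tn V H"
  by (rule tensor_same; simp add: same_module_def)+
 then show "T.LI (tb V) = LI V" "T.RI (tb V) = RI V"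
  by (simp_all add: left_invariant_def right_invariant_def one')
qed

lemma cm_braided:
 assumes V: "bbi V" and W: "bbi W" and t: "t :< (hT V W)"
 shows "braiding K H V W (cm V W t) = cm W V (braiding K H' (tb V) (tb W) t)"
proof -
 note tV = twb_bbi[OF V] and tW = twb_bbi[OF W] and VW = bbi_ht[OF V W] and WV = bbi_ht[OF W V]
 note Br = braiding_bhom[OF V W] and Br' = T.braiding_bhom[OF tV tW]
 note Bt = twb_bhom[OF VW WV Br] and C1 = cm_bhom[OF V W] and C2 = cm_bhom[OF W V]
 note c1 = T.bhom_closed[OF C1]
 have l1: "lmap (hT V W) (W >< V) (%t. braiding K H V W (cm V W t))"
  by (rule linear_compose[OF cm_linear[OF V W] bhom_linear[OF Br]])
 have l2: "lmap (hT V W) (W >< V) (%t. cm W V (braiding K H' (tb V) (tb W) t))"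
  by (rule linear_compose[OF T.bhom_linear[OF Br'] cm_linear[OF W V]])
 show ?thesis
 proof (rule T.span_ht[OF tV tW ht_module[OF W V] l1 l2 _ t])
  fix h v w k assume "h :< H'" "k :< H'" and v: "v : T.LI (tb V)" and w: "w : T.RI (tb W)"
  then have hk: "h :< H'" "k :< H'" and v': "v : LI V" and w': "w : RI W" by (simp_all add: tb_LI)
  note vV = T.LI_mem[OF v] and wW = T.RI_mem[OF w]
  have z: "htensor H' (tb V) (tb W) v w :< (hT V W)" "htensor H' (tb W) (tb V) w v :< (hT W V)"
   using T.ht_closed[OF tV tW vV wW] T.ht_closed[OF tW tV wW vV] by auto
  note la = bilinear_closed[OF T.ht_lact_bilinear[OF tV tW] hk(1) z(1)] bilinear_closed[OF T.ht_lact_bilinear[OF tW tV] hk(1) z(2)]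
  have e1: "htensor H' (tb V) (tb W) (lact (tb V) h v) (ract (tb W) w k) = ract (hT V W) (lact (hT V W) h (htensor H' (tb V) (tb W) v w)) k"
   using T.ht_lact[OF tV tW hk(1) vV wW] T.ht_ract[OF tV tW hk(2) T.lact_closed[OF tV hk(1) vV] wW] by simp
  have e2: "htensor H' (tb W) (tb V) (lact (tb W) h w) (ract (tb V) v k) = ract (hT W V) (lact (hT W V) h (htensor H' (tb W) (tb V) w v)) k"
   using T.ht_lact[OF tW tV hk(1) wW vV] T.ht_ract[OF tW tV hk(2) T.lact_closed[OF tW hk(1) wW] vV] by simp
  have g1: "cm V W (htensor H' (tb V) (tb W) v w) = ht V W v w"
   using cm_gen[OF V W, of v w] ftw_LI_RI[OF bb_bic[OF V] bb_bic[OF W] ht_module[OF V W] ht_bilinear[OF V W] v' w'] vV wW by simp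
  have g2: "cm W V (htensor H' (tb W) (tb V) w v) = ht W V w v"
   using cm_gen[OF W V, of w v] ftw_RI_LI[OF bb_bic[OF W] bb_bic[OF V] ht_module[OF W V] ht_bilinear[OF W V] w' v'] vV wW by simp
  have g3: "braiding K H V W (ht V W v w) = ht W V w v"
   using braiding_gen[OF V W, of u u v w] v' w' by (simp add: lact_one[OF V] lact_one[OF W] ract_one[OF V] ract_one[OF W] LI_mem RI_mem)
  \<comment> \<open>Both comparison maps and the braiding of \<open>H\<close>, as a morphism between
    twisted bimodules, commute with the actions of \<open>H'\<close>. This strips off
    \<open>h\<close> and \<open>k\<close>, and on \<open>v \<otimes> w\<close> itself none of the
    maps sees the twist.\<close>
  have "braiding K H V W (cm V W (htensor H' (tb V) (tb W) (lact (tb V) h v) (ract (tb W) w k)))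
    = ract (tb (W >< V)) (lact (tb (W >< V)) h (braiding K H V W (cm V W (htensor H' (tb V) (tb W) v w)))) k"
   unfolding e1 T.bhom_ract[OF C1 hk(2) la(1)] T.bhom_lact[OF C1 hk(1) z(1)]
    T.bhom_ract[OF Bt hk(2) T.lact_closed[OF twb_bbi[OF VW] hk(1) c1[OF z(1)]]] T.bhom_lact[OF Bt hk(1) c1[OF z(1)]] ..
  also have "... = ract (tb (W >< V)) (lact (tb (W >< V)) h (cm W V (htensor H' (tb W) (tb V) w v))) k"
   by (simp only: g1 g2 g3)
  also have "... = cm W V (htensor H' (tb W) (tb V) (lact (tb W) h w) (ract (tb V) v k))"
   unfolding e2 T.bhom_ract[OF C2 hk(2) la(2)] T.bhom_lact[OF C2 hk(1) z(2)] ..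
  also have "... = cm W V (braiding K H' (tb V) (tb W) (htensor H' (tb V) (tb W) (lact (tb V) h v) (ract (tb W) w k)))"
   by (simp only: T.braiding_gen[OF tV tW hk v w])
  finally show "braiding K H V W (cm V W (htensor H' (tb V) (tb W) (lact (tb V) h v) (ract (tb W) w k)))
    = cm W V (braiding K H' (tb V) (tb W) (htensor H' (tb V) (tb W) (lact (tb V) h v) (ract (tb W) w k)))" .
 qed
qed

end

section \<open>Sweedler formulas\<close>

context hopf_loc
begin

lemma sw_ground [simp]: "sweedler2 K H h F = sw G h F"
 by (simp add: sweedler2_def tensor_lift_ground)

lemma counit2_tensor: "h : cH ==> g : cH ==> counit2 K H (tn H H h g) = eps h \<star> eps g"
 unfolding counit2_def tensor_lift_ground[of K, symmetric]
 by (rule tl_tensor[OF modH modH modG]) (intro lin cl; assumption)+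

text \<open>Translates convolution on the coalgebra \<open>H \<otimes> H\<close>, whose functionals
  take tensors, into the form with two arguments that \<open>cocyc\<close> uses.\<close>

lemma convolution2_tensor:
 assumes phi: "lmap (ts H H) G phi" and psi: "lmap (ts H H) G psi" and h: "h : cH" and g: "g : cH"
 shows "convolution K (comult2 K H) phi psi (tn H H h g) = sw G h (%h1 h2. sw G g (%g1 g2. phi (tn H H h1 g1) \<star> psi (tn H H h2 g2)))"
proof -
 define HH where "HH = ts H H"
 define HHHH where "HHHH = ts HH HH"
 let ?F = "%x1 x2. phi x1 \<star> psi x2"
 let ?t = "tn H H"
 have mHH: "kmod HH" unfolding HH_def by (intro cl modH)
 have mH4: "kmod HHHH" unfolding HHHH_def by (intro cl mHH)
 have b: "bmap HH HH G ?F"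
  using linear_closed[OF phi] linear_closed[OF psi] unfolding HH_def
  by (intro bilinear_mapI linear_multK_l linear_multK_r phi psi) simp_all
 note lF = linear_tl[OF mHH mHH modG b, folded HHHH_def]
 have tc: "?t a b :< HH" if "a : cH" "b : cH" for a b unfolding HH_def by (intro cl that modH)
 have tb: "bmap H H HH ?t" unfolding HH_def by (rule bilinear_tensor[OF modH modH])
 have Tb: "bmap HH HH HHHH (tn HH HH)" unfolding HHHH_def by (rule bilinear_tensor[OF mHH mHH])
 note R = lin cl linear_bil_l[OF tb] linear_bil_r[OF tb] linear_bil_l[OF Tb] linear_bil_r[OF Tb] tc bilinear_closed[OF Tb] mH4
 have "comult2 K H (?t h g) = sw HHHH h (%h1 h2. sw HHHH g (%g1 g2. tn HH HH (?t h1 g1) (?t h2 g2)))"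
  unfolding comult2_def Let_def HH_def[symmetric] HHHH_def[symmetric]
  by (rule tl_tensor[OF modH modH mH4 _ h g]) (intro R; assumption)
 then have "convolution K (comult2 K H) phi psi (?t h g) = tlift G ?F (sw HHHH h (%h1 h2. sw HHHH g (%g1 g2. tn HH HH (?t h1 g1) (?t h2 g2))))"
  by (simp add: convolution_def tensor_lift_ground)
 also have "... = sw G h (%h1 h2. tlift G ?F (sw HHHH g (%g1 g2. tn HH HH (?t h1 g1) (?t h2 g2))))"
  by (rule sw_push[OF h mH4 modG _ lF]) (intro R g; assumption)
 also have "... = sw G h (%h1 h2. sw G g (%g1 g2. tlift G ?F (tn HH HH (?t h1 g1) (?t h2 g2))))"
  by (rule sw_cong[OF h], rule sw_push[OF g mH4 modG _ lF]) (intro R; assumption)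
 also have "... = sw G h (%h1 h2. sw G g (%g1 g2. phi (?t h1 g1) \<star> psi (?t h2 g2)))"
  by (intro sw_cong h g tl_tensor[OF mHH mHH modG b] tc)
 finally show ?thesis .
qed

text \<open>In the definition of the twisted antipode the inverse of \<open>U\<close> is a choice;
  uniqueness identifies it with the explicit \<open>Ui\<close>.\<close>

lemma convolution_inverse_unique:
 assumes l: "lmap H G f" "lmap H G g" "lmap H G k"
  and gf: "!!h. h : cH ==> sw G h (%a b. g a \<star> f b) = eps h" and fk: "!!h. h : cH ==> sw G h (%a b. f a \<star> k b) = eps h"
  and h: "h : cH"
 shows "g h = k h"
proof -
 note M = modG
 note c = linear_closed[OF l(1), simplified] linear_closed[OF l(2), simplified] linear_closed[OF l(3), simplified]
 note R = lin cl linear_compose[OF _ l(1)] linear_compose[OF _ l(2)] linear_compose[OF _ l(3)] c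
 have "g h = sw G h (%a r. eps r *[G] g a)" by (rule sw_counit_r[OF h M l(2), symmetric])
 also have "... = sw G h (%a r. g a \<star> sw G r (%b d. f b \<star> k d))" by (intro sw_cong h) (simp add: fk c K.m_comm)
 also have "... = sw G h (%a r. sw G r (%b d. g a \<star> (f b \<star> k d)))" by (intro sw_cong h sw_multK) (simp_all add: c)
 also have "... = sw G h (%r d. sw G r (%a b. g a \<star> (f b \<star> k d)))" by (rule sw_coassoc[OF h M, symmetric]) (intro R; assumption)
 also have "... = sw G h (%r d. sw G r (%a b. (g a \<star> f b) \<star> k d))" by (intro sw_cong h) (simp_all add: c K.m_assoc)
 also have "... = sw G h (%r d. sw G r (%a b. g a \<star> f b) \<star> k d)" by (intro sw_cong h sw_multK(2)[symmetric]) (simp_all add: c)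
 also have "... = sw G h (%r d. eps r *[G] k d)" by (intro sw_cong h) (simp add: gf)
 also have "... = k h" by (rule sw_counit_l[OF h M l(3)])
 finally show ?thesis .
qed

lemma bisweedler_unit:
 assumes h: "h : cH" shows "bisweedler M HU h f = sweedler3 M H h f"
proof -
 have "bisweedler M HU h f = lsw M HU h (%a x. tlift M (f a) (rcoact HU x))"
  by (simp add: bisweedler_def lsw_def)
 also have "... = lsw M HU h (%a x. sw M x (f a))"
  using h by (intro lsw_cong[OF coact_unit]) (simp_all add: sweedler2_def)
 finally show ?thesis using h by (simp add: sweedler3_def)
qed

text \<open>The displayed formulas apply both coactions to \<open>x\<close> before turning to
  \<open>y\<close>, whereas \<open>ftw\<close> applies the left coactions of both before the right
  ones. Independent sums may be exchanged.\<close>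

lemma bisweedler2:
 assumes X: "bic X" and Y: "bic Y" and x: "x :< X" and y: "y :< Y" and M: "kmod M"
  and F: "hexa_map H H H H X Y M F"
 shows "bisweedler M X x (%a x' c. bisweedler M Y y (%b y' d. F a b c d x' y')) =
  lsw M X x (%a x'. lsw M Y y (%b y'. lsw M (bcop X) x' (%c x''. lsw M (bcop Y) y' (%d y''. F a b c d x'' y''))))"
proof -
 note cX = bic_coact[OF X] and cY = bic_coact[OF Y] and ccX = bic_cop_coact[OF X] and ccY = bic_cop_coact[OF Y]
 note D = hexa_mapD[OF F] and C = hexa_closed[OF F]
 have mX: "kmod X" and mY: "kmod Y" using X Y by (simp_all add: bic_module)
 have rX: "rcoact X z :< (ts X H)" if "z :< X" for z
  using bic_hopf_bicomodule[OF X] that by (auto simp: hopf_bicomodule_def)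
 note R = bilinear_mapI cop_lsw[OF ccX] cop_lsw[OF ccY] lsw_linear_fun[OF cX] lsw_linear_fun[OF cY] lsw_linear_arg[OF cY]
  D linear_id lsw_closed[OF cX] lsw_closed[OF cY] C M
 have 1: "bisweedler M Y y (%b y' d. F a b c d x' y') = lsw M Y y (%b y'. lsw M (bcop Y) y' (%d y''. F a b c d x' y''))"
  if a: "a : cH" "c : cH" "x' :< X" for a c x'
  unfolding bisweedler_def lsw_def[of _ Y, symmetric]
  by (rule lsw_cong[OF cY y], rule lsw_cop[OF ccY _ M, symmetric], assumption) (intro R a; assumption)
 have "bisweedler M X x (%a x' c. bisweedler M Y y (%b y' d. F a b c d x' y')) =
   lsw M X x (%a x'. tlift M (%x'' c. lsw M Y y (%b y'. lsw M (bcop Y) y' (%d y''. F a b c d x'' y''))) (rcoact X x'))"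
  unfolding bisweedler_def[of _ X] lsw_def[of _ X, symmetric]
  by (rule lsw_cong[OF cX x], rule ts_cong[OF mX modH rX]) (simp_all add: 1)
 also have "... = lsw M X x (%a x'. lsw M (bcop X) x' (%c x''. lsw M Y y (%b y'. lsw M (bcop Y) y' (%d y''. F a b c d x'' y''))))"
  by (rule lsw_cong[OF cX x], rule lsw_cop[OF ccX _ M, symmetric], assumption) (intro R y; assumption)
 also have "... = lsw M X x (%a x'. lsw M Y y (%b y'. lsw M (bcop X) x' (%c x''. lsw M (bcop Y) y' (%d y''. F a b c d x'' y''))))"
  by (rule lsw_cong[OF cX x], rule lsw_swap[OF ccX _ cY y M], simp) (intro R; simp)
 finally show ?thesis .
qed

end

context cocyc
begin

lemma ftw_formula:
 assumes X: "bic X" and Y: "bic Y" and P: "kmod P" and m: "bmap X Y P m" and x: "x :< X" and y: "y :< Y"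
 shows "bisweedler P X x (%a x' c. bisweedler P Y y (%b y' d. (chi a b \<star> chi' c d) *[P] m x' y')) = ft X Y P m x y"
proof -
 interpret P: module K P by (rule P)
 note cX = bic_coact[OF X] and cY = bic_coact[OF Y] and ccX = bic_cop_coact[OF X] and ccY = bic_cop_coact[OF Y]
 note mr = bmap_rules[OF m]
 have h: "hexa_map H H H H X Y P (%a b c d x y. (chi a b \<star> chi' c d) *[P] m x y)"
  by (intro lin cl mr P P.smult_closed; assumption)
 have "lsw P X x (%a x'. lsw P Y y (%b y'. lsw P (bcop X) x' (%c x''. lsw P (bcop Y) y' (%d y''. (chi a b \<star> chi' c d) *[P] m x'' y'')))) =
   lsw P X x (%a x'. lsw P Y y (%b y'. chi a b *[P] ctw chi' X Y P m x' y'))"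
 proof (rule lsw_cong[OF cX x], rule lsw_cong[OF cY y])
  fix a x' b y' assume a: "a : cH" "x' :< X" "b : cH" "y' :< Y"
  then have x': "x' :< (bcop X)" and y': "y' :< (bcop Y)" by simp_all
  have l: "lmap P P (%v. chi a b *[P] v)" by (intro lin P chi_closed a)
  have c: "lsw P (bcop Y) y' F :< P" if "!!h z. h : cH ==> z :< Y ==> F h z :< P" for F
   using that by (intro lsw_closed[OF ccY y' P]) simp_all
  have "chi a b *[P] ctw chi' X Y P m x' y' = lsw P (bcop X) x' (%c x''. chi a b *[P] lsw P (bcop Y) y' (%d y''. chi' c d *[P] m x'' y''))"
   unfolding tw_def by (rule lsw_push[OF ccX x' P P _ l]) (rule c, simp add: mr)
  also have "... = lsw P (bcop X) x' (%c x''. lsw P (bcop Y) y' (%d y''. chi a b *[P] (chi' c d *[P] m x'' y'')))"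
   by (rule lsw_cong[OF ccX x'], rule lsw_push[OF ccY y' P P _ l]) (simp add: mr)
  also have "... = lsw P (bcop X) x' (%c x''. lsw P (bcop Y) y' (%d y''. (chi a b \<star> chi' c d) *[P] m x'' y''))"
   by (rule lsw_cong[OF ccX x'], rule lsw_cong[OF ccY y']) (simp add: P.smult_assoc1 a mr)
  finally show "lsw P (bcop X) x' (%c x''. lsw P (bcop Y) y' (%d y''. (chi a b \<star> chi' c d) *[P] m x'' y'')) =
    chi a b *[P] ctw chi' X Y P m x' y'" ..
 qed
 then show ?thesis unfolding bisweedler2[OF X Y x y P h] by (simp add: ftw_def tw_def)
qed

end

section \<open>Specialisation to the given cocycle\<close>

locale twisted = hopf_loc K H for K :: "('k, 'l) ring_scheme" and H :: "('k, 'h) hopf" +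
 fixes chi :: "('h \<times> 'h) list set \<Rightarrow> 'k"
 assumes cocycle: "unital_2_cocycle K H chi"
begin

definition "xi a b = chi (tn H H a b)"
definition "xi' a b = cocycle_inverse K H chi (tn H H a b)"
definition "H' = twisted_hopf K H chi"

lemma inverse: "is_convolution_inverse K (ts H H) (comult2 K H) (counit2 K H) chi (cocycle_inverse K H chi)"
proof -
 obtain psi where "is_convolution_inverse K (ts H H) (comult2 K H) (counit2 K H) chi psi"
  using cocycle unfolding unital_2_cocycle_def by blast
 then show ?thesis unfolding cocycle_inverse_def convolution_inverse_def
  by (rule someI[of "is_convolution_inverse K (ts H H) (comult2 K H) (counit2 K H) chi"])
qed

lemma xi_linear: "lmap (ts H H) G chi" "lmap (ts H H) G (cocycle_inverse K H chi)"
 using cocycle inverse by (simp_all add: unital_2_cocycle_def is_convolution_inverse_def)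

lemma xi_cocyc: "cocyc K H xi xi'"
proof unfold_locales
 note tb = bilinear_tensor[OF modH modH]
 note tl = bilinear_l[OF tb] bilinear_r[OF tb]
 have b: "bmap H H G (%a b. f (tn H H a b))" if "lmap (ts H H) G f" for f
  by (intro bilinear_mapI linear_compose[OF tl(1) that] linear_compose[OF tl(2) that])
 show "bmap H H G xi" "bmap H H G xi'"
  unfolding xi_def[abs_def] xi'_def[abs_def] by (intro b xi_linear)+
 fix h g f assume h: "h : cH" and g: "g : cH" and f: "f : cH"
 have t: "tn H H h g :< (ts H H)" by (intro cl modH h g)
 show "sw G h (%a h'. sw G g (%b g'. xi a b \<star> xi' h' g')) = eps h \<star> eps g" "sw G h (%a h'. sw G g (%b g'. xi' a b \<star> xi h' g')) = eps h \<star> eps g"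
  using inverse t counit2_tensor[OF h g] convolution2_tensor[OF xi_linear h g] convolution2_tensor[OF xi_linear(2,1) h g]
  by (simp_all add: is_convolution_inverse_def xi_def xi'_def)
 show "xi u h = eps h" using cocycle h by (simp add: unital_2_cocycle_def xi_def)
 show "sw G g (%g1 g2. sw G f (%f1 f2. xi g1 f1 \<star> xi h (g2 ** f2))) = sw G h (%h1 h2. sw G g (%g1 g2. xi h1 g1 \<star> xi (h2 ** g2) f))"
  using cocycle h g f by (simp add: unital_2_cocycle_def xi_def)
qed

sublocale c: cocyc K H xi xi' by (rule xi_cocyc)

lemma xi_formula:
 assumes "bic X" "bic Y" "kmod P" "bmap X Y P m" "x :< X" "y :< Y"
 shows "bisweedler P X x (%a x' c. bisweedler P Y y (%b y' d.
   (chi (tn H H a b) \<star> cocycle_inverse K H chi (tn H H c d)) *[P] m x' y')) = ftw xi xi' X Y P m x y"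
 using c.ftw_formula[OF assms] by (simp add: xi_def xi'_def)

lemma twisted_antipode:
 assumes h: "h : cH" shows "antipode H' h = S (conj_fun c.U c.Ui h)"
proof -
 have U: "twist_functional K H chi = c.U"
  by (simp add: fun_eq_iff twist_functional_def c.U_def xi_def)
 note l = c.U_lin[OF linear_id]
 let ?V = "convolution_inverse K H (comult H) (counit H) c.U"
 have "is_convolution_inverse K H (comult H) (counit H) c.U c.Ui"
  unfolding is_convolution_inverse_def convolution_def tensor_lift_ground[of K, symmetric]
  using l c.U_Ui c.Ui_U by (simp add: sweedler2_def)
 then have "is_convolution_inverse K H (comult H) (counit H) c.U ?V"
  unfolding convolution_inverse_def
  by (rule someI[of "is_convolution_inverse K H (comult H) (counit H) c.U"])
 then have V: "lmap H G ?V" "!!x. x : cH ==> sw G x (%a b. c.U a \<star> ?V b) = eps x"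
  by (simp_all add: is_convolution_inverse_def convolution_def tensor_lift_ground[of K, symmetric] sweedler2_def)
 have e: "?V x = c.Ui x" if "x : cH" for x
  by (rule convolution_inverse_unique[OF l(1,2) V(1) c.Ui_U V(2) that, symmetric])
 have "antipode H' h = sw H h (%a r. sw H r (%b c. (c.U a \<star> ?V c) *[H] S b))"
  by (simp add: H'_def twisted_hopf_def U sweedler3_def)
 also have "... = sw H h (%a r. sw H r (%b c. (c.U a \<star> c.Ui c) *[H] S b))"
  by (intro sw_cong h) (simp_all add: e)
 finally show ?thesis by (simp add: c.S_conj_fun h)
qed

sublocale tm: twist_mult K H xi xi' H'
proof unfold_locales
 show "same_coalg H H'" "one H' = u"
  by (simp_all add: H'_def twisted_hopf_def same_coalg_def same_module_def)
 fix x y assume x: "x : cH" and y: "y : cH"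
 have mH: "bmap HU HU H (%x y. x ** y)" using mult_bilinear by simp
 show "x \<otimes>\<^bsub>H'\<^esub> y = ftw xi xi' HU HU H (%x y. x ** y) x y"
  using xi_formula[OF bic_unit bic_unit modH mH, of x y] x y
  by (simp add: H'_def twisted_hopf_def bisweedler_unit)
qed

sublocale tp: tpair K H xi xi' H'
 by unfold_locales (rule tm.twist_hopf[OF twisted_antipode])

lemma twisted_bimodule_eq:
 assumes V: "bbi V" shows "twisted_bimodule K H chi V = tp.tb V"
proof -
 note d = tp.bbiD[OF V] and b = bb_bic[OF V] and mV = bb_module[OF V]
 show ?thesis
  unfolding twisted_bimodule_def twb_def
 proof (intro arg_cong2[where f = "%l r. V\<lparr>lact := l, ract := r\<rparr>"] restrict_ext)
  fix h v assume a: "h : cH" "v :< V"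
  show "sweedler3 V H h (%h1 h2 h3. bisweedler V V v (%v1 v2 v3.
     (chi (tn H H h1 v1) \<star> cocycle_inverse K H chi (tn H H h3 v3)) *[V] lact V h2 v2)) = ftw xi xi' HU V V (lact V) h v"
   using xi_formula[OF bic_unit b mV d(1), of h v] a by (simp add: bisweedler_unit)
 next
  fix v h assume a: "v :< V" "h : cH"
  show "bisweedler V V v (%v1 v2 v3. sweedler3 V H h (%h1 h2 h3.
     (chi (tn H H v1 h1) \<star> cocycle_inverse K H chi (tn H H v3 h3)) *[V] ract V v2 h2)) = ftw xi xi' V HU V (ract V) v h"
   using xi_formula[OF b bic_unit mV d(2), of v h] a by (simp add: bisweedler_unit)
 qed
qed

lemma twist_formula_eq:
 assumes V: "bbi V" and W: "bbi W" and v: "v :< V" and w: "w :< W"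
 shows "twist_formula K H chi V W v w = ftw xi xi' V W (V >< W) (ht V W) v w"
 unfolding twist_formula_def Let_def
 by (rule xi_formula[OF bb_bic[OF V] bb_bic[OF W] ht_module[OF V W] ht_bilinear[OF V W] v w])

text \<open>The two bilinear maps agree on the carriers but need not agree as HOL functions. Both
  are balanced, so the maps they induce are compared by the universal property.\<close>

lemma monoidal_twist_eq:
 assumes V: "bbi V" and W: "bbi W" shows "monoidal_twist K H chi V W = tp.cm V W"
proof -
 interpret T: hopf_loc K H' by (rule tp.T)
 note tV = tp.twb_bbi[OF V] and tW = tp.twb_bbi[OF W] and M = ht_module[OF V W]
 note bal = tp.cm_bal[OF V W]
 have bal': "T.hbal (tp.tb V) (tp.tb W) (V >< W) (twist_formula K H chi V W)"
  unfolding T.hbal_def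
 proof (intro conjI ballI)
  have "bmap V W (V >< W) (twist_formula K H chi V W)"
   using bilinear_cong[OF twist_formula_eq[OF V W] bb_module[OF V] bb_module[OF W], where M = "V >< W"] tp.cm_bil[OF V W] by simp
  then show "bmap (tp.tb V) (tp.tb W) (V >< W) (twist_formula K H chi V W)" by simp
  fix v h w assume a: "v :< (tp.tb V)" "h :< H'" "w :< (tp.tb W)"
  note r = T.ract_closed[OF tV a(2,1)] and l = T.lact_closed[OF tW a(2,3)]
  show "twist_formula K H chi V W (ract (tp.tb V) v h) w = twist_formula K H chi V W v (lact (tp.tb W) h w)"
   using bal a r l unfolding T.hbal_def by (simp add: twist_formula_eq[OF V W] del: twb_simps(7,8))
 qed
 show ?thesis
  unfolding monoidal_twist_def tp.cm_def H'_def[symmetric] twisted_bimodule_eq[OF V] twisted_bimodule_eq[OF W]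
 proof (rule restrict_ext)
  fix t assume t: "t :< (tp.hT V W)"
  show "tlift (V >< W) (twist_formula K H chi V W) t = tlift (V >< W) (ftw xi xi' V W (V >< W) (ht V W)) t"
   by (rule T.ht_ext[OF tV tW M T.ht_lift(1)[OF tV tW M bal'] T.ht_lift(1)[OF tV tW M bal] _ t])
    (simp add: T.ht_lift(2)[OF tV tW M bal'] T.ht_lift(2)[OF tV tW M bal] twist_formula_eq[OF V W])
 qed
qed

lemma monoidal_functor:
 assumes V: "bbi V" and V': "bbi V'" and W: "bbi W" and W': "bbi W'" and X: "bbi X"
 shows "monoidal_functor_axioms K H chi V V' W W' X"
proof -
 note VW = bbi_ht[OF V W] and WX = bbi_ht[OF W X]
 note eqs = twisted_bimodule_eq[OF V] twisted_bimodule_eq[OF V'] twisted_bimodule_eq[OF W] twisted_bimodule_eq[OF W'] twisted_bimodule_eq[OF X]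
  twisted_bimodule_eq[OF VW] twisted_bimodule_eq[OF WX] twisted_bimodule_eq[OF bbi_unit]
  monoidal_twist_eq[OF V W] monoidal_twist_eq[OF V' W'] monoidal_twist_eq[OF VW X] monoidal_twist_eq[OF V WX] monoidal_twist_eq[OF W X]
  monoidal_twist_eq[OF bbi_unit V] monoidal_twist_eq[OF V bbi_unit]
 show ?thesis
  unfolding monoidal_functor_axioms_def Let_def H'_def[symmetric] eqs
 proof (intro conjI ballI)
  show "tp.cm V W : bicovariant_iso K H' (tp.hT V W) (tp.tb (V >< W))" by (rule tp.cm_iso[OF V W])
  show "tp.cm V W (htensor H' (tp.tb V) (tp.tb W) v w) = twist_formula K H chi V W v w" if "v :< V" "w :< W" for v w
   using tp.cm_gen[OF V W that] twist_formula_eq[OF V W that] by simp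
  show "tp.cm V' W' (htensor_map K H' (tp.tb V) (tp.tb W) (tp.tb V') (tp.tb W') f g t) = htensor_map K H V W V' W' f g (tp.cm V W t)"
   if "f : bicovariant_hom K H V V'" "g : bicovariant_hom K H W W'" "t :< (tp.hT V W)" for f g t
   using that by (intro tp.cm_natural[OF V W V' W']) (simp_all add: bhom_iff V V' W W')
  show "tp.tb HU = unit_bimodule H'" by (rule tp.tb_unit)
 qed (rule tp.cm_assoc[OF V W X] tp.cm_left_unit[OF V] tp.cm_right_unit[OF V]; assumption)+
qed

lemma braided_functor:
 assumes V: "bbi V" and W: "bbi W" shows "braided_functor_axiom K H chi V W"
 unfolding braided_functor_axiom_def Let_def H'_def[symmetric]
  twisted_bimodule_eq[OF V] twisted_bimodule_eq[OF W] monoidal_twist_eq[OF V W] monoidal_twist_eq[OF W V]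
 by (intro ballI tp.cm_braided[OF V W])

lemma bij: "bij_betw (twisted_bimodule K H chi) (bicovariant_bimodules K H :: ('k, 'h, 'v) bimodule set) (bicovariant_bimodules K H')"
proof -
 have s: "bicovariant_bimodules K H = {V. bbi V}" "bicovariant_bimodules K H' = {V. tp.bbi' V}"
  using bbi_iff hopf_loc.bbi_iff[OF tp.T] by auto
 show ?thesis
  unfolding s by (subst bij_betw_cong[where g = tp.tb]) (auto simp: twisted_bimodule_eq tp.twb_bij)
qed

lemma hom_eq:
 assumes V: "bbi V" and W: "bbi W"
 shows "bicovariant_hom K H' (twisted_bimodule K H chi V) (twisted_bimodule K H chi W) = bicovariant_hom K H V W"
 unfolding twisted_bimodule_eq[OF V] twisted_bimodule_eq[OF W]
 using hopf_loc.bhom_iff[OF tp.T tp.twb_bbi[OF V] tp.twb_bbi[OF W]] bhom_iff[OF V W] tp.twb_bhom_iff[OF V W] by auto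

end

theorem theorem2p5:
  fixes K :: "('k, 'l) ring_scheme" and H :: "('k, 'h) hopf" and \<chi> :: "('h \<times> 'h) list set \<Rightarrow> 'k"
  assumes "field K" and "hopf_algebra K H" and "unital_2_cocycle K H \<chi>"
  shows "let H\<chi> = twisted_hopf K H \<chi> in
    hopf_algebra K H\<chi> \<and>
    (\<forall>V\<in>bicovariant_bimodules K H. \<forall>V'\<in>bicovariant_bimodules K H. \<forall>V''\<in>bicovariant_bimodules K H.
      \<forall>W\<in>bicovariant_bimodules K H. \<forall>W'\<in>bicovariant_bimodules K H. \<forall>W''\<in>bicovariant_bimodules K H.
      \<forall>U\<in>bicovariant_bimodules K H. \<forall>U'\<in>bicovariant_bimodules K H. \<forall>X\<in>bicovariant_bimodules K H.
        braided_monoidal_axioms K H V V' V'' W W' W'' U U' X) \<and>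
    (\<forall>V\<in>bicovariant_bimodules K H\<chi>. \<forall>V'\<in>bicovariant_bimodules K H\<chi>. \<forall>V''\<in>bicovariant_bimodules K H\<chi>.
      \<forall>W\<in>bicovariant_bimodules K H\<chi>. \<forall>W'\<in>bicovariant_bimodules K H\<chi>. \<forall>W''\<in>bicovariant_bimodules K H\<chi>.
      \<forall>U\<in>bicovariant_bimodules K H\<chi>. \<forall>U'\<in>bicovariant_bimodules K H\<chi>. \<forall>X\<in>bicovariant_bimodules K H\<chi>.
        braided_monoidal_axioms K H\<chi> V V' V'' W W' W'' U U' X) \<and>
    bij_betw (twisted_bimodule K H \<chi>) (bicovariant_bimodules K H) (bicovariant_bimodules K H\<chi>) \<and>
    (\<forall>V\<in>bicovariant_bimodules K H. \<forall>W\<in>bicovariant_bimodules K H.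
        bicovariant_hom K H\<chi> (twisted_bimodule K H \<chi> V) (twisted_bimodule K H \<chi> W)
          = bicovariant_hom K H V W) \<and>
    (\<forall>V\<in>bicovariant_bimodules K H. \<forall>V'\<in>bicovariant_bimodules K H.
      \<forall>W\<in>bicovariant_bimodules K H. \<forall>W'\<in>bicovariant_bimodules K H.
      \<forall>U\<in>bicovariant_bimodules K H.
        monoidal_functor_axioms K H \<chi> V V' W W' U) \<and>
    (\<forall>V\<in>bicovariant_bimodules K H. \<forall>W\<in>bicovariant_bimodules K H.
        braided_functor_axiom K H \<chi> V W)"
proof -
 interpret K: field K by (rule assms)
 have "cring K" ..
 then interpret t: twisted K H \<chi>
  by unfold_locales (use assms in \<open>simp_all add: cring.axioms\<close>)
 \<comment> \<open>The twist is again a Hopf algebra, so the general theory gives the braided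
   category of its bicovariant bimodules as well.\<close>
 interpret T: hopf_loc K t.H' by (rule t.tp.T)
 show ?thesis
  unfolding Let_def t.H'_def[symmetric]
  by (intro conjI ballI t.tp.H'_hopf t.braided_monoidal_ax T.braided_monoidal_ax t.bij t.hom_eq t.monoidal_functor t.braided_functor;
   simp add: t.bbi_iff T.bbi_iff)
qed

end
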